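(* Let $\mathcal A$ and $\mathcal B$ be finite tensor categories and $\mathcal M$ an $\mathcal A$-$\mathcal B$-bimodule category. Then the Nakayama functor $\mathrm N^{\rm r}_{\mathcal M}=\int^{m\in\mathcal M}\mathrm{Hom}_{\mathcal M}(-,m)^*\otimes m$ extends to a bimodule functor $\mathrm N^{\rm r}_{\mathcal M}:\mathcal M\to{}^{\rm ll}\mathcal M^{\rm rr}$: there are isomorphisms $$\mathrm N^{\rm r}_{\mathcal M}(a.m.b)\;\cong\;{}^{\vee\vee}a.\,\mathrm N^{\rm r}_{\mathcal M}(m)\,.\,b^{\vee\vee}$$ coherently for all $m\in\mathcal M$, $a\in\mathcal A$ and $b\in\mathcal B$.
   Context: $\Bbbk$ is an algebraically closed field; all categories and functors are $\Bbbk$-linear. A finite linear category is one equivalent to the category of finite-dimensional modules over a finite-dimensional $\Bbbk$-algebra. A finite tensor category is a finite linear category that is rigid monoidal with bilinear tensor product and $\mathrm{End}(\mathbf 1)\cong\Bbbk$. The right dual $c^\vee$ of $c$ comes with $c^\vee\otimes c\to\mathbf 1$ and $\mathbf 1\to c\otimes c^\vee$; the left dual ${}^\vee c$ comes with $c\otimes{}^\vee c\to\mathbf 1$ and $\mathbf 1\to{}^\vee c\otimes c$. A left $\mathcal A$-module category is a finite linear category $\mathcal M$ with a bilinear action functor $\mathcal A\times\mathcal M\to\mathcal M$, $(a,m)\mapsto a.m$, exact in the $\mathcal A$-variable, and natural associativity and unit isomorphisms satisfying pentagon and triangle axioms; right module categories and bimodule categories are defined analogously. ${}^{\rm ll}\mathcal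 M^{\rm rr}$ is the $\mathcal A$-$\mathcal B$-bimodule category that equals $\mathcal M$ as a linear category, with $a$ acting from the left as ${}^{\vee\vee}a$ does on $\mathcal M$ and $b$ acting from the right as $b^{\vee\vee}$ does on $\mathcal M$. "Coherently" means that the natural isomorphisms satisfy the axioms of a bimodule functor (compatibility with the associativity and unit constraints of both actions). $v\otimes m$ for finite-dimensional $v$ is the object with $\mathrm{Hom}_{\mathcal M}(-,v\otimes m)\cong v\otimes_{\Bbbk}\mathrm{Hom}_{\mathcal M}(-,m)$; $v^*$ is the dual vector space, and $\int^m$ is a coend. *)

theory Defs
  imports
    "HOL-Library.Poly_Mapping"
    "HOL-Library.Function_Algebras"
    "HOL-Computational_Algebra.Polynomial"
begin

section \<open>Linear categories and functors\<close>

text \<open>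
  The arrows of a linear category live in one ambient vector space (the type
  \<open>'m\<close> with scalar multiplication \<open>scl\<close>) that contains all hom-spaces
  \<open>Hom x y\<close> as subspaces, two different ones meeting only in \<open>0\<close>; every small linear category has this
  form, e.g. inside the direct sum of its hom-spaces. A nonzero arrow thus has a
  unique source and target, and all operations on arrows that send \<open>0\<close> to \<open>0\<close>
  need not be indexed by objects.
\<close>

record ('k, 'o, 'm) lcat =
  Obj :: "'o set"
  Hom :: "'o \<Rightarrow> 'o \<Rightarrow> 'm set"
  Id :: "'o \<Rightarrow> 'm"
  Comp :: "'m \<Rightarrow> 'm \<Rightarrow> 'm" (infixl "\<cdot>\<index>" 70)
  scl :: "'k \<Rightarrow> 'm \<Rightarrow> 'm"

locale linear_category =
  vector_space "scl C" for C :: "('k::field, 'o, 'm::ab_group_add, 'z) lcat_scheme" (structure) +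
  assumes Hom_subspace: "\<lbrakk>x \<in> Obj C; y \<in> Obj C\<rbrakk> \<Longrightarrow> subspace (Hom C x y)"
    and Hom_disjoint:
      "\<lbrakk>x \<in> Obj C; y \<in> Obj C; x' \<in> Obj C; y' \<in> Obj C; (x, y) \<noteq> (x', y')\<rbrakk>
        \<Longrightarrow> Hom C x y \<inter> Hom C x' y' = {0}"
    and Id_Hom: "x \<in> Obj C \<Longrightarrow> Id C x \<in> Hom C x x"
    and Comp_Hom:
      "\<lbrakk>x \<in> Obj C; y \<in> Obj C; z \<in> Obj C; f \<in> Hom C x y; g \<in> Hom C y z\<rbrakk>
        \<Longrightarrow> g \<cdot> f \<in> Hom C x z"
    and Comp_Id: "\<lbrakk>x \<in> Obj C; y \<in> Obj C; f \<in> Hom C x y\<rbrakk> \<Longrightarrow> f \<cdot> Id C x = f"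
    and Id_Comp: "\<lbrakk>x \<in> Obj C; y \<in> Obj C; f \<in> Hom C x y\<rbrakk> \<Longrightarrow> Id C y \<cdot> f = f"
    and Comp_assoc:
      "\<lbrakk>w \<in> Obj C; x \<in> Obj C; y \<in> Obj C; z \<in> Obj C;
        f \<in> Hom C w x; g \<in> Hom C x y; h \<in> Hom C y z\<rbrakk>
        \<Longrightarrow> (h \<cdot> g) \<cdot> f = h \<cdot> (g \<cdot> f)"
    and Comp_add_left:
      "\<lbrakk>x \<in> Obj C; y \<in> Obj C; z \<in> Obj C; f \<in> Hom C x y; g \<in> Hom C y z; g' \<in> Hom C y z\<rbrakk>
        \<Longrightarrow> (g + g') \<cdot> f = g \<cdot> f + g' \<cdot> f"
    and Comp_add_right:
      "\<lbrakk>x \<in> Obj C; y \<in> Obj C; z \<in> Obj C; f \<in> Hom C x y; f' \<in> Hom C x y; g \<in> Hom C y z\<rbrakk>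
        \<Longrightarrow> g \<cdot> (f + f') = g \<cdot> f + g \<cdot> f'"
    and Comp_scl_left:
      "\<lbrakk>x \<in> Obj C; y \<in> Obj C; z \<in> Obj C; f \<in> Hom C x y; g \<in> Hom C y z\<rbrakk>
        \<Longrightarrow> scl C c g \<cdot> f = scl C c (g \<cdot> f)"
    and Comp_scl_right:
      "\<lbrakk>x \<in> Obj C; y \<in> Obj C; z \<in> Obj C; f \<in> Hom C x y; g \<in> Hom C y z\<rbrakk>
        \<Longrightarrow> g \<cdot> scl C c f = scl C c (g \<cdot> f)"

definition inverse_arrows ::
  "('k, 'o, 'm, 'z) lcat_scheme \<Rightarrow> 'o \<Rightarrow> 'o \<Rightarrow> 'm \<Rightarrow> 'm \<Rightarrow> bool" where
  "inverse_arrows C x y f g \<longleftrightarrow>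
     f \<in> Hom C x y \<and> g \<in> Hom C y x \<and> g \<cdot>\<^bsub>C\<^esub> f = Id C x \<and> f \<cdot>\<^bsub>C\<^esub> g = Id C y"

definition iso_arrow :: "('k, 'o, 'm, 'z) lcat_scheme \<Rightarrow> 'o \<Rightarrow> 'o \<Rightarrow> 'm \<Rightarrow> bool" where
  "iso_arrow C x y f \<longleftrightarrow> (\<exists>g. inverse_arrows C x y f g)"

definition inv_arrow :: "('k, 'o, 'm, 'z) lcat_scheme \<Rightarrow> 'm \<Rightarrow> 'm" ("inv\<index> _" [81] 80) where
  "inv_arrow C f = (THE g. \<exists>x \<in> Obj C. \<exists>y \<in> Obj C. inverse_arrows C x y f g)"

record ('o, 'm, 'p, 'n) functor_data =
  FO :: "'o \<Rightarrow> 'p"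
  FA :: "'m \<Rightarrow> 'n"

locale linear_functor =
  fixes C :: "('k::field, 'o, 'm::ab_group_add, 'z) lcat_scheme"
    and D :: "('k, 'p, 'n::ab_group_add, 'y) lcat_scheme"
    and F :: "('o, 'm, 'p, 'n) functor_data"
  assumes FO_Obj: "x \<in> Obj C \<Longrightarrow> FO F x \<in> Obj D"
    and FA_Hom: "\<lbrakk>x \<in> Obj C; y \<in> Obj C; f \<in> Hom C x y\<rbrakk> \<Longrightarrow> FA F f \<in> Hom D (FO F x) (FO F y)"
    and FA_Id: "x \<in> Obj C \<Longrightarrow> FA F (Id C x) = Id D (FO F x)"
    and FA_Comp:
      "\<lbrakk>x \<in> Obj C; y \<in> Obj C; z \<in> Obj C; f \<in> Hom C x y; g \<in> Hom C y z\<rbrakk>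
        \<Longrightarrow> FA F (g \<cdot>\<^bsub>C\<^esub> f) = FA F g \<cdot>\<^bsub>D\<^esub> FA F f"
    and FA_add:
      "\<lbrakk>x \<in> Obj C; y \<in> Obj C; f \<in> Hom C x y; f' \<in> Hom C x y\<rbrakk>
        \<Longrightarrow> FA F (f + f') = FA F f + FA F f'"
    and FA_scl:
      "\<lbrakk>x \<in> Obj C; y \<in> Obj C; f \<in> Hom C x y\<rbrakk> \<Longrightarrow> FA F (scl C c f) = scl D c (FA F f)"

locale bilinear_functor =
  fixes A :: "('k::field, 'oa, 'ma::ab_group_add, 'za) lcat_scheme"
    and M :: "('k, 'om, 'mm::ab_group_add, 'zm) lcat_scheme"
    and P :: "('k, 'op, 'mp::ab_group_add, 'zp) lcat_scheme"
    and T :: "'oa \<Rightarrow> 'om \<Rightarrow> 'op"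
    and Ta :: "'ma \<Rightarrow> 'mm \<Rightarrow> 'mp"
  assumes bi_Obj: "\<lbrakk>a \<in> Obj A; m \<in> Obj M\<rbrakk> \<Longrightarrow> T a m \<in> Obj P"
    and bi_Hom:
      "\<lbrakk>a \<in> Obj A; a' \<in> Obj A; m \<in> Obj M; m' \<in> Obj M; f \<in> Hom A a a'; g \<in> Hom M m m'\<rbrakk>
        \<Longrightarrow> Ta f g \<in> Hom P (T a m) (T a' m')"
    and bi_Id: "\<lbrakk>a \<in> Obj A; m \<in> Obj M\<rbrakk> \<Longrightarrow> Ta (Id A a) (Id M m) = Id P (T a m)"
    and bi_Comp:
      "\<lbrakk>a \<in> Obj A; a' \<in> Obj A; a'' \<in> Obj A; m \<in> Obj M; m' \<in> Obj M; m'' \<in> Obj M;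
        f \<in> Hom A a a'; f' \<in> Hom A a' a''; g \<in> Hom M m m'; g' \<in> Hom M m' m''\<rbrakk>
        \<Longrightarrow> Ta (f' \<cdot>\<^bsub>A\<^esub> f) (g' \<cdot>\<^bsub>M\<^esub> g) = Ta f' g' \<cdot>\<^bsub>P\<^esub> Ta f g"
    and bi_add_left:
      "\<lbrakk>a \<in> Obj A; a' \<in> Obj A; m \<in> Obj M; m' \<in> Obj M;
        f \<in> Hom A a a'; f' \<in> Hom A a a'; g \<in> Hom M m m'\<rbrakk>
        \<Longrightarrow> Ta (f + f') g = Ta f g + Ta f' g"
    and bi_add_right:
      "\<lbrakk>a \<in> Obj A; a' \<in> Obj A; m \<in> Obj M; m' \<in> Obj M;
        f \<in> Hom A a a'; g \<in> Hom M m m'; g' \<in> Hom M m m'\<rbrakk>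
        \<Longrightarrow> Ta f (g + g') = Ta f g + Ta f g'"
    and bi_scl_left:
      "\<lbrakk>a \<in> Obj A; a' \<in> Obj A; m \<in> Obj M; m' \<in> Obj M; f \<in> Hom A a a'; g \<in> Hom M m m'\<rbrakk>
        \<Longrightarrow> Ta (scl A c f) g = scl P c (Ta f g)"
    and bi_scl_right:
      "\<lbrakk>a \<in> Obj A; a' \<in> Obj A; m \<in> Obj M; m' \<in> Obj M; f \<in> Hom A a a'; g \<in> Hom M m m'\<rbrakk>
        \<Longrightarrow> Ta f (scl M c g) = scl P c (Ta f g)"

definition is_kernel ::
  "('k, 'o, 'm::zero, 'z) lcat_scheme \<Rightarrow> 'o \<Rightarrow> 'o \<Rightarrow> 'o \<Rightarrow> 'm \<Rightarrow> 'm \<Rightarrow> bool" where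
  "is_kernel C x y z f g \<longleftrightarrow>
     f \<in> Hom C x y \<and> g \<in> Hom C y z \<and> g \<cdot>\<^bsub>C\<^esub> f = 0 \<and>
     (\<forall>w \<in> Obj C. \<forall>h \<in> Hom C w y. g \<cdot>\<^bsub>C\<^esub> h = 0 \<longrightarrow> (\<exists>!u. u \<in> Hom C w x \<and> f \<cdot>\<^bsub>C\<^esub> u = h))"

definition is_cokernel ::
  "('k, 'o, 'm::zero, 'z) lcat_scheme \<Rightarrow> 'o \<Rightarrow> 'o \<Rightarrow> 'o \<Rightarrow> 'm \<Rightarrow> 'm \<Rightarrow> bool" where
  "is_cokernel C x y z f g \<longleftrightarrow>
     f \<in> Hom C x y \<and> g \<in> Hom C y z \<and> g \<cdot>\<^bsub>C\<^esub> f = 0 \<and>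
     (\<forall>w \<in> Obj C. \<forall>h \<in> Hom C y w. h \<cdot>\<^bsub>C\<^esub> f = 0 \<longrightarrow> (\<exists>!u. u \<in> Hom C z w \<and> u \<cdot>\<^bsub>C\<^esub> g = h))"

text \<open>Short exactness of \<open>0 \<rightarrow> x \<rightarrow> y \<rightarrow> z \<rightarrow> 0\<close>; a functor between finite linear categories
  (which are abelian) is exact if it preserves short exact sequences.\<close>

definition short_exact ::
  "('k, 'o, 'm::zero, 'z) lcat_scheme \<Rightarrow> 'o \<Rightarrow> 'o \<Rightarrow> 'o \<Rightarrow> 'm \<Rightarrow> 'm \<Rightarrow> bool" where
  "short_exact C x y z f g \<longleftrightarrow> is_kernel C x y z f g \<and> is_cokernel C x y z f g"

definition exact_functor ::
  "('k, 'o, 'm::zero, 'z) lcat_scheme \<Rightarrow> ('k, 'p, 'n::zero, 'y) lcat_scheme \<Rightarrow>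
     ('o, 'm, 'p, 'n) functor_data \<Rightarrow> bool" where
  "exact_functor C D F \<longleftrightarrow>
     (\<forall>x \<in> Obj C. \<forall>y \<in> Obj C. \<forall>z \<in> Obj C. \<forall>f g. short_exact C x y z f g \<longrightarrow>
        short_exact D (FO F x) (FO F y) (FO F z) (FA F f) (FA F g))"


section \<open>Finite linear categories\<close>

definition linear_on ::
  "('k \<Rightarrow> 'v::ab_group_add \<Rightarrow> 'v) \<Rightarrow> ('k \<Rightarrow> 'w::ab_group_add \<Rightarrow> 'w) \<Rightarrow> 'v set \<Rightarrow> ('v \<Rightarrow> 'w) \<Rightarrow> bool" where
  "linear_on s t V h \<longleftrightarrow>
     (\<forall>u \<in> V. \<forall>v \<in> V. h (u + v) = h u + h v) \<and> (\<forall>c. \<forall>v \<in> V. h (s c v) = t c (h v))"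

definition bilinear_on ::
  "('k \<Rightarrow> 'u::ab_group_add \<Rightarrow> 'u) \<Rightarrow> ('k \<Rightarrow> 'v::ab_group_add \<Rightarrow> 'v) \<Rightarrow>
   ('k \<Rightarrow> 'w::ab_group_add \<Rightarrow> 'w) \<Rightarrow> 'u set \<Rightarrow> 'v set \<Rightarrow> ('u \<Rightarrow> 'v \<Rightarrow> 'w) \<Rightarrow> bool" where
  "bilinear_on r s t U V h \<longleftrightarrow>
     (\<forall>v \<in> V. linear_on r t U (\<lambda>u. h u v)) \<and> (\<forall>u \<in> U. linear_on s t V (h u))"

text \<open>Scalar multiplication on the free vector space on the type \<open>'i\<close>.\<close>

definition fscl :: "'k::field \<Rightarrow> ('i \<Rightarrow>\<^sub>0 'k) \<Rightarrow> ('i \<Rightarrow>\<^sub>0 'k)" where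
  "fscl c p = Poly_Mapping.map ((*) c) p"

text \<open>
  Every finite-dimensional vector space is isomorphic to a subspace of the space
  \<open>nat \<Rightarrow>\<^sub>0 'k\<close> of countable dimension. Finite-dimensional algebras and their modules are
  taken with such subspaces as carriers, which loses nothing up to isomorphism.
\<close>

type_synonym 'k fvec = "nat \<Rightarrow>\<^sub>0 'k"

definition fin_dim_subspace :: "'k::field fvec set \<Rightarrow> bool" where
  "fin_dim_subspace V \<longleftrightarrow> (\<exists>B. finite B \<and> module.span fscl B = V)"

record 'v alg =
  acarr :: "'v set"
  amult :: "'v \<Rightarrow> 'v \<Rightarrow> 'v"
  aone :: 'v

definition fin_dim_algebra :: "'k::field fvec alg \<Rightarrow> bool" where
  "fin_dim_algebra R \<longleftrightarrow>
     fin_dim_subspace (acarr R) \<and> aone R \<in> acarr R \<and>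
     (\<forall>r \<in> acarr R. \<forall>s \<in> acarr R. amult R r s \<in> acarr R) \<and>
     bilinear_on fscl fscl fscl (acarr R) (acarr R) (amult R) \<and>
     (\<forall>r \<in> acarr R. \<forall>s \<in> acarr R. \<forall>t \<in> acarr R.
        amult R (amult R r s) t = amult R r (amult R s t)) \<and>
     (\<forall>r \<in> acarr R. amult R (aone R) r = r \<and> amult R r (aone R) = r)"

record 'v amod =
  mcarr :: "'v set"
  mact :: "'v \<Rightarrow> 'v \<Rightarrow> 'v"

definition fin_dim_module :: "'k::field fvec alg \<Rightarrow> 'k fvec amod \<Rightarrow> bool" where
  "fin_dim_module R V \<longleftrightarrow>
     fin_dim_subspace (mcarr V) \<and>
     (\<forall>r \<in> acarr R. \<forall>v \<in> mcarr V. mact V r v \<in> mcarr V) \<and>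
     bilinear_on fscl fscl fscl (acarr R) (mcarr V) (mact V) \<and>
     (\<forall>r \<in> acarr R. \<forall>s \<in> acarr R. \<forall>v \<in> mcarr V. mact V (amult R r s) v = mact V r (mact V s v)) \<and>
     (\<forall>v \<in> mcarr V. mact V (aone R) v = v)"

text \<open>Module homomorphisms are represented by functions that vanish outside the carrier of
  the source.\<close>

definition module_homs ::
  "'k::field fvec alg \<Rightarrow> 'k fvec amod \<Rightarrow> 'k fvec amod \<Rightarrow> ('k fvec \<Rightarrow> 'k fvec) set" where
  "module_homs R V W =
     {h. (\<forall>v \<in> mcarr V. h v \<in> mcarr W) \<and> (\<forall>v. v \<notin> mcarr V \<longrightarrow> h v = 0) \<and>
         linear_on fscl fscl (mcarr V) h \<and>
         (\<forall>r \<in> acarr R. \<forall>v \<in> mcarr V. h (mact V r v) = mact W r (h v))}"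

text \<open>A linear equivalence, i.e. a fully faithful and essentially surjective linear functor
  \<open>(V, F)\<close>, from \<open>C\<close> to the category of finite-dimensional \<open>R\<close>-modules.\<close>

definition equivalence_to_modules ::
  "('k::field, 'o, 'm::ab_group_add, 'z) lcat_scheme \<Rightarrow> 'k fvec alg \<Rightarrow>
     ('o \<Rightarrow> 'k fvec amod) \<Rightarrow> ('m \<Rightarrow> 'k fvec \<Rightarrow> 'k fvec) \<Rightarrow> bool" where
  "equivalence_to_modules C R V F \<longleftrightarrow>
     (\<forall>x \<in> Obj C. fin_dim_module R (V x)) \<and>
     (\<forall>x \<in> Obj C. \<forall>v \<in> mcarr (V x). F (Id C x) v = v) \<and>
     (\<forall>x \<in> Obj C. \<forall>y \<in> Obj C. \<forall>z \<in> Obj C. \<forall>f \<in> Hom C x y. \<forall>g \<in> Hom C y z.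
        F (g \<cdot>\<^bsub>C\<^esub> f) = F g \<circ> F f) \<and>
     (\<forall>x \<in> Obj C. \<forall>y \<in> Obj C.
        linear_on (scl C) (\<lambda>c h v. fscl c (h v)) (Hom C x y) F \<and>
        bij_betw F (Hom C x y) (module_homs R (V x) (V y))) \<and>
     (\<forall>W. fin_dim_module R W \<longrightarrow>
        (\<exists>x \<in> Obj C. \<exists>h \<in> module_homs R (V x) W. bij_betw h (mcarr (V x)) (mcarr W)))"

definition finite_linear_category ::
  "('k::field, 'o, 'm::ab_group_add, 'z) lcat_scheme \<Rightarrow> bool" where
  "finite_linear_category C \<longleftrightarrow>
     linear_category C \<and> (\<exists>R V F. fin_dim_algebra R \<and> equivalence_to_modules C R V F)"


section \<open>Finite tensor categories\<close>

text \<open>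
  A rigid monoidal category comes with a choice of left duals \<open>ldual x\<close>
  (\<open>lev x: x \<otimes> ldual x \<rightarrow> 1\<close>, \<open>lcoev x: 1 \<rightarrow> ldual x \<otimes> x\<close>) and of right duals
  \<open>rdual x\<close> (\<open>rev x: rdual x \<otimes> x \<rightarrow> 1\<close>, \<open>rcoev x: 1 \<rightarrow> x \<otimes> rdual x\<close>).
\<close>

record ('k, 'o, 'm) tcat = "('k, 'o, 'm) lcat" +
  tens :: "'o \<Rightarrow> 'o \<Rightarrow> 'o" (infixr "\<otimes>\<index>" 75)
  tensa :: "'m \<Rightarrow> 'm \<Rightarrow> 'm" (infixr "\<star>\<index>" 75)
  unit :: 'o
  asc :: "'o \<Rightarrow> 'o \<Rightarrow> 'o \<Rightarrow> 'm"  \<comment> \<open>\<open>(x \<otimes> y) \<otimes> z \<rightarrow> x \<otimes> (y \<otimes> z)\<close>\<close>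
  lun :: "'o \<Rightarrow> 'm"  \<comment> \<open>\<open>1 \<otimes> x \<rightarrow> x\<close>\<close>
  run :: "'o \<Rightarrow> 'm"  \<comment> \<open>\<open>x \<otimes> 1 \<rightarrow> x\<close>\<close>
  ldual :: "'o \<Rightarrow> 'o"
  lev :: "'o \<Rightarrow> 'm"
  lcoev :: "'o \<Rightarrow> 'm"
  rdual :: "'o \<Rightarrow> 'o"
  rev :: "'o \<Rightarrow> 'm"
  rcoev :: "'o \<Rightarrow> 'm"

locale finite_tensor_category =
  fixes C :: "('k::field, 'o, 'm::ab_group_add, 'z) tcat_scheme" (structure)
  assumes finite_linear: "finite_linear_category C"
    and tens_bilinear: "bilinear_functor C C C (tens C) (tensa C)"
    and unit_Obj: "unit C \<in> Obj C"
    and asc_iso: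
      "\<lbrakk>x \<in> Obj C; y \<in> Obj C; z \<in> Obj C\<rbrakk>
        \<Longrightarrow> iso_arrow C ((x \<otimes> y) \<otimes> z) (x \<otimes> (y \<otimes> z)) (asc C x y z)"
    and asc_natural:
      "\<lbrakk>x \<in> Obj C; x' \<in> Obj C; y \<in> Obj C; y' \<in> Obj C; z \<in> Obj C; z' \<in> Obj C;
        f \<in> Hom C x x'; g \<in> Hom C y y'; h \<in> Hom C z z'\<rbrakk>
        \<Longrightarrow> asc C x' y' z' \<cdot> ((f \<star> g) \<star> h) = (f \<star> (g \<star> h)) \<cdot> asc C x y z"
    and lun_iso: "x \<in> Obj C \<Longrightarrow> iso_arrow C (unit C \<otimes> x) x (lun C x)"
    and lun_natural:
      "\<lbrakk>x \<in> Obj C; x' \<in> Obj C; f \<in> Hom C x x'\<rbrakk>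
        \<Longrightarrow> lun C x' \<cdot> (Id C (unit C) \<star> f) = f \<cdot> lun C x"
    and run_iso: "x \<in> Obj C \<Longrightarrow> iso_arrow C (x \<otimes> unit C) x (run C x)"
    and run_natural:
      "\<lbrakk>x \<in> Obj C; x' \<in> Obj C; f \<in> Hom C x x'\<rbrakk>
        \<Longrightarrow> run C x' \<cdot> (f \<star> Id C (unit C)) = f \<cdot> run C x"
    and pentagon:
      "\<lbrakk>w \<in> Obj C; x \<in> Obj C; y \<in> Obj C; z \<in> Obj C\<rbrakk>
        \<Longrightarrow> asc C w x (y \<otimes> z) \<cdot> asc C (w \<otimes> x) y z =
            (Id C w \<star> asc C x y z) \<cdot> asc C w (x \<otimes> y) z \<cdot> (asc C w x y \<star> Id C z)"
    and triangle:
      "\<lbrakk>x \<in> Obj C; y \<in> Obj C\<rbrakk>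
        \<Longrightarrow> (Id C x \<star> lun C y) \<cdot> asc C x (unit C) y = run C x \<star> Id C y"
    and End_unit: "bij_betw (\<lambda>c. scl C c (Id C (unit C))) UNIV (Hom C (unit C) (unit C))"
    and ldual_Obj: "x \<in> Obj C \<Longrightarrow> ldual C x \<in> Obj C"
    and lev_Hom: "x \<in> Obj C \<Longrightarrow> lev C x \<in> Hom C (x \<otimes> ldual C x) (unit C)"
    and lcoev_Hom: "x \<in> Obj C \<Longrightarrow> lcoev C x \<in> Hom C (unit C) (ldual C x \<otimes> x)"
    and ldual_zigzag1:
      "x \<in> Obj C \<Longrightarrow>
        lun C x \<cdot> (lev C x \<star> Id C x) \<cdot> inv (asc C x (ldual C x) x)
          \<cdot> (Id C x \<star> lcoev C x) \<cdot> inv (run C x) = Id C x"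
    and ldual_zigzag2:
      "x \<in> Obj C \<Longrightarrow>
        run C (ldual C x) \<cdot> (Id C (ldual C x) \<star> lev C x) \<cdot> asc C (ldual C x) x (ldual C x)
          \<cdot> (lcoev C x \<star> Id C (ldual C x)) \<cdot> inv (lun C (ldual C x)) = Id C (ldual C x)"
    and rdual_Obj: "x \<in> Obj C \<Longrightarrow> rdual C x \<in> Obj C"
    and rev_Hom: "x \<in> Obj C \<Longrightarrow> rev C x \<in> Hom C (rdual C x \<otimes> x) (unit C)"
    and rcoev_Hom: "x \<in> Obj C \<Longrightarrow> rcoev C x \<in> Hom C (unit C) (x \<otimes> rdual C x)"
    and rdual_zigzag1:
      "x \<in> Obj C \<Longrightarrow>
        run C x \<cdot> (Id C x \<star> rev C x) \<cdot> asc C x (rdual C x) x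
          \<cdot> (rcoev C x \<star> Id C x) \<cdot> inv (lun C x) = Id C x"
    and rdual_zigzag2:
      "x \<in> Obj C \<Longrightarrow>
        lun C (rdual C x) \<cdot> (rev C x \<star> Id C (rdual C x)) \<cdot> inv (asc C (rdual C x) x (rdual C x))
          \<cdot> (Id C (rdual C x) \<star> rcoev C x) \<cdot> inv (run C (rdual C x)) = Id C (rdual C x)"


section \<open>The double dual functors and their monoidal structure\<close>

context
  fixes C :: "('k, 'o, 'm, 'z) tcat_scheme" (structure)
begin

text \<open>The arrow \<open>d \<rightarrow> ldual x\<close> corresponding under duality to \<open>g: x \<otimes> d \<rightarrow> 1\<close>.\<close>

definition ltranspose :: "'o \<Rightarrow> 'o \<Rightarrow> 'm \<Rightarrow> 'm" where
  "ltranspose x d g =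
     run C (ldual C x) \<cdot> (Id C (ldual C x) \<star> g) \<cdot> asc C (ldual C x) x d
       \<cdot> (lcoev C x \<star> Id C d) \<cdot> inv (lun C d)"

text \<open>The left dual \<open>ldual y \<rightarrow> ldual x\<close> of \<open>f: x \<rightarrow> y\<close>. The description is unambiguous also for
  \<open>f = 0\<close>, where the source and target of \<open>f\<close> are not determined, as it then yields \<open>0\<close>.\<close>

definition ldual_arr :: "'m \<Rightarrow> 'm" where
  "ldual_arr f = (THE g. \<exists>x \<in> Obj C. \<exists>y \<in> Obj C. f \<in> Hom C x y \<and>
     g = ltranspose x (ldual C y) (lev C y \<cdot> (f \<star> Id C (ldual C y))))"

text \<open>The canonical isomorphism \<open>ldual y \<otimes> ldual x \<rightarrow> ldual (x \<otimes> y)\<close>, obtained from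
  the nested evaluation.\<close>

definition ldual_tens :: "'o \<Rightarrow> 'o \<Rightarrow> 'm" where
  "ldual_tens x y = ltranspose (x \<otimes> y) (ldual C y \<otimes> ldual C x)
     (lev C x \<cdot> (Id C x \<star> lun C (ldual C x)) \<cdot> (Id C x \<star> (lev C y \<star> Id C (ldual C x)))
       \<cdot> (Id C x \<star> inv (asc C y (ldual C y) (ldual C x)))
       \<cdot> asc C x y (ldual C y \<otimes> ldual C x))"

definition ldual_unit :: 'm where  \<comment> \<open>\<open>1 \<rightarrow> ldual 1\<close>\<close>
  "ldual_unit = ltranspose (unit C) (unit C) (lun C (unit C))"

definition lldual :: "'o \<Rightarrow> 'o" where
  "lldual x = ldual C (ldual C x)"

definition lldual_arr :: "'m \<Rightarrow> 'm" where
  "lldual_arr f = ldual_arr (ldual_arr f)"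

definition lldual_tens :: "'o \<Rightarrow> 'o \<Rightarrow> 'm" where  \<comment> \<open>\<open>lldual x \<otimes> lldual y \<rightarrow> lldual (x \<otimes> y)\<close>\<close>
  "lldual_tens x y = ldual_arr (inv (ldual_tens x y)) \<cdot> ldual_tens (ldual C y) (ldual C x)"

definition lldual_unit :: 'm where  \<comment> \<open>\<open>1 \<rightarrow> lldual 1\<close>\<close>
  "lldual_unit = ldual_arr (inv ldual_unit) \<cdot> ldual_unit"

text \<open>The same for right duals: the arrow \<open>d \<rightarrow> rdual x\<close> corresponding to \<open>g: d \<otimes> x \<rightarrow> 1\<close>, etc.\<close>

definition rtranspose :: "'o \<Rightarrow> 'o \<Rightarrow> 'm \<Rightarrow> 'm" where
  "rtranspose x d g =
     lun C (rdual C x) \<cdot> (g \<star> Id C (rdual C x)) \<cdot> inv (asc C d x (rdual C x))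
       \<cdot> (Id C d \<star> rcoev C x) \<cdot> inv (run C d)"

definition rdual_arr :: "'m \<Rightarrow> 'm" where
  "rdual_arr f = (THE g. \<exists>x \<in> Obj C. \<exists>y \<in> Obj C. f \<in> Hom C x y \<and>
     g = rtranspose x (rdual C y) (rev C y \<cdot> (Id C (rdual C y) \<star> f)))"

definition rdual_tens :: "'o \<Rightarrow> 'o \<Rightarrow> 'm" where  \<comment> \<open>\<open>rdual y \<otimes> rdual x \<rightarrow> rdual (x \<otimes> y)\<close>\<close>
  "rdual_tens x y = rtranspose (x \<otimes> y) (rdual C y \<otimes> rdual C x)
     (rev C y \<cdot> (Id C (rdual C y) \<star> lun C y) \<cdot> (Id C (rdual C y) \<star> (rev C x \<star> Id C y))
       \<cdot> (Id C (rdual C y) \<star> inv (asc C (rdual C x) x y))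
       \<cdot> asc C (rdual C y) (rdual C x) (x \<otimes> y))"

definition rdual_unit :: 'm where  \<comment> \<open>\<open>1 \<rightarrow> rdual 1\<close>\<close>
  "rdual_unit = rtranspose (unit C) (unit C) (lun C (unit C))"

definition rrdual :: "'o \<Rightarrow> 'o" where
  "rrdual x = rdual C (rdual C x)"

definition rrdual_arr :: "'m \<Rightarrow> 'm" where
  "rrdual_arr f = rdual_arr (rdual_arr f)"

definition rrdual_tens :: "'o \<Rightarrow> 'o \<Rightarrow> 'm" where  \<comment> \<open>\<open>rrdual x \<otimes> rrdual y \<rightarrow> rrdual (x \<otimes> y)\<close>\<close>
  "rrdual_tens x y = rdual_arr (inv (rdual_tens x y)) \<cdot> rdual_tens (rdual C y) (rdual C x)"

definition rrdual_unit :: 'm where  \<comment> \<open>\<open>1 \<rightarrow> rrdual 1\<close>\<close>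
  "rrdual_unit = rdual_arr (inv rdual_unit) \<cdot> rdual_unit"

end


section \<open>Bimodule categories and bimodule functors\<close>

text \<open>
  \<open>\<rhd>\<close> and \<open>\<lhd>\<close> are the actions on objects, \<open>\<unrhd>\<close> and \<open>\<unlhd>\<close> those on arrows.
\<close>

record ('k, 'o, 'm, 'oa, 'ma, 'ob, 'mb) bimod = "('k, 'o, 'm) lcat" +
  lact :: "'oa \<Rightarrow> 'o \<Rightarrow> 'o" (infixr "\<rhd>\<index>" 75)
  lacta :: "'ma \<Rightarrow> 'm \<Rightarrow> 'm" (infixr "\<unrhd>\<index>" 75)
  lasc :: "'oa \<Rightarrow> 'oa \<Rightarrow> 'o \<Rightarrow> 'm"  \<comment> \<open>\<open>(a \<otimes> a') \<rhd> m \<rightarrow> a \<rhd> (a' \<rhd> m)\<close>\<close>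
  lunit :: "'o \<Rightarrow> 'm"  \<comment> \<open>\<open>1 \<rhd> m \<rightarrow> m\<close>\<close>
  ract :: "'o \<Rightarrow> 'ob \<Rightarrow> 'o" (infixl "\<lhd>\<index>" 75)
  racta :: "'m \<Rightarrow> 'mb \<Rightarrow> 'm" (infixl "\<unlhd>\<index>" 75)
  rasc :: "'o \<Rightarrow> 'ob \<Rightarrow> 'ob \<Rightarrow> 'm"  \<comment> \<open>\<open>(m \<lhd> b) \<lhd> b' \<rightarrow> m \<lhd> (b \<otimes> b')\<close>\<close>
  runit :: "'o \<Rightarrow> 'm"  \<comment> \<open>\<open>m \<lhd> 1 \<rightarrow> m\<close>\<close>
  masc :: "'oa \<Rightarrow> 'o \<Rightarrow> 'ob \<Rightarrow> 'm"  \<comment> \<open>\<open>(a \<rhd> m) \<lhd> b \<rightarrow> a \<rhd> (m \<lhd> b)\<close>\<close>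

locale bimodule_category =
  fixes A :: "('k::field, 'oa, 'ma::ab_group_add, 'za) tcat_scheme"
    and B :: "('k, 'ob, 'mb::ab_group_add, 'zb) tcat_scheme"
    and M :: "('k, 'o, 'm::ab_group_add, 'oa, 'ma, 'ob, 'mb, 'z) bimod_scheme" (structure)
  assumes finite_linear: "finite_linear_category M"
    \<comment> \<open>left module category\<close>
    and lact_bilinear: "bilinear_functor A M M (lact M) (lacta M)"
    and lact_exact:
      "m \<in> Obj M \<Longrightarrow> exact_functor A M \<lparr>FO = \<lambda>a. a \<rhd> m, FA = \<lambda>f. f \<unrhd> Id M m\<rparr>"
    and lasc_iso:
      "\<lbrakk>a \<in> Obj A; a' \<in> Obj A; m \<in> Obj M\<rbrakk>
        \<Longrightarrow> iso_arrow M ((a \<otimes>\<^bsub>A\<^esub> a') \<rhd> m) (a \<rhd> (a' \<rhd> m)) (lasc M a a' m)"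
    and lasc_natural:
      "\<lbrakk>a \<in> Obj A; a1 \<in> Obj A; a' \<in> Obj A; a1' \<in> Obj A; m \<in> Obj M; m1 \<in> Obj M;
        f \<in> Hom A a a1; f' \<in> Hom A a' a1'; h \<in> Hom M m m1\<rbrakk>
        \<Longrightarrow> lasc M a1 a1' m1 \<cdot> ((f \<star>\<^bsub>A\<^esub> f') \<unrhd> h) = (f \<unrhd> (f' \<unrhd> h)) \<cdot> lasc M a a' m"
    and lunit_iso: "m \<in> Obj M \<Longrightarrow> iso_arrow M (unit A \<rhd> m) m (lunit M m)"
    and lunit_natural:
      "\<lbrakk>m \<in> Obj M; m1 \<in> Obj M; h \<in> Hom M m m1\<rbrakk>
        \<Longrightarrow> lunit M m1 \<cdot> (Id A (unit A) \<unrhd> h) = h \<cdot> lunit M m"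
    and left_pentagon:
      "\<lbrakk>a \<in> Obj A; a' \<in> Obj A; a'' \<in> Obj A; m \<in> Obj M\<rbrakk>
        \<Longrightarrow> lasc M a a' (a'' \<rhd> m) \<cdot> lasc M (a \<otimes>\<^bsub>A\<^esub> a') a'' m =
            (Id A a \<unrhd> lasc M a' a'' m) \<cdot> lasc M a (a' \<otimes>\<^bsub>A\<^esub> a'') m
              \<cdot> (asc A a a' a'' \<unrhd> Id M m)"
    and left_triangle:
      "\<lbrakk>a \<in> Obj A; m \<in> Obj M\<rbrakk>
        \<Longrightarrow> (Id A a \<unrhd> lunit M m) \<cdot> lasc M a (unit A) m = run A a \<unrhd> Id M m"
    \<comment> \<open>right module category\<close>
    and ract_bilinear: "bilinear_functor M B M (ract M) (racta M)"
    and ract_exact: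
      "m \<in> Obj M \<Longrightarrow> exact_functor B M \<lparr>FO = \<lambda>b. m \<lhd> b, FA = \<lambda>f. Id M m \<unlhd> f\<rparr>"
    and rasc_iso:
      "\<lbrakk>m \<in> Obj M; b \<in> Obj B; b' \<in> Obj B\<rbrakk>
        \<Longrightarrow> iso_arrow M ((m \<lhd> b) \<lhd> b') (m \<lhd> (b \<otimes>\<^bsub>B\<^esub> b')) (rasc M m b b')"
    and rasc_natural:
      "\<lbrakk>m \<in> Obj M; m1 \<in> Obj M; b \<in> Obj B; b1 \<in> Obj B; b' \<in> Obj B; b1' \<in> Obj B;
        h \<in> Hom M m m1; g \<in> Hom B b b1; g' \<in> Hom B b' b1'\<rbrakk>
        \<Longrightarrow> rasc M m1 b1 b1' \<cdot> ((h \<unlhd> g) \<unlhd> g') = (h \<unlhd> (g \<star>\<^bsub>B\<^esub> g')) \<cdot> rasc M m b b'"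
    and runit_iso: "m \<in> Obj M \<Longrightarrow> iso_arrow M (m \<lhd> unit B) m (runit M m)"
    and runit_natural:
      "\<lbrakk>m \<in> Obj M; m1 \<in> Obj M; h \<in> Hom M m m1\<rbrakk>
        \<Longrightarrow> runit M m1 \<cdot> (h \<unlhd> Id B (unit B)) = h \<cdot> runit M m"
    and right_pentagon:
      "\<lbrakk>m \<in> Obj M; b \<in> Obj B; b' \<in> Obj B; b'' \<in> Obj B\<rbrakk>
        \<Longrightarrow> rasc M m b (b' \<otimes>\<^bsub>B\<^esub> b'') \<cdot> rasc M (m \<lhd> b) b' b'' =
            (Id M m \<unlhd> asc B b b' b'') \<cdot> rasc M m (b \<otimes>\<^bsub>B\<^esub> b') b''
              \<cdot> (rasc M m b b' \<unlhd> Id B b'')"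
    and right_triangle:
      "\<lbrakk>m \<in> Obj M; b \<in> Obj B\<rbrakk>
        \<Longrightarrow> (Id M m \<unlhd> lun B b) \<cdot> rasc M m (unit B) b = runit M m \<unlhd> Id B b"
    \<comment> \<open>compatibility of the two actions; the triangles for the units of \<open>A\<close> and \<open>B\<close> follow\<close>
    and masc_iso:
      "\<lbrakk>a \<in> Obj A; m \<in> Obj M; b \<in> Obj B\<rbrakk>
        \<Longrightarrow> iso_arrow M ((a \<rhd> m) \<lhd> b) (a \<rhd> (m \<lhd> b)) (masc M a m b)"
    and masc_natural:
      "\<lbrakk>a \<in> Obj A; a1 \<in> Obj A; m \<in> Obj M; m1 \<in> Obj M; b \<in> Obj B; b1 \<in> Obj B;
        f \<in> Hom A a a1; h \<in> Hom M m m1; g \<in> Hom B b b1\<rbrakk>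
        \<Longrightarrow> masc M a1 m1 b1 \<cdot> ((f \<unrhd> h) \<unlhd> g) = (f \<unrhd> (h \<unlhd> g)) \<cdot> masc M a m b"
    and middle_pentagon_left:
      "\<lbrakk>a \<in> Obj A; a' \<in> Obj A; m \<in> Obj M; b \<in> Obj B\<rbrakk>
        \<Longrightarrow> lasc M a a' (m \<lhd> b) \<cdot> masc M (a \<otimes>\<^bsub>A\<^esub> a') m b =
            (Id A a \<unrhd> masc M a' m b) \<cdot> masc M a (a' \<rhd> m) b \<cdot> (lasc M a a' m \<unlhd> Id B b)"
    and middle_pentagon_right:
      "\<lbrakk>a \<in> Obj A; m \<in> Obj M; b \<in> Obj B; b' \<in> Obj B\<rbrakk>
        \<Longrightarrow> masc M a m (b \<otimes>\<^bsub>B\<^esub> b') \<cdot> rasc M (a \<rhd> m) b b' =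
            (Id A a \<unrhd> rasc M m b b') \<cdot> masc M a (m \<lhd> b) b' \<cdot> (masc M a m b \<unlhd> Id B b')"

text \<open>The bimodule category \<open>\<^sup>l\<^sup>lM\<^sup>r\<^sup>r\<close>: the actions are pulled back along the double dual
  functors, and their constraints are composed with the monoidal structures of these.\<close>

definition ll_rr ::
  "('k, 'oa, 'ma, 'za) tcat_scheme \<Rightarrow> ('k, 'ob, 'mb, 'zb) tcat_scheme \<Rightarrow>
   ('k, 'o, 'm, 'oa, 'ma, 'ob, 'mb, 'z) bimod_scheme \<Rightarrow>
   ('k, 'o, 'm, 'oa, 'ma, 'ob, 'mb, 'z) bimod_scheme" where
  "ll_rr A B M = M\<lparr>
     lact := \<lambda>a m. lldual A a \<rhd>\<^bsub>M\<^esub> m,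
     lacta := \<lambda>f h. lldual_arr A f \<unrhd>\<^bsub>M\<^esub> h,
     lasc := \<lambda>a a' m. lasc M (lldual A a) (lldual A a') m
               \<cdot>\<^bsub>M\<^esub> (inv\<^bsub>A\<^esub> (lldual_tens A a a') \<unrhd>\<^bsub>M\<^esub> Id M m),
     lunit := \<lambda>m. lunit M m \<cdot>\<^bsub>M\<^esub> (inv\<^bsub>A\<^esub> (lldual_unit A) \<unrhd>\<^bsub>M\<^esub> Id M m),
     ract := \<lambda>m b. m \<lhd>\<^bsub>M\<^esub> rrdual B b,
     racta := \<lambda>h f. h \<unlhd>\<^bsub>M\<^esub> rrdual_arr B f,
     rasc := \<lambda>m b b'. (Id M m \<unlhd>\<^bsub>M\<^esub> rrdual_tens B b b')
               \<cdot>\<^bsub>M\<^esub> rasc M m (rrdual B b) (rrdual B b'),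
     runit := \<lambda>m. runit M m \<cdot>\<^bsub>M\<^esub> (Id M m \<unlhd>\<^bsub>M\<^esub> inv\<^bsub>B\<^esub> (rrdual_unit B)),
     masc := \<lambda>a m b. masc M (lldual A a) m (rrdual B b)\<rparr>"

text \<open>A bimodule functor \<open>(F, \<phi>, \<psi>)\<close> from \<open>M\<close> to \<open>M'\<close>, with
  \<open>\<phi> a m: F (a \<rhd> m) \<rightarrow> a \<rhd> F m\<close> and \<open>\<psi> m b: F (m \<lhd> b) \<rightarrow> F m \<lhd> b\<close>.\<close>

locale bimodule_functor =
  fixes A :: "('k::field, 'oa, 'ma::ab_group_add, 'za) tcat_scheme"
    and B :: "('k, 'ob, 'mb::ab_group_add, 'zb) tcat_scheme"
    and M :: "('k, 'o, 'm::ab_group_add, 'oa, 'ma, 'ob, 'mb, 'z) bimod_scheme"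
    and M' :: "('k, 'o', 'm'::ab_group_add, 'oa, 'ma, 'ob, 'mb, 'z') bimod_scheme"
    and F :: "('o, 'm, 'o', 'm') functor_data"
    and \<phi> :: "'oa \<Rightarrow> 'o \<Rightarrow> 'm'"
    and \<psi> :: "'o \<Rightarrow> 'ob \<Rightarrow> 'm'"
  assumes linear_functor: "linear_functor M M' F"
    and left_iso:
      "\<lbrakk>a \<in> Obj A; m \<in> Obj M\<rbrakk>
        \<Longrightarrow> iso_arrow M' (FO F (a \<rhd>\<^bsub>M\<^esub> m)) (a \<rhd>\<^bsub>M'\<^esub> FO F m) (\<phi> a m)"
    and left_natural:
      "\<lbrakk>a \<in> Obj A; a1 \<in> Obj A; m \<in> Obj M; m1 \<in> Obj M; f \<in> Hom A a a1; h \<in> Hom M m m1\<rbrakk>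
        \<Longrightarrow> \<phi> a1 m1 \<cdot>\<^bsub>M'\<^esub> FA F (f \<unrhd>\<^bsub>M\<^esub> h) = (f \<unrhd>\<^bsub>M'\<^esub> FA F h) \<cdot>\<^bsub>M'\<^esub> \<phi> a m"
    and left_assoc:
      "\<lbrakk>a \<in> Obj A; a' \<in> Obj A; m \<in> Obj M\<rbrakk>
        \<Longrightarrow> lasc M' a a' (FO F m) \<cdot>\<^bsub>M'\<^esub> \<phi> (a \<otimes>\<^bsub>A\<^esub> a') m =
            (Id A a \<unrhd>\<^bsub>M'\<^esub> \<phi> a' m) \<cdot>\<^bsub>M'\<^esub> \<phi> a (a' \<rhd>\<^bsub>M\<^esub> m) \<cdot>\<^bsub>M'\<^esub> FA F (lasc M a a' m)"
    and left_unit: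
      "m \<in> Obj M \<Longrightarrow> lunit M' (FO F m) \<cdot>\<^bsub>M'\<^esub> \<phi> (unit A) m = FA F (lunit M m)"
    and right_iso:
      "\<lbrakk>m \<in> Obj M; b \<in> Obj B\<rbrakk>
        \<Longrightarrow> iso_arrow M' (FO F (m \<lhd>\<^bsub>M\<^esub> b)) (FO F m \<lhd>\<^bsub>M'\<^esub> b) (\<psi> m b)"
    and right_natural:
      "\<lbrakk>m \<in> Obj M; m1 \<in> Obj M; b \<in> Obj B; b1 \<in> Obj B; h \<in> Hom M m m1; g \<in> Hom B b b1\<rbrakk>
        \<Longrightarrow> \<psi> m1 b1 \<cdot>\<^bsub>M'\<^esub> FA F (h \<unlhd>\<^bsub>M\<^esub> g) = (FA F h \<unlhd>\<^bsub>M'\<^esub> g) \<cdot>\<^bsub>M'\<^esub> \<psi> m b"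
    and right_assoc:
      "\<lbrakk>m \<in> Obj M; b \<in> Obj B; b' \<in> Obj B\<rbrakk>
        \<Longrightarrow> rasc M' (FO F m) b b' \<cdot>\<^bsub>M'\<^esub> (\<psi> m b \<unlhd>\<^bsub>M'\<^esub> Id B b') \<cdot>\<^bsub>M'\<^esub> \<psi> (m \<lhd>\<^bsub>M\<^esub> b) b' =
            \<psi> m (b \<otimes>\<^bsub>B\<^esub> b') \<cdot>\<^bsub>M'\<^esub> FA F (rasc M m b b')"
    and right_unit:
      "m \<in> Obj M \<Longrightarrow> runit M' (FO F m) \<cdot>\<^bsub>M'\<^esub> \<psi> m (unit B) = FA F (runit M m)"
    and middle:
      "\<lbrakk>a \<in> Obj A; m \<in> Obj M; b \<in> Obj B\<rbrakk>
        \<Longrightarrow> masc M' a (FO F m) b \<cdot>\<^bsub>M'\<^esub> (\<phi> a m \<unlhd>\<^bsub>M'\<^esub> Id B b) \<cdot>\<^bsub>M'\<^esub> \<psi> (a \<rhd>\<^bsub>M\<^esub> m) b =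
            (Id A a \<unrhd>\<^bsub>M'\<^esub> \<psi> m b) \<cdot>\<^bsub>M'\<^esub> \<phi> a (m \<lhd>\<^bsub>M\<^esub> b) \<cdot>\<^bsub>M'\<^esub> FA F (masc M a m b)"


section \<open>Coends and the Nakayama functor\<close>

text \<open>
  \<open>t: V \<times> W \<rightarrow> T\<close> exhibits \<open>T\<close> as the tensor product of \<open>V\<close> and \<open>W\<close>, i.e. it induces an isomorphism
  from the free vector space on \<open>V \<times> W\<close> modulo the span of the bilinearity relations to \<open>T\<close>.
\<close>

definition bilinearity_relations ::
  "('k::field \<Rightarrow> 'v::ab_group_add \<Rightarrow> 'v) \<Rightarrow> ('k \<Rightarrow> 'w::ab_group_add \<Rightarrow> 'w) \<Rightarrow>
   'v set \<Rightarrow> 'w set \<Rightarrow> ('v \<times> 'w \<Rightarrow>\<^sub>0 'k) set" where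
  "bilinearity_relations sV sW V W =
     (let e = (\<lambda>v w. Poly_Mapping.single (v, w) (1::'k)) in
      {e (v + v') w - e v w - e v' w | v v' w. v \<in> V \<and> v' \<in> V \<and> w \<in> W} \<union>
      {e v (w + w') - e v w - e v w' | v w w'. v \<in> V \<and> w \<in> W \<and> w' \<in> W} \<union>
      {e (sV c v) w - fscl c (e v w) | c v w. v \<in> V \<and> w \<in> W} \<union>
      {e v (sW c w) - fscl c (e v w) | c v w. v \<in> V \<and> w \<in> W})"

definition is_tensor_product ::
  "('k::field \<Rightarrow> 'v::ab_group_add \<Rightarrow> 'v) \<Rightarrow> ('k \<Rightarrow> 'w::ab_group_add \<Rightarrow> 'w) \<Rightarrow>
   ('k \<Rightarrow> 't::ab_group_add \<Rightarrow> 't) \<Rightarrow> 'v set \<Rightarrow> 'w set \<Rightarrow> 't set \<Rightarrow> ('v \<Rightarrow> 'w \<Rightarrow> 't) \<Rightarrow> bool" where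
  "is_tensor_product sV sW sT V W T t \<longleftrightarrow>
     (let free = {p :: 'v \<times> 'w \<Rightarrow>\<^sub>0 'k. Poly_Mapping.keys p \<subseteq> V \<times> W};
          ext = (\<lambda>p. \<Sum>(v, w) \<in> Poly_Mapping.keys p. sT (Poly_Mapping.lookup p (v, w)) (t v w))
      in ext ` free = T \<and>
         {p \<in> free. ext p = 0} = module.span fscl (bilinearity_relations sV sW V W))"

text \<open>
  \<open>p\<close> is the object \<open>V \<otimes> m\<close>: the maps \<open>t: V \<times> Hom(y, m) \<rightarrow> Hom(y, p)\<close> exhibit
  \<open>Hom(-, p)\<close> as \<open>V \<otimes> Hom(-, m)\<close>, naturally in the argument.
\<close>

definition is_copower ::
  "('k::field, 'o, 'm::ab_group_add, 'z) lcat_scheme \<Rightarrow> ('k \<Rightarrow> 'v::ab_group_add \<Rightarrow> 'v) \<Rightarrow> 'v set \<Rightarrow>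
   'o \<Rightarrow> 'o \<Rightarrow> ('v \<Rightarrow> 'm \<Rightarrow> 'm) \<Rightarrow> bool" where
  "is_copower C sV V m p t \<longleftrightarrow>
     p \<in> Obj C \<and>
     (\<forall>y \<in> Obj C. is_tensor_product sV (scl C) (scl C) V (Hom C y m) (Hom C y p) t) \<and>
     (\<forall>y \<in> Obj C. \<forall>z \<in> Obj C. \<forall>u \<in> V. \<forall>g \<in> Hom C y m. \<forall>h \<in> Hom C z y.
        t u (g \<cdot>\<^bsub>C\<^esub> h) = t u g \<cdot>\<^bsub>C\<^esub> h)"

text \<open>The arrow \<open>\<alpha> \<otimes> f: V \<otimes> m \<rightarrow> V' \<otimes> m'\<close> induced by a linear map \<open>\<alpha>: V \<rightarrow> V'\<close> and \<open>f: m \<rightarrow> m'\<close>,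
  for copowers \<open>(p, t)\<close> and \<open>(p', t')\<close>.\<close>

definition copower_map ::
  "('k, 'o, 'm, 'z) lcat_scheme \<Rightarrow> 'v set \<Rightarrow> 'o \<Rightarrow> 'o \<Rightarrow> ('v \<Rightarrow> 'm \<Rightarrow> 'm) \<Rightarrow>
   'o \<Rightarrow> ('v' \<Rightarrow> 'm \<Rightarrow> 'm) \<Rightarrow> ('v \<Rightarrow> 'v') \<Rightarrow> 'm \<Rightarrow> 'm" where
  "copower_map C V m p t p' t' \<alpha> f =
     (THE q. q \<in> Hom C p p' \<and>
        (\<forall>y \<in> Obj C. \<forall>u \<in> V. \<forall>g \<in> Hom C y m. q \<cdot>\<^bsub>C\<^esub> t u g = t' (\<alpha> u) (f \<cdot>\<^bsub>C\<^esub> g)))"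

text \<open>
  Coends of functors \<open>G: C\<^sup>o\<^sup>p \<times> C \<rightarrow> D\<close>, where \<open>G\<close> is given by \<open>G\<^sub>o\<close> on objects and
  \<open>G\<^sub>a m n y z h f: G\<^sub>o m y \<rightarrow> G\<^sub>o n z\<close> for \<open>h: n \<rightarrow> m\<close> and \<open>f: y \<rightarrow> z\<close>.
\<close>

definition is_wedge ::
  "('k, 'o, 'm, 'z) lcat_scheme \<Rightarrow> ('l, 'p, 'n, 'y) lcat_scheme \<Rightarrow> ('o \<Rightarrow> 'o \<Rightarrow> 'p) \<Rightarrow>
   ('o \<Rightarrow> 'o \<Rightarrow> 'o \<Rightarrow> 'o \<Rightarrow> 'm \<Rightarrow> 'm \<Rightarrow> 'n) \<Rightarrow> 'p \<Rightarrow> ('o \<Rightarrow> 'n) \<Rightarrow> bool" where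
  "is_wedge C D G\<^sub>o G\<^sub>a d j \<longleftrightarrow>
     d \<in> Obj D \<and> (\<forall>m \<in> Obj C. j m \<in> Hom D (G\<^sub>o m m) d) \<and>
     (\<forall>m \<in> Obj C. \<forall>n \<in> Obj C. \<forall>h \<in> Hom C n m.
        j m \<cdot>\<^bsub>D\<^esub> G\<^sub>a m m n m (Id C m) h = j n \<cdot>\<^bsub>D\<^esub> G\<^sub>a m n n n h (Id C n))"

definition is_coend ::
  "('k, 'o, 'm, 'z) lcat_scheme \<Rightarrow> ('l, 'p, 'n, 'y) lcat_scheme \<Rightarrow> ('o \<Rightarrow> 'o \<Rightarrow> 'p) \<Rightarrow>
   ('o \<Rightarrow> 'o \<Rightarrow> 'o \<Rightarrow> 'o \<Rightarrow> 'm \<Rightarrow> 'm \<Rightarrow> 'n) \<Rightarrow> 'p \<Rightarrow> ('o \<Rightarrow> 'n) \<Rightarrow> bool" where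
  "is_coend C D G\<^sub>o G\<^sub>a e i \<longleftrightarrow>
     is_wedge C D G\<^sub>o G\<^sub>a e i \<and>
     (\<forall>d j. is_wedge C D G\<^sub>o G\<^sub>a d j \<longrightarrow>
        (\<exists>!u. u \<in> Hom D e d \<and> (\<forall>m \<in> Obj C. u \<cdot>\<^bsub>D\<^esub> i m = j m)))"

text \<open>The dual space of \<open>Hom(x, m)\<close>; functionals are represented by functions that vanish outside
  \<open>Hom(x, m)\<close>, with pointwise operations.\<close>

definition Hom_dual :: "('k::field, 'o, 'm::ab_group_add, 'z) lcat_scheme \<Rightarrow> 'o \<Rightarrow> 'o \<Rightarrow> ('m \<Rightarrow> 'k) set" where
  "Hom_dual C x m =
     {\<xi>. linear_on (scl C) (*) (Hom C x m) \<xi> \<and> (\<forall>g. g \<notin> Hom C x m \<longrightarrow> \<xi> g = 0)}"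

definition dual_scl :: "'k::field \<Rightarrow> ('m \<Rightarrow> 'k) \<Rightarrow> ('m \<Rightarrow> 'k)" where
  "dual_scl c \<xi> = (\<lambda>g. c * \<xi> g)"

text \<open>For \<open>h: n \<rightarrow> m\<close>, the map \<open>Hom(x, h)\<^sup>*: Hom(x, m)\<^sup>* \<rightarrow> Hom(x, n)\<^sup>*\<close>.\<close>

definition Hom_dual_right ::
  "('k::field, 'o, 'm, 'z) lcat_scheme \<Rightarrow> 'o \<Rightarrow> 'o \<Rightarrow> 'm \<Rightarrow> ('m \<Rightarrow> 'k) \<Rightarrow> ('m \<Rightarrow> 'k)" where
  "Hom_dual_right C x n h \<xi> = (\<lambda>g. if g \<in> Hom C x n then \<xi> (h \<cdot>\<^bsub>C\<^esub> g) else 0)"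

text \<open>For \<open>f: x \<rightarrow> x'\<close>, the map \<open>Hom(f, m)\<^sup>*: Hom(x, m)\<^sup>* \<rightarrow> Hom(x', m)\<^sup>*\<close>.\<close>

definition Hom_dual_left ::
  "('k::field, 'o, 'm, 'z) lcat_scheme \<Rightarrow> 'o \<Rightarrow> 'o \<Rightarrow> 'm \<Rightarrow> ('m \<Rightarrow> 'k) \<Rightarrow> ('m \<Rightarrow> 'k)" where
  "Hom_dual_left C x' m f \<xi> = (\<lambda>g. if g \<in> Hom C x' m then \<xi> (g \<cdot>\<^bsub>C\<^esub> f) else 0)"

text \<open>
  \<open>N\<close> is the right exact Nakayama functor of \<open>C\<close>: for some choice of copowers
  \<open>P x m y = Hom(x, m)\<^sup>* \<otimes> y\<close> (with structure maps \<open>t x m y\<close>), \<open>N x\<close> is for every \<open>x\<close> the coend over \<open>m\<close>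
  of \<open>Hom(x, m)\<^sup>* \<otimes> m\<close> with structure arrows \<open>i x m\<close>, and the value of \<open>N\<close> on \<open>f: x \<rightarrow> x'\<close> is
  the arrow of coends induced by the maps \<open>Hom(f, m)\<^sup>* \<otimes> m\<close>.
\<close>

definition nakayama_functor ::
  "('k::field, 'o, 'm::ab_group_add, 'z) lcat_scheme \<Rightarrow> ('o, 'm, 'o, 'm) functor_data \<Rightarrow> bool" where
  "nakayama_functor C N \<longleftrightarrow>
     linear_functor C C N \<and>
     (\<exists>P t i.
        (\<forall>x \<in> Obj C. \<forall>m \<in> Obj C. \<forall>y \<in> Obj C.
           is_copower C dual_scl (Hom_dual C x m) y (P x m y) (t x m y)) \<and>
        (\<forall>x \<in> Obj C.
           is_coend C C (P x)
             (\<lambda>m n y z h f. copower_map C (Hom_dual C x m) y (P x m y) (t x m y)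
                (P x n z) (t x n z) (Hom_dual_right C x n h) f)
             (FO N x) (i x)) \<and>
        (\<forall>x \<in> Obj C. \<forall>x' \<in> Obj C. \<forall>f \<in> Hom C x x'. \<forall>m \<in> Obj C.
           FA N f \<cdot>\<^bsub>C\<^esub> i x m =
             i x' m \<cdot>\<^bsub>C\<^esub> copower_map C (Hom_dual C x m) m (P x m m) (t x m m)
                (P x' m m) (t x' m m) (Hom_dual_left C x' m f) (Id C m)))"

end

theory Submission
  imports Defs
begin

text \<open>
  Writing \<open>a\<close> also for the functor \<open>a \<rhd> -\<close>, the left duals of \<open>a\<close> give a chain of adjunctions
  \<open>a \<stileturn> ldual a \<stileturn> lldual a \<stileturn> ldual (lldual a)\<close> on \<open>M\<close>. The coend \<open>N x\<close> represents the natural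
  transformations \<open>Hom(x, -)\<^sup>* \<rightarrow> Hom(-, d)\<close>, so for any functors \<open>L \<stileturn> K \<stileturn> R \<stileturn> S\<close> precomposing functionals
  with the partial trace \<open>Hom(L m, R n) \<rightarrow> Hom(m, n)\<close> defines an isomorphism \<open>R (N m) \<rightarrow> N (L m)\<close>. It depends only
  on the partial trace, hence is compatible with every pair of transformations \<open>L \<rightarrow> L'\<close>, \<open>R \<rightarrow> R'\<close> that are mates
  of one transformation \<open>K' \<rightarrow> K\<close>. Naturality in \<open>a\<close> and all coherence axioms are instances, with mates
  computed from the evaluations alone. Right actions are left actions of the reversed tensor category.
\<close>

section \<open>Module categories over monoidal categories\<close>

text \<open>Behind the isomorphism is a change of variables. \<open>N (L m)\<close> is the coend
  over \<open>n\<close> of the dual of \<open>Hom(L m, n)\<close> tensored with \<open>n\<close>.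
  The adjunction of \<open>L\<close> and \<open>K\<close> replaces this dual by that of
  \<open>Hom(m, K n)\<close>, the adjunction of \<open>K\<close> and \<open>R\<close> turns the
  coend into the one over \<open>p\<close> of the dual of \<open>Hom(m, p)\<close> tensored with
  \<open>R p\<close>, and \<open>R\<close> commutes with that coend because it has the right adjoint
  \<open>S\<close>. \<open>S\<close> has a second role: it makes the images under \<open>R\<close>
  of the universal arrows jointly epic, so coherence is tested on these arrows and never on an
  explicit formula for the isomorphism. Two obstacles shape the development. The zero of the ambient
  vector space lies in every hom-space, so a raw arrow need not determine its endpoints; categories
  and duals are therefore treated with arrows that carry their endpoints, and the results are
  translated back. And the Nakayama functor comes with arbitrary copowers and coends; a Yoneda
  argument eliminates them once and for all in favour of the natural transformations that they
  represent.\<close>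

text \<open>Source and target of a composite are unconditional, so that the simplifier can discharge the typing
  conditions of the category axioms.\<close>

locale cat =
  fixes Ob :: "'o set"
    and arr :: "'f \<Rightarrow> bool"
    and src tgt :: "'f \<Rightarrow> 'o"
    and cmp :: "'f \<Rightarrow> 'f \<Rightarrow> 'f"  (infixr "\<bullet>" 70)
    and one :: "'o \<Rightarrow> 'f"
  assumes src_cmp [simp]: "src (g \<bullet> f) = src f"
    and tgt_cmp [simp]: "tgt (g \<bullet> f) = tgt g"
    and arr_cmp [simp]: "\<lbrakk>arr f; arr g; src g = tgt f\<rbrakk> \<Longrightarrow> arr (g \<bullet> f)"
    and assoc: "\<lbrakk>arr f; arr g; arr h; src g = tgt f; src h = tgt g\<rbrakk> \<Longrightarrow> (h \<bullet> g) \<bullet> f = h \<bullet> g \<bullet> f"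
    and src_one [simp]: "src (one x) = x"
    and tgt_one [simp]: "tgt (one x) = x"
    and arr_one [simp]: "x \<in> Ob \<Longrightarrow> arr (one x)"
    and src_Ob [simp]: "arr f \<Longrightarrow> src f \<in> Ob"
    and tgt_Ob [simp]: "arr f \<Longrightarrow> tgt f \<in> Ob"
    and one_cmp [simp]: "\<lbrakk>arr f; tgt f = x\<rbrakk> \<Longrightarrow> one x \<bullet> f = f"
    and cmp_one [simp]: "\<lbrakk>arr f; src f = x\<rbrakk> \<Longrightarrow> f \<bullet> one x = f"
begin

definition invs :: "'f \<Rightarrow> 'f \<Rightarrow> bool" where
  "invs f g \<longleftrightarrow> arr f \<and> arr g \<and> src g = tgt f \<and> tgt g = src f \<and>
     g \<bullet> f = one (src f) \<and> f \<bullet> g = one (tgt f)"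

definition iso :: "'f \<Rightarrow> bool" where
  "iso f \<longleftrightarrow> (\<exists>g. invs f g)"

definition iv :: "'f \<Rightarrow> 'f" where
  "iv f = (THE g. invs f g)"

lemma invs_unique: "\<lbrakk>invs f g; invs f h\<rbrakk> \<Longrightarrow> g = h"
  unfolding invs_def using assoc[of f g f] assoc[of f h f] assoc[of h f g] by auto

lemma iv_eq: "invs f g \<Longrightarrow> iv f = g"
  unfolding iv_def using invs_unique by blast

lemma invs_iv: "iso f \<Longrightarrow> invs f (iv f)"
  unfolding iso_def using iv_eq by blast

lemma iso_arr [simp]: "iso f \<Longrightarrow> arr f"
  and arr_iv [simp]: "iso f \<Longrightarrow> arr (iv f)"
  and src_iv [simp]: "iso f \<Longrightarrow> src (iv f) = tgt f"
  and tgt_iv [simp]: "iso f \<Longrightarrow> tgt (iv f) = src f"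
  and iv_cmp [simp]: "iso f \<Longrightarrow> iv f \<bullet> f = one (src f)"
  and cmp_iv [simp]: "iso f \<Longrightarrow> f \<bullet> iv f = one (tgt f)"
  using invs_iv[of f] by (auto simp: invs_def iso_def)

lemma iv_cmp_cmp [simp]: "\<lbrakk>iso f; arr g; tgt g = src f\<rbrakk> \<Longrightarrow> iv f \<bullet> f \<bullet> g = g"
  by (subst assoc[symmetric]) auto

lemma cmp_iv_cmp [simp]: "\<lbrakk>iso f; arr g; tgt g = tgt f\<rbrakk> \<Longrightarrow> f \<bullet> iv f \<bullet> g = g"
  by (subst assoc[symmetric]) auto

lemma isoI: "\<lbrakk>arr f; arr g; src g = tgt f; tgt g = src f; g \<bullet> f = one (src f); f \<bullet> g = one (tgt f)\<rbrakk> \<Longrightarrow> iso f"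
  unfolding iso_def invs_def by blast

lemma iv_eqI: "\<lbrakk>iso f; arr g; src g = tgt f; g \<bullet> f = one (src f)\<rbrakk> \<Longrightarrow> iv f = g"
  by (metis assoc cmp_one cmp_iv arr_iv iso_arr one_cmp src_iv tgt_cmp tgt_iv tgt_one)

lemma iso_iv [simp]: "iso f \<Longrightarrow> iso (iv f)"
  by (rule isoI[of _ f]) auto

lemma iv_iv [simp]: "iso f \<Longrightarrow> iv (iv f) = f"
  by (rule iv_eqI) auto

lemma iso_one [simp]: "x \<in> Ob \<Longrightarrow> iso (one x)"
  by (rule isoI[of _ "one x"]) auto

lemma iv_one [simp]: "x \<in> Ob \<Longrightarrow> iv (one x) = one x"
  by (rule iv_eqI) auto

lemma iso_cmp [simp]: "\<lbrakk>iso f; iso g; src g = tgt f\<rbrakk> \<Longrightarrow> iso (g \<bullet> f)"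
  by (rule isoI[of _ "iv f \<bullet> iv g"]) (auto simp: assoc)

lemma iv_of_cmp: "\<lbrakk>iso f; iso g; src g = tgt f\<rbrakk> \<Longrightarrow> iv (g \<bullet> f) = iv f \<bullet> iv g"
  by (rule iv_eqI) (auto simp: assoc)

lemma cancel_right: "\<lbrakk>g \<bullet> f = h \<bullet> f; iso f; arr g; arr h; src g = tgt f; src h = tgt f\<rbrakk> \<Longrightarrow> g = h"
  by (metis assoc arr_iv cmp_iv cmp_one iso_arr tgt_iv)

lemma cancel_left: "\<lbrakk>f \<bullet> g = f \<bullet> h; iso f; arr g; arr h; tgt g = src f; tgt h = src f\<rbrakk> \<Longrightarrow> g = h"
  by (metis iv_cmp_cmp)

text \<open>Composing a commuting square with the inverses of two opposite sides gives the square of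
  these inverses. Naturality of inverted associators and of other families of inverses is obtained
  in this way.\<close>

lemma cmp_iv_swap:
  "\<lbrakk>k \<bullet> f = g \<bullet> h; iso h; iso k; arr f; arr g; src k = tgt f; src g = tgt h; src f = src h; tgt g = tgt k\<rbrakk>
    \<Longrightarrow> f \<bullet> iv h = iv k \<bullet> g"
  by (rule cancel_left[of k], simp_all, metis arr_iv assoc cmp_iv cmp_one iso_arr src_iv tgt_iv)

text \<open>Composites are kept nested to the right, where an equation for two factors does not
  match inside a longer chain; this form carries the remaining factor \<open>x\<close>
  along.\<close>

lemma cmp_cong2: "\<lbrakk>g \<bullet> f = k; arr f; arr g; src g = tgt f; arr x; tgt x = src f\<rbrakk> \<Longrightarrow> g \<bullet> f \<bullet> x = k \<bullet> x"
  by (metis assoc)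

end

section \<open>Functors of two variables, monoidal categories and module categories\<close>

locale bifunctor =
  A: cat ObA arrA srcA tgtA cmpA oneA + M: cat Ob arr src tgt cmp one
  for ObA :: "'oa set" and arrA :: "'fa \<Rightarrow> bool" and srcA tgtA
    and cmpA (infixr "\<bullet>\<^sub>A" 70) and oneA
    and Ob :: "'o set" and arr :: "'f \<Rightarrow> bool" and src tgt
    and cmp (infixr "\<bullet>" 70) and one +
  fixes act :: "'oa \<Rightarrow> 'o \<Rightarrow> 'o"  (infixr "\<triangleright>" 75)
    and acta :: "'fa \<Rightarrow> 'f \<Rightarrow> 'f"  (infixr "\<triangleright>\<^sub>f" 75)
  assumes act_Ob [simp]: "\<lbrakk>a \<in> ObA; m \<in> Ob\<rbrakk> \<Longrightarrow> a \<triangleright> m \<in> Ob"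
    and src_act [simp]: "src (f \<triangleright>\<^sub>f h) = srcA f \<triangleright> src h"
    and tgt_act [simp]: "tgt (f \<triangleright>\<^sub>f h) = tgtA f \<triangleright> tgt h"
    and arr_act [simp]: "\<lbrakk>arrA f; arr h\<rbrakk> \<Longrightarrow> arr (f \<triangleright>\<^sub>f h)"
    and act_one [simp]: "\<lbrakk>a \<in> ObA; m \<in> Ob\<rbrakk> \<Longrightarrow> oneA a \<triangleright>\<^sub>f one m = one (a \<triangleright> m)"
    and interchange: "\<lbrakk>arrA f; arrA g; arr h; arr k; srcA g = tgtA f; src k = tgt h\<rbrakk>
       \<Longrightarrow> (g \<triangleright>\<^sub>f k) \<bullet> (f \<triangleright>\<^sub>f h) = (g \<bullet>\<^sub>A f) \<triangleright>\<^sub>f (k \<bullet> h)"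
begin

lemma interchange': 
  assumes "arrA f" "arrA g" "arr h" "arr k" "arr x" "srcA g = tgtA f" "src k = tgt h" "tgt x = srcA f \<triangleright> src h"
  shows "(g \<triangleright>\<^sub>f k) \<bullet> (f \<triangleright>\<^sub>f h) \<bullet> x = ((g \<bullet>\<^sub>A f) \<triangleright>\<^sub>f (k \<bullet> h)) \<bullet> x"
  using assms by (intro M.cmp_cong2) (auto simp: interchange)

lemma iso_act [simp]: "\<lbrakk>A.iso f; M.iso h\<rbrakk> \<Longrightarrow> M.iso (f \<triangleright>\<^sub>f h)"
  by (rule M.isoI[of _ "A.iv f \<triangleright>\<^sub>f M.iv h"]) (auto simp: interchange)

lemma iv_act: "\<lbrakk>A.iso f; M.iso h\<rbrakk> \<Longrightarrow> M.iv (f \<triangleright>\<^sub>f h) = A.iv f \<triangleright>\<^sub>f M.iv h"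
  by (rule M.iv_eqI) (auto simp: interchange)

end

locale monoidal =
  bifunctor Ob arr src tgt cmp one Ob arr src tgt cmp one tns tna
  for Ob :: "'o set" and arr :: "'f \<Rightarrow> bool" and src tgt
    and cmp (infixr "\<bullet>\<^sub>A" 70) and one
    and tns :: "'o \<Rightarrow> 'o \<Rightarrow> 'o"  (infixr "\<odot>" 75)
    and tna :: "'f \<Rightarrow> 'f \<Rightarrow> 'f"  (infixr "\<odot>\<^sub>f" 75) +
  fixes I :: 'o
    and as :: "'o \<Rightarrow> 'o \<Rightarrow> 'o \<Rightarrow> 'f"
    and lu ru :: "'o \<Rightarrow> 'f"
  assumes I_Ob [simp]: "I \<in> Ob"
    and as_iso [simp]: "\<lbrakk>x \<in> Ob; y \<in> Ob; z \<in> Ob\<rbrakk> \<Longrightarrow> A.iso (as x y z)"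
    and src_as [simp]: "\<lbrakk>x \<in> Ob; y \<in> Ob; z \<in> Ob\<rbrakk> \<Longrightarrow> src (as x y z) = (x \<odot> y) \<odot> z"
    and tgt_as [simp]: "\<lbrakk>x \<in> Ob; y \<in> Ob; z \<in> Ob\<rbrakk> \<Longrightarrow> tgt (as x y z) = x \<odot> y \<odot> z"
    and as_natural: "\<lbrakk>arr f; arr g; arr h\<rbrakk>
        \<Longrightarrow> as (tgt f) (tgt g) (tgt h) \<bullet>\<^sub>A ((f \<odot>\<^sub>f g) \<odot>\<^sub>f h) = (f \<odot>\<^sub>f g \<odot>\<^sub>f h) \<bullet>\<^sub>A as (src f) (src g) (src h)"
    and lu_iso [simp]: "x \<in> Ob \<Longrightarrow> A.iso (lu x)"
    and src_lu [simp]: "x \<in> Ob \<Longrightarrow> src (lu x) = I \<odot> x"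
    and tgt_lu [simp]: "x \<in> Ob \<Longrightarrow> tgt (lu x) = x"
    and lu_natural: "arr f \<Longrightarrow> lu (tgt f) \<bullet>\<^sub>A (one I \<odot>\<^sub>f f) = f \<bullet>\<^sub>A lu (src f)"
    and ru_iso [simp]: "x \<in> Ob \<Longrightarrow> A.iso (ru x)"
    and src_ru [simp]: "x \<in> Ob \<Longrightarrow> src (ru x) = x \<odot> I"
    and tgt_ru [simp]: "x \<in> Ob \<Longrightarrow> tgt (ru x) = x"
    and ru_natural: "arr f \<Longrightarrow> ru (tgt f) \<bullet>\<^sub>A (f \<odot>\<^sub>f one I) = f \<bullet>\<^sub>A ru (src f)"
    and pentagon: "\<lbrakk>w \<in> Ob; x \<in> Ob; y \<in> Ob; z \<in> Ob\<rbrakk>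
        \<Longrightarrow> as w x (y \<odot> z) \<bullet>\<^sub>A as (w \<odot> x) y z =
            (one w \<odot>\<^sub>f as x y z) \<bullet>\<^sub>A as w (x \<odot> y) z \<bullet>\<^sub>A (as w x y \<odot>\<^sub>f one z)"
    and triangle: "\<lbrakk>x \<in> Ob; y \<in> Ob\<rbrakk>
        \<Longrightarrow> (one x \<odot>\<^sub>f lu y) \<bullet>\<^sub>A as x I y = ru x \<odot>\<^sub>f one y"

text \<open>The axioms contain one triangle, with the unit as second tensor factor; the one with the
  unit as first tensor factor is derived as \<open>lu'_as'\<close>.\<close>

locale module_cat =
  A: monoidal ObA arrA srcA tgtA cmpA oneA tns tna I as lu ru +
  bifunctor ObA arrA srcA tgtA cmpA oneA Ob arr src tgt cmp one act acta
  for ObA :: "'oa set" and arrA :: "'fa \<Rightarrow> bool" and srcA tgtA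
    and cmpA (infixr "\<bullet>\<^sub>A" 70) and oneA
    and tns (infixr "\<odot>" 75) and tna (infixr "\<odot>\<^sub>f" 75) and I as lu ru
    and Ob :: "'o set" and arr :: "'f \<Rightarrow> bool" and src tgt
    and cmp (infixr "\<bullet>" 70) and one
    and act (infixr "\<triangleright>" 75) and acta (infixr "\<triangleright>\<^sub>f" 75) +
  fixes as' :: "'oa \<Rightarrow> 'oa \<Rightarrow> 'o \<Rightarrow> 'f"
    and lu' :: "'o \<Rightarrow> 'f"
  assumes as'_iso [simp]: "\<lbrakk>a \<in> ObA; b \<in> ObA; m \<in> Ob\<rbrakk> \<Longrightarrow> M.iso (as' a b m)"
    and src_as' [simp]: "\<lbrakk>a \<in> ObA; b \<in> ObA; m \<in> Ob\<rbrakk> \<Longrightarrow> src (as' a b m) = (a \<odot> b) \<triangleright> m"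
    and tgt_as' [simp]: "\<lbrakk>a \<in> ObA; b \<in> ObA; m \<in> Ob\<rbrakk> \<Longrightarrow> tgt (as' a b m) = a \<triangleright> b \<triangleright> m"
    and as'_natural: "\<lbrakk>arrA f; arrA g; arr h\<rbrakk>
        \<Longrightarrow> as' (tgtA f) (tgtA g) (tgt h) \<bullet> ((f \<odot>\<^sub>f g) \<triangleright>\<^sub>f h) =
            (f \<triangleright>\<^sub>f g \<triangleright>\<^sub>f h) \<bullet> as' (srcA f) (srcA g) (src h)"
    and lu'_iso [simp]: "m \<in> Ob \<Longrightarrow> M.iso (lu' m)"
    and src_lu' [simp]: "m \<in> Ob \<Longrightarrow> src (lu' m) = I \<triangleright> m"
    and tgt_lu' [simp]: "m \<in> Ob \<Longrightarrow> tgt (lu' m) = m"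
    and lu'_natural: "arr h \<Longrightarrow> lu' (tgt h) \<bullet> (oneA I \<triangleright>\<^sub>f h) = h \<bullet> lu' (src h)"
    and pentagon': "\<lbrakk>a \<in> ObA; b \<in> ObA; c \<in> ObA; m \<in> Ob\<rbrakk>
        \<Longrightarrow> as' a b (c \<triangleright> m) \<bullet> as' (a \<odot> b) c m =
            (oneA a \<triangleright>\<^sub>f as' b c m) \<bullet> as' a (b \<odot> c) m \<bullet> (as a b c \<triangleright>\<^sub>f one m)"
    and triangle': "\<lbrakk>a \<in> ObA; m \<in> Ob\<rbrakk>
        \<Longrightarrow> (oneA a \<triangleright>\<^sub>f lu' m) \<bullet> as' a I m = ru a \<triangleright>\<^sub>f one m"
begin

lemma as'_nat:
  "\<lbrakk>arrA f; arrA g; arr h; srcA f = a; tgtA f = a1; srcA g = b; tgtA g = b1; src h = m; tgt h = m1\<rbrakk>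
     \<Longrightarrow> as' a1 b1 m1 \<bullet> ((f \<odot>\<^sub>f g) \<triangleright>\<^sub>f h) = (f \<triangleright>\<^sub>f g \<triangleright>\<^sub>f h) \<bullet> as' a b m"
  using as'_natural by blast

lemma lu'_nat: "\<lbrakk>arr h; src h = m; tgt h = m1\<rbrakk> \<Longrightarrow> lu' m1 \<bullet> (oneA I \<triangleright>\<^sub>f h) = h \<bullet> lu' m"
  using lu'_natural by blast

text \<open>The unitor \<open>lu'\<close> identifies the action of the unit with the identity
  functor.\<close>

lemma unit_faithful:
  assumes "oneA I \<triangleright>\<^sub>f f = oneA I \<triangleright>\<^sub>f g" "arr f" "arr g" "src f = src g" "tgt f = tgt g"
  shows "f = g"
proof (rule M.cancel_right)
  show "f \<bullet> lu' (src f) = g \<bullet> lu' (src f)"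
    using assms lu'_natural[of f] lu'_natural[of g] by simp
qed (use assms in auto)

text \<open>For an evaluation \<open>e\<close> this is the counit of the adjunction between the
  actions of \<open>a\<close> and \<open>k\<close>. It is defined for every arrow \<open>e\<close>
  from \<open>a \<odot> k\<close> to \<open>I\<close>, so that transposed and nested evaluations and
  the unitor \<open>lu I\<close> are covered by the same computations.\<close>

definition ev :: "'oa \<Rightarrow> 'oa \<Rightarrow> 'fa \<Rightarrow> 'o \<Rightarrow> 'f" where
  "ev a k e n = lu' n \<bullet> (e \<triangleright>\<^sub>f one n) \<bullet> M.iv (as' a k n)"

definition coev :: "'oa \<Rightarrow> 'oa \<Rightarrow> 'fa \<Rightarrow> 'o \<Rightarrow> 'f" where
  "coev k a c m = as' k a m \<bullet> (c \<triangleright>\<^sub>f one m) \<bullet> M.iv (lu' m)"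

lemma ev_typ [simp]:
  assumes "arrA e" "srcA e = a \<odot> k" "tgtA e = I" "a \<in> ObA" "k \<in> ObA" "n \<in> Ob"
  shows "arr (ev a k e n)" "src (ev a k e n) = a \<triangleright> k \<triangleright> n" "tgt (ev a k e n) = n"
  using assms by (auto simp: ev_def)

lemma coev_typ [simp]:
  assumes "arrA c" "srcA c = I" "tgtA c = k \<odot> a" "a \<in> ObA" "k \<in> ObA" "n \<in> Ob"
  shows "arr (coev k a c n)" "src (coev k a c n) = n" "tgt (coev k a c n) = k \<triangleright> a \<triangleright> n"
  using assms by (auto simp: coev_def)

lemma ev_as:
  assumes "arrA e" "srcA e = a \<odot> k" "tgtA e = I" "a \<in> ObA" "k \<in> ObA" "n \<in> Ob"
  shows "ev a k e n \<bullet> as' a k n = lu' n \<bullet> (e \<triangleright>\<^sub>f one n)"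
  using assms by (simp add: ev_def M.assoc)

lemma coev_lu:
  assumes "arrA c" "srcA c = I" "tgtA c = k \<odot> a" "a \<in> ObA" "k \<in> ObA" "n \<in> Ob"
  shows "coev k a c n \<bullet> lu' n = as' k a n \<bullet> (c \<triangleright>\<^sub>f one n)"
  using assms by (simp add: coev_def M.assoc)

text \<open>Arrows acting on \<open>a\<close> and \<open>k\<close> are absorbed into
  \<open>e\<close>; equations between counits on the module category thus reduce to equations
  between evaluations in the tensor category. The comparison takes place after the associator, which
  is invertible.\<close>

lemma ev_natural:
  assumes "arrA e" "srcA e = a \<odot> k" "tgtA e = I" 
    and "arrA f" "srcA f = a1" "tgtA f = a" "arrA g" "srcA g = k1" "tgtA g = k" "arr h" "src h = m" "tgt h = n"
  shows "ev a k e n \<bullet> (f \<triangleright>\<^sub>f g \<triangleright>\<^sub>f h) = h \<bullet> ev a1 k1 (e \<bullet>\<^sub>A (f \<odot>\<^sub>f g)) m"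
proof (rule M.cancel_right)
  have [simp]: "a \<in> ObA" "a1 \<in> ObA" "k \<in> ObA" "k1 \<in> ObA" "n \<in> Ob" "m \<in> Ob"
    using assms by auto
  have "ev a k e n \<bullet> (f \<triangleright>\<^sub>f g \<triangleright>\<^sub>f h) \<bullet> as' a1 k1 m = ev a k e n \<bullet> as' a k n \<bullet> ((f \<odot>\<^sub>f g) \<triangleright>\<^sub>f h)"
    using assms by (simp add: as'_nat)
  also have "\<dots> = lu' n \<bullet> (e \<triangleright>\<^sub>f one n) \<bullet> ((f \<odot>\<^sub>f g) \<triangleright>\<^sub>f h)"
    using assms by (subst M.cmp_cong2[OF ev_as]) (auto simp: M.assoc)
  also have "\<dots> = lu' n \<bullet> (oneA I \<triangleright>\<^sub>f h) \<bullet> ((e \<bullet>\<^sub>A (f \<odot>\<^sub>f g)) \<triangleright>\<^sub>f one m)"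
    using assms by (simp add: interchange)
  also have "\<dots> = h \<bullet> lu' m \<bullet> ((e \<bullet>\<^sub>A (f \<odot>\<^sub>f g)) \<triangleright>\<^sub>f one m)"
    using assms by (subst M.cmp_cong2[OF lu'_nat]) (auto simp: M.assoc)
  also have "\<dots> = h \<bullet> ev a1 k1 (e \<bullet>\<^sub>A (f \<odot>\<^sub>f g)) m \<bullet> as' a1 k1 m"
    using assms by (simp add: ev_as)
  finally show "(ev a k e n \<bullet> (f \<triangleright>\<^sub>f g \<triangleright>\<^sub>f h)) \<bullet> as' a1 k1 m = (h \<bullet> ev a1 k1 (e \<bullet>\<^sub>A (f \<odot>\<^sub>f g)) m) \<bullet> as' a1 k1 m"
    using assms by (simp add: M.assoc)
qed (use assms in auto)

end

section \<open>Module functors and duality\<close>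

locale module_functor =
  X: module_cat ObA arrA srcA tgtA cmpA oneA tns tna I as lu ru
       ObX arrX srcX tgtX cmpX oneX actX actaX asX luX +
  Y: module_cat ObA arrA srcA tgtA cmpA oneA tns tna I as lu ru
       Ob arr src tgt cmp one act acta as' lu'
  for ObA :: "'oa set" and arrA :: "'fa \<Rightarrow> bool" and srcA tgtA
    and cmpA (infixr "\<bullet>\<^sub>A" 70) and oneA
    and tns (infixr "\<odot>" 75) and tna (infixr "\<odot>\<^sub>f" 75) and I as lu ru
    and ObX :: "'ox set" and arrX :: "'fx \<Rightarrow> bool" and srcX tgtX
    and cmpX (infixr "\<bullet>\<^sub>X" 70) and oneX
    and actX (infixr "\<triangleright>\<^sub>X" 75) and actaX (infixr "\<triangleright>\<^sub>X\<^sub>f" 75) and asX luX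
    and Ob :: "'o set" and arr :: "'f \<Rightarrow> bool" and src tgt
    and cmp (infixr "\<bullet>" 70) and one
    and act (infixr "\<triangleright>" 75) and acta (infixr "\<triangleright>\<^sub>f" 75) and as' lu' +
  fixes Go :: "'ox \<Rightarrow> 'o"
    and Ga :: "'fx \<Rightarrow> 'f"
    and g :: "'oa \<Rightarrow> 'ox \<Rightarrow> 'f"
  assumes Go_Ob [simp]: "m \<in> ObX \<Longrightarrow> Go m \<in> Ob"
    and arr_Ga [simp]: "arrX h \<Longrightarrow> arr (Ga h)"
    and src_Ga [simp]: "arrX h \<Longrightarrow> src (Ga h) = Go (srcX h)"
    and tgt_Ga [simp]: "arrX h \<Longrightarrow> tgt (Ga h) = Go (tgtX h)"
    and Ga_one [simp]: "m \<in> ObX \<Longrightarrow> Ga (oneX m) = one (Go m)"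
    and Ga_cmp: "\<lbrakk>arrX h; arrX k; srcX k = tgtX h\<rbrakk> \<Longrightarrow> Ga (k \<bullet>\<^sub>X h) = Ga k \<bullet> Ga h"
    and g_iso [simp]: "\<lbrakk>a \<in> ObA; m \<in> ObX\<rbrakk> \<Longrightarrow> Y.M.iso (g a m)"
    and src_g [simp]: "\<lbrakk>a \<in> ObA; m \<in> ObX\<rbrakk> \<Longrightarrow> src (g a m) = Go (a \<triangleright>\<^sub>X m)"
    and tgt_g [simp]: "\<lbrakk>a \<in> ObA; m \<in> ObX\<rbrakk> \<Longrightarrow> tgt (g a m) = a \<triangleright> Go m"
    and g_natural: "\<lbrakk>arrA f; arrX h\<rbrakk> \<Longrightarrow>
        g (tgtA f) (tgtX h) \<bullet> Ga (f \<triangleright>\<^sub>X\<^sub>f h) = (f \<triangleright>\<^sub>f Ga h) \<bullet> g (srcA f) (srcX h)"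
    and g_assoc: "\<lbrakk>a \<in> ObA; b \<in> ObA; m \<in> ObX\<rbrakk> \<Longrightarrow>
        as' a b (Go m) \<bullet> g (a \<odot> b) m = (oneA a \<triangleright>\<^sub>f g b m) \<bullet> g a (b \<triangleright>\<^sub>X m) \<bullet> Ga (asX a b m)"
begin

lemma g_nat:
  "\<lbrakk>arrA f; arrX h; srcA f = a; tgtA f = a1; srcX h = m; tgtX h = m1\<rbrakk> \<Longrightarrow>
     g a1 m1 \<bullet> Ga (f \<triangleright>\<^sub>X\<^sub>f h) = (f \<triangleright>\<^sub>f Ga h) \<bullet> g a m"
  using g_natural by blast

lemma Ga_iso [simp]: "X.M.iso h \<Longrightarrow> Y.M.iso (Ga h)"
  by (rule Y.M.isoI[of _ "Ga (X.M.iv h)"]) (auto simp: Ga_cmp[symmetric])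

text \<open>Kelly's argument: compatibility with the associators forces compatibility with the units.\<close>

lemma g_unit:
  assumes "m \<in> ObX"
  shows "lu' (Go m) \<bullet> g I m = Ga (luX m)"
proof (rule Y.unit_faithful, rule Y.M.cancel_right)
  \<comment> \<open>An isomorphism, and the tail of \<open>g_assoc\<close> at
    \<open>a = b = I\<close>. After it, the left side is computed by \<open>triangle'\<close> in the
    target and the right side by \<open>triangle'\<close> in the source.\<close>
  let ?z = "g I (I \<triangleright>\<^sub>X m) \<bullet> Ga (asX I I m)"
  have "(oneA I \<triangleright>\<^sub>f (lu' (Go m) \<bullet> g I m)) \<bullet> ?z
      = (oneA I \<triangleright>\<^sub>f lu' (Go m)) \<bullet> (oneA I \<triangleright>\<^sub>f g I m) \<bullet> ?z"
    using assms by (simp add: Y.interchange')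
  also have "\<dots> = (oneA I \<triangleright>\<^sub>f lu' (Go m)) \<bullet> as' I I (Go m) \<bullet> g (I \<odot> I) m"
    using assms by (simp add: g_assoc)
  also have "\<dots> = (ru I \<triangleright>\<^sub>f one (Go m)) \<bullet> g (I \<odot> I) m"
    using assms by (subst Y.M.cmp_cong2[OF Y.triangle']) auto
  also have "\<dots> = g I m \<bullet> Ga (ru I \<triangleright>\<^sub>X\<^sub>f oneX m)"
    using assms by (simp add: g_nat)
  also have "\<dots> = g I m \<bullet> Ga (oneA I \<triangleright>\<^sub>X\<^sub>f luX m) \<bullet> Ga (asX I I m)"
    using assms by (simp add: X.triangle'[symmetric] Ga_cmp)
  also have "\<dots> = (oneA I \<triangleright>\<^sub>f Ga (luX m)) \<bullet> ?z"
    using assms by (subst Y.M.cmp_cong2[OF g_nat]) (auto simp: Y.M.assoc)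
  finally show "(oneA I \<triangleright>\<^sub>f (lu' (Go m) \<bullet> g I m)) \<bullet> ?z = (oneA I \<triangleright>\<^sub>f Ga (luX m)) \<bullet> ?z" .
qed (use assms in auto)

text \<open>A counit is made of \<open>as'\<close>, the action of \<open>e\<close> and
  \<open>lu'\<close>, with which \<open>g\<close> is compatible by \<open>g_assoc\<close>,
  \<open>g_nat\<close> and \<open>g_unit\<close>. This serves both the functors sending
  \<open>b\<close> to \<open>b \<triangleright> m\<close> and the actions that commute with the
  given one.\<close>

lemma g_ev:
  assumes "arrA e" "srcA e = a \<odot> k" "tgtA e = I" "a \<in> ObA" "k \<in> ObA" "n \<in> ObX"
  shows "Y.ev a k e (Go n) \<bullet> (oneA a \<triangleright>\<^sub>f g k n) \<bullet> g a (k \<triangleright>\<^sub>X n) = Ga (X.ev a k e n)"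
proof (rule Y.M.cancel_right)
  let ?z = "Ga (asX a k n)"
  have "(Y.ev a k e (Go n) \<bullet> (oneA a \<triangleright>\<^sub>f g k n) \<bullet> g a (k \<triangleright>\<^sub>X n)) \<bullet> ?z
     = Y.ev a k e (Go n) \<bullet> as' a k (Go n) \<bullet> g (a \<odot> k) n"
    using assms by (simp add: g_assoc Y.M.assoc)
  also have "\<dots> = lu' (Go n) \<bullet> (e \<triangleright>\<^sub>f one (Go n)) \<bullet> g (a \<odot> k) n"
    using assms by (subst Y.M.cmp_cong2[OF Y.ev_as]) (auto simp: Y.M.assoc)
  also have "\<dots> = lu' (Go n) \<bullet> g I n \<bullet> Ga (e \<triangleright>\<^sub>X\<^sub>f oneX n)"
    using assms by (simp add: g_nat)
  also have "\<dots> = Ga (luX n) \<bullet> Ga (e \<triangleright>\<^sub>X\<^sub>f oneX n)"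
    using assms by (subst Y.M.cmp_cong2[OF g_unit]) auto
  also have "\<dots> = Ga (X.ev a k e n) \<bullet> ?z"
    using assms by (simp add: Ga_cmp[symmetric] X.ev_as)
  finally show "(Y.ev a k e (Go n) \<bullet> (oneA a \<triangleright>\<^sub>f g k n) \<bullet> g a (k \<triangleright>\<^sub>X n)) \<bullet> ?z = Ga (X.ev a k e n) \<bullet> ?z" .
qed (use assms in auto)

end

section \<open>The regular module and the reversed tensor product\<close>

context monoidal
begin

text \<open>With the tensor category acting on itself, lemmas about modules specialise to lemmas
  about its tensor products and duals.\<close>

lemma regular: "module_cat Ob arr src tgt cmp one tns tna I as lu ru Ob arr src tgt cmp one tns tna as lu"
  by unfold_locales (auto simp: as_natural lu_natural pentagon triangle)

text \<open>This is \<open>ev\<close> of the regular module, written out because \<open>ev\<close>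
  belongs to the locale of module categories.\<close>

definition tev where
  "tev a k e n = lu n \<bullet>\<^sub>A (e \<odot>\<^sub>f one n) \<bullet>\<^sub>A A.iv (as a k n)"

text \<open>Reversal turns the associator around, so its inverse takes its place and the two unitors
  change roles; the new pentagon is the inverse of the old one.\<close>

lemma reversed:
  "monoidal Ob arr src tgt cmp one (\<lambda>x y. y \<odot> x) (\<lambda>f g. g \<odot>\<^sub>f f) I (\<lambda>x y z. A.iv (as z y x)) ru lu"
proof unfold_locales
  fix f g h
  assume [simp]: "arr f" "arr g" "arr h"
  show "A.iv (as (tgt h) (tgt g) (tgt f)) \<bullet>\<^sub>A (h \<odot>\<^sub>f g \<odot>\<^sub>f f)
      = ((h \<odot>\<^sub>f g) \<odot>\<^sub>f f) \<bullet>\<^sub>A A.iv (as (src h) (src g) (src f))"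
    by (rule A.cmp_iv_swap[symmetric]) (auto simp: as_natural)
next
  fix w x y z
  assume [simp]: "w \<in> Ob" "x \<in> Ob" "y \<in> Ob" "z \<in> Ob"
  have "A.iv (as z y x \<odot>\<^sub>f one w) \<bullet>\<^sub>A A.iv (as z (y \<odot> x) w) \<bullet>\<^sub>A A.iv (one z \<odot>\<^sub>f as y x w)
      = A.iv (as z y (x \<odot> w) \<bullet>\<^sub>A as (z \<odot> y) x w)"
    by (simp add: pentagon A.iv_of_cmp A.assoc)
  then show "A.iv (as (z \<odot> y) x w) \<bullet>\<^sub>A A.iv (as z y (x \<odot> w)) =
       (A.iv (as z y x) \<odot>\<^sub>f one w) \<bullet>\<^sub>A A.iv (as z (y \<odot> x) w) \<bullet>\<^sub>A (one z \<odot>\<^sub>f A.iv (as y x w))"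
    by (simp add: A.iv_of_cmp iv_act)
next
  fix x y
  assume [simp]: "x \<in> Ob" "y \<in> Ob"
  show "(ru y \<odot>\<^sub>f one x) \<bullet>\<^sub>A A.iv (as y I x) = one y \<odot>\<^sub>f lu x"
    by (simp add: triangle[symmetric] A.assoc)
qed (auto simp: interchange lu_natural ru_natural)

end

context module_cat
begin

text \<open>The functor sending \<open>b\<close> to \<open>b \<triangleright> m\<close> is a module
  functor from the regular module, with structure \<open>as'\<close>, and \<open>g_unit\<close>
  applies to it.\<close>

lemma lu'_as':
  assumes "a \<in> ObA" "m \<in> Ob"
  shows "lu' (a \<triangleright> m) \<bullet> as' I a m = lu a \<triangleright>\<^sub>f one m"
proof -
  interpret R: module_cat ObA arrA srcA tgtA cmpA oneA tns tna I as lu ru ObA arrA srcA tgtA cmpA oneA tns tna as lu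
    by (rule A.regular)
  interpret module_functor ObA arrA srcA tgtA cmpA oneA tns tna I as lu ru ObA arrA srcA tgtA cmpA oneA tns tna as lu
    Ob arr src tgt cmp one act acta as' lu' "\<lambda>b. b \<triangleright> m" "\<lambda>f. f \<triangleright>\<^sub>f one m" "\<lambda>a b. as' a b m"
    using assms by unfold_locales (auto simp: interchange as'_nat pentagon')
  show ?thesis using g_unit assms by simp
qed

text \<open>The module functor of \<open>lu'_as'\<close> again, now with
  \<open>g_ev\<close>.\<close>

lemma ev_regular:
  assumes "arrA e" "srcA e = a \<odot> k" "tgtA e = I" "a \<in> ObA" "k \<in> ObA" "b \<in> ObA" "m \<in> Ob"
  shows "ev a k e (b \<triangleright> m) \<bullet> (oneA a \<triangleright>\<^sub>f as' k b m) \<bullet> as' a (k \<odot> b) m 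
    = A.tev a k e b \<triangleright>\<^sub>f one m"
proof -
  interpret R: module_cat ObA arrA srcA tgtA cmpA oneA tns tna I as lu ru ObA arrA srcA tgtA cmpA oneA tns tna as lu
    by (rule A.regular)
  interpret module_functor ObA arrA srcA tgtA cmpA oneA tns tna I as lu ru ObA arrA srcA tgtA cmpA oneA tns tna as lu
    Ob arr src tgt cmp one act acta as' lu' "\<lambda>b. b \<triangleright> m" "\<lambda>f. f \<triangleright>\<^sub>f one m" "\<lambda>a b. as' a b m"
    using assms by unfold_locales (auto simp: interchange as'_nat pentagon')
  show ?thesis using g_ev assms by (simp add: R.ev_def A.tev_def)
qed

lemma coev_natural:
  assumes "arrA c" "srcA c = I" "tgtA c = k \<odot> a" "a \<in> ObA" "k \<in> ObA" "arr h" "src h = m" "tgt h = n"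
  shows "coev k a c n \<bullet> h = (oneA k \<triangleright>\<^sub>f oneA a \<triangleright>\<^sub>f h) \<bullet> coev k a c m"
proof (rule M.cancel_right)
  have [simp]: "n \<in> Ob" "m \<in> Ob"
    using assms by auto
  have "coev k a c n \<bullet> h \<bullet> lu' m = coev k a c n \<bullet> lu' n \<bullet> (oneA I \<triangleright>\<^sub>f h)"
    using assms by (simp add: lu'_nat)
  also have "\<dots> = as' k a n \<bullet> (c \<triangleright>\<^sub>f one n) \<bullet> (oneA I \<triangleright>\<^sub>f h)"
    using assms by (subst M.cmp_cong2[OF coev_lu]) (auto simp: M.assoc)
  also have "\<dots> = as' k a n \<bullet> (oneA (k \<odot> a) \<triangleright>\<^sub>f h) \<bullet> (c \<triangleright>\<^sub>f one m)"
    using assms by (simp add: interchange)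
  also have "\<dots> = as' k a n \<bullet> ((oneA k \<odot>\<^sub>f oneA a) \<triangleright>\<^sub>f h) \<bullet> (c \<triangleright>\<^sub>f one m)"
    using assms by simp
  also have "\<dots> = (oneA k \<triangleright>\<^sub>f oneA a \<triangleright>\<^sub>f h) \<bullet> as' k a m \<bullet> (c \<triangleright>\<^sub>f one m)"
    using assms by (subst M.cmp_cong2[OF as'_nat]) (auto simp: M.assoc)
  also have "\<dots> = (oneA k \<triangleright>\<^sub>f oneA a \<triangleright>\<^sub>f h) \<bullet> coev k a c m \<bullet> lu' m"
    using assms by (simp add: coev_lu)
  finally show "(coev k a c n \<bullet> h) \<bullet> lu' m = ((oneA k \<triangleright>\<^sub>f oneA a \<triangleright>\<^sub>f h) \<bullet> coev k a c m) \<bullet> lu' m"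
    using assms by (simp add: M.assoc)
qed (use assms in auto)

end

section \<open>Dual pairs and the triangle identities on a module category\<close>

context monoidal
begin

text \<open>The zigzag identities, with the outer inverse unitor moved to the other side, where it
  can be compared with the triangles of an action.\<close>

definition dual_pair where
  "dual_pair a k e c \<longleftrightarrow> a \<in> Ob \<and> k \<in> Ob \<and>
     arr e \<and> src e = a \<odot> k \<and> tgt e = I \<and> arr c \<and> src c = I \<and> tgt c = k \<odot> a \<and>
     lu a \<bullet>\<^sub>A (e \<odot>\<^sub>f one a) \<bullet>\<^sub>A A.iv (as a k a) \<bullet>\<^sub>A (one a \<odot>\<^sub>f c) = ru a \<and>
     ru k \<bullet>\<^sub>A (one k \<odot>\<^sub>f e) \<bullet>\<^sub>A as k a k \<bullet>\<^sub>A (c \<odot>\<^sub>f one k) = lu k"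

end

context module_cat
begin

lemma ev_coev:
  assumes "A.dual_pair a k e c" "m \<in> Ob"
  shows "ev a k e (a \<triangleright> m) \<bullet> (oneA a \<triangleright>\<^sub>f coev k a c m) = one (a \<triangleright> m)"
proof (rule M.cancel_right)
  \<comment> \<open>Precomposition with this isomorphism turns the claim into the first zigzag
    identity acting on \<open>m\<close>: by \<open>triangle'\<close>, \<open>?z\<close> is the
    action of \<open>ru a\<close>.\<close>
  let ?z = "(oneA a \<triangleright>\<^sub>f lu' m) \<bullet> as' a I m"
  have [simp]: "a \<in> ObA" "k \<in> ObA" "arrA e" "srcA e = a \<odot> k" "tgtA e = I" "arrA c" "srcA c = I" "tgtA c = k \<odot> a"
    using assms by (auto simp: A.dual_pair_def)
  let ?w = "A.A.iv (as a k a) \<bullet>\<^sub>A (oneA a \<odot>\<^sub>f c)"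
  have "(ev a k e (a \<triangleright> m) \<bullet> (oneA a \<triangleright>\<^sub>f coev k a c m)) \<bullet> ?z
      = ev a k e (a \<triangleright> m) \<bullet> (oneA a \<triangleright>\<^sub>f as' k a m) \<bullet> (oneA a \<triangleright>\<^sub>f c \<triangleright>\<^sub>f one m) \<bullet> as' a I m"
    using assms(2) by (simp add: M.assoc interchange' coev_lu)
  also have "\<dots> = ev a k e (a \<triangleright> m) \<bullet> (oneA a \<triangleright>\<^sub>f as' k a m) \<bullet> as' a (k \<odot> a) m \<bullet> ((oneA a \<odot>\<^sub>f c) \<triangleright>\<^sub>f one m)"
    using assms(2) by (simp add: as'_nat)
  also have "(oneA a \<odot>\<^sub>f c) \<triangleright>\<^sub>f one m = (as a k a \<triangleright>\<^sub>f one m) \<bullet> (?w \<triangleright>\<^sub>f one m)"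
    using assms(2) by (simp add: interchange)
  also have "(oneA a \<triangleright>\<^sub>f as' k a m) \<bullet> as' a (k \<odot> a) m \<bullet> (as a k a \<triangleright>\<^sub>f one m) \<bullet> (?w \<triangleright>\<^sub>f one m)
      = (as' a k (a \<triangleright> m) \<bullet> as' (a \<odot> k) a m) \<bullet> (?w \<triangleright>\<^sub>f one m)"
    using assms(2) by (subst pentagon') (auto simp: M.assoc)
  also have "ev a k e (a \<triangleright> m) \<bullet> \<dots> = lu' (a \<triangleright> m) \<bullet> (e \<triangleright>\<^sub>f one (a \<triangleright> m)) \<bullet> as' (a \<odot> k) a m \<bullet> (?w \<triangleright>\<^sub>f one m)"
    using assms(2) by (simp add: M.assoc M.cmp_cong2[OF ev_as])
  also have "\<dots> = lu' (a \<triangleright> m) \<bullet> (e \<triangleright>\<^sub>f oneA a \<triangleright>\<^sub>f one m) \<bullet> as' (a \<odot> k) a m \<bullet> (?w \<triangleright>\<^sub>f one m)"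
    using assms(2) by simp
  also have "\<dots> = lu' (a \<triangleright> m) \<bullet> as' I a m \<bullet> ((e \<odot>\<^sub>f oneA a) \<triangleright>\<^sub>f one m) \<bullet> (?w \<triangleright>\<^sub>f one m)"
    using assms(2) by (simp add: M.assoc M.cmp_cong2[OF as'_nat[symmetric]] del: act_one)
  also have "\<dots> = (lu a \<triangleright>\<^sub>f one m) \<bullet> ((e \<odot>\<^sub>f oneA a) \<triangleright>\<^sub>f one m) \<bullet> (?w \<triangleright>\<^sub>f one m)"
    using assms(2) by (simp add: M.assoc M.cmp_cong2[OF lu'_as'])
  also have "\<dots> = ru a \<triangleright>\<^sub>f one m"
    using assms by (simp add: A.dual_pair_def interchange)
  also have "\<dots> = one (a \<triangleright> m) \<bullet> ?z"
    using assms(2) by (simp add: triangle')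
  finally show "(ev a k e (a \<triangleright> m) \<bullet> (oneA a \<triangleright>\<^sub>f coev k a c m)) \<bullet> ?z = one (a \<triangleright> m) \<bullet> ?z" .
qed (use assms in \<open>auto simp: A.dual_pair_def\<close>)

lemma coev_ev:
  assumes "A.dual_pair a k e c" "n \<in> Ob"
  shows "(oneA k \<triangleright>\<^sub>f ev a k e n) \<bullet> coev k a c (k \<triangleright> n) = one (k \<triangleright> n)"
proof (rule M.cancel_right)
  \<comment> \<open>By \<open>lu'_as'\<close> this isomorphism is the action of \<open>lu k\<close>,
    the right-hand side of the second zigzag identity.\<close>
  let ?z = "lu' (k \<triangleright> n) \<bullet> as' I k n"
  have [simp]: "a \<in> ObA" "k \<in> ObA" "arrA e" "srcA e = a \<odot> k" "tgtA e = I" "arrA c" "srcA c = I" "tgtA c = k \<odot> a"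
    using assms by (auto simp: A.dual_pair_def)
  let ?w = "as k a k \<bullet>\<^sub>A (c \<odot>\<^sub>f oneA k)"
  have "((oneA k \<triangleright>\<^sub>f ev a k e n) \<bullet> coev k a c (k \<triangleright> n)) \<bullet> ?z
      = (oneA k \<triangleright>\<^sub>f ev a k e n) \<bullet> as' k a (k \<triangleright> n) \<bullet> (c \<triangleright>\<^sub>f oneA k \<triangleright>\<^sub>f one n) \<bullet> as' I k n"
    using assms(2) by (simp add: M.assoc M.cmp_cong2[OF coev_lu])
  also have "\<dots> = (oneA k \<triangleright>\<^sub>f ev a k e n) \<bullet> as' k a (k \<triangleright> n) \<bullet> as' (k \<odot> a) k n \<bullet> ((c \<odot>\<^sub>f oneA k) \<triangleright>\<^sub>f one n)"
    using assms(2) by (simp add: as'_nat del: act_one)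
  also have "\<dots> = (oneA k \<triangleright>\<^sub>f ev a k e n) \<bullet> (oneA k \<triangleright>\<^sub>f as' a k n) \<bullet> as' k (a \<odot> k) n \<bullet> (?w \<triangleright>\<^sub>f one n)"
    using assms(2) by (simp add: M.assoc M.cmp_cong2[OF pentagon'] interchange)
  also have "\<dots> = (oneA k \<triangleright>\<^sub>f lu' n) \<bullet> (oneA k \<triangleright>\<^sub>f e \<triangleright>\<^sub>f one n) \<bullet> as' k (a \<odot> k) n \<bullet> (?w \<triangleright>\<^sub>f one n)"
    using assms(2) by (simp add: interchange' ev_as)
  also have "\<dots> = (oneA k \<triangleright>\<^sub>f lu' n) \<bullet> as' k I n \<bullet> ((oneA k \<odot>\<^sub>f e) \<triangleright>\<^sub>f one n) \<bullet> (?w \<triangleright>\<^sub>f one n)"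
    using assms(2) by (simp add: M.assoc M.cmp_cong2[OF as'_nat[symmetric]])
  also have "\<dots> = (ru k \<triangleright>\<^sub>f one n) \<bullet> ((oneA k \<odot>\<^sub>f e) \<triangleright>\<^sub>f one n) \<bullet> (?w \<triangleright>\<^sub>f one n)"
    using assms(2) by (simp add: M.assoc M.cmp_cong2[OF triangle'])
  also have "\<dots> = lu k \<triangleright>\<^sub>f one n"
    using assms by (simp add: A.dual_pair_def interchange)
  also have "\<dots> = one (k \<triangleright> n) \<bullet> ?z"
    using assms(2) by (simp add: lu'_as')
  finally show "((oneA k \<triangleright>\<^sub>f ev a k e n) \<bullet> coev k a c (k \<triangleright> n)) \<bullet> ?z = one (k \<triangleright> n) \<bullet> ?z" .
qed (use assms in \<open>auto simp: A.dual_pair_def\<close>)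

end

section \<open>Adjunctions and mates\<close>

definition compF :: "('p, 'n, 'q, 'l) functor_data \<Rightarrow> ('o, 'm, 'p, 'n) functor_data \<Rightarrow> ('o, 'm, 'q, 'l) functor_data" where
  "compF G F = \<lparr>FO = \<lambda>x. FO G (FO F x), FA = \<lambda>f. FA G (FA F f)\<rparr>"

definition idF :: "('o, 'm, 'o, 'm) functor_data" where
  "idF = \<lparr>FO = \<lambda>x. x, FA = \<lambda>f. f\<rparr>"

lemma compF_simps [simp]: "FO (compF G F) x = FO G (FO F x)" "FA (compF G F) f = FA G (FA F f)"
  by (simp_all add: compF_def)

lemma idF_simps [simp]: "FO idF x = x" "FA idF f = f"
  by (simp_all add: idF_def)

section \<open>Endofunctors, universal arrows and adjunctions on one category\<close>

context cat
begin

definition endo :: "('o, 'f, 'o, 'f) functor_data \<Rightarrow> bool" where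
  "endo F \<longleftrightarrow> (\<forall>x \<in> Ob. FO F x \<in> Ob) \<and>
     (\<forall>f. arr f \<longrightarrow> arr (FA F f) \<and> src (FA F f) = FO F (src f) \<and> tgt (FA F f) = FO F (tgt f)) \<and>
     (\<forall>x \<in> Ob. FA F (one x) = one (FO F x)) \<and>
     (\<forall>f g. arr f \<longrightarrow> arr g \<longrightarrow> src g = tgt f \<longrightarrow> FA F (g \<bullet> f) = FA F g \<bullet> FA F f)"

lemma endo_simps [simp]:
  assumes "endo F"
  shows "x \<in> Ob \<Longrightarrow> FO F x \<in> Ob"
    and "arr f \<Longrightarrow> arr (FA F f)"
    and "arr f \<Longrightarrow> src (FA F f) = FO F (src f)"
    and "arr f \<Longrightarrow> tgt (FA F f) = FO F (tgt f)"
    and "x \<in> Ob \<Longrightarrow> FA F (one x) = one (FO F x)"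
  using assms unfolding endo_def by blast+

lemma endo_cmp:
  assumes "endo F" "arr f" "arr g" "src g = tgt f"
  shows "FA F (g \<bullet> f) = FA F g \<bullet> FA F f"
  using assms unfolding endo_def by blast

lemma endoI:
  assumes "\<And>x. x \<in> Ob \<Longrightarrow> FO F x \<in> Ob"
    and "\<And>f. arr f \<Longrightarrow> arr (FA F f)"
    and "\<And>f. arr f \<Longrightarrow> src (FA F f) = FO F (src f)"
    and "\<And>f. arr f \<Longrightarrow> tgt (FA F f) = FO F (tgt f)"
    and "\<And>x. x \<in> Ob \<Longrightarrow> FA F (one x) = one (FO F x)"
    and "\<And>f g. \<lbrakk>arr f; arr g; src g = tgt f\<rbrakk> \<Longrightarrow> FA F (g \<bullet> f) = FA F g \<bullet> FA F f"
  shows "endo F"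
  using assms unfolding endo_def by blast

lemma endo_idF [simp]: "endo idF"
  by (rule endoI) auto

lemma endo_compF [simp]: "\<lbrakk>endo F; endo G\<rbrakk> \<Longrightarrow> endo (compF G F)"
  by (rule endoI) (auto simp: endo_cmp)

lemma endo_iso [simp]: "\<lbrakk>endo F; iso f\<rbrakk> \<Longrightarrow> iso (FA F f)"
  by (rule isoI[of _ "FA F (iv f)"]) (auto simp: endo_cmp[symmetric])

definition natural :: "('o, 'f, 'o, 'f) functor_data \<Rightarrow> ('o, 'f, 'o, 'f) functor_data \<Rightarrow> ('o \<Rightarrow> 'f) \<Rightarrow> bool" where
  "natural F G \<alpha> \<longleftrightarrow>
     (\<forall>m \<in> Ob. arr (\<alpha> m) \<and> src (\<alpha> m) = FO F m \<and> tgt (\<alpha> m) = FO G m) \<and>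
     (\<forall>h. arr h \<longrightarrow> \<alpha> (tgt h) \<bullet> FA F h = FA G h \<bullet> \<alpha> (src h))"

lemma natural_typ:
  assumes "natural F G \<alpha>" "m \<in> Ob"
  shows "arr (\<alpha> m)" "src (\<alpha> m) = FO F m" "tgt (\<alpha> m) = FO G m"
  using assms by (auto simp: natural_def)

lemma natural_nat: "\<lbrakk>natural F G \<alpha>; arr h; src h = m; tgt h = n\<rbrakk> \<Longrightarrow> \<alpha> n \<bullet> FA F h = FA G h \<bullet> \<alpha> m"
  by (auto simp: natural_def)

text \<open>The object \<open>p\<close> with \<open>e\<close> represents the arrows from
  \<open>L m\<close> to \<open>n\<close>. Adjunctions are built from this property of their counits,
  so uniqueness of factorisations replaces calculations with units.\<close>

definition universal :: "('o, 'f, 'o, 'f) functor_data \<Rightarrow> 'o \<Rightarrow> 'f \<Rightarrow> 'o \<Rightarrow> bool" where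
  "universal L p e n \<longleftrightarrow> p \<in> Ob \<and> arr e \<and> src e = FO L p \<and> tgt e = n \<and>
     (\<forall>f. \<forall>m \<in> Ob. arr f \<longrightarrow> src f = FO L m \<longrightarrow> tgt f = n \<longrightarrow>
        (\<exists>!h. arr h \<and> src h = m \<and> tgt h = p \<and> e \<bullet> FA L h = f))"

lemma universal_typ:
  assumes "universal L p e n"
  shows "p \<in> Ob" "arr e" "src e = FO L p" "tgt e = n"
  using assms unfolding universal_def by blast+

lemma universal_ex:
  assumes "universal L p e n" "m \<in> Ob" "arr f" "src f = FO L m" "tgt f = n"
  obtains h where "arr h" "src h = m" "tgt h = p" "e \<bullet> FA L h = f"
  using assms unfolding universal_def by metis

lemma universal_unique:
  assumes "universal L p e n" "endo L" "e \<bullet> FA L h = e \<bullet> FA L k"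
    and "arr h" "arr k" "src h = src k" "tgt h = p" "tgt k = p"
  shows "h = k"
proof -
  have "\<exists>!h'. arr h' \<and> src h' = src k \<and> tgt h' = p \<and> e \<bullet> FA L h' = e \<bullet> FA L k"
    using assms(1) universal_typ[OF assms(1)] assms(2-) unfolding universal_def
    by (metis arr_cmp endo_simps(2-4) src_Ob src_cmp tgt_cmp)
  then show ?thesis
    using assms by metis
qed

lemma universalI:
  assumes "p \<in> Ob" "arr e" "src e = FO L p" "tgt e = n"
    and "\<And>f m. \<lbrakk>m \<in> Ob; arr f; src f = FO L m; tgt f = n\<rbrakk> \<Longrightarrow>
           \<exists>h. arr h \<and> src h = m \<and> tgt h = p \<and> e \<bullet> FA L h = f"
    and "\<And>h k. \<lbrakk>arr h; arr k; src h = src k; tgt h = p; tgt k = p; e \<bullet> FA L h = e \<bullet> FA L k\<rbrakk> \<Longrightarrow> h = k"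
  shows "universal L p e n"
  unfolding universal_def using assms by metis

lemma universal_cmp_iso:
  assumes "universal L p e n" "endo L" "iso u" "tgt u = p"
  shows "universal L (src u) (e \<bullet> FA L u) n"
proof (rule universalI)
  note ty = universal_typ[OF assms(1)]
  fix f m
  assume f: "m \<in> Ob" "arr f" "src f = FO L m" "tgt f = n"
  then obtain h where h: "arr h" "src h = m" "tgt h = p" "e \<bullet> FA L h = f"
    using universal_ex assms by metis
  show "\<exists>h. arr h \<and> src h = m \<and> tgt h = src u \<and> (e \<bullet> FA L u) \<bullet> FA L h = f"
    using h assms ty by (intro exI[of _ "iv u \<bullet> h"]) (simp add: assoc endo_cmp[symmetric])
next
  note ty = universal_typ[OF assms(1)]
  fix h k
  assume h: "arr h" "arr k" "src h = src k" "tgt h = src u" "tgt k = src u"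
    and eq: "(e \<bullet> FA L u) \<bullet> FA L h = (e \<bullet> FA L u) \<bullet> FA L k"
  have "u \<bullet> h = u \<bullet> k"
    by (rule universal_unique[OF assms(1,2)]) (use h assms ty eq in \<open>simp_all add: assoc endo_cmp\<close>)
  then show "h = k"
    using h assms cancel_left by auto
qed (use assms universal_typ[OF assms(1)] in auto)

lemma universal_compF:
  assumes "universal L p e n" "universal L' q e' p" "endo L" "endo L'"
  shows "universal (compF L L') q (e \<bullet> FA L e') n"
proof (rule universalI)
  note ty = universal_typ[OF assms(1)] universal_typ[OF assms(2)]
  fix f m
  assume f: "m \<in> Ob" "arr f" "src f = FO (compF L L') m" "tgt f = n"
  obtain h where h: "arr h" "src h = FO L' m" "tgt h = p" "e \<bullet> FA L h = f"
    using universal_ex[OF assms(1), of "FO L' m" f] f assms by auto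
  obtain k where k: "arr k" "src k = m" "tgt k = q" "e' \<bullet> FA L' k = h"
    using universal_ex[OF assms(2), of m h] f h assms by auto
  show "\<exists>h. arr h \<and> src h = m \<and> tgt h = q \<and> (e \<bullet> FA L e') \<bullet> FA (compF L L') h = f"
    using h k assms ty by (intro exI[of _ k]) (simp add: assoc endo_cmp[symmetric])
next
  note ty = universal_typ[OF assms(1)] universal_typ[OF assms(2)]
  fix h k
  assume h: "arr h" "arr k" "src h = src k" "tgt h = q" "tgt k = q"
    and eq: "(e \<bullet> FA L e') \<bullet> FA (compF L L') h = (e \<bullet> FA L e') \<bullet> FA (compF L L') k"
  have "e' \<bullet> FA L' h = e' \<bullet> FA L' k"
    by (rule universal_unique[OF assms(1,3)]) (use h assms ty eq in \<open>simp_all add: assoc endo_cmp\<close>)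
  then show "h = k"
    by (rule universal_unique[OF assms(2,4)]) (use h assms ty in simp_all)
qed (use assms universal_typ[OF assms(1)] universal_typ[OF assms(2)] in auto)

text \<open>Composition with the inverse of \<alpha> turns a factorisation problem for
  \<open>L'\<close> into one for \<open>L\<close>. Together with \<open>universal_cmp_iso\<close>
  and \<open>universal_compF\<close> this shows that nested evaluations are universal without
  exhibiting coevaluations for them.\<close>

lemma universal_transport:
  assumes "universal L p e n" "endo L" "natural L' L \<alpha>" "\<And>m. m \<in> Ob \<Longrightarrow> iso (\<alpha> m)" "endo L'"
  shows "universal L' p (e \<bullet> \<alpha> p) n"
proof (rule universalI)
  note ty = universal_typ[OF assms(1)] natural_typ[OF assms(3)]
  fix f m
  assume f: "m \<in> Ob" "arr f" "src f = FO L' m" "tgt f = n"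
  obtain h where h: "arr h" "src h = m" "tgt h = p" "e \<bullet> FA L h = f \<bullet> iv (\<alpha> m)"
    using universal_ex[OF assms(1), of m "f \<bullet> iv (\<alpha> m)"] f assms ty by auto
  have "(e \<bullet> \<alpha> p) \<bullet> FA L' h = e \<bullet> FA L h \<bullet> \<alpha> m"
    using h assms ty by (simp add: assoc natural_nat[OF assms(3)])
  also have "\<dots> = f"
    using f h assms ty by (simp add: cmp_cong2[OF h(4)] assoc)
  finally show "\<exists>h. arr h \<and> src h = m \<and> tgt h = p \<and> (e \<bullet> \<alpha> p) \<bullet> FA L' h = f"
    using h by blast
next
  note ty = universal_typ[OF assms(1)] natural_typ[OF assms(3)]
  fix h k
  assume h: "arr h" "arr k" "src h = src k" "tgt h = p" "tgt k = p"
    and eq: "(e \<bullet> \<alpha> p) \<bullet> FA L' h = (e \<bullet> \<alpha> p) \<bullet> FA L' k"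
  have "(e \<bullet> FA L h) \<bullet> \<alpha> (src k) = (e \<bullet> FA L k) \<bullet> \<alpha> (src k)"
    using h assms ty eq by (simp add: assoc natural_nat[OF assms(3)])
  then have "e \<bullet> FA L h = e \<bullet> FA L k"
    by (rule cancel_right) (use h assms ty in auto)
  then show "h = k"
    by (rule universal_unique[OF assms(1,2)]) (use h assms ty in simp_all)
qed (use assms natural_typ[OF assms(3)] universal_typ[OF assms(1)] in auto)

text \<open>Both objects represent the same functor and \<open>u\<close> is the comparison arrow;
  its inverse is the factorisation of \<open>d\<close> through \<open>e\<close>.\<close>

lemma universal_iso:
  assumes "universal L p e n" "universal L q d n" "endo L" "arr u" "src u = p" "tgt u = q" "d \<bullet> FA L u = e"
  shows "iso u"
proof -
  note ty = universal_typ[OF assms(1)] universal_typ[OF assms(2)]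
  obtain v where v: "arr v" "src v = q" "tgt v = p" "e \<bullet> FA L v = d"
    using universal_ex[OF assms(1), of q d] ty assms by auto
  have 1: "v \<bullet> u = one p"
    by (rule universal_unique[OF assms(1,3)]) (use ty v assms in \<open>simp_all add: endo_cmp assoc[symmetric]\<close>)
  have 2: "u \<bullet> v = one q"
    by (rule universal_unique[OF assms(2,3)]) (use ty v assms in \<open>simp_all add: endo_cmp assoc[symmetric]\<close>)
  show ?thesis
    by (rule isoI[of u v]) (use v assms 1 2 in auto)
qed

text \<open>The last clause says that the action of \<open>K\<close> on arrows is the one induced by
  the universal arrows.\<close>

definition adj :: "('o, 'f, 'o, 'f) functor_data \<Rightarrow> ('o, 'f, 'o, 'f) functor_data \<Rightarrow> ('o \<Rightarrow> 'f) \<Rightarrow> bool" where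
  "adj L K e \<longleftrightarrow> endo L \<and> endo K \<and> (\<forall>n \<in> Ob. universal L (FO K n) (e n) n) \<and>
     (\<forall>h. arr h \<longrightarrow> e (tgt h) \<bullet> FA L (FA K h) = h \<bullet> e (src h))"

lemma adj_endo: "adj L K e \<Longrightarrow> endo L" "adj L K e \<Longrightarrow> endo K"
  by (auto simp: adj_def)

lemma adj_universal: "\<lbrakk>adj L K e; n \<in> Ob\<rbrakk> \<Longrightarrow> universal L (FO K n) (e n) n"
  by (auto simp: adj_def)

lemma adj_typ:
  assumes "adj L K e" "n \<in> Ob"
  shows "arr (e n)" "src (e n) = FO L (FO K n)" "tgt (e n) = n"
  using universal_typ[OF adj_universal[OF assms]] by auto

lemma adj_nat: "\<lbrakk>adj L K e; arr h; src h = m; tgt h = n\<rbrakk> \<Longrightarrow> e n \<bullet> FA L (FA K h) = h \<bullet> e m"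
  by (auto simp: adj_def)

lemma adj_idF: "adj idF idF one"
  unfolding adj_def by (auto intro!: universalI)

definition comp_counit ::
  "('o, 'f, 'o, 'f) functor_data \<Rightarrow> ('o, 'f, 'o, 'f) functor_data \<Rightarrow> ('o \<Rightarrow> 'f) \<Rightarrow> ('o \<Rightarrow> 'f) \<Rightarrow> 'o \<Rightarrow> 'f" where
  "comp_counit L K e e' = (\<lambda>n. e n \<bullet> FA L (e' (FO K n)))"

lemma adj_compF:
  assumes 1: "adj L K e" and 2: "adj L' K' e'"
  shows "adj (compF L L') (compF K' K) (comp_counit L K e e')"
  unfolding adj_def
proof (intro conjI ballI allI impI)
  note [simp] = adj_endo[OF 1] adj_endo[OF 2] adj_typ[OF 1] adj_typ[OF 2]
  show "endo (compF L L')" "endo (compF K' K)"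
    by auto
  show "universal (compF L L') (FO (compF K' K) n) (comp_counit L K e e' n) n" if "n \<in> Ob" for n
    using universal_compF[OF adj_universal[OF 1 that] adj_universal[OF 2, of "FO K n"]] that
    by (simp add: comp_counit_def)
  fix h
  assume [simp]: "arr h"
  have "comp_counit L K e e' (tgt h) \<bullet> FA (compF L L') (FA (compF K' K) h)
     = e (tgt h) \<bullet> FA L (e' (FO K (tgt h)) \<bullet> FA L' (FA K' (FA K h)))"
    by (simp add: comp_counit_def assoc endo_cmp)
  also have "\<dots> = e (tgt h) \<bullet> FA L (FA K h \<bullet> e' (FO K (src h)))"
    by (subst adj_nat[OF 2]) auto
  also have "\<dots> = h \<bullet> e (src h) \<bullet> FA L (e' (FO K (src h)))"
    by (simp add: endo_cmp cmp_cong2[OF adj_nat[OF 1]] assoc)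
  finally show "comp_counit L K e e' (tgt h) \<bullet> FA (compF L L') (FA (compF K' K) h) = h \<bullet> comp_counit L K e e' (src h)"
    by (simp add: comp_counit_def)
qed

text \<open>For counits \<open>e: L K \<rightarrow> 1\<close> and \<open>e': L' K' \<rightarrow> 1\<close>, the transformations \<open>\<alpha>: L \<rightarrow> L'\<close> and
  \<open>\<kappa>: K' \<rightarrow> K\<close> correspond to each other under the adjunctions.\<close>

definition mates where
  "mates L K e L' K' e' \<alpha> \<kappa> \<longleftrightarrow> natural L L' \<alpha> \<and> natural K' K \<kappa> \<and>
     (\<forall>n \<in> Ob. e' n \<bullet> \<alpha> (FO K' n) = e n \<bullet> FA L (\<kappa> n))"

lemma mates_natural: "mates L K e L' K' e' \<alpha> \<kappa> \<Longrightarrow> natural L L' \<alpha>" "mates L K e L' K' e' \<alpha> \<kappa> \<Longrightarrow> natural K' K \<kappa>"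
  by (auto simp: mates_def)

lemma mates_eq: "\<lbrakk>mates L K e L' K' e' \<alpha> \<kappa>; n \<in> Ob\<rbrakk> \<Longrightarrow> e' n \<bullet> \<alpha> (FO K' n) = e n \<bullet> FA L (\<kappa> n)"
  by (auto simp: mates_def)

lemma natural_comp:
  assumes "natural F G \<alpha>" "natural G H \<beta>" "endo F" "endo G" "endo H"
  shows "natural F H (\<lambda>n. \<beta> n \<bullet> \<alpha> n)"
  unfolding natural_def
proof (intro conjI ballI allI impI)
  note [simp] = natural_typ[OF assms(1)] natural_typ[OF assms(2)] assms(3-)
  fix h assume [simp]: "arr h"
  show "(\<beta> (tgt h) \<bullet> \<alpha> (tgt h)) \<bullet> FA F h = FA H h \<bullet> \<beta> (src h) \<bullet> \<alpha> (src h)"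
    by (simp add: assoc natural_nat[OF assms(1)] cmp_cong2[OF natural_nat[OF assms(2)]])
qed (use natural_typ[OF assms(1)] natural_typ[OF assms(2)] in auto)

lemma natural_iv:
  assumes "natural F G \<alpha>" "endo F" "endo G" "\<And>n. n \<in> Ob \<Longrightarrow> iso (\<alpha> n)"
  shows "natural G F (\<lambda>n. iv (\<alpha> n))"
  unfolding natural_def
proof (intro conjI ballI allI impI)
  note [simp] = natural_typ[OF assms(1)] assms(2-)
  fix h assume [simp]: "arr h"
  show "iv (\<alpha> (tgt h)) \<bullet> FA G h = FA F h \<bullet> iv (\<alpha> (src h))"
    by (rule cmp_iv_swap[symmetric]) (auto simp: natural_nat[OF assms(1)])
qed (use assms natural_typ[OF assms(1)] in auto)

text \<open>The two mate equations are pasted along the naturality square of \<alpha> at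
  \<mu>.\<close>

lemma mates_comp:
  assumes 1: "mates L K e L' K' e' \<alpha> \<kappa>" and 2: "mates L' K' e' L'' K'' e'' \<beta> \<mu>"
    and a: "adj L K e" "adj L' K' e'" "adj L'' K'' e''"
  shows "mates L K e L'' K'' e'' (\<lambda>n. \<beta> n \<bullet> \<alpha> n) (\<lambda>n. \<kappa> n \<bullet> \<mu> n)"
  unfolding mates_def
proof (intro conjI ballI)
  note [simp] = natural_typ[OF mates_natural(1)[OF 1]] natural_typ[OF mates_natural(2)[OF 1]]
    natural_typ[OF mates_natural(1)[OF 2]] natural_typ[OF mates_natural(2)[OF 2]]
    adj_endo[OF a(1)] adj_endo[OF a(2)] adj_endo[OF a(3)] adj_typ[OF a(1)] adj_typ[OF a(2)] adj_typ[OF a(3)]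
  show "natural L L'' (\<lambda>n. \<beta> n \<bullet> \<alpha> n)" "natural K'' K (\<lambda>n. \<kappa> n \<bullet> \<mu> n)"
    using mates_natural[OF 1] mates_natural[OF 2] by (auto intro: natural_comp)
  fix n assume [simp]: "n \<in> Ob"
  have "e'' n \<bullet> \<beta> (FO K'' n) \<bullet> \<alpha> (FO K'' n) = e' n \<bullet> FA L' (\<mu> n) \<bullet> \<alpha> (FO K'' n)"
    by (simp add: cmp_cong2[OF mates_eq[OF 2]] assoc)
  also have "\<dots> = e' n \<bullet> \<alpha> (FO K' n) \<bullet> FA L (\<mu> n)"
    by (simp add: natural_nat[OF mates_natural(1)[OF 1]])
  also have "\<dots> = e n \<bullet> FA L (\<kappa> n \<bullet> \<mu> n)"
    by (simp add: cmp_cong2[OF mates_eq[OF 1]] assoc endo_cmp)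
  finally show "e'' n \<bullet> \<beta> (FO K'' n) \<bullet> \<alpha> (FO K'' n) = e n \<bullet> FA L (\<kappa> n \<bullet> \<mu> n)" .
qed

text \<open>Along a chain of duals, associators and inverse associators alternate; inverting a pair
  of mates passes from one kind to the other. After composition with the invertible \<kappa> the new
  equation becomes the given one.\<close>

lemma mates_iv:
  assumes 1: "mates L K e L' K' e' \<alpha> \<kappa>" and a: "adj L K e" "adj L' K' e'"
    and i [simp]: "\<And>n. n \<in> Ob \<Longrightarrow> iso (\<alpha> n)" "\<And>n. n \<in> Ob \<Longrightarrow> iso (\<kappa> n)"
  shows "mates L' K' e' L K e (\<lambda>n. iv (\<alpha> n)) (\<lambda>n. iv (\<kappa> n))"
  unfolding mates_def
proof (intro conjI ballI)
  note [simp] = natural_typ[OF mates_natural(1)[OF 1]] natural_typ[OF mates_natural(2)[OF 1]]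
    adj_endo[OF a(1)] adj_endo[OF a(2)] adj_typ[OF a(1)] adj_typ[OF a(2)]
  show n: "natural L' L (\<lambda>n. iv (\<alpha> n))" "natural K K' (\<lambda>n. iv (\<kappa> n))"
    using mates_natural[OF 1] by (auto intro: natural_iv)
  fix n assume [simp]: "n \<in> Ob"
  show "e n \<bullet> iv (\<alpha> (FO K n)) = e' n \<bullet> FA L' (iv (\<kappa> n))"
  proof (rule cancel_right)
    have "(e n \<bullet> iv (\<alpha> (FO K n))) \<bullet> FA L' (\<kappa> n) = e n \<bullet> FA L (\<kappa> n) \<bullet> iv (\<alpha> (FO K' n))"
      by (simp add: assoc natural_nat[OF n(1)])
    also have "\<dots> = e' n \<bullet> \<alpha> (FO K' n) \<bullet> iv (\<alpha> (FO K' n))"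
      by (simp add: cmp_cong2[OF mates_eq[OF 1, symmetric]] assoc)
    also have "\<dots> = (e' n \<bullet> FA L' (iv (\<kappa> n))) \<bullet> FA L' (\<kappa> n)"
      by (simp add: assoc endo_cmp[symmetric])
    finally show "(e n \<bullet> iv (\<alpha> (FO K n))) \<bullet> FA L' (\<kappa> n) = (e' n \<bullet> FA L' (iv (\<kappa> n))) \<bullet> FA L' (\<kappa> n)" .
  qed auto
qed

end

section \<open>Duals\<close>

context module_cat
begin

definition actF :: "'oa \<Rightarrow> ('o, 'f, 'o, 'f) functor_data" where
  "actF a = \<lparr>FO = \<lambda>m. a \<triangleright> m, FA = \<lambda>h. oneA a \<triangleright>\<^sub>f h\<rparr>"

lemma actF_simps [simp]: "FO (actF a) m = a \<triangleright> m" "FA (actF a) h = oneA a \<triangleright>\<^sub>f h"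
  by (simp_all add: actF_def)

lemma endo_actF [simp]: "a \<in> ObA \<Longrightarrow> M.endo (actF a)"
  by (rule M.endoI) (auto simp: interchange)

lemma natural_act: "\<lbrakk>arrA f; srcA f = a; tgtA f = b\<rbrakk> \<Longrightarrow> M.natural (actF a) (actF b) (\<lambda>n. f \<triangleright>\<^sub>f one n)"
  unfolding M.natural_def by (auto simp: interchange)

lemma natural_as':
  assumes "a \<in> ObA" "b \<in> ObA"
  shows "M.natural (actF (a \<odot> b)) (compF (actF a) (actF b)) (as' a b)"
  unfolding M.natural_def
proof (intro conjI allI impI ballI)
  fix h assume "arr h"
  then show "as' a b (tgt h) \<bullet> FA (actF (a \<odot> b)) h = FA (compF (actF a) (actF b)) h \<bullet> as' a b (src h)"
    using assms as'_natural[of "oneA a" "oneA b" h] by simp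
qed (use assms in auto)

lemma natural_lu': "M.natural (actF I) idF lu'"
  unfolding M.natural_def using lu'_natural by auto

text \<open>The transpose of \<open>f\<close> is built from the coevaluation as usual: naturality of
  the counit moves \<open>f\<close> to the front, and \<open>ev_coev\<close> cancels the rest. This
  is the existence half of the universal property.\<close>

lemma ev_transpose:
  assumes "A.dual_pair a k e c" "arr f" "src f = a \<triangleright> m" "tgt f = n" "m \<in> Ob"
  shows "ev a k e n \<bullet> (oneA a \<triangleright>\<^sub>f ((oneA k \<triangleright>\<^sub>f f) \<bullet> coev k a c m)) = f"
proof -
  have [simp]: "a \<in> ObA" "k \<in> ObA" "arrA e" "srcA e = a \<odot> k" "tgtA e = I" "arrA c" "srcA c = I" "tgtA c = k \<odot> a"
    using assms by (auto simp: A.dual_pair_def)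
  have [simp]: "n \<in> Ob" using assms by auto
  have "ev a k e n \<bullet> (oneA a \<triangleright>\<^sub>f ((oneA k \<triangleright>\<^sub>f f) \<bullet> coev k a c m))
      = ev a k e n \<bullet> (oneA a \<triangleright>\<^sub>f oneA k \<triangleright>\<^sub>f f) \<bullet> (oneA a \<triangleright>\<^sub>f coev k a c m)"
    using assms by (simp add: interchange)
  also have "\<dots> = f \<bullet> ev a k e (a \<triangleright> m) \<bullet> (oneA a \<triangleright>\<^sub>f coev k a c m)"
    using assms by (simp add: M.cmp_cong2[OF ev_natural[where k=k and a=a]] M.assoc)
  also have "\<dots> = f"
    using assms by (simp add: ev_coev)
  finally show ?thesis .
qed

lemma adj_act:
  assumes "A.dual_pair a k e c"
  shows "M.adj (actF a) (actF k) (ev a k e)"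
  unfolding M.adj_def
proof (intro conjI ballI allI impI)
  have [simp]: "a \<in> ObA" "k \<in> ObA" "arrA e" "srcA e = a \<odot> k" "tgtA e = I" "arrA c" "srcA c = I" "tgtA c = k \<odot> a"
    using assms by (auto simp: A.dual_pair_def)
  show "M.endo (actF a)" "M.endo (actF k)" by auto
  show "ev a k e (tgt h) \<bullet> FA (actF a) (FA (actF k) h) = h \<bullet> ev a k e (src h)" if "arr h" for h
    using that ev_natural[of e a k "oneA a" a "oneA k" k h "src h" "tgt h"] by simp
  fix n assume [simp]: "n \<in> Ob"
  show "M.universal (actF a) (FO (actF k) n) (ev a k e n) n"
  proof (rule M.universalI)
    fix f m
    assume f: "m \<in> Ob" "arr f" "src f = FO (actF a) m" "tgt f = n"
    show "\<exists>h. arr h \<and> src h = m \<and> tgt h = FO (actF k) n \<and> ev a k e n \<bullet> FA (actF a) h = f"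
      using f ev_transpose[OF assms, of f m n] by (intro exI[of _ "(oneA k \<triangleright>\<^sub>f f) \<bullet> coev k a c m"]) auto
  next
    \<comment> \<open>Every \<open>h\<close> is recovered from its composite with the counit, by
      naturality of the coevaluation and \<open>coev_ev\<close>; uniqueness follows.\<close>
    have *: "(oneA k \<triangleright>\<^sub>f (ev a k e n \<bullet> (oneA a \<triangleright>\<^sub>f h))) \<bullet> coev k a c (src h) = h" if "arr h" "tgt h = k \<triangleright> n" for h
    proof -
      have "(oneA k \<triangleright>\<^sub>f (ev a k e n \<bullet> (oneA a \<triangleright>\<^sub>f h))) \<bullet> coev k a c (src h)
         = (oneA k \<triangleright>\<^sub>f ev a k e n) \<bullet> (oneA k \<triangleright>\<^sub>f oneA a \<triangleright>\<^sub>f h) \<bullet> coev k a c (src h)"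
        using that by (simp add: interchange')
      also have "\<dots> = (oneA k \<triangleright>\<^sub>f ev a k e n) \<bullet> coev k a c (k \<triangleright> n) \<bullet> h"
        using that by (simp add: coev_natural[of c k a h "src h" "k \<triangleright> n", symmetric])
      also have "\<dots> = h"
        using that by (simp add: M.cmp_cong2[OF coev_ev[OF assms]])
      finally show ?thesis .
    qed
    fix h j
    assume h: "arr h" "arr j" "src h = src j" "tgt h = FO (actF k) n" "tgt j = FO (actF k) n"
      "ev a k e n \<bullet> FA (actF a) h = ev a k e n \<bullet> FA (actF a) j"
    have "h = (oneA k \<triangleright>\<^sub>f (ev a k e n \<bullet> (oneA a \<triangleright>\<^sub>f h))) \<bullet> coev k a c (src h)"
      using *[of h] h(1,4) by simp
    also have "\<dots> = (oneA k \<triangleright>\<^sub>f (ev a k e n \<bullet> (oneA a \<triangleright>\<^sub>f j))) \<bullet> coev k a c (src j)"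
      using h(3,6) by simp
    also have "\<dots> = j"
      using *[of j] h(2,5) by simp
    finally show "h = j" .
  qed auto
qed

end

section \<open>Evaluations of tensor products and of the unit\<close>

context monoidal
begin

text \<open>An evaluation for \<open>x \<odot> y\<close>: \<open>y\<close> is evaluated against
  \<open>l\<close> on the inside, then \<open>x\<close> against \<open>k\<close>, so the duals occur
  in the opposite order.\<close>

definition nested where
  "nested x y k l ex ey = ex \<bullet>\<^sub>A (one x \<odot>\<^sub>f tev y l ey k) \<bullet>\<^sub>A as x y (l \<odot> k)"

lemma tev_typ [simp]:
  assumes "arr e" "src e = a \<odot> k" "tgt e = I" "a \<in> Ob" "k \<in> Ob" "n \<in> Ob"
  shows "arr (tev a k e n)" "src (tev a k e n) = a \<odot> k \<odot> n" "tgt (tev a k e n) = n"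
  using assms by (auto simp: tev_def)

lemma dual_pair_typ [simp]:
  assumes "dual_pair a k e c"
  shows "a \<in> Ob" "k \<in> Ob" "arr e" "src e = a \<odot> k" "tgt e = I" "arr c" "src c = I" "tgt c = k \<odot> a"
  using assms by (auto simp: dual_pair_def)

lemma nested_typ [simp]:
  assumes "arr ex" "src ex = x \<odot> k" "tgt ex = I" "x \<in> Ob" "k \<in> Ob" "arr ey" "src ey = y \<odot> l" "tgt ey = I" "y \<in> Ob" "l \<in> Ob"
  shows "arr (nested x y k l ex ey)" "src (nested x y k l ex ey) = (x \<odot> y) \<odot> l \<odot> k" "tgt (nested x y k l ex ey) = I"
  using assms by (auto simp: nested_def)

text \<open>This is \<open>lu'_as'\<close> for the regular module of the reversed tensor product,
  with the inverse associator moved across.\<close>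

lemma ru_as:
  assumes "x \<in> Ob" "y \<in> Ob"
  shows "(one x \<odot>\<^sub>f ru y) \<bullet>\<^sub>A as x y I = ru (x \<odot> y)"
proof -
  have "ru (x \<odot> y) \<bullet>\<^sub>A A.iv (as x y I) = one x \<odot>\<^sub>f ru y"
    using module_cat.lu'_as'[OF monoidal.regular[OF reversed], of y x] assms by simp
  then have "(one x \<odot>\<^sub>f ru y) \<bullet>\<^sub>A as x y I = (ru (x \<odot> y) \<bullet>\<^sub>A A.iv (as x y I)) \<bullet>\<^sub>A as x y I"
    by simp
  then show ?thesis
    using assms by (simp add: A.assoc)
qed

text \<open>Naturality of \<open>lu\<close> at \<open>lu I\<close> gives the first equation. With
  it, the triangle and \<open>lu'_as'\<close> identify the two unitors after tensoring with
  \<open>I\<close>, and naturality of \<open>ru\<close> removes that factor.\<close>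

lemma lu_I: "lu I = ru I"
proof -
  have 1: "one I \<odot>\<^sub>f lu I = lu (I \<odot> I)"
    by (rule A.cancel_left[of "lu I"]) (use lu_natural[of "lu I"] in auto)
  have "lu I \<odot>\<^sub>f one I = ru I \<odot>\<^sub>f one I"
    using module_cat.lu'_as'[OF regular, of I I] triangle[of I I] 1 by simp
  then have "lu I \<bullet>\<^sub>A ru (I \<odot> I) = ru I \<bullet>\<^sub>A ru (I \<odot> I)"
    using ru_natural[of "lu I"] ru_natural[of "ru I"] by simp
  then show ?thesis
    by (rule A.cancel_right) auto
qed

text \<open>An evaluation has source \<open>x \<odot> k\<close>, whereas the counit at the object
  \<open>I\<close> has an extra factor \<open>I\<close> in its source; this equation mediates
  between the two.\<close>

lemma tev_I:
  assumes "arr e" "src e = x \<odot> k" "tgt e = I" "x \<in> Ob" "k \<in> Ob"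
  shows "tev x k e I = e \<bullet>\<^sub>A (one x \<odot>\<^sub>f ru k)"
proof (rule A.cancel_right)
  have "tev x k e I \<bullet>\<^sub>A as x k I = ru I \<bullet>\<^sub>A (e \<odot>\<^sub>f one I)"
    using assms by (simp add: tev_def A.assoc lu_I)
  also have "\<dots> = e \<bullet>\<^sub>A ru (x \<odot> k)"
    using assms ru_natural[of e] by simp
  also have "\<dots> = (e \<bullet>\<^sub>A (one x \<odot>\<^sub>f ru k)) \<bullet>\<^sub>A as x k I"
    using assms by (simp add: A.assoc ru_as)
  finally show "tev x k e I \<bullet>\<^sub>A as x k I = (e \<bullet>\<^sub>A (one x \<odot>\<^sub>f ru k)) \<bullet>\<^sub>A as x k I" .
qed (use assms in auto)

end

context module_cat
begin

text \<open>Up to associators, the counit of a nested evaluation is the composite of the two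
  counits. This is why the associator of the module category is a mate of the tensor constraint of
  the duals.\<close>

lemma ev_nested:
  assumes [simp]: "arrA ex" "srcA ex = x \<odot> k" "tgtA ex = I" "x \<in> ObA" "k \<in> ObA"
    "arrA ey" "srcA ey = y \<odot> l" "tgtA ey = I" "y \<in> ObA" "l \<in> ObA" "n \<in> Ob"
  shows "ev (x \<odot> y) (l \<odot> k) (A.nested x y k l ex ey) n =
    ev x k ex n \<bullet> (oneA x \<triangleright>\<^sub>f ev y l ey (k \<triangleright> n)) \<bullet> as' x y (l \<triangleright> k \<triangleright> n) \<bullet> (oneA (x \<odot> y) \<triangleright>\<^sub>f as' l k n)"
proof (rule M.cancel_right)
  let ?t = "A.tev y l ey k"
  have "ev (x \<odot> y) (l \<odot> k) (A.nested x y k l ex ey) n \<bullet> as' (x \<odot> y) (l \<odot> k) n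
     = lu' n \<bullet> (ex \<triangleright>\<^sub>f one n) \<bullet> ((oneA x \<odot>\<^sub>f ?t) \<triangleright>\<^sub>f one n) \<bullet> (as x y (l \<odot> k) \<triangleright>\<^sub>f one n)"
    by (simp add: ev_as interchange) (simp add: A.nested_def)
  also have "\<dots> = ev x k ex n \<bullet> as' x k n \<bullet> ((oneA x \<odot>\<^sub>f ?t) \<triangleright>\<^sub>f one n) \<bullet> (as x y (l \<odot> k) \<triangleright>\<^sub>f one n)"
    by (simp add: M.cmp_cong2[OF ev_as] M.assoc)
  also have "\<dots> = ev x k ex n \<bullet> (oneA x \<triangleright>\<^sub>f ?t \<triangleright>\<^sub>f one n) \<bullet> as' x (y \<odot> l \<odot> k) n \<bullet> (as x y (l \<odot> k) \<triangleright>\<^sub>f one n)"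
    by (simp add: M.cmp_cong2[OF as'_nat] M.assoc)
  also have "?t \<triangleright>\<^sub>f one n = ev y l ey (k \<triangleright> n) \<bullet> (oneA y \<triangleright>\<^sub>f as' l k n) \<bullet> as' y (l \<odot> k) n"
    by (simp add: ev_regular)
  also have "ev x k ex n \<bullet> (oneA x \<triangleright>\<^sub>f \<dots>) \<bullet> as' x (y \<odot> l \<odot> k) n \<bullet> (as x y (l \<odot> k) \<triangleright>\<^sub>f one n)
    = ev x k ex n \<bullet> (oneA x \<triangleright>\<^sub>f ev y l ey (k \<triangleright> n)) \<bullet> (oneA x \<triangleright>\<^sub>f oneA y \<triangleright>\<^sub>f as' l k n)
      \<bullet> (oneA x \<triangleright>\<^sub>f as' y (l \<odot> k) n) \<bullet> as' x (y \<odot> l \<odot> k) n \<bullet> (as x y (l \<odot> k) \<triangleright>\<^sub>f one n)"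
    by (simp add: interchange')
  also have "\<dots> = ev x k ex n \<bullet> (oneA x \<triangleright>\<^sub>f ev y l ey (k \<triangleright> n)) \<bullet> (oneA x \<triangleright>\<^sub>f oneA y \<triangleright>\<^sub>f as' l k n)
      \<bullet> as' x y ((l \<odot> k) \<triangleright> n) \<bullet> as' (x \<odot> y) (l \<odot> k) n"
    by (simp add: pentagon')
  also have "\<dots> = ev x k ex n \<bullet> (oneA x \<triangleright>\<^sub>f ev y l ey (k \<triangleright> n)) \<bullet> as' x y (l \<triangleright> k \<triangleright> n)
      \<bullet> ((oneA x \<odot>\<^sub>f oneA y) \<triangleright>\<^sub>f as' l k n) \<bullet> as' (x \<odot> y) (l \<odot> k) n"
    by (simp add: M.cmp_cong2[OF as'_nat] M.assoc del: A.act_one)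
  finally show "ev (x \<odot> y) (l \<odot> k) (A.nested x y k l ex ey) n \<bullet> as' (x \<odot> y) (l \<odot> k) n =
    (ev x k ex n \<bullet> (oneA x \<triangleright>\<^sub>f ev y l ey (k \<triangleright> n)) \<bullet> as' x y (l \<triangleright> k \<triangleright> n) \<bullet> (oneA (x \<odot> y) \<triangleright>\<^sub>f as' l k n))
       \<bullet> as' (x \<odot> y) (l \<odot> k) n"
    by (simp add: M.assoc)
qed auto

text \<open>The unit counterpart of \<open>ev_nested\<close>: \<open>I\<close> is its own dual with
  evaluation \<open>lu I\<close>. The triangle produces \<open>ru I\<close>, hence the appeal to
  \<open>lu_I\<close>.\<close>

lemma ev_lu:
  assumes [simp]: "n \<in> Ob"
  shows "ev I I (lu I) n = lu' n \<bullet> (oneA I \<triangleright>\<^sub>f lu' n)"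
proof (rule M.cancel_right)
  show "ev I I (lu I) n \<bullet> as' I I n = (lu' n \<bullet> (oneA I \<triangleright>\<^sub>f lu' n)) \<bullet> as' I I n"
    by (simp add: ev_as M.assoc triangle' A.lu_I)
qed auto

text \<open>From this the canonical arrow from \<open>l \<odot> k\<close> to the chosen dual of
  \<open>x \<odot> y\<close> will be seen to be invertible, without a formula for its
  inverse.\<close>

lemma universal_nested:
  assumes d: "A.dual_pair x k ex cx" "A.dual_pair y l ey cy" and [simp]: "n \<in> Ob"
  shows "M.universal (actF (x \<odot> y)) ((l \<odot> k) \<triangleright> n) (ev (x \<odot> y) (l \<odot> k) (A.nested x y k l ex ey) n) n"
proof -
  note [simp] = A.dual_pair_typ[OF d(1)] A.dual_pair_typ[OF d(2)]
  have "M.universal (compF (actF x) (actF y)) (l \<triangleright> k \<triangleright> n) (ev x k ex n \<bullet> (oneA x \<triangleright>\<^sub>f ev y l ey (k \<triangleright> n))) n"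
    using M.universal_compF[OF M.adj_universal[OF adj_act[OF d(1)]] M.adj_universal[OF adj_act[OF d(2)]], of n]
    by simp
  then have "M.universal (actF (x \<odot> y)) (l \<triangleright> k \<triangleright> n)
      ((ev x k ex n \<bullet> (oneA x \<triangleright>\<^sub>f ev y l ey (k \<triangleright> n))) \<bullet> as' x y (l \<triangleright> k \<triangleright> n)) n"
    by (rule M.universal_transport) (auto intro: natural_as')
  from M.universal_cmp_iso[OF this, of "as' l k n"] show ?thesis
    by (simp add: ev_nested M.assoc)
qed

lemma universal_lu:
  assumes [simp]: "n \<in> Ob"
  shows "M.universal (actF I) (I \<triangleright> n) (ev I I (lu I) n) n"
proof -
  have "M.universal idF n (one n) n"
    using M.adj_universal[OF M.adj_idF, of n] by simp
  then have "M.universal (actF I) n (one n \<bullet> lu' n) n"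
    by (rule M.universal_transport) (auto intro: natural_lu')
  from M.universal_cmp_iso[OF this, of "lu' n"] show ?thesis
    by (simp add: ev_lu)
qed

end

section \<open>Chosen left duals, duals of arrows and double dual constraints\<close>

locale left_rigid = monoidal +
  fixes dl :: "'a \<Rightarrow> 'a" and le lc :: "'a \<Rightarrow> 'b"
  assumes dual: "x \<in> Ob \<Longrightarrow> dual_pair x (dl x) (le x) (lc x)"
begin

lemma dual_typ [simp]:
  assumes "x \<in> Ob"
  shows "dl x \<in> Ob" "arr (le x)" "src (le x) = x \<odot> dl x" "tgt (le x) = I" "arr (lc x)" "src (lc x) = I" "tgt (lc x) = dl x \<odot> x"
  using dual_pair_typ[OF dual[OF assms]] by auto

definition ltr where
  "ltr x d g = ru (dl x) \<bullet>\<^sub>A (one (dl x) \<odot>\<^sub>f g) \<bullet>\<^sub>A as (dl x) x d \<bullet>\<^sub>A (lc x \<odot>\<^sub>f one d) \<bullet>\<^sub>A A.iv (lu d)"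

definition da where
  "da f = ltr (src f) (dl (tgt f)) (le (tgt f) \<bullet>\<^sub>A (f \<odot>\<^sub>f one (dl (tgt f))))"

definition dtens where
  "dtens x y = ltr (x \<odot> y) (dl y \<odot> dl x) (nested x y (dl x) (dl y) (le x) (le y))"

definition dunit where
  "dunit = ltr I I (lu I)"

definition ddtens where
  "ddtens x y = da (A.iv (dtens x y)) \<bullet>\<^sub>A dtens (dl y) (dl x)"

definition ddunit where
  "ddunit = da (A.iv dunit) \<bullet>\<^sub>A dunit"

lemma ltr_typ [simp]:
  assumes "arr g" "src g = x \<odot> d" "tgt g = I" "x \<in> Ob" "d \<in> Ob"
  shows "arr (ltr x d g)" "src (ltr x d g) = d" "tgt (ltr x d g) = dl x"
  using assms by (auto simp: ltr_def)

text \<open>This is \<open>ev_transpose\<close> in the regular module at the object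
  \<open>I\<close>; \<open>tev_I\<close> absorbs the unitor.\<close>

lemma le_ltr:
  assumes "arr g" "src g = x \<odot> d" "tgt g = I" "x \<in> Ob" "d \<in> Ob"
  shows "le x \<bullet>\<^sub>A (one x \<odot>\<^sub>f ltr x d g) = g"
proof -
  interpret R: module_cat Ob arr src tgt cmp one tns tna I as lu ru Ob arr src tgt cmp one tns tna as lu
    by (rule regular)
  let ?h = "(one (dl x) \<odot>\<^sub>f g) \<bullet>\<^sub>A R.coev (dl x) x (lc x) d"
  have "le x \<bullet>\<^sub>A (one x \<odot>\<^sub>f ltr x d g) = tev x (dl x) (le x) I \<bullet>\<^sub>A (one x \<odot>\<^sub>f ?h)"
    using assms by (simp add: tev_I interchange A.assoc ltr_def R.coev_def)
  also have "\<dots> = g"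
    using R.ev_transpose[OF dual, of x g d I] assms by (simp add: tev_def R.ev_def)
  finally show ?thesis .
qed

text \<open>Arrows into a dual are determined by their composites with the evaluation. Functoriality
  of \<open>da\<close> follows from this and \<open>le_da\<close>, without unfolding any
  transpose.\<close>

lemma le_unique:
  assumes "le x \<bullet>\<^sub>A (one x \<odot>\<^sub>f h) = le x \<bullet>\<^sub>A (one x \<odot>\<^sub>f j)" "x \<in> Ob" "arr h" "arr j" "src h = src j" "tgt h = dl x" "tgt j = dl x"
  shows "h = j"
proof -
  interpret R: module_cat Ob arr src tgt cmp one tns tna I as lu ru Ob arr src tgt cmp one tns tna as lu
    by (rule regular)
  \<comment> \<open>Composites with \<open>le x\<close> are rewritten as composites with the counit
    at \<open>I\<close>, for which factorisations are unique; the inverse unitor accounts for the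
    extra factor \<open>I\<close>.\<close>
  have *: "R.ev x (dl x) (le x) I \<bullet>\<^sub>A FA (R.actF x) (A.iv (ru (dl x)) \<bullet>\<^sub>A i) = le x \<bullet>\<^sub>A (one x \<odot>\<^sub>f i)"
    if "arr i" "tgt i = dl x" for i
    using that assms(2) tev_I[of "le x" x "dl x"] by (simp add: tev_def R.ev_def interchange A.assoc)
  have "A.iv (ru (dl x)) \<bullet>\<^sub>A h = A.iv (ru (dl x)) \<bullet>\<^sub>A j"
    by (rule A.universal_unique[of "R.actF x" "dl x \<odot> I" "R.ev x (dl x) (le x) I" I])
      (use assms A.adj_universal[OF R.adj_act[OF dual], of x I] in \<open>simp_all add: * del: R.actF_simps(2)\<close>)
  then show ?thesis
    by (rule A.cancel_left) (use assms in auto)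
qed

lemma da_typ [simp]:
  assumes "arr f"
  shows "arr (da f)" "src (da f) = dl (tgt f)" "tgt (da f) = dl (src f)"
  using assms by (auto simp: da_def)

text \<open>Duality of arrows in terms of evaluations; its image under the action is
  \<open>mates_arr\<close>.\<close>

lemma le_da:
  assumes "arr f" "src f = x" "tgt f = y"
  shows "le x \<bullet>\<^sub>A (one x \<odot>\<^sub>f da f) = le y \<bullet>\<^sub>A (f \<odot>\<^sub>f one (dl y))"
  using le_ltr[of "le y \<bullet>\<^sub>A (f \<odot>\<^sub>f one (dl y))" x "dl y"] assms by (auto simp: da_def)

lemma da_one: "x \<in> Ob \<Longrightarrow> da (one x) = one (dl x)"
  by (rule le_unique[of x]) (use le_da[of "one x" x x] in auto)

lemma da_cmp:
  assumes "arr f" "arr g" "src g = tgt f"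
  shows "da (g \<bullet>\<^sub>A f) = da f \<bullet>\<^sub>A da g"
proof (rule le_unique)
  let ?x = "src f" and ?y = "tgt f" and ?z = "tgt g"
  have "le ?x \<bullet>\<^sub>A (one ?x \<odot>\<^sub>f (da f \<bullet>\<^sub>A da g)) = le ?x \<bullet>\<^sub>A (one ?x \<odot>\<^sub>f da f) \<bullet>\<^sub>A (one ?x \<odot>\<^sub>f da g)"
    using assms by (simp add: interchange)
  also have "\<dots> = le ?y \<bullet>\<^sub>A (f \<odot>\<^sub>f one (dl ?y)) \<bullet>\<^sub>A (one ?x \<odot>\<^sub>f da g)"
    using assms by (simp add: A.cmp_cong2[OF le_da] A.assoc)
  also have "\<dots> = le ?y \<bullet>\<^sub>A (one ?y \<odot>\<^sub>f da g) \<bullet>\<^sub>A (f \<odot>\<^sub>f one (dl ?z))"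
    using assms by (simp add: interchange)
  also have "\<dots> = le ?z \<bullet>\<^sub>A (g \<odot>\<^sub>f one (dl ?z)) \<bullet>\<^sub>A (f \<odot>\<^sub>f one (dl ?z))"
    using assms by (simp add: A.cmp_cong2[OF le_da] A.assoc)
  also have "\<dots> = le ?z \<bullet>\<^sub>A ((g \<bullet>\<^sub>A f) \<odot>\<^sub>f one (dl ?z))"
    using assms by (simp add: interchange)
  finally show "le ?x \<bullet>\<^sub>A (one ?x \<odot>\<^sub>f da (g \<bullet>\<^sub>A f)) = le ?x \<bullet>\<^sub>A (one ?x \<odot>\<^sub>f (da f \<bullet>\<^sub>A da g))"
    using assms le_da[of "g \<bullet>\<^sub>A f" ?x ?z] by simp
qed (use assms in auto)

lemma iso_da [simp]: "A.iso f \<Longrightarrow> A.iso (da f)"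
  by (rule A.isoI[of _ "da (A.iv f)"]) (auto simp: da_cmp[symmetric] da_one)

lemma iv_da: "A.iso f \<Longrightarrow> A.iv (da f) = da (A.iv f)"
  by (rule A.iv_eqI) (auto simp: da_cmp[symmetric] da_one)

text \<open>Universality at \<open>I\<close> makes \<open>k\<close> and the chosen dual represent
  the same functor, up to a factor \<open>I\<close> that naturality of \<open>ru\<close> removes;
  \<open>ltr x k e\<close> is the comparison between them. The functor is spelled out because
  \<open>actF\<close> belongs to module categories.\<close>

lemma iso_of_universal:
  assumes u: "cat.universal Ob arr src tgt cmp \<lparr>FO = \<lambda>m. x \<odot> m, FA = \<lambda>h. one x \<odot>\<^sub>f h\<rparr> (k \<odot> I) (tev x k e I) I"
    and [simp]: "x \<in> Ob" "k \<in> Ob" "arr e" "src e = x \<odot> k" "tgt e = I"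
  shows "A.iso (ltr x k e)"
proof -
  interpret R: module_cat Ob arr src tgt cmp one tns tna I as lu ru Ob arr src tgt cmp one tns tna as lu
    by (rule regular)
  let ?c = "ltr x k e"
  have 1: "R.ev x (dl x) (le x) I \<bullet>\<^sub>A (one x \<odot>\<^sub>f ?c \<odot>\<^sub>f one I) = R.ev x k e I"
    by (subst R.ev_natural[where a=x and k="dl x"]) (auto simp: le_ltr)
  have "A.iso (?c \<odot>\<^sub>f one I)"
  proof (rule A.universal_iso)
    show "A.universal (R.actF x) (k \<odot> I) (R.ev x k e I) I"
      using u by (simp add: R.actF_def R.ev_def tev_def)
    show "A.universal (R.actF x) (dl x \<odot> I) (R.ev x (dl x) (le x) I) I"
      using A.adj_universal[OF R.adj_act[OF dual], of x I] by simp
  qed (use 1 in auto)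
  then have "A.iso (ru (dl x) \<bullet>\<^sub>A (?c \<odot>\<^sub>f one I) \<bullet>\<^sub>A A.iv (ru k))"
    by simp
  moreover have "ru (dl x) \<bullet>\<^sub>A (?c \<odot>\<^sub>f one I) \<bullet>\<^sub>A A.iv (ru k) = ?c"
    using ru_natural[of ?c] by (simp add: A.assoc[symmetric]) (simp add: A.assoc)
  ultimately show ?thesis
    by simp
qed

lemma dtens_typ [simp]:
  assumes "x \<in> Ob" "y \<in> Ob"
  shows "arr (dtens x y)" "src (dtens x y) = dl y \<odot> dl x" "tgt (dtens x y) = dl (x \<odot> y)"
  using assms by (auto simp: dtens_def)

lemma iso_dtens [simp]:
  assumes [simp]: "x \<in> Ob" "y \<in> Ob"
  shows "A.iso (dtens x y)"
proof -
  interpret R: module_cat Ob arr src tgt cmp one tns tna I as lu ru Ob arr src tgt cmp one tns tna as lu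
    by (rule regular)
  show ?thesis
    unfolding dtens_def
    using R.universal_nested[OF dual dual, of x y I] by (intro iso_of_universal) (auto simp: R.actF_def R.ev_def tev_def)
qed

lemma dunit_typ [simp]: "arr dunit" "src dunit = I" "tgt dunit = dl I"
  by (auto simp: dunit_def)

lemma iso_dunit [simp]: "A.iso dunit"
proof -
  interpret R: module_cat Ob arr src tgt cmp one tns tna I as lu ru Ob arr src tgt cmp one tns tna as lu
    by (rule regular)
  show ?thesis
    unfolding dunit_def
    using R.universal_lu[of I] by (intro iso_of_universal) (auto simp: R.actF_def R.ev_def tev_def)
qed

lemma le_dtens:
  "\<lbrakk>x \<in> Ob; y \<in> Ob\<rbrakk> \<Longrightarrow> le (x \<odot> y) \<bullet>\<^sub>A (one (x \<odot> y) \<odot>\<^sub>f dtens x y) = nested x y (dl x) (dl y) (le x) (le y)"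
  unfolding dtens_def by (rule le_ltr) auto

lemma le_dunit: "le I \<bullet>\<^sub>A (one I \<odot>\<^sub>f dunit) = lu I"
  unfolding dunit_def by (rule le_ltr) auto

lemma ddtens_typ [simp]:
  assumes "x \<in> Ob" "y \<in> Ob"
  shows "arr (ddtens x y)" "src (ddtens x y) = dl (dl x) \<odot> dl (dl y)" "tgt (ddtens x y) = dl (dl (x \<odot> y))"
    "A.iso (ddtens x y)"
  using assms by (auto simp: ddtens_def)

lemma ddunit_typ [simp]: "arr ddunit" "src ddunit = I" "tgt ddunit = dl (dl I)" "A.iso ddunit"
  by (auto simp: ddunit_def)

text \<open>The left associator of \<open>ll_rr\<close> contains this inverse; in the factorised
  form it arises from a composition of mates.\<close>

lemma iv_ddtens:
  "\<lbrakk>x \<in> Ob; y \<in> Ob\<rbrakk> \<Longrightarrow> A.iv (ddtens x y) = A.iv (dtens (dl y) (dl x)) \<bullet>\<^sub>A da (dtens x y)"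
  by (simp add: ddtens_def A.iv_of_cmp iv_da)

lemma iv_ddunit: "A.iv ddunit = A.iv dunit \<bullet>\<^sub>A da dunit"
  by (simp add: ddunit_def A.iv_of_cmp iv_da)

end

section \<open>Mates for the action functors\<close>

context cat
begin

lemma natural_cong:
  assumes "natural F G \<alpha>" "\<And>n. n \<in> Ob \<Longrightarrow> \<alpha> n = \<beta> n"
  shows "natural F G \<beta>"
  using assms unfolding natural_def by (metis src_Ob tgt_Ob)

text \<open>Transformations are functions on a whole type, while only their values at objects carry
  information; composed mates are brought to a wanted formula at objects.\<close>

lemma mates_cong:
  assumes "mates L K e L' K' e' \<alpha> \<kappa>" "\<And>n. n \<in> Ob \<Longrightarrow> \<alpha> n = \<alpha>' n" "\<And>n. n \<in> Ob \<Longrightarrow> \<kappa> n = \<kappa>' n"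
    and "endo K'"
  shows "mates L K e L' K' e' \<alpha>' \<kappa>'"
  using assms natural_cong[of L L' \<alpha> \<alpha>'] natural_cong[of K' K \<kappa> \<kappa>'] unfolding mates_def
  by (metis endo_simps(1))

end

locale rigid_module =
  A: left_rigid ObA arrA srcA tgtA cmpA oneA tns tna I as lu ru dl le lc +
  module_cat ObA arrA srcA tgtA cmpA oneA tns tna I as lu ru Ob arr src tgt cmp one act acta as' lu'
  for ObA :: "'oa set" and arrA :: "'fa \<Rightarrow> bool" and srcA tgtA
    and cmpA (infixr "\<bullet>\<^sub>A" 70) and oneA
    and tns (infixr "\<odot>" 75) and tna (infixr "\<odot>\<^sub>f" 75) and I as lu ru dl le lc
    and Ob :: "'o set" and arr :: "'f \<Rightarrow> bool" and src tgt
    and cmp (infixr "\<bullet>" 70) and one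
    and act (infixr "\<triangleright>" 75) and acta (infixr "\<triangleright>\<^sub>f" 75) and as' lu'
begin

abbreviation "E a \<equiv> ev a (dl a) (le a)"

lemma adj_E [simp]: "a \<in> ObA \<Longrightarrow> M.adj (actF a) (actF (dl a)) (E a)"
  by (rule adj_act[OF A.dual])

text \<open>By \<open>ev_natural\<close> both sides are counits formed from arrows
  \<open>a \<odot> dl b\<close> to \<open>I\<close>, and \<open>le_da\<close> says that the two
  arrows coincide.\<close>

lemma mates_arr:
  assumes "arrA f" "srcA f = a" "tgtA f = b"
  shows "M.mates (actF a) (actF (dl a)) (E a) (actF b) (actF (dl b)) (E b)
    (\<lambda>n. f \<triangleright>\<^sub>f one n) (\<lambda>n. A.da f \<triangleright>\<^sub>f one n)"
  unfolding M.mates_def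
proof (intro conjI ballI)
  have [simp]: "a \<in> ObA" "b \<in> ObA" "arrA f" using assms by auto
  show "M.natural (actF a) (actF b) (\<lambda>n. f \<triangleright>\<^sub>f one n)" "M.natural (actF (dl b)) (actF (dl a)) (\<lambda>n. A.da f \<triangleright>\<^sub>f one n)"
    using assms by (auto intro!: natural_act)
  fix n assume [simp]: "n \<in> Ob"
  have "E b n \<bullet> (f \<triangleright>\<^sub>f oneA (dl b) \<triangleright>\<^sub>f one n) = one n \<bullet> ev a (dl b) (le b \<bullet>\<^sub>A (f \<odot>\<^sub>f oneA (dl b))) n"
    by (rule ev_natural) (use assms in auto)
  moreover have "E a n \<bullet> (oneA a \<triangleright>\<^sub>f A.da f \<triangleright>\<^sub>f one n) = one n \<bullet> ev a (dl b) (le a \<bullet>\<^sub>A (oneA a \<odot>\<^sub>f A.da f)) n"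
    by (rule ev_natural) (use assms in auto)
  ultimately show "E b n \<bullet> (f \<triangleright>\<^sub>f one (FO (actF (dl b)) n)) = E a n \<bullet> FA (actF a) (A.da f \<triangleright>\<^sub>f one n)"
    using assms by (simp add: A.le_da)
qed

lemma adj_EE: "\<lbrakk>a \<in> ObA; b \<in> ObA\<rbrakk> \<Longrightarrow>
    M.adj (compF (actF a) (actF b)) (compF (actF (dl b)) (actF (dl a))) (M.comp_counit (actF a) (actF (dl a)) (E a) (E b))"
  by (auto intro: M.adj_compF)

text \<open>Naturality moves \<open>dtens\<close> into the evaluation of \<open>x \<odot> y\<close>,
  \<open>le_dtens\<close> turns the result into the nested evaluation, and \<open>ev_nested\<close>
  splits this into two counits.\<close>

lemma mates_tens:
  assumes [simp]: "x \<in> ObA" "y \<in> ObA"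
  shows "M.mates (actF (x \<odot> y)) (actF (dl (x \<odot> y))) (E (x \<odot> y))
    (compF (actF x) (actF y)) (compF (actF (dl y)) (actF (dl x))) (M.comp_counit (actF x) (actF (dl x)) (E x) (E y))
    (as' x y) (\<lambda>n. (A.dtens x y \<triangleright>\<^sub>f one n) \<bullet> M.iv (as' (dl y) (dl x) n))"
  unfolding M.mates_def
proof (intro conjI ballI)
  show "M.natural (actF (x \<odot> y)) (compF (actF x) (actF y)) (as' x y)"
    by (simp add: natural_as')
  have "M.natural (compF (actF (dl y)) (actF (dl x))) (actF (dl y \<odot> dl x)) (\<lambda>n. M.iv (as' (dl y) (dl x) n))"
    by (rule M.natural_iv[OF natural_as']) auto
  then show "M.natural (compF (actF (dl y)) (actF (dl x))) (actF (dl (x \<odot> y)))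
     (\<lambda>n. (A.dtens x y \<triangleright>\<^sub>f one n) \<bullet> M.iv (as' (dl y) (dl x) n))"
    by (rule M.natural_comp[OF _ natural_act]) auto
  fix n assume [simp]: "n \<in> Ob"
  let ?c = "A.dtens x y"
  have 1: "E (x \<odot> y) n \<bullet> (oneA (x \<odot> y) \<triangleright>\<^sub>f ?c \<triangleright>\<^sub>f one n)
     = one n \<bullet> ev (x \<odot> y) (dl y \<odot> dl x) (le (x \<odot> y) \<bullet>\<^sub>A (oneA (x \<odot> y) \<odot>\<^sub>f ?c)) n"
    by (rule ev_natural) auto
  have "E (x \<odot> y) n \<bullet> (oneA (x \<odot> y) \<triangleright>\<^sub>f ((?c \<triangleright>\<^sub>f one n) \<bullet> M.iv (as' (dl y) (dl x) n)))
    = (E (x \<odot> y) n \<bullet> (oneA (x \<odot> y) \<triangleright>\<^sub>f ?c \<triangleright>\<^sub>f one n)) \<bullet> (oneA (x \<odot> y) \<triangleright>\<^sub>f M.iv (as' (dl y) (dl x) n))"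
    by (simp add: M.assoc interchange)
  also have "\<dots> = E x n \<bullet> (oneA x \<triangleright>\<^sub>f E y (dl x \<triangleright> n)) \<bullet> as' x y (dl y \<triangleright> dl x \<triangleright> n)"
    by (simp add: 1 A.le_dtens ev_nested M.assoc interchange)
  finally show "M.comp_counit (actF x) (actF (dl x)) (E x) (E y) n \<bullet> as' x y (FO (compF (actF (dl y)) (actF (dl x))) n) =
     E (x \<odot> y) n \<bullet> FA (actF (x \<odot> y)) ((?c \<triangleright>\<^sub>f one n) \<bullet> M.iv (as' (dl y) (dl x) n))"
    by (simp add: M.comp_counit_def M.assoc)
qed

text \<open>The next link of the chain: \<open>mates_tens\<close> at \<open>dl y\<close> and
  \<open>dl x\<close>, inverted, followed by the mate of the arrow \<open>dtens x y\<close>. What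
  results on double duals has the form of the left associator of \<open>ll_rr\<close>.\<close>

lemma mates_tens_dual:
  assumes [simp]: "x \<in> ObA" "y \<in> ObA"
  shows "M.mates (compF (actF (dl y)) (actF (dl x))) (compF (actF (dl (dl x))) (actF (dl (dl y))))
    (M.comp_counit (actF (dl y)) (actF (dl (dl y))) (E (dl y)) (E (dl x)))
    (actF (dl (x \<odot> y))) (actF (dl (dl (x \<odot> y)))) (E (dl (x \<odot> y)))
    (\<lambda>n. (A.dtens x y \<triangleright>\<^sub>f one n) \<bullet> M.iv (as' (dl y) (dl x) n))
    (\<lambda>n. as' (dl (dl x)) (dl (dl y)) n \<bullet> (A.A.iv (A.ddtens x y) \<triangleright>\<^sub>f one n))"
proof (rule M.mates_cong)
  have 1: "M.mates (compF (actF (dl y)) (actF (dl x))) (compF (actF (dl (dl x))) (actF (dl (dl y))))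
    (M.comp_counit (actF (dl y)) (actF (dl (dl y))) (E (dl y)) (E (dl x)))
    (actF (dl y \<odot> dl x)) (actF (dl (dl y \<odot> dl x))) (E (dl y \<odot> dl x)) 
    (\<lambda>n. M.iv (as' (dl y) (dl x) n))
    (\<lambda>n. M.iv ((A.dtens (dl y) (dl x) \<triangleright>\<^sub>f one n) \<bullet> M.iv (as' (dl (dl x)) (dl (dl y)) n)))"
    by (rule M.mates_iv[OF mates_tens]) (auto intro: adj_EE)
  show "M.mates (compF (actF (dl y)) (actF (dl x))) (compF (actF (dl (dl x))) (actF (dl (dl y))))
    (M.comp_counit (actF (dl y)) (actF (dl (dl y))) (E (dl y)) (E (dl x)))
    (actF (dl (x \<odot> y))) (actF (dl (dl (x \<odot> y)))) (E (dl (x \<odot> y)))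
    (\<lambda>n. (A.dtens x y \<triangleright>\<^sub>f one n) \<bullet> M.iv (as' (dl y) (dl x) n))
    (\<lambda>n. M.iv ((A.dtens (dl y) (dl x) \<triangleright>\<^sub>f one n) \<bullet> M.iv (as' (dl (dl x)) (dl (dl y)) n)) \<bullet> (A.da (A.dtens x y) \<triangleright>\<^sub>f one n))"
    by (rule M.mates_comp[OF 1 mates_arr]) (auto intro: adj_EE)
  show "M.iv ((A.dtens (dl y) (dl x) \<triangleright>\<^sub>f one n) \<bullet> M.iv (as' (dl (dl x)) (dl (dl y)) n)) \<bullet> (A.da (A.dtens x y) \<triangleright>\<^sub>f one n)
    = as' (dl (dl x)) (dl (dl y)) n \<bullet> (A.A.iv (A.ddtens x y) \<triangleright>\<^sub>f one n)" if "n \<in> Ob" for n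
    using that by (simp add: M.iv_of_cmp iv_act A.iv_ddtens M.assoc interchange)
qed auto

lemma mates_unit:
  "M.mates (actF I) (actF (dl I)) (E I) idF idF one lu' (\<lambda>n. (A.dunit \<triangleright>\<^sub>f one n) \<bullet> M.iv (lu' n))"
  unfolding M.mates_def
proof (intro conjI ballI)
  show "M.natural (actF I) idF lu'"
    by (rule natural_lu')
  have "M.natural idF (actF I) (\<lambda>n. M.iv (lu' n))"
    by (rule M.natural_iv[OF natural_lu']) auto
  then show "M.natural idF (actF (dl I)) (\<lambda>n. (A.dunit \<triangleright>\<^sub>f one n) \<bullet> M.iv (lu' n))"
    by (rule M.natural_comp[OF _ natural_act]) auto
  fix n assume [simp]: "n \<in> Ob"
  have 1: "E I n \<bullet> (oneA I \<triangleright>\<^sub>f A.dunit \<triangleright>\<^sub>f one n) = one n \<bullet> ev I I (le I \<bullet>\<^sub>A (oneA I \<odot>\<^sub>f A.dunit)) n"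
    by (rule ev_natural) auto
  have "E I n \<bullet> (oneA I \<triangleright>\<^sub>f ((A.dunit \<triangleright>\<^sub>f one n) \<bullet> M.iv (lu' n)))
      = (E I n \<bullet> (oneA I \<triangleright>\<^sub>f A.dunit \<triangleright>\<^sub>f one n)) \<bullet> (oneA I \<triangleright>\<^sub>f M.iv (lu' n))"
    by (simp add: M.assoc interchange)
  also have "\<dots> = lu' n"
    by (simp add: 1 A.le_dunit ev_lu M.assoc interchange)
  finally show "one n \<bullet> lu' (FO idF n) = E I n \<bullet> FA (actF I) ((A.dunit \<triangleright>\<^sub>f one n) \<bullet> M.iv (lu' n))"
    by simp
qed

text \<open>As for tensor products, \<open>mates_unit\<close> is inverted and followed by the mate
  of \<open>dunit\<close>; what results on the double dual of \<open>I\<close> has the form of the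
  left unitor of \<open>ll_rr\<close>.\<close>

lemma mates_unit_dual:
  "M.mates idF idF one (actF (dl I)) (actF (dl (dl I))) (E (dl I)) (\<lambda>n. (A.dunit \<triangleright>\<^sub>f one n) \<bullet> M.iv (lu' n))
    (\<lambda>n. lu' n \<bullet> (A.A.iv A.ddunit \<triangleright>\<^sub>f one n))"
proof (rule M.mates_cong)
  have 1: "M.mates idF idF one (actF I) (actF (dl I)) (E I) (\<lambda>n. M.iv (lu' n)) (\<lambda>n. M.iv ((A.dunit \<triangleright>\<^sub>f one n) \<bullet> M.iv (lu' n)))"
    by (rule M.mates_iv[OF mates_unit]) (auto intro: M.adj_idF)
  show "M.mates idF idF one (actF (dl I)) (actF (dl (dl I))) (E (dl I)) (\<lambda>n. (A.dunit \<triangleright>\<^sub>f one n) \<bullet> M.iv (lu' n))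
    (\<lambda>n. M.iv ((A.dunit \<triangleright>\<^sub>f one n) \<bullet> M.iv (lu' n)) \<bullet> (A.da A.dunit \<triangleright>\<^sub>f one n))"
    by (rule M.mates_comp[OF 1 mates_arr]) (auto intro: M.adj_idF)
  show "M.iv ((A.dunit \<triangleright>\<^sub>f one n) \<bullet> M.iv (lu' n)) \<bullet> (A.da A.dunit \<triangleright>\<^sub>f one n) = lu' n \<bullet> (A.A.iv A.ddunit \<triangleright>\<^sub>f one n)"
    if "n \<in> Ob" for n
    using that by (simp add: M.iv_of_cmp iv_act A.iv_ddunit M.assoc interchange)
qed auto

end

text \<open>Both actions are written as left actions. A right action enters with an inverted
  associator \<open>asB'\<close>, so \<open>mas_right\<close> is stated for inverses. It makes the
  inverse of \<open>mas\<close> a module functor structure on \<open>a \<triangleright> -\<close>,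
  as \<open>mas_left\<close> makes \<open>mas\<close> one on
  \<open>b \<triangleright>\<^sub>B -\<close>.\<close>

locale commuting_modules =
  L: module_cat ObA arrA srcA tgtA cmpA oneA tns tna I as lu ru Ob arr src tgt cmp one act acta as' lu' +
  R: module_cat ObB arrB srcB tgtB cmpB oneB tnsB tnaB IB asB luB ruB Ob arr src tgt cmp one actB actaB asB' luB'
  for ObA :: "'oa set" and arrA :: "'fa \<Rightarrow> bool" and srcA tgtA
    and cmpA (infixr "\<bullet>\<^sub>A" 70) and oneA
    and tns (infixr "\<odot>" 75) and tna (infixr "\<odot>\<^sub>f" 75) and I as lu ru
    and ObB :: "'ob set" and arrB :: "'fb \<Rightarrow> bool" and srcB tgtB
    and cmpB (infixr "\<bullet>\<^sub>B" 70) and oneB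
    and tnsB (infixr "\<odot>\<^sub>B" 75) and tnaB (infixr "\<odot>\<^sub>B\<^sub>f" 75) and IB asB luB ruB
    and Ob :: "'o set" and arr :: "'f \<Rightarrow> bool" and src tgt
    and cmp (infixr "\<bullet>" 70) and one
    and act (infixr "\<triangleright>" 75) and acta (infixr "\<triangleright>\<^sub>f" 75) and as' lu'
    and actB (infixr "\<triangleright>\<^sub>B" 75) and actaB (infixr "\<triangleright>\<^sub>B\<^sub>f" 75) and asB' luB' +
  fixes mas :: "'oa \<Rightarrow> 'o \<Rightarrow> 'ob \<Rightarrow> 'f"
  assumes mas_iso [simp]: "\<lbrakk>a \<in> ObA; m \<in> Ob; b \<in> ObB\<rbrakk> \<Longrightarrow> L.M.iso (mas a m b)"
    and src_mas [simp]: "\<lbrakk>a \<in> ObA; m \<in> Ob; b \<in> ObB\<rbrakk> \<Longrightarrow> src (mas a m b) = b \<triangleright>\<^sub>B a \<triangleright> m"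
    and tgt_mas [simp]: "\<lbrakk>a \<in> ObA; m \<in> Ob; b \<in> ObB\<rbrakk> \<Longrightarrow> tgt (mas a m b) = a \<triangleright> b \<triangleright>\<^sub>B m"
    and mas_natural: "\<lbrakk>arrA f; arr h; arrB g; srcA f = a; tgtA f = a1; src h = m; tgt h = m1; srcB g = b; tgtB g = b1\<rbrakk> \<Longrightarrow>
        mas a1 m1 b1 \<bullet> (g \<triangleright>\<^sub>B\<^sub>f f \<triangleright>\<^sub>f h) = (f \<triangleright>\<^sub>f g \<triangleright>\<^sub>B\<^sub>f h) \<bullet> mas a m b"
    and mas_left: "\<lbrakk>a \<in> ObA; a' \<in> ObA; m \<in> Ob; b \<in> ObB\<rbrakk> \<Longrightarrow>
        as' a a' (b \<triangleright>\<^sub>B m) \<bullet> mas (a \<odot> a') m b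
          = (oneA a \<triangleright>\<^sub>f mas a' m b) \<bullet> mas a (a' \<triangleright> m) b \<bullet> (oneB b \<triangleright>\<^sub>B\<^sub>f as' a a' m)"
    and mas_right: "\<lbrakk>a \<in> ObA; m \<in> Ob; b \<in> ObB; b' \<in> ObB\<rbrakk> \<Longrightarrow>
        asB' b' b (a \<triangleright> m) \<bullet> L.M.iv (mas a m (b' \<odot>\<^sub>B b))
          = (oneB b' \<triangleright>\<^sub>B\<^sub>f L.M.iv (mas a m b)) \<bullet> L.M.iv (mas a (b \<triangleright>\<^sub>B m) b') \<bullet> (oneA a \<triangleright>\<^sub>f asB' b' b m)"
begin

text \<open>Acting with \<open>b\<close> is a module functor for the other action, with structure
  \<open>mas\<close>, so \<open>g_ev\<close> applies.\<close>

lemma ev_mas_left: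
  assumes "arrA e" "srcA e = a \<odot> k" "tgtA e = I" "a \<in> ObA" "k \<in> ObA" "n \<in> Ob" "b \<in> ObB"
  shows "L.ev a k e (b \<triangleright>\<^sub>B n) \<bullet> (oneA a \<triangleright>\<^sub>f mas k n b) \<bullet> mas a (k \<triangleright> n) b = oneB b \<triangleright>\<^sub>B\<^sub>f L.ev a k e n"
proof -
  interpret module_functor ObA arrA srcA tgtA cmpA oneA tns tna I as lu ru Ob arr src tgt cmp one act acta as' lu'
    Ob arr src tgt cmp one act acta as' lu' "\<lambda>m. b \<triangleright>\<^sub>B m" "\<lambda>h. oneB b \<triangleright>\<^sub>B\<^sub>f h" "\<lambda>a m. mas a m b"
    using assms(7) by unfold_locales (auto simp: R.interchange mas_left intro!: mas_natural)
  show ?thesis using g_ev assms by simp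
qed

lemma ev_mas_right:
  assumes "arrB e" "srcB e = b \<odot>\<^sub>B l" "tgtB e = IB" "b \<in> ObB" "l \<in> ObB" "n \<in> Ob" "a \<in> ObA"
  shows "R.ev b l e (a \<triangleright> n) \<bullet> (oneB b \<triangleright>\<^sub>B\<^sub>f L.M.iv (mas a n l)) \<bullet> L.M.iv (mas a (l \<triangleright>\<^sub>B n) b) = oneA a \<triangleright>\<^sub>f R.ev b l e n"
proof -
  interpret module_functor ObB arrB srcB tgtB cmpB oneB tnsB tnaB IB asB luB ruB Ob arr src tgt cmp one actB actaB asB' luB'
    Ob arr src tgt cmp one actB actaB asB' luB' "\<lambda>m. a \<triangleright> m" "\<lambda>h. oneA a \<triangleright>\<^sub>f h" "\<lambda>b m. L.M.iv (mas a m b)"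
  proof unfold_locales
    fix f h assume "arrB f" "arr h"
    then show "L.M.iv (mas a (tgt h) (tgtB f)) \<bullet> (oneA a \<triangleright>\<^sub>f f \<triangleright>\<^sub>B\<^sub>f h) = (f \<triangleright>\<^sub>B\<^sub>f oneA a \<triangleright>\<^sub>f h) \<bullet> L.M.iv (mas a (src h) (srcB f))"
      using assms(7) by (intro L.M.cmp_iv_swap[symmetric] mas_natural) auto
  qed (use assms(7) in \<open>auto simp: L.interchange mas_right\<close>)
  show ?thesis using g_ev assms by simp
qed

text \<open>The mate of \<open>mas\<close> is \<open>mas\<close> at the dual objects, so the
  statement iterates along the chain of duals. Naturality exchanges the order of the two counits,
  and \<open>ev_mas_left\<close> and \<open>ev_mas_right\<close> move them past
  \<open>mas\<close>.\<close>

lemma mates_mas: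
  assumes d: "L.A.dual_pair a k e c" "R.A.dual_pair b l d c'"
  shows "L.M.mates (compF (R.actF b) (L.actF a)) (compF (L.actF k) (R.actF l))
      (L.M.comp_counit (R.actF b) (R.actF l) (R.ev b l d) (L.ev a k e))
    (compF (L.actF a) (R.actF b)) (compF (R.actF l) (L.actF k))
      (L.M.comp_counit (L.actF a) (L.actF k) (L.ev a k e) (R.ev b l d))
    (\<lambda>m. mas a m b) (\<lambda>n. mas k n l)"
  unfolding L.M.mates_def
proof (intro conjI ballI)
  note [simp] = L.A.dual_pair_typ[OF d(1)] R.A.dual_pair_typ[OF d(2)]
  show "L.M.natural (compF (R.actF b) (L.actF a)) (compF (L.actF a) (R.actF b)) (\<lambda>m. mas a m b)"
    "L.M.natural (compF (R.actF l) (L.actF k)) (compF (L.actF k) (R.actF l)) (\<lambda>n. mas k n l)"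
    unfolding L.M.natural_def by (auto intro!: mas_natural)
  fix n assume [simp]: "n \<in> Ob"
  have 1: "L.ev a k e n \<bullet> R.ev b l d (a \<triangleright> k \<triangleright> n) = R.ev b l d n \<bullet> (oneB b \<triangleright>\<^sub>B\<^sub>f oneB l \<triangleright>\<^sub>B\<^sub>f L.ev a k e n)"
    using R.ev_natural[of d b l "oneB b" b "oneB l" l "L.ev a k e n" "a \<triangleright> k \<triangleright> n" n] by simp
  have "(L.ev a k e n \<bullet> (oneA a \<triangleright>\<^sub>f R.ev b l d (k \<triangleright> n))) \<bullet> mas a (l \<triangleright>\<^sub>B k \<triangleright> n) b
     = L.ev a k e n \<bullet> R.ev b l d (a \<triangleright> k \<triangleright> n) \<bullet> (oneB b \<triangleright>\<^sub>B\<^sub>f L.M.iv (mas a (k \<triangleright> n) l))"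
    by (subst ev_mas_right[symmetric]) (auto simp: L.M.assoc)
  also have "\<dots> = R.ev b l d n \<bullet> (oneB b \<triangleright>\<^sub>B\<^sub>f oneB l \<triangleright>\<^sub>B\<^sub>f L.ev a k e n) \<bullet> (oneB b \<triangleright>\<^sub>B\<^sub>f L.M.iv (mas a (k \<triangleright> n) l))"
    by (subst L.M.cmp_cong2[OF 1]) (auto simp: L.M.assoc)
  also have "\<dots> = R.ev b l d n \<bullet> (oneB b \<triangleright>\<^sub>B\<^sub>f (L.ev a k e (l \<triangleright>\<^sub>B n) \<bullet> (oneA a \<triangleright>\<^sub>f mas k n l)))"
    by (subst ev_mas_left[symmetric]) (auto simp: R.interchange L.M.assoc)
  also have "\<dots> = (R.ev b l d n \<bullet> (oneB b \<triangleright>\<^sub>B\<^sub>f L.ev a k e (l \<triangleright>\<^sub>B n))) \<bullet> (oneB b \<triangleright>\<^sub>B\<^sub>f oneA a \<triangleright>\<^sub>f mas k n l)"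
    by (simp add: R.interchange L.M.assoc)
  finally show "L.M.comp_counit (L.actF a) (L.actF k) (L.ev a k e) (R.ev b l d) n \<bullet> mas a (FO (compF (R.actF l) (L.actF k)) n) b
    = L.M.comp_counit (R.actF b) (R.actF l) (R.ev b l d) (L.ev a k e) n \<bullet> FA (compF (R.actF b) (L.actF a)) (mas k n l)"
    by (simp add: L.M.comp_counit_def)
qed

end

section \<open>The Nakayama functor and chains of adjoints\<close>

datatype ('o, 'm) arrow = Arrow (asrc: 'o) (raw: 'm) (atgt: 'o)

lemma arrow_eqI: "\<lbrakk>asrc f = asrc g; atgt f = atgt g; raw f = raw g\<rbrakk> \<Longrightarrow> f = g"
  by (cases f; cases g) simp

text \<open>A zero arrow of an \<open>lcat\<close> does not determine its source and target; the following arrows do.\<close>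

definition tarr :: "('k, 'o, 'm, 'z) lcat_scheme \<Rightarrow> ('o, 'm) arrow \<Rightarrow> bool" where
  "tarr C f \<longleftrightarrow> asrc f \<in> Obj C \<and> atgt f \<in> Obj C \<and> raw f \<in> Hom C (asrc f) (atgt f)"

definition tcmp :: "('k, 'o, 'm, 'z) lcat_scheme \<Rightarrow> ('o, 'm) arrow \<Rightarrow> ('o, 'm) arrow \<Rightarrow> ('o, 'm) arrow" where
  "tcmp C g f = Arrow (asrc f) (raw g \<cdot>\<^bsub>C\<^esub> raw f) (atgt g)"

definition tone :: "('k, 'o, 'm, 'z) lcat_scheme \<Rightarrow> 'o \<Rightarrow> ('o, 'm) arrow" where
  "tone C x = Arrow x (Id C x) x"

definition tF :: "('o, 'm, 'p, 'n) functor_data \<Rightarrow> ('o, ('o, 'm) arrow, 'p, ('p, 'n) arrow) functor_data" where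
  "tF F = \<lparr>FO = FO F, FA = \<lambda>f. Arrow (FO F (asrc f)) (FA F (raw f)) (FO F (atgt f))\<rparr>"

definition tadd :: "('o, 'm::plus) arrow \<Rightarrow> ('o, 'm) arrow \<Rightarrow> ('o, 'm) arrow" where
  "tadd f g = Arrow (asrc f) (raw f + raw g) (atgt f)"

definition tscl :: "('k, 'o, 'm, 'z) lcat_scheme \<Rightarrow> 'k \<Rightarrow> ('o, 'm) arrow \<Rightarrow> ('o, 'm) arrow" where
  "tscl C c f = Arrow (asrc f) (scl C c (raw f)) (atgt f)"

lemma tF_simps [simp]: "FO (tF F) x = FO F x"
    "FA (tF F) f = Arrow (FO F (asrc f)) (FA F (raw f)) (FO F (atgt f))"
  by (simp_all add: tF_def)

lemma tadd_simps [simp]: "asrc (tadd f g) = asrc f" "atgt (tadd f g) = atgt f" "raw (tadd f g) = raw f + raw g"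
  by (simp_all add: tadd_def)

lemma tscl_simps [simp]: "asrc (tscl C c f) = asrc f" "atgt (tscl C c f) = atgt f" "raw (tscl C c f) = scl C c (raw f)"
  by (simp_all add: tscl_def)

lemma raw_tcmp [simp]: "raw (tcmp C g f) = raw g \<cdot>\<^bsub>C\<^esub> raw f"
  by (simp add: tcmp_def)

lemma raw_tone [simp]: "raw (tone C x) = Id C x"
  by (simp add: tone_def)

section \<open>Transposes and partial traces\<close>

context cat
begin

text \<open>Transposition as an operation on arrows, so that its linearity can be stated.\<close>

definition sharp where
  "sharp L p e m f = (THE h. arr h \<and> src h = m \<and> tgt h = p \<and> e \<bullet> FA L h = f)"

lemma sharp:
  assumes "universal L p e n" "m \<in> Ob" "arr f" "src f = FO L m" "tgt f = n"
  shows "arr (sharp L p e m f)" "src (sharp L p e m f) = m" "tgt (sharp L p e m f) = p"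
    "e \<bullet> FA L (sharp L p e m f) = f"
proof -
  have "\<exists>!h. arr h \<and> src h = m \<and> tgt h = p \<and> e \<bullet> FA L h = f"
    using assms unfolding universal_def by blast
  from theI'[OF this] show "arr (sharp L p e m f)" "src (sharp L p e m f) = m" "tgt (sharp L p e m f) = p"
    "e \<bullet> FA L (sharp L p e m f) = f"
    unfolding sharp_def by blast+
qed

lemma sharp_eq:
  assumes "universal L p e n" "endo L" "arr h" "src h = m" "tgt h = p" "e \<bullet> FA L h = f"
  shows "sharp L p e m f = h"
proof -
  have "m \<in> Ob" "arr f" "src f = FO L m" "tgt f = n"
    using assms universal_typ[OF assms(1)] by auto
  note s = sharp[OF assms(1) this]
  show ?thesis
    by (rule universal_unique[OF assms(1,2)]) (use s assms in auto)
qed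

text \<open>For \<open>L \<stileturn> K \<stileturn> R\<close>, the partial trace \<open>Hom(L m, R n) \<rightarrow> Hom(m, n)\<close>; for the actions of an object and
  its iterated left duals it is the usual partial trace built from coevaluation and evaluation.\<close>

definition tr :: "('o, 'f, 'o, 'f) functor_data \<Rightarrow> ('o, 'f, 'o, 'f) functor_data \<Rightarrow> ('o, 'f, 'o, 'f) functor_data \<Rightarrow>
    ('o \<Rightarrow> 'f) \<Rightarrow> ('o \<Rightarrow> 'f) \<Rightarrow> 'o \<Rightarrow> 'o \<Rightarrow> 'f \<Rightarrow> 'f" where
  "tr L K R e e' m n f = e' n \<bullet> sharp L (FO K (FO R n)) (e (FO R n)) m f"

text \<open>By universality every arrow from \<open>L m\<close> to \<open>R n\<close> is a counit
  after some \<open>L h\<close>; traces are computed by bringing their argument into this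
  form.\<close>

lemma tr_eq:
  assumes "adj L K e" "adj K R e'" "n \<in> Ob" "arr h" "src h = m" "tgt h = FO K (FO R n)"
  shows "tr L K R e e' m n (e (FO R n) \<bullet> FA L h) = e' n \<bullet> h"
proof -
  have "FO R n \<in> Ob" using adj_endo[OF assms(2)] assms by simp
  from sharp_eq[OF adj_universal[OF assms(1) this] adj_endo(1)[OF assms(1)]] assms
  show ?thesis by (simp add: tr_def)
qed

lemma tr_ex:
  assumes "adj L K e" "adj K R e'" "m \<in> Ob" "n \<in> Ob" "arr f" "src f = FO L m" "tgt f = FO R n"
  obtains h where "arr h" "src h = m" "tgt h = FO K (FO R n)" "f = e (FO R n) \<bullet> FA L h"
    "tr L K R e e' m n f = e' n \<bullet> h"
proof -
  have "FO R n \<in> Ob" using adj_endo[OF assms(2)] assms by simp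
  from universal_ex[OF adj_universal[OF assms(1) this] assms(3,5,6,7)] obtain h where
    "arr h" "src h = m" "tgt h = FO K (FO R n)" "e (FO R n) \<bullet> FA L h = f" by blast
  with tr_eq[OF assms(1,2,4), of h m] that show ?thesis by metis
qed

lemma tr_typ:
  assumes "adj L K e" "adj K R e'" "m \<in> Ob" "n \<in> Ob" "arr f" "src f = FO L m" "tgt f = FO R n"
  shows "arr (tr L K R e e' m n f)" "src (tr L K R e e' m n f) = m" "tgt (tr L K R e e' m n f) = n"
proof -
  obtain h where "arr h" "src h = m" "tgt h = FO K (FO R n)" "tr L K R e e' m n f = e' n \<bullet> h"
    using tr_ex[OF assms] .
  then show "arr (tr L K R e e' m n f)" "src (tr L K R e e' m n f) = m" "tgt (tr L K R e e' m n f) = n"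
    using adj_typ[OF assms(2,4)] by auto
qed

lemma tr_natural_src:
  assumes "adj L K e" "adj K R e'" "n \<in> Ob" "arr f" "src f = FO L (tgt h)" "tgt f = FO R n" "arr h"
  shows "tr L K R e e' (src h) n (f \<bullet> FA L h) = tr L K R e e' (tgt h) n f \<bullet> h"
proof -
  have t [simp]: "tgt h \<in> Ob" "FO R n \<in> Ob" using assms adj_endo[OF assms(2)] by auto
  note [simp] = adj_endo[OF assms(1)] adj_endo[OF assms(2)] adj_typ[OF assms(1)] adj_typ[OF assms(2)]
  obtain g where g: "arr g" "src g = tgt h" "tgt g = FO K (FO R n)" "f = e (FO R n) \<bullet> FA L g" "tr L K R e e' (tgt h) n f = e' n \<bullet> g"
    using tr_ex[OF assms(1,2) t(1) assms(3-6)] .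
  have "f \<bullet> FA L h = e (FO R n) \<bullet> FA L (g \<bullet> h)"
    using g(1-3) assms(3,7) unfolding g(4) by (simp add: assoc endo_cmp)
  then have "tr L K R e e' (src h) n (f \<bullet> FA L h) = e' n \<bullet> g \<bullet> h"
    using tr_eq[OF assms(1,2,3), of "g \<bullet> h"] g(1-3) assms(7) by simp
  then show ?thesis
    using g assms(3,7) by (simp add: assoc)
qed

text \<open>With \<open>f\<close> written as the transpose of \<open>h\<close>, both traces become
  \<open>e' n\<close> after \<kappa> after \<open>h\<close>: \<alpha> is traded for \<kappa> in the
  first adjunction and \<rho> for the same \<kappa> in the second. The shared \<kappa> is what
  couples a change of \<open>L\<close> to a change of \<open>R\<close>.\<close>

lemma tr_mates:
  assumes a: "adj L K e" "adj K R e'" "adj L' K' d" "adj K' R' d'"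
    and m1: "mates L K e L' K' d \<alpha> \<kappa>" and m2: "mates K' R' d' K R e' \<kappa> \<rho>"
    and f: "m \<in> Ob" "n \<in> Ob" "arr f" "src f = FO L' m" "tgt f = FO R n"
  shows "tr L K R e e' m n (f \<bullet> \<alpha> m) = tr L' K' R' d d' m n (\<rho> n \<bullet> f)"
proof -
  note [simp] = adj_endo[OF a(1)] adj_endo[OF a(2)] adj_endo[OF a(3)] adj_endo[OF a(4)]
    adj_typ[OF a(1)] adj_typ[OF a(2)] adj_typ[OF a(3)] adj_typ[OF a(4)]
    natural_typ[OF mates_natural(1)[OF m1]] natural_typ[OF mates_natural(2)[OF m1]] natural_typ[OF mates_natural(2)[OF m2]]
  have Rn [simp]: "FO R n \<in> Ob" using f by simp
  from universal_ex[OF adj_universal[OF a(3) Rn] f(1,3,4,5)] obtain h where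
    h: "arr h" "src h = m" "tgt h = FO K' (FO R n)" "f = d (FO R n) \<bullet> FA L' h" by metis
  have "f \<bullet> \<alpha> m = d (FO R n) \<bullet> \<alpha> (FO K' (FO R n)) \<bullet> FA L h"
    using h(1-3) f(1) unfolding h(4) by (simp add: assoc natural_nat[OF mates_natural(1)[OF m1]])
  also have "\<dots> = e (FO R n) \<bullet> FA L (\<kappa> (FO R n) \<bullet> h)"
    using h(1-3) f(1) by (simp add: cmp_cong2[OF mates_eq[OF m1]] assoc endo_cmp)
  finally have 1: "tr L K R e e' m n (f \<bullet> \<alpha> m) = e' n \<bullet> \<kappa> (FO R n) \<bullet> h"
    using tr_eq[OF a(1,2) f(2), of "\<kappa> (FO R n) \<bullet> h" m] h(1-3) by simp
  have "\<rho> n \<bullet> f = d (FO R' n) \<bullet> FA L' (FA K' (\<rho> n)) \<bullet> FA L' h"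
    using h(1-3) f(2) unfolding h(4) by (simp add: cmp_cong2[OF adj_nat[OF a(3)]] assoc)
  also have "\<dots> = d (FO R' n) \<bullet> FA L' (FA K' (\<rho> n) \<bullet> h)"
    using h(1-3) f(2) by (simp add: endo_cmp)
  finally have 2: "tr L' K' R' d d' m n (\<rho> n \<bullet> f) = d' n \<bullet> FA K' (\<rho> n) \<bullet> h"
    using tr_eq[OF a(3,4) f(2), of "FA K' (\<rho> n) \<bullet> h" m] h(1-3) f(2) by simp
  show ?thesis
    unfolding 1 2 using h(1-3) f(2) by (simp add: cmp_cong2[OF mates_eq[OF m2]] assoc)
qed

text \<open>Transposition under the composite adjunction is done in two stages; naturality of
  \<open>d\<close> brings the counit \<open>e'\<close> of the first stage into the transpose of the
  second.\<close>

lemma tr_compF: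
  assumes a: "adj L K e" "adj K R e'" "adj L' K' d" "adj K' R' d'"
    and f: "m \<in> Ob" "n \<in> Ob" "arr f" "src f = FO L (FO L' m)" "tgt f = FO R (FO R' n)"
  shows "tr (compF L L') (compF K' K) (compF R R') (comp_counit L K e d) (comp_counit K' R' d' e') m n f
     = tr L' K' R' d d' m n (tr L K R e e' (FO L' m) (FO R' n) f)"
proof -
  note [simp] = adj_endo[OF a(1)] adj_endo[OF a(2)] adj_endo[OF a(3)] adj_endo[OF a(4)]
    adj_typ[OF a(1)] adj_typ[OF a(2)] adj_typ[OF a(3)] adj_typ[OF a(4)]
  note c = adj_compF[OF a(1,3)] adj_compF[OF a(4,2)]
  obtain h where h: "arr h" "src h = m" "tgt h = FO K' (FO K (FO R (FO R' n)))"
    "f = comp_counit L K e d (FO R (FO R' n)) \<bullet> FA L (FA L' h)"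
    "tr (compF L L') (compF K' K) (compF R R') (comp_counit L K e d) (comp_counit K' R' d' e') m n f
      = comp_counit K' R' d' e' n \<bullet> h"
    using tr_ex[OF c f(1,2,3)] f by auto
  let ?h = "d (FO K (FO R (FO R' n))) \<bullet> FA L' h"
  have "f = e (FO R (FO R' n)) \<bullet> FA L ?h"
    using h(1-3) f(2) unfolding h(4) by (simp add: comp_counit_def assoc endo_cmp)
  then have "tr L K R e e' (FO L' m) (FO R' n) f = e' (FO R' n) \<bullet> ?h"
    using tr_eq[OF a(1,2), of "FO R' n" ?h "FO L' m"] h(1-3) f by simp
  also have "\<dots> = d (FO R' n) \<bullet> FA L' (FA K' (e' (FO R' n)) \<bullet> h)"
    using h(1-3) f(2) by (simp add: cmp_cong2[OF adj_nat[OF a(3), symmetric]] assoc endo_cmp)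
  finally have "tr L' K' R' d d' m n (tr L K R e e' (FO L' m) (FO R' n) f) = d' n \<bullet> FA K' (e' (FO R' n)) \<bullet> h"
    using tr_eq[OF a(3,4), of n "FA K' (e' (FO R' n)) \<bullet> h" m] h(1-3) f(2) by simp
  then show ?thesis
    using h(1-3) f(2) unfolding h(5) by (simp add: comp_counit_def assoc)
qed

lemma tr_idF: "\<lbrakk>m \<in> Ob; n \<in> Ob; arr f; src f = m; tgt f = n\<rbrakk> \<Longrightarrow> tr idF idF idF one one m n f = f"
  using tr_eq[OF adj_idF adj_idF, of n f m] by simp

end

section \<open>Linear structure on typed arrows and pullback of functionals\<close>

context linear_category
begin

sublocale T: cat "Obj C" "tarr C" asrc atgt "tcmp C" "tone C"
  by unfold_locales
    (auto simp: tarr_def tcmp_def tone_def Id_Comp Comp_Id intro: Comp_Hom Comp_assoc Id_Hom intro!: arrow.expand)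

abbreviation tcmp' (infixr "\<bullet>" 70) where "tcmp' \<equiv> tcmp C"

lemma tarr_tadd [simp]: "\<lbrakk>tarr C f; tarr C g; asrc g = asrc f; atgt g = atgt f\<rbrakk> \<Longrightarrow> tarr C (tadd f g)"
  unfolding tarr_def using subspace_add[OF Hom_subspace] by simp

lemma tarr_tscl [simp]: "tarr C f \<Longrightarrow> tarr C (tscl C c f)"
  unfolding tarr_def using subspace_scale[OF Hom_subspace] by simp

lemma tcmp_tadd_right:
  "\<lbrakk>tarr C f; tarr C f'; tarr C g; asrc f' = asrc f; atgt f' = atgt f; asrc g = atgt f\<rbrakk>
    \<Longrightarrow> g \<bullet> tadd f f' = tadd (g \<bullet> f) (g \<bullet> f')"
  using Comp_add_right[of "asrc f" "atgt f" "atgt g" "raw f" "raw f'" "raw g"] by (simp add: tarr_def tcmp_def tadd_def del: T.src_Ob T.tgt_Ob)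

lemma tcmp_tadd_left:
  "\<lbrakk>tarr C f; tarr C g; tarr C g'; asrc g' = asrc g; atgt g' = atgt g; asrc g = atgt f\<rbrakk>
    \<Longrightarrow> tadd g g' \<bullet> f = tadd (g \<bullet> f) (g' \<bullet> f)"
  using Comp_add_left[of "asrc f" "atgt f" "atgt g" "raw f" "raw g" "raw g'"] by (simp add: tarr_def tcmp_def tadd_def del: T.src_Ob T.tgt_Ob)

lemma tcmp_tscl_right: "\<lbrakk>tarr C f; tarr C g; asrc g = atgt f\<rbrakk> \<Longrightarrow> g \<bullet> tscl C c f = tscl C c (g \<bullet> f)"
  using Comp_scl_right[of "asrc f" "atgt f" "atgt g" "raw f" "raw g"] by (simp add: tarr_def tcmp_def tscl_def del: T.src_Ob T.tgt_Ob)

lemma tcmp_tscl_left: "\<lbrakk>tarr C f; tarr C g; asrc g = atgt f\<rbrakk> \<Longrightarrow> tscl C c g \<bullet> f = tscl C c (g \<bullet> f)"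
  using Comp_scl_left[of "asrc f" "atgt f" "atgt g" "raw f" "raw g"] by (simp add: tarr_def tcmp_def tscl_def del: T.src_Ob T.tgt_Ob)

definition lin where
  "lin L \<longleftrightarrow> (\<forall>f g. tarr C f \<longrightarrow> tarr C g \<longrightarrow> asrc g = asrc f \<longrightarrow> atgt g = atgt f \<longrightarrow> FA L (tadd f g) = tadd (FA L f) (FA L g)) \<and>
     (\<forall>c f. tarr C f \<longrightarrow> FA L (tscl C c f) = tscl C c (FA L f))"

lemma lin_add: "\<lbrakk>lin L; tarr C f; tarr C g; asrc g = asrc f; atgt g = atgt f\<rbrakk> \<Longrightarrow> FA L (tadd f g) = tadd (FA L f) (FA L g)"
  unfolding lin_def by blast

lemma lin_scl: "\<lbrakk>lin L; tarr C f\<rbrakk> \<Longrightarrow> FA L (tscl C c f) = tscl C c (FA L f)"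
  unfolding lin_def by blast

lemma lin_idF [simp]: "lin idF"
  by (simp add: lin_def)

lemma lin_compF [simp]: "\<lbrakk>lin L; lin L'; T.endo L; T.endo L'\<rbrakk> \<Longrightarrow> lin (compF L L')"
  unfolding lin_def[of "compF L L'"] by (auto simp: lin_add lin_scl)

definition additive where
  "additive x y F \<longleftrightarrow> (\<forall>f g. tarr C f \<longrightarrow> asrc f = x \<longrightarrow> atgt f = y \<longrightarrow> tarr C g \<longrightarrow> asrc g = x \<longrightarrow> atgt g = y \<longrightarrow>
      F (tadd f g) = tadd (F f) (F g)) \<and>
     (\<forall>c f. tarr C f \<longrightarrow> asrc f = x \<longrightarrow> atgt f = y \<longrightarrow> F (tscl C c f) = tscl C c (F f))"

lemma sharp_add:
  assumes u: "T.universal L p e n" and e: "T.endo L" and l: "lin L" and m: "m \<in> Obj C"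
    and f: "tarr C f" "asrc f = FO L m" "atgt f = n" and g: "tarr C g" "asrc g = FO L m" "atgt g = n"
  shows "T.sharp L p e m (tadd f g) = tadd (T.sharp L p e m f) (T.sharp L p e m g)"
  by (rule T.sharp_eq[OF u e])
    (use T.sharp[OF u m f] T.sharp[OF u m g] T.universal_typ[OF u] e in
      \<open>simp_all add: lin_add[OF l] tcmp_tadd_right\<close>)

lemma sharp_scl:
  assumes u: "T.universal L p e n" and e: "T.endo L" and l: "lin L" and m: "m \<in> Obj C"
    and f: "tarr C f" "asrc f = FO L m" "atgt f = n"
  shows "T.sharp L p e m (tscl C c f) = tscl C c (T.sharp L p e m f)"
  by (rule T.sharp_eq[OF u e])
    (use T.sharp[OF u m f] T.universal_typ[OF u] e in \<open>simp_all add: lin_scl[OF l] tcmp_tscl_right\<close>)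

lemma additive_tr:
  assumes a: "T.adj L K e" "T.adj K R e'" and l: "lin L" and m: "m \<in> Obj C" "n \<in> Obj C"
  shows "additive (FO L m) (FO R n) (T.tr L K R e e' m n)"
proof -
  have Rn: "FO R n \<in> Obj C" using T.adj_endo[OF a(2)] m by simp
  note u = T.adj_universal[OF a(1) Rn] and en = T.adj_endo(1)[OF a(1)]
  show ?thesis
    unfolding additive_def T.tr_def
    using T.adj_typ[OF a(2) m(2)] T.sharp[OF u m(1)]
    by (simp add: sharp_add[OF u en l m(1)] sharp_scl[OF u en l m(1)] tcmp_tadd_right tcmp_tscl_right)
qed

text \<open>Precomposition of a functional with a map of hom-spaces. Elements of
  \<open>Hom_dual\<close> vanish outside their hom-space, whence the case distinction.\<close>

definition pull where
  "pull x y F \<xi> = (\<lambda>r. if r \<in> Hom C x y then \<xi> (raw (F (Arrow x r y))) else 0)"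

lemma pull_dual:
  assumes "\<xi> \<in> Hom_dual C x' y'" "additive x y F" "x \<in> Obj C" "y \<in> Obj C"
    and F: "\<And>f. \<lbrakk>tarr C f; asrc f = x; atgt f = y\<rbrakk> \<Longrightarrow> tarr C (F f) \<and> asrc (F f) = x' \<and> atgt (F f) = y'"
  shows "pull x y F \<xi> \<in> Hom_dual C x y"
proof -
  have *: "raw (F (Arrow x r y)) \<in> Hom C x' y'" if "r \<in> Hom C x y" for r
    using F[of "Arrow x r y"] that assms(3,4) by (auto simp: tarr_def simp del: T.src_Ob T.tgt_Ob)
  have l: "linear_on (scl C) (*) (Hom C x' y') \<xi>"
    using assms(1) by (simp add: Hom_dual_def)
  have "pull x y F \<xi> (r + s) = pull x y F \<xi> r + pull x y F \<xi> s" if "r \<in> Hom C x y" "s \<in> Hom C x y" for r s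
  proof -
    have "F (tadd (Arrow x r y) (Arrow x s y)) = tadd (F (Arrow x r y)) (F (Arrow x s y))"
      using assms(2-4) that unfolding additive_def by (simp add: tarr_def del: T.src_Ob T.tgt_Ob)
    moreover have "r + s \<in> Hom C x y"
      using that assms(3,4) Hom_subspace subspace_add by blast
    ultimately show ?thesis
      using that l * by (simp add: pull_def tadd_def linear_on_def)
  qed
  moreover have "pull x y F \<xi> (scl C c r) = c * pull x y F \<xi> r" if "r \<in> Hom C x y" for r c
  proof -
    have "F (tscl C c (Arrow x r y)) = tscl C c (F (Arrow x r y))"
      using assms(2-4) that unfolding additive_def by (simp add: tarr_def del: T.src_Ob T.tgt_Ob)
    moreover have "scl C c r \<in> Hom C x y"
      using that assms(3,4) Hom_subspace subspace_scale by blast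
    ultimately show ?thesis
      using that l * by (simp add: pull_def tscl_def linear_on_def)
  qed
  ultimately show ?thesis
    by (auto simp: Hom_dual_def linear_on_def pull_def)
qed

lemma pull_cong:
  assumes "\<And>f. \<lbrakk>tarr C f; asrc f = x; atgt f = y\<rbrakk> \<Longrightarrow> F f = G f" "x \<in> Obj C" "y \<in> Obj C"
  shows "pull x y F \<xi> = pull x y G \<xi>"
  using assms unfolding pull_def by (auto simp: tarr_def simp del: T.src_Ob T.tgt_Ob)

lemma pull_pull:
  assumes "\<And>f. \<lbrakk>tarr C f; asrc f = x; atgt f = y\<rbrakk> \<Longrightarrow> tarr C (F f) \<and> asrc (F f) = x' \<and> atgt (F f) = y'"
    and "x \<in> Obj C" "y \<in> Obj C"
  shows "pull x y F (pull x' y' G \<xi>) = pull x y (\<lambda>f. G (F f)) \<xi>"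
proof
  fix r
  show "pull x y F (pull x' y' G \<xi>) r = pull x y (\<lambda>f. G (F f)) \<xi> r"
  proof (cases "r \<in> Hom C x y")
    case True
    then have "tarr C (Arrow x r y)"
      using assms(2,3) by (simp add: tarr_def del: T.src_Ob T.tgt_Ob)
    then have *: "tarr C (F (Arrow x r y))" "asrc (F (Arrow x r y)) = x'" "atgt (F (Arrow x r y)) = y'"
      using assms(1)[of "Arrow x r y"] by simp_all
    then have "Arrow x' (raw (F (Arrow x r y))) y' = F (Arrow x r y)"
      using arrow.collapse[of "F (Arrow x r y)"] by simp
    moreover have "raw (F (Arrow x r y)) \<in> Hom C x' y'"
      using * unfolding tarr_def by simp
    ultimately show ?thesis
      using True by (simp add: pull_def)
  qed (simp add: pull_def)
qed

lemma pull_id: "\<xi> \<in> Hom_dual C x y \<Longrightarrow> pull x y (\<lambda>f. f) \<xi> = \<xi>"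
  by (auto simp: pull_def Hom_dual_def)

lemma pull_add:
  fixes \<xi> :: "_ \<Rightarrow> 'v::monoid_add"
  shows "pull x y F (\<xi> + \<xi>') = pull x y F \<xi> + pull x y F \<xi>'"
  by (rule ext) (simp add: pull_def)

lemma pull_scl: "pull x y F (dual_scl c \<xi>) = dual_scl c (pull x y F \<xi>)"
  by (auto simp: pull_def dual_scl_def)

lemma pull_post: "pull x n (\<lambda>g. h \<bullet> g) \<xi> = Hom_dual_right C x n (raw h) \<xi>"
  by (auto simp: pull_def Hom_dual_right_def)

lemma pull_pre: "pull x m (\<lambda>g. g \<bullet> h) \<xi> = Hom_dual_left C x m (raw h) \<xi>"
  by (auto simp: pull_def Hom_dual_left_def)

lemma additive_post: "\<lbrakk>tarr C h; asrc h = y\<rbrakk> \<Longrightarrow> additive x y (\<lambda>g. h \<bullet> g)"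
  unfolding additive_def by (auto simp: tcmp_tadd_right tcmp_tscl_right)

lemma additive_pre: "\<lbrakk>tarr C h; atgt h = x\<rbrakk> \<Longrightarrow> additive x y (\<lambda>g. g \<bullet> h)"
  unfolding additive_def by (auto simp: tcmp_tadd_left tcmp_tscl_left)

lemma pull_post_dual: "\<lbrakk>\<xi> \<in> Hom_dual C x y'; tarr C h; asrc h = y; atgt h = y'; x \<in> Obj C\<rbrakk> \<Longrightarrow> pull x y (\<lambda>g. h \<bullet> g) \<xi> \<in> Hom_dual C x y"
  by (rule pull_dual[OF _ additive_post]) auto

lemma pull_pre_dual: "\<lbrakk>\<xi> \<in> Hom_dual C x' y; tarr C h; asrc h = x'; atgt h = x; y \<in> Obj C\<rbrakk> \<Longrightarrow> pull x y (\<lambda>g. g \<bullet> h) \<xi> \<in> Hom_dual C x y"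
  by (rule pull_dual[OF _ additive_pre]) auto

lemma pull_tr_dual:
  assumes a: "T.adj L K e" "T.adj K R e'" and l: "lin L" and m: "m \<in> Obj C" "n \<in> Obj C" and "\<xi> \<in> Hom_dual C m n"
  shows "pull (FO L m) (FO R n) (T.tr L K R e e' m n) \<xi> \<in> Hom_dual C (FO L m) (FO R n)"
  by (rule pull_dual[OF assms(6) additive_tr[OF a l m]]) (use T.tr_typ[OF a m] T.adj_endo[OF a(1)] T.adj_endo[OF a(2)] m in auto)

end

text \<open>
  An arrow \<open>Hom(x, m)\<^sup>* \<otimes> m \<rightarrow> d\<close> is a linear map \<open>Hom(x, m)\<^sup>* \<rightarrow> Hom(m, d)\<close>, so the coend \<open>N x\<close> represents
  the natural transformations \<open>Hom(x, -)\<^sup>* \<rightarrow> Hom(-, d)\<close>; \<open>\<iota> x\<close> is the universal one.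
\<close>

locale nakayama_universal = linear_category C
  for C :: "('k::field, 'o, 'm::ab_group_add, 'z) lcat_scheme" (structure) +
  fixes N :: "('o, ('o, 'm) arrow, 'o, ('o, 'm) arrow) functor_data"
    and \<iota> :: "'o \<Rightarrow> 'o \<Rightarrow> ('m \<Rightarrow> 'k) \<Rightarrow> ('o, 'm) arrow"
  assumes endo_N [simp]: "T.endo N"
    and \<iota>_typ [simp]: "\<lbrakk>x \<in> Obj C; m \<in> Obj C; \<xi> \<in> Hom_dual C x m\<rbrakk> \<Longrightarrow> tarr C (\<iota> x m \<xi>)"
    and src_\<iota> [simp]: "asrc (\<iota> x m \<xi>) = m"
    and tgt_\<iota> [simp]: "atgt (\<iota> x m \<xi>) = FO N x"
    and \<iota>_add: "\<lbrakk>x \<in> Obj C; m \<in> Obj C; \<xi> \<in> Hom_dual C x m; \<xi>' \<in> Hom_dual C x m\<rbrakk>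
      \<Longrightarrow> \<iota> x m (\<xi> + \<xi>') = tadd (\<iota> x m \<xi>) (\<iota> x m \<xi>')"
    and \<iota>_scl: "\<lbrakk>x \<in> Obj C; m \<in> Obj C; \<xi> \<in> Hom_dual C x m\<rbrakk>
      \<Longrightarrow> \<iota> x m (dual_scl c \<xi>) = tscl C c (\<iota> x m \<xi>)"
    and \<iota>_natural: "\<lbrakk>x \<in> Obj C; tarr C h; asrc h = n; atgt h = m; \<xi> \<in> Hom_dual C x m\<rbrakk>
      \<Longrightarrow> tcmp C (\<iota> x m \<xi>) h = \<iota> x n (pull x n (\<lambda>g. tcmp C h g) \<xi>)"
    and N_\<iota>: "\<lbrakk>tarr C f; asrc f = x; atgt f = x'; m \<in> Obj C; \<xi> \<in> Hom_dual C x m\<rbrakk>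
      \<Longrightarrow> tcmp C (FA N f) (\<iota> x m \<xi>) = \<iota> x' m (pull x' m (\<lambda>g. tcmp C g f) \<xi>)"
    and \<iota>_epi: "\<lbrakk>x \<in> Obj C; tarr C u; tarr C v; asrc u = FO N x; asrc v = FO N x; atgt u = atgt v;
        \<And>m \<xi>. \<lbrakk>m \<in> Obj C; \<xi> \<in> Hom_dual C x m\<rbrakk> \<Longrightarrow> tcmp C u (\<iota> x m \<xi>) = tcmp C v (\<iota> x m \<xi>)\<rbrakk> \<Longrightarrow> u = v"
    and \<iota>_universal: "\<lbrakk>x \<in> Obj C; d \<in> Obj C;
        \<And>m \<xi>. \<lbrakk>m \<in> Obj C; \<xi> \<in> Hom_dual C x m\<rbrakk> \<Longrightarrow> tarr C (\<tau> m \<xi>) \<and> asrc (\<tau> m \<xi>) = m \<and> atgt (\<tau> m \<xi>) = d;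
        \<And>m \<xi> \<xi>'. \<lbrakk>m \<in> Obj C; \<xi> \<in> Hom_dual C x m; \<xi>' \<in> Hom_dual C x m\<rbrakk> \<Longrightarrow> \<tau> m (\<xi> + \<xi>') = tadd (\<tau> m \<xi>) (\<tau> m \<xi>');
        \<And>m \<xi> c. \<lbrakk>m \<in> Obj C; \<xi> \<in> Hom_dual C x m\<rbrakk> \<Longrightarrow> \<tau> m (dual_scl c \<xi>) = tscl C c (\<tau> m \<xi>);
        \<And>h \<xi>. \<lbrakk>tarr C h; \<xi> \<in> Hom_dual C x (atgt h)\<rbrakk> \<Longrightarrow>
           tcmp C (\<tau> (atgt h) \<xi>) h = \<tau> (asrc h) (pull x (asrc h) (\<lambda>g. tcmp C h g) \<xi>)\<rbrakk>
      \<Longrightarrow> \<exists>u. tarr C u \<and> asrc u = FO N x \<and> atgt u = d \<and> (\<forall>m \<in> Obj C. \<forall>\<xi> \<in> Hom_dual C x m. tcmp C u (\<iota> x m \<xi>) = \<tau> m \<xi>)"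
begin

definition dual_trace where
  "dual_trace L K R e e' m n = pull (FO L m) (FO R n) (T.tr L K R e e' m n)"

text \<open>The family \<open>R (\<iota> m n \<xi>)\<close> is jointly epic as soon as \<open>R\<close> has a right adjoint, so this determines \<open>\<phi>\<^sup>-\<^sup>1\<close>.\<close>

definition mate where
  "mate L K R e e' m \<phi> \<longleftrightarrow> T.iso \<phi> \<and> asrc \<phi> = FO N (FO L m) \<and> atgt \<phi> = FO R (FO N m) \<and>
     (\<forall>n \<in> Obj C. \<forall>\<xi> \<in> Hom_dual C m n. \<phi> \<bullet> \<iota> (FO L m) (FO R n) (dual_trace L K R e e' m n \<xi>) = FA R (\<iota> m n \<xi>))"

lemma mate_simps:
  assumes "mate L K R e e' m \<phi>"
  shows "T.iso \<phi>" "asrc \<phi> = FO N (FO L m)" "atgt \<phi> = FO R (FO N m)"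
    and "\<lbrakk>n \<in> Obj C; \<xi> \<in> Hom_dual C m n\<rbrakk> \<Longrightarrow> \<phi> \<bullet> \<iota> (FO L m) (FO R n) (dual_trace L K R e e' m n \<xi>) = FA R (\<iota> m n \<xi>)"
  using assms unfolding mate_def by blast+

lemma dual_trace_dual:
  assumes "T.adj L K e" "T.adj K R e'" "lin L" "m \<in> Obj C" "n \<in> Obj C" "\<xi> \<in> Hom_dual C m n"
  shows "dual_trace L K R e e' m n \<xi> \<in> Hom_dual C (FO L m) (FO R n)"
  unfolding dual_trace_def by (rule pull_tr_dual[OF assms])

text \<open>Under the adjunction of \<open>R\<close> and \<open>S\<close> the two arrows correspond
  to arrows out of \<open>N m\<close>, where \<open>\<iota>_epi\<close> applies.\<close>

lemma epi_R:
  assumes a: "T.adj R S e" and m: "m \<in> Obj C"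
    and u: "tarr C u" "tarr C v" "asrc u = FO R (FO N m)" "asrc v = FO R (FO N m)" "atgt u = atgt v"
    and eq: "\<And>n \<xi>. \<lbrakk>n \<in> Obj C; \<xi> \<in> Hom_dual C m n\<rbrakk> \<Longrightarrow> u \<bullet> FA R (\<iota> m n \<xi>) = v \<bullet> FA R (\<iota> m n \<xi>)"
  shows "u = v"
proof -
  note [simp] = T.adj_endo[OF a] m
  note U = T.adj_universal[OF a T.tgt_Ob[OF u(1)]]
  have Nm: "FO N m \<in> Obj C" by simp
  obtain p where p: "tarr C p" "asrc p = FO N m" "atgt p = FO S (atgt u)" "e (atgt u) \<bullet> FA R p = u"
    using T.universal_ex[OF U Nm u(1,3) refl] .
  obtain q where q: "tarr C q" "asrc q = FO N m" "atgt q = FO S (atgt u)" "e (atgt u) \<bullet> FA R q = v"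
    using T.universal_ex[OF U Nm u(2,4) u(5)[symmetric]] .
  have "p = q"
  proof (rule \<iota>_epi[OF m])
    fix n \<xi> assume n: "n \<in> Obj C" "\<xi> \<in> Hom_dual C m n"
    have "e (atgt u) \<bullet> FA R (p \<bullet> \<iota> m n \<xi>) = u \<bullet> FA R (\<iota> m n \<xi>)"
      using p(1-3) n T.adj_typ[OF a T.tgt_Ob[OF u(1)]] by (subst p(4)[symmetric]) (simp add: T.assoc T.endo_cmp)
    moreover have "e (atgt u) \<bullet> FA R (q \<bullet> \<iota> m n \<xi>) = v \<bullet> FA R (\<iota> m n \<xi>)"
      using q(1-3) n T.adj_typ[OF a T.tgt_Ob[OF u(1)]] by (subst q(4)[symmetric]) (simp add: T.assoc T.endo_cmp)
    ultimately have "e (atgt u) \<bullet> FA R (p \<bullet> \<iota> m n \<xi>) = e (atgt u) \<bullet> FA R (q \<bullet> \<iota> m n \<xi>)"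
      using eq[OF n] by simp
    then show "p \<bullet> \<iota> m n \<xi> = q \<bullet> \<iota> m n \<xi>"
      by (rule T.universal_unique[OF U T.adj_endo(1)[OF a]]) (use p(1-3) q(1-3) n in auto)
  qed (use p q in auto)
  then show ?thesis using p(4) q(4) by simp
qed

text \<open>The arrow \<phi> comes from the universal property of \<open>N (L m)\<close>; its
  inverse comes from that of \<open>N m\<close> by transposition. Each adjunction enters once in the
  constructions of the families: the first in \<open>P\<close>, the second in \<tau> and the third
  in \<sigma>.\<close>

theorem mate_exists:
  assumes a: "T.adj L K e" "T.adj K R e'" "T.adj R S e''" and l: "lin L" "lin K" "lin R" and m: "m \<in> Obj C"
  shows "\<exists>\<phi>. mate L K R e e' m \<phi>"
proof -
  note en [simp] = T.adj_endo[OF a(1)] T.adj_endo[OF a(2)] T.adj_endo[OF a(3)]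
  note [simp] = T.adj_typ[OF a(1)] T.adj_typ[OF a(2)] T.adj_typ[OF a(3)] m
  \<comment> \<open>The dual of the bijection from \<open>Hom(m, K n)\<close> to
    \<open>Hom(L m, n)\<close>.\<close>
  define P :: "'o \<Rightarrow> ('m \<Rightarrow> 'k) \<Rightarrow> 'm \<Rightarrow> 'k" where "P n = pull m (FO K n) (\<lambda>g. e n \<bullet> FA L g)" for n
  \<comment> \<open>Through \<open>P\<close>, a functional on \<open>Hom(L m, n)\<close> gives an
    arrow from \<open>K n\<close> to \<open>N m\<close>, and by transposition one from
    \<open>n\<close> to \<open>R (N m)\<close>.\<close>
  define \<tau> where "\<tau> n \<xi> = T.sharp K (FO R (FO N m)) (e' (FO N m)) n (\<iota> m (FO K n) (P n \<xi>))" for n \<xi>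
  have P_dual [simp]: "P n \<xi> \<in> Hom_dual C m (FO K n)" if "n \<in> Obj C" "\<xi> \<in> Hom_dual C (FO L m) n" for n \<xi>
    unfolding P_def using that
    by (intro pull_dual[OF that(2)])
      (auto simp: additive_def lin_add[OF l(1)] lin_scl[OF l(1)] tcmp_tadd_right tcmp_tscl_right)
  have U': "T.universal K (FO R (FO N m)) (e' (FO N m)) (FO N m)"
    using T.adj_universal[OF a(2), of "FO N m"] by simp
  have \<tau>: "tarr C (\<tau> n \<xi>)" "asrc (\<tau> n \<xi>) = n" "atgt (\<tau> n \<xi>) = FO R (FO N m)"
     "e' (FO N m) \<bullet> FA K (\<tau> n \<xi>) = \<iota> m (FO K n) (P n \<xi>)"
    if "n \<in> Obj C" "\<xi> \<in> Hom_dual C (FO L m) n" for n \<xi>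
    using T.sharp[OF U', of n "\<iota> m (FO K n) (P n \<xi>)"] that unfolding \<tau>_def by auto
  have "\<exists>\<phi>. tarr C \<phi> \<and> asrc \<phi> = FO N (FO L m) \<and> atgt \<phi> = FO R (FO N m) \<and>
     (\<forall>n \<in> Obj C. \<forall>\<xi> \<in> Hom_dual C (FO L m) n. \<phi> \<bullet> \<iota> (FO L m) n \<xi> = \<tau> n \<xi>)"
  proof (rule \<iota>_universal)
    fix n \<xi> \<xi>' assume n: "n \<in> Obj C" "\<xi> \<in> Hom_dual C (FO L m) n" "\<xi>' \<in> Hom_dual C (FO L m) n"
    show "\<tau> n (\<xi> + \<xi>') = tadd (\<tau> n \<xi>) (\<tau> n \<xi>')"
      using n unfolding \<tau>_def P_def pull_add by (simp add: \<iota>_add sharp_add[OF U' en(2) l(2)] flip: P_def)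
  next
    fix n \<xi> c assume n: "n \<in> Obj C" "\<xi> \<in> Hom_dual C (FO L m) n"
    show "\<tau> n (dual_scl c \<xi>) = tscl C c (\<tau> n \<xi>)"
      using n unfolding \<tau>_def P_def pull_scl by (simp add: \<iota>_scl sharp_scl[OF U' en(2) l(2)] flip: P_def)
  next
    fix h \<xi> assume h: "tarr C h" "\<xi> \<in> Hom_dual C (FO L m) (atgt h)"
    let ?\<xi> = "pull (FO L m) (asrc h) (\<lambda>g. h \<bullet> g) \<xi>"
    have "P (asrc h) ?\<xi> = pull m (FO K (asrc h)) (\<lambda>g. h \<bullet> e (asrc h) \<bullet> FA L g) \<xi>"
      unfolding P_def using h by (subst pull_pull) auto
    also have "\<dots> = pull m (FO K (asrc h)) (\<lambda>g. e (atgt h) \<bullet> FA L (FA K h \<bullet> g)) \<xi>"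
      using h by (intro pull_cong) (auto simp: T.endo_cmp T.cmp_cong2[OF T.adj_nat[OF a(1)]] T.assoc)
    also have "\<dots> = pull m (FO K (asrc h)) (\<lambda>g. FA K h \<bullet> g) (P (atgt h) \<xi>)"
      unfolding P_def using h by (subst pull_pull) auto
    finally have "\<iota> m (FO K (asrc h)) (P (asrc h) ?\<xi>) = \<iota> m (FO K (atgt h)) (P (atgt h) \<xi>) \<bullet> FA K h"
      using h by (subst \<iota>_natural) auto
    also have "\<dots> = e' (FO N m) \<bullet> FA K (\<tau> (atgt h) \<xi> \<bullet> h)"
      using h \<tau>(1-3)[of "atgt h" \<xi>] by (subst \<tau>(4)[symmetric]) (auto simp: T.assoc T.endo_cmp)
    finally show "\<tau> (atgt h) \<xi> \<bullet> h = \<tau> (asrc h) ?\<xi>"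
      unfolding \<tau>_def[of "asrc h"]
      by (intro T.sharp_eq[OF U', symmetric]) (use h \<tau>(1-3)[of "atgt h" \<xi>] in auto)
  qed (use \<tau> in auto)
  then obtain \<phi> where \<phi>: "tarr C \<phi>" "asrc \<phi> = FO N (FO L m)" "atgt \<phi> = FO R (FO N m)"
    "\<And>n \<xi>. \<lbrakk>n \<in> Obj C; \<xi> \<in> Hom_dual C (FO L m) n\<rbrakk> \<Longrightarrow> \<phi> \<bullet> \<iota> (FO L m) n \<xi> = \<tau> n \<xi>"
    by blast
  let ?T = "dual_trace L K R e e' m"
  note dual_trace_in [simp] = dual_trace_dual[OF a(1,2) l(1) m]
  \<comment> \<open>On a functional pulled back along the trace, the bijection in \<open>P\<close>
    cancels the transposition inside the trace, and the counit \<open>e'\<close> remains. By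
    naturality of \<open>e'\<close> the transpose is then \<open>R\<close> applied to the universal
    arrow.\<close>
  have char: "\<phi> \<bullet> \<iota> (FO L m) (FO R n) (?T n \<xi>) = FA R (\<iota> m n \<xi>)" if n: "n \<in> Obj C" "\<xi> \<in> Hom_dual C m n" for n \<xi>
  proof -
    have "P (FO R n) (?T n \<xi>) = pull m (FO K (FO R n)) (\<lambda>g. T.tr L K R e e' m n (e (FO R n) \<bullet> FA L g)) \<xi>"
      unfolding P_def dual_trace_def using n by (subst pull_pull) auto
    also have "\<dots> = pull m (FO K (FO R n)) (\<lambda>g. e' n \<bullet> g) \<xi>"
      using n by (intro pull_cong T.tr_eq[OF a(1,2)]) auto
    finally have "\<iota> m (FO K (FO R n)) (P (FO R n) (?T n \<xi>)) = \<iota> m n \<xi> \<bullet> e' n"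
      using n by (subst \<iota>_natural) auto
    also have "\<dots> = e' (FO N m) \<bullet> FA K (FA R (\<iota> m n \<xi>))"
      using n by (intro T.adj_nat[OF a(2), symmetric]) auto
    finally have "\<tau> (FO R n) (?T n \<xi>) = FA R (\<iota> m n \<xi>)"
      unfolding \<tau>_def by (intro T.sharp_eq[OF U']) (use n in auto)
    then show ?thesis
      using n by (simp add: \<phi>(4))
  qed
  \<comment> \<open>The inverse is an arrow out of \<open>R (N m)\<close>, that is, the transpose of
    an arrow out of \<open>N m\<close>; this is the family describing the latter.\<close>
  define \<sigma> where "\<sigma> n \<xi> = T.sharp R (FO S (FO N (FO L m))) (e'' (FO N (FO L m))) n (\<iota> (FO L m) (FO R n) (?T n \<xi>))" for n \<xi>
  have U'': "T.universal R (FO S (FO N (FO L m))) (e'' (FO N (FO L m))) (FO N (FO L m))"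
    using T.adj_universal[OF a(3), of "FO N (FO L m)"] by simp
  have \<sigma>: "tarr C (\<sigma> n \<xi>)" "asrc (\<sigma> n \<xi>) = n" "atgt (\<sigma> n \<xi>) = FO S (FO N (FO L m))"
     "e'' (FO N (FO L m)) \<bullet> FA R (\<sigma> n \<xi>) = \<iota> (FO L m) (FO R n) (?T n \<xi>)"
    if "n \<in> Obj C" "\<xi> \<in> Hom_dual C m n" for n \<xi>
    using T.sharp[OF U'', of n "\<iota> (FO L m) (FO R n) (?T n \<xi>)"] that unfolding \<sigma>_def by auto
  have "\<exists>\<theta>. tarr C \<theta> \<and> asrc \<theta> = FO N m \<and> atgt \<theta> = FO S (FO N (FO L m)) \<and>
     (\<forall>n \<in> Obj C. \<forall>\<xi> \<in> Hom_dual C m n. \<theta> \<bullet> \<iota> m n \<xi> = \<sigma> n \<xi>)"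
  proof (rule \<iota>_universal)
    fix n \<xi> \<xi>' assume n: "n \<in> Obj C" "\<xi> \<in> Hom_dual C m n" "\<xi>' \<in> Hom_dual C m n"
    show "\<sigma> n (\<xi> + \<xi>') = tadd (\<sigma> n \<xi>) (\<sigma> n \<xi>')"
      using n unfolding \<sigma>_def dual_trace_def pull_add by (simp add: \<iota>_add sharp_add[OF U'' en(5) l(3)] flip: dual_trace_def)
  next
    fix n \<xi> c assume n: "n \<in> Obj C" "\<xi> \<in> Hom_dual C m n"
    show "\<sigma> n (dual_scl c \<xi>) = tscl C c (\<sigma> n \<xi>)"
      using n unfolding \<sigma>_def dual_trace_def pull_scl by (simp add: \<iota>_scl sharp_scl[OF U'' en(5) l(3)] flip: dual_trace_def)
  next
    fix h \<xi> assume h: "tarr C h" "\<xi> \<in> Hom_dual C m (atgt h)"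
    let ?\<xi> = "pull m (asrc h) (\<lambda>g. h \<bullet> g) \<xi>"
    have "?T (asrc h) ?\<xi> = pull (FO L m) (FO R (asrc h)) (\<lambda>g. h \<bullet> T.tr L K R e e' m (asrc h) g) \<xi>"
      unfolding dual_trace_def using h T.tr_typ[OF a(1,2) m] by (subst pull_pull) auto
    \<comment> \<open>Naturality of the partial trace in its target: \<open>h\<close> outside the
      trace becomes \<open>R h\<close> inside.\<close>
    also have "\<dots> = pull (FO L m) (FO R (asrc h)) (\<lambda>g. T.tr L K R e e' m (atgt h) (FA R h \<bullet> g)) \<xi>"
    proof (rule pull_cong)
      fix f assume f: "tarr C f" "asrc f = FO L m" "atgt f = FO R (asrc h)"
      obtain g where g: "tarr C g" "asrc g = m" "atgt g = FO K (FO R (asrc h))" "f = e (FO R (asrc h)) \<bullet> FA L g"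
        "T.tr L K R e e' m (asrc h) f = e' (asrc h) \<bullet> g"
        using T.tr_ex[OF a(1,2) m T.src_Ob[OF h(1)] f] .
      have "FA R h \<bullet> f = e (FO R (atgt h)) \<bullet> FA L (FA K (FA R h) \<bullet> g)"
        using g(1-3) h unfolding g(4)
        by (simp add: T.endo_cmp T.cmp_cong2[OF T.adj_nat[OF a(1)]] T.assoc)
      then have "T.tr L K R e e' m (atgt h) (FA R h \<bullet> f) = e' (atgt h) \<bullet> FA K (FA R h) \<bullet> g"
        using T.tr_eq[OF a(1,2) T.tgt_Ob[OF h(1)], of "FA K (FA R h) \<bullet> g" m] g(1-3) h by simp
      also have "\<dots> = h \<bullet> e' (asrc h) \<bullet> g"
        using g(1-3) h by (simp add: T.cmp_cong2[OF T.adj_nat[OF a(2)]] T.assoc)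
      finally show "h \<bullet> T.tr L K R e e' m (asrc h) f = T.tr L K R e e' m (atgt h) (FA R h \<bullet> f)"
        using g(5) by simp
    qed (use h in auto)
    also have "\<dots> = pull (FO L m) (FO R (asrc h)) (\<lambda>g. FA R h \<bullet> g) (?T (atgt h) \<xi>)"
      unfolding dual_trace_def using h by (subst pull_pull) auto
    finally have "\<iota> (FO L m) (FO R (asrc h)) (?T (asrc h) ?\<xi>) = \<iota> (FO L m) (FO R (atgt h)) (?T (atgt h) \<xi>) \<bullet> FA R h"
      using h by (subst \<iota>_natural) auto
    also have "\<dots> = e'' (FO N (FO L m)) \<bullet> FA R (\<sigma> (atgt h) \<xi> \<bullet> h)"
      using h \<sigma>(1-3)[of "atgt h" \<xi>] by (subst \<sigma>(4)[symmetric]) (auto simp: T.assoc T.endo_cmp)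
    finally show "\<sigma> (atgt h) \<xi> \<bullet> h = \<sigma> (asrc h) ?\<xi>"
      unfolding \<sigma>_def[of "asrc h"]
      by (intro T.sharp_eq[OF U'', symmetric]) (use h \<sigma>(1-3)[of "atgt h" \<xi>] in auto)
  qed (use \<sigma> in auto)
  then obtain t where t: "tarr C t" "asrc t = FO N m" "atgt t = FO S (FO N (FO L m))"
    "\<And>n \<xi>. \<lbrakk>n \<in> Obj C; \<xi> \<in> Hom_dual C m n\<rbrakk> \<Longrightarrow> t \<bullet> \<iota> m n \<xi> = \<sigma> n \<xi>"
    by blast
  define \<theta> where "\<theta> = e'' (FO N (FO L m)) \<bullet> FA R t"
  have \<theta> [simp]: "tarr C \<theta>" "asrc \<theta> = FO R (FO N m)" "atgt \<theta> = FO N (FO L m)"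
    using t(1-3) unfolding \<theta>_def by auto
  have \<theta>R: "\<theta> \<bullet> FA R (\<iota> m n \<xi>) = \<iota> (FO L m) (FO R n) (?T n \<xi>)" if n: "n \<in> Obj C" "\<xi> \<in> Hom_dual C m n" for n \<xi>
    using n t(1-3) \<sigma>[OF n] t(4)[OF n] unfolding \<theta>_def by (simp add: T.assoc T.endo_cmp[symmetric])
  have 1: "\<phi> \<bullet> \<theta> = tone C (FO R (FO N m))"
    by (rule epi_R[OF a(3) m]) (use \<phi>(1-3) char \<theta>R in \<open>auto simp: T.assoc\<close>)
  have 2: "\<theta> \<bullet> \<phi> = tone C (FO N (FO L m))"
  proof (rule \<iota>_epi)
    fix n \<xi> assume n: "n \<in> Obj C" "\<xi> \<in> Hom_dual C (FO L m) n"
    \<comment> \<open>The unit of the adjunction of \<open>K\<close> and \<open>R\<close> at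
      \<open>n\<close>. It expresses \<tau> through the arrows
      \<open>FA R (\<iota> m (FO K n) _)\<close>, on which \<theta> is known, and its triangle
      identity then cancels the trace.\<close>
    define \<eta> where "\<eta> = T.sharp K (FO R (FO K n)) (e' (FO K n)) n (tone C (FO K n))"
    have \<eta>: "tarr C \<eta>" "asrc \<eta> = n" "atgt \<eta> = FO R (FO K n)" "e' (FO K n) \<bullet> FA K \<eta> = tone C (FO K n)"
      using T.sharp[OF T.adj_universal[OF a(2), of "FO K n"], of n "tone C (FO K n)"] n unfolding \<eta>_def by auto
    have "\<tau> n \<xi> = FA R (\<iota> m (FO K n) (P n \<xi>)) \<bullet> \<eta>"
      unfolding \<tau>_def
      by (rule T.sharp_eq[OF U'])
        (use n \<eta> in \<open>auto simp: T.endo_cmp T.cmp_cong2[OF T.adj_nat[OF a(2)]] T.assoc\<close>)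
    then have "(\<theta> \<bullet> \<phi>) \<bullet> \<iota> (FO L m) n \<xi> = \<theta> \<bullet> FA R (\<iota> m (FO K n) (P n \<xi>)) \<bullet> \<eta>"
      using n \<phi> by (simp add: T.assoc)
    also have "\<dots> = \<iota> (FO L m) (FO R (FO K n)) (?T (FO K n) (P n \<xi>)) \<bullet> \<eta>"
      using n \<eta>(1-3) by (simp add: T.cmp_cong2[OF \<theta>R])
    also have "\<dots> = \<iota> (FO L m) n (pull (FO L m) n (\<lambda>f. \<eta> \<bullet> f) (?T (FO K n) (P n \<xi>)))"
      using n \<eta>(1-3) by (intro \<iota>_natural) auto
    also have "pull (FO L m) n (\<lambda>f. \<eta> \<bullet> f) (?T (FO K n) (P n \<xi>))
       = pull (FO L m) n (\<lambda>f. e n \<bullet> FA L (T.tr L K R e e' m (FO K n) (\<eta> \<bullet> f))) \<xi>"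
      unfolding dual_trace_def P_def using n \<eta>(1-3) T.tr_typ[OF a(1,2) m]
      by (subst pull_pull, auto) (subst pull_pull, auto)
    also have "\<dots> = pull (FO L m) n (\<lambda>f. f) \<xi>"
    proof (rule pull_cong)
      fix f assume f: "tarr C f" "asrc f = FO L m" "atgt f = n"
      obtain g where g: "tarr C g" "asrc g = m" "atgt g = FO K n" "e n \<bullet> FA L g = f"
        using T.universal_ex[OF T.adj_universal[OF a(1) n(1)] m f] .
      have "\<eta> \<bullet> f = e (FO R (FO K n)) \<bullet> FA L (FA K \<eta> \<bullet> g)"
        using g(1-3) n \<eta>(1-3) by (simp add: g(4)[symmetric] T.endo_cmp T.cmp_cong2[OF T.adj_nat[OF a(1)]] T.assoc)
      then have "T.tr L K R e e' m (FO K n) (\<eta> \<bullet> f) = e' (FO K n) \<bullet> FA K \<eta> \<bullet> g"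
        using T.tr_eq[OF a(1,2), of "FO K n" "FA K \<eta> \<bullet> g" m] g(1-3) n \<eta>(1-3) by simp
      also have "\<dots> = g"
        using g(1-3) n \<eta>(1-3) by (simp add: T.cmp_cong2[OF \<eta>(4)])
      finally show "e n \<bullet> FA L (T.tr L K R e e' m (FO K n) (\<eta> \<bullet> f)) = f"
        using g(4) by simp
    qed (use n in auto)
    also have "\<dots> = \<xi>"
      using n by (simp add: pull_id)
    finally show "(\<theta> \<bullet> \<phi>) \<bullet> \<iota> (FO L m) n \<xi> = tone C (FO N (FO L m)) \<bullet> \<iota> (FO L m) n \<xi>"
      using n by simp
  qed (use \<phi>(1-3) in auto)
  have "T.iso \<phi>"
    by (rule T.isoI[of \<phi> \<theta>]) (use \<phi>(1-3) 1 2 in auto)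
  then have "mate L K R e e' m \<phi>"
    unfolding mate_def using \<phi>(2,3) char by blast
  then show ?thesis ..
qed

end

section \<open>Comparison of the isomorphisms belonging to different chains\<close>

context nakayama_universal
begin

text \<open>The invertible \<phi> carries the family to the images under \<open>R\<close>, which are
  jointly epic by \<open>epi_R\<close>. The comparisons below are tested on this family, and it
  shows that a mate is unique.\<close>

lemma mate_epi:
  assumes mt: "mate L K R e e' m \<phi>"
    and a: "T.adj L K e" "T.adj K R e'" "T.adj R S e''" and l: "lin L" and m: "m \<in> Obj C"
    and u: "tarr C u" "tarr C v" "asrc u = FO N (FO L m)" "asrc v = FO N (FO L m)" "atgt u = atgt v"
    and eq: "\<And>n \<xi>. \<lbrakk>n \<in> Obj C; \<xi> \<in> Hom_dual C m n\<rbrakk> \<Longrightarrow>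
      u \<bullet> \<iota> (FO L m) (FO R n) (dual_trace L K R e e' m n \<xi>) = v \<bullet> \<iota> (FO L m) (FO R n) (dual_trace L K R e e' m n \<xi>)"
  shows "u = v"
proof -
  note [simp] = T.adj_endo[OF a(1)] T.adj_endo[OF a(3)] m mate_simps(1-3)[OF mt] dual_trace_dual[OF a(1,2) l m]
  have "u \<bullet> T.iv \<phi> = v \<bullet> T.iv \<phi>"
  proof (rule epi_R[OF a(3) m])
    fix n \<xi> assume n: "n \<in> Obj C" "\<xi> \<in> Hom_dual C m n"
    have "T.iv \<phi> \<bullet> FA R (\<iota> m n \<xi>) = \<iota> (FO L m) (FO R n) (dual_trace L K R e e' m n \<xi>)"
      using n by (simp add: mate_simps(4)[OF mt n, symmetric])
    then show "(u \<bullet> T.iv \<phi>) \<bullet> FA R (\<iota> m n \<xi>) = (v \<bullet> T.iv \<phi>) \<bullet> FA R (\<iota> m n \<xi>)"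
      using n u eq[OF n] by (simp add: T.assoc)
  qed (use u in auto)
  then show ?thesis
    by (rule T.cancel_right) (use u in auto)
qed

text \<open>On the test family, \<open>N_\<iota>\<close> turns \<open>N\<close> of \<alpha> into
  precomposition of functionals with \<alpha>; \<open>tr_mates\<close> exchanges this for
  postcomposition with \<rho>, which \<open>\<iota>_natural\<close> takes out of the functional
  again.\<close>

theorem mate_compare:
  assumes mt: "mate L K R e e' m \<phi>" "mate L' K' R' d d' m \<psi>"
    and a: "T.adj L K e" "T.adj K R e'" "T.adj R S e''" "T.adj L' K' d" "T.adj K' R' d'" and l: "lin L" "lin L'"
    and m1: "T.mates L K e L' K' d \<alpha> \<kappa>" and m2: "T.mates K' R' d' K R e' \<kappa> \<rho>" and m: "m \<in> Obj C"
  shows "\<rho> (FO N m) \<bullet> \<phi> = \<psi> \<bullet> FA N (\<alpha> m)"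
proof (rule mate_epi[OF mt(1) a(1-3) l(1) m])
  note [simp] = T.adj_endo[OF a(1)] T.adj_endo[OF a(2)] T.adj_endo[OF a(4)] T.adj_endo[OF a(5)] m
    mate_simps(1-3)[OF mt(1)] mate_simps(1-3)[OF mt(2)] dual_trace_dual[OF a(1,2) l(1) m] dual_trace_dual[OF a(4,5) l(2) m]
    T.natural_typ[OF T.mates_natural(1)[OF m1]] T.natural_typ[OF T.mates_natural(2)[OF m2]]
  show "tarr C (\<rho> (FO N m) \<bullet> \<phi>)" "tarr C (\<psi> \<bullet> FA N (\<alpha> m))" "asrc (\<rho> (FO N m) \<bullet> \<phi>) = FO N (FO L m)"
    "asrc (\<psi> \<bullet> FA N (\<alpha> m)) = FO N (FO L m)" "atgt (\<rho> (FO N m) \<bullet> \<phi>) = atgt (\<psi> \<bullet> FA N (\<alpha> m))"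
    by simp_all
  fix n \<xi> assume n: "n \<in> Obj C" "\<xi> \<in> Hom_dual C m n"
  let ?T = "dual_trace L K R e e' m n \<xi>" and ?T' = "dual_trace L' K' R' d d' m n \<xi>"
  note t1 = T.tr_typ[OF a(1,2) m n(1)] and t2 = T.tr_typ[OF a(4,5) m n(1)]
  have "pull (FO L' m) (FO R n) (\<lambda>g. g \<bullet> \<alpha> m) ?T = pull (FO L' m) (FO R n) (\<lambda>g. T.tr L K R e e' m n (g \<bullet> \<alpha> m)) \<xi>"
    unfolding dual_trace_def using n by (intro pull_pull) auto
  also have "\<dots> = pull (FO L' m) (FO R n) (\<lambda>g. T.tr L' K' R' d d' m n (\<rho> n \<bullet> g)) \<xi>"
    using n by (intro pull_cong T.tr_mates[OF a(1,2,4,5) m1 m2]) auto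
  also have "\<dots> = pull (FO L' m) (FO R n) (\<lambda>g. \<rho> n \<bullet> g) ?T'"
    unfolding dual_trace_def using n by (intro pull_pull[symmetric]) auto
  finally have eq: "pull (FO L' m) (FO R n) (\<lambda>g. g \<bullet> \<alpha> m) ?T = pull (FO L' m) (FO R n) (\<lambda>g. \<rho> n \<bullet> g) ?T'" .
  have "(\<psi> \<bullet> FA N (\<alpha> m)) \<bullet> \<iota> (FO L m) (FO R n) ?T = \<psi> \<bullet> \<iota> (FO L' m) (FO R n) (pull (FO L' m) (FO R n) (\<lambda>g. g \<bullet> \<alpha> m) ?T)"
    using n by (simp add: T.assoc N_\<iota>)
  also have "\<dots> = \<psi> \<bullet> \<iota> (FO L' m) (FO R' n) ?T' \<bullet> \<rho> n"
    unfolding eq using n by (subst \<iota>_natural[where m="FO R' n"]) auto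
  also have "\<dots> = FA R' (\<iota> m n \<xi>) \<bullet> \<rho> n"
    using n by (simp add: T.cmp_cong2[OF mate_simps(4)[OF mt(2) n]])
  also have "\<dots> = \<rho> (FO N m) \<bullet> FA R (\<iota> m n \<xi>)"
    using n by (intro T.natural_nat[OF T.mates_natural(2)[OF m2], symmetric]) auto
  also have "\<dots> = (\<rho> (FO N m) \<bullet> \<phi>) \<bullet> \<iota> (FO L m) (FO R n) ?T"
    using n by (simp add: T.assoc mate_simps(4)[OF mt(1) n])
  finally show "(\<rho> (FO N m) \<bullet> \<phi>) \<bullet> \<iota> (FO L m) (FO R n) ?T = (\<psi> \<bullet> FA N (\<alpha> m)) \<bullet> \<iota> (FO L m) (FO R n) ?T" ..
qed

text \<open>By \<open>tr_natural_src\<close> a functional may be precomposed with \<open>h\<close>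
  before or after tracing, and \<open>N_\<iota>\<close> translates both precompositions into values
  of \<open>N\<close>.\<close>

theorem mate_natural:
  assumes mt: "mate L K R e e' m \<phi>" "mate L K R e e' m' \<phi>'"
    and a: "T.adj L K e" "T.adj K R e'" "T.adj R S e''" and l: "lin L"
    and h: "tarr C h" "asrc h = m" "atgt h = m'"
  shows "\<phi>' \<bullet> FA N (FA L h) = FA R (FA N h) \<bullet> \<phi>"
proof (rule mate_epi[OF mt(1) a l])
  have m: "m \<in> Obj C" "m' \<in> Obj C" using h by auto
  note [simp] = T.adj_endo[OF a(1)] T.adj_endo[OF a(2)] T.adj_endo[OF a(3)] m h
    mate_simps(1-3)[OF mt(1)] mate_simps(1-3)[OF mt(2)] dual_trace_dual[OF a(1,2) l m(1)] dual_trace_dual[OF a(1,2) l m(2)]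
  show "m \<in> Obj C" "tarr C (\<phi>' \<bullet> FA N (FA L h))" "tarr C (FA R (FA N h) \<bullet> \<phi>)"
    "asrc (\<phi>' \<bullet> FA N (FA L h)) = FO N (FO L m)" "asrc (FA R (FA N h) \<bullet> \<phi>) = FO N (FO L m)"
    "atgt (\<phi>' \<bullet> FA N (FA L h)) = atgt (FA R (FA N h) \<bullet> \<phi>)"
    by simp_all
  fix n \<xi> assume n: "n \<in> Obj C" "\<xi> \<in> Hom_dual C m n"
  note t = T.tr_typ[OF a(1,2) m(1) n(1)] T.tr_typ[OF a(1,2) m(2) n(1)]
  let ?T = "dual_trace L K R e e' m n \<xi>"
  let ?\<xi> = "pull m' n (\<lambda>g. g \<bullet> h) \<xi>"
  have d: "?\<xi> \<in> Hom_dual C m' n"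
    using n by (intro pull_pre_dual) auto
  have "pull (FO L m') (FO R n) (\<lambda>g. g \<bullet> FA L h) ?T = pull (FO L m') (FO R n) (\<lambda>g. T.tr L K R e e' m n (g \<bullet> FA L h)) \<xi>"
    unfolding dual_trace_def using n by (intro pull_pull) auto
  also have "\<dots> = pull (FO L m') (FO R n) (\<lambda>g. T.tr L K R e e' m' n g \<bullet> h) \<xi>"
    using n T.tr_natural_src[OF a(1,2) n(1), of _ h] by (intro pull_cong) auto
  also have "\<dots> = dual_trace L K R e e' m' n ?\<xi>"
    unfolding dual_trace_def using n t by (intro pull_pull[symmetric]) auto
  finally have eq: "pull (FO L m') (FO R n) (\<lambda>g. g \<bullet> FA L h) ?T = dual_trace L K R e e' m' n ?\<xi>" .
  have "(\<phi>' \<bullet> FA N (FA L h)) \<bullet> \<iota> (FO L m) (FO R n) ?T = \<phi>' \<bullet> \<iota> (FO L m') (FO R n) (dual_trace L K R e e' m' n ?\<xi>)"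
    using n by (simp add: T.assoc N_\<iota>[of "FA L h" _ "FO L m'"] eq)
  also have "\<dots> = FA R (\<iota> m' n ?\<xi>)"
    using n d by (intro mate_simps(4)[OF mt(2)]) auto
  also have "\<dots> = FA R (FA N h \<bullet> \<iota> m n \<xi>)"
    using n by (simp add: N_\<iota>)
  also have "\<dots> = (FA R (FA N h) \<bullet> \<phi>) \<bullet> \<iota> (FO L m) (FO R n) ?T"
    using n by (simp add: T.assoc mate_simps(4)[OF mt(1) n] T.endo_cmp)
  finally show "(\<phi>' \<bullet> FA N (FA L h)) \<bullet> \<iota> (FO L m) (FO R n) ?T = (FA R (FA N h) \<bullet> \<phi>) \<bullet> \<iota> (FO L m) (FO R n) ?T" .
qed

text \<open>By \<open>tr_compF\<close> the trace of the composite chain is an iterated one, so the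
  characterising equations of \<phi> and \<psi> apply in turn, the second one under
  \<open>R\<close>.\<close>

lemma mate_compF:
  assumes mt: "mate L K R e e' (FO L' m) \<phi>" "mate L' K' R' d d' m \<psi>"
    and a: "T.adj L K e" "T.adj K R e'" "T.adj L' K' d" "T.adj K' R' d'" and l: "lin L" "lin L'" and m: "m \<in> Obj C"
  shows "mate (compF L L') (compF K' K) (compF R R') (T.comp_counit L K e d) (T.comp_counit K' R' d' e') m
    (FA R \<psi> \<bullet> \<phi>)"
  unfolding mate_def
proof (intro conjI ballI)
  note [simp] = T.adj_endo[OF a(1)] T.adj_endo[OF a(2)] T.adj_endo[OF a(3)] T.adj_endo[OF a(4)] m
    mate_simps(1-3)[OF mt(1)] mate_simps(1-3)[OF mt(2)]
  show "T.iso (FA R \<psi> \<bullet> \<phi>)" "asrc (FA R \<psi> \<bullet> \<phi>) = FO N (FO (compF L L') m)" "atgt (FA R \<psi> \<bullet> \<phi>) = FO (compF R R') (FO N m)"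
    by simp_all
  fix n \<xi> assume n [simp]: "n \<in> Obj C" "\<xi> \<in> Hom_dual C m n"
  have Lm: "FO L' m \<in> Obj C" by simp
  have [simp]: "dual_trace L' K' R' d d' m n \<xi> \<in> Hom_dual C (FO L' m) (FO R' n)"
    by (rule dual_trace_dual[OF a(3,4) l(2) m n])
  note [simp] = dual_trace_dual[OF a(1,2) l(1) Lm]
  have "dual_trace (compF L L') (compF K' K) (compF R R') (T.comp_counit L K e d) (T.comp_counit K' R' d' e') m n \<xi>
     = pull (FO L (FO L' m)) (FO R (FO R' n)) (\<lambda>f. T.tr L' K' R' d d' m n (T.tr L K R e e' (FO L' m) (FO R' n) f)) \<xi>"
    unfolding dual_trace_def compF_simps by (rule pull_cong) (auto intro: T.tr_compF[OF a])
  also have "\<dots> = dual_trace L K R e e' (FO L' m) (FO R' n) (dual_trace L' K' R' d d' m n \<xi>)"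
    unfolding dual_trace_def using T.tr_typ[OF a(1,2) Lm, of "FO R' n"] by (intro pull_pull[symmetric]) auto
  finally have eq: "dual_trace (compF L L') (compF K' K) (compF R R') (T.comp_counit L K e d) (T.comp_counit K' R' d' e') m n \<xi>
    = dual_trace L K R e e' (FO L' m) (FO R' n) (dual_trace L' K' R' d d' m n \<xi>)" .
  have "(FA R \<psi> \<bullet> \<phi>) \<bullet> \<iota> (FO L (FO L' m)) (FO R (FO R' n)) (dual_trace L K R e e' (FO L' m) (FO R' n) (dual_trace L' K' R' d d' m n \<xi>))
     = FA R \<psi> \<bullet> FA R (\<iota> (FO L' m) (FO R' n) (dual_trace L' K' R' d d' m n \<xi>))"
    by (simp add: T.assoc mate_simps(4)[OF mt(1)])
  also have "\<dots> = FA R (\<psi> \<bullet> \<iota> (FO L' m) (FO R' n) (dual_trace L' K' R' d d' m n \<xi>))"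
    by (intro T.endo_cmp[symmetric]) simp_all
  also have "\<dots> = FA R (FA R' (\<iota> m n \<xi>))"
    by (simp add: mate_simps(4)[OF mt(2)])
  finally show "(FA R \<psi> \<bullet> \<phi>) \<bullet> \<iota> (FO (compF L L') m) (FO (compF R R') n)
       (dual_trace (compF L L') (compF K' K) (compF R R') (T.comp_counit L K e d) (T.comp_counit K' R' d' e') m n \<xi>)
     = FA (compF R R') (\<iota> m n \<xi>)"
    by (simp add: eq)
qed

text \<open>The chain of identity functors, with which the chain of the unit object will be
  compared.\<close>

lemma mate_idF:
  assumes [simp]: "m \<in> Obj C"
  shows "mate idF idF idF (tone C) (tone C) m (tone C (FO N m))"
  unfolding mate_def
proof (intro conjI ballI)
  fix n \<xi> assume n [simp]: "n \<in> Obj C" "\<xi> \<in> Hom_dual C m n"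
  have "dual_trace idF idF idF (tone C) (tone C) m n \<xi> = pull m n (\<lambda>f. f) \<xi>"
    unfolding dual_trace_def idF_simps by (rule pull_cong) (auto intro: T.tr_idF)
  then show "tone C (FO N m) \<bullet> \<iota> (FO idF m) (FO idF n) (dual_trace idF idF idF (tone C) (tone C) m n \<xi>) = FA idF (\<iota> m n \<xi>)"
    by (simp add: pull_id)
qed auto

end

section \<open>The universal property of the coend\<close>

lemma lookup_fscl [simp]: "Poly_Mapping.lookup (fscl c p) z = c * Poly_Mapping.lookup p z"
  by (simp add: fscl_def Poly_Mapping.map.rep_eq when_def)

lemma vector_space_fscl: "vector_space fscl"
  by unfold_locales (auto intro!: poly_mapping_eqI simp: lookup_add algebra_simps)

text \<open>For a function on pairs this is the map \<open>ext\<close> in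
  \<open>is_tensor_product\<close>.\<close>

definition lin_ext :: "('k \<Rightarrow> 'b \<Rightarrow> 'b) \<Rightarrow> ('i \<Rightarrow> 'b::comm_monoid_add) \<Rightarrow> ('i \<Rightarrow>\<^sub>0 'k::zero) \<Rightarrow> 'b" where
  "lin_ext s \<beta> p = (\<Sum>z \<in> Poly_Mapping.keys p. s (Poly_Mapping.lookup p z) (\<beta> z))"

context vector_space
begin

lemma lin_ext_superset:
  assumes "finite S" "Poly_Mapping.keys p \<subseteq> S"
  shows "lin_ext scale \<beta> p = (\<Sum>z \<in> S. scale (Poly_Mapping.lookup p z) (\<beta> z))"
  unfolding lin_ext_def using assms by (intro sum.mono_neutral_left) (auto simp: in_keys_iff)

lemma lin_ext_add: "lin_ext scale \<beta> (p + q) = lin_ext scale \<beta> p + lin_ext scale \<beta> q"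
proof -
  let ?S = "Poly_Mapping.keys p \<union> Poly_Mapping.keys q"
  have "lin_ext scale \<beta> (p + q) = (\<Sum>z \<in> ?S. scale (Poly_Mapping.lookup (p + q) z) (\<beta> z))"
    using Poly_Mapping.keys_add[of p q] by (intro lin_ext_superset) auto
  moreover have "lin_ext scale \<beta> p = (\<Sum>z \<in> ?S. scale (Poly_Mapping.lookup p z) (\<beta> z))"
    by (rule lin_ext_superset) auto
  moreover have "lin_ext scale \<beta> q = (\<Sum>z \<in> ?S. scale (Poly_Mapping.lookup q z) (\<beta> z))"
    by (rule lin_ext_superset) auto
  ultimately show ?thesis
    by (simp add: lookup_add scale_left_distrib sum.distrib)
qed

lemma lin_ext_fscl: "lin_ext scale \<beta> (fscl c p) = scale c (lin_ext scale \<beta> p)"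
proof -
  have "lin_ext scale \<beta> (fscl c p) = (\<Sum>z \<in> Poly_Mapping.keys p. scale (Poly_Mapping.lookup (fscl c p) z) (\<beta> z))"
    by (rule lin_ext_superset) (auto simp: in_keys_iff)
  then show ?thesis
    by (simp add: lin_ext_def scale_sum_right)
qed

lemma lin_ext_0: "lin_ext scale \<beta> 0 = 0"
  by (simp add: lin_ext_def)

lemma lin_ext_minus: "lin_ext scale \<beta> (p - q) = lin_ext scale \<beta> p - lin_ext scale \<beta> q"
  using lin_ext_add[of \<beta> "p - q" q] by simp

lemma lin_ext_single: "lin_ext scale \<beta> (Poly_Mapping.single z c) = scale c (\<beta> z)"
  by (cases "c = 0") (auto simp: lin_ext_def)

lemma lin_ext_sum: "lin_ext scale \<beta> (\<Sum>k \<in> K. p k) = (\<Sum>k \<in> K. lin_ext scale \<beta> (p k))"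
  by (induction K rule: infinite_finite_induct) (auto simp: lin_ext_0 lin_ext_add)

lemma lin_ext_span:
  assumes "p \<in> module.span fscl R" "\<And>r. r \<in> R \<Longrightarrow> lin_ext scale \<beta> r = 0"
  shows "lin_ext scale \<beta> p = 0"
proof -
  interpret F: vector_space "fscl :: 'a \<Rightarrow> ('c \<Rightarrow>\<^sub>0 'a) \<Rightarrow> _" by (rule vector_space_fscl)
  have "F.subspace {p. lin_ext scale \<beta> p = 0}"
    by (auto simp: F.subspace_def lin_ext_0 lin_ext_add lin_ext_fscl)
  then show ?thesis
    using F.span_minimal[of R "{p. lin_ext scale \<beta> p = 0}"] assms by auto
qed

lemma tensor_product_lin_ext:
  assumes "is_tensor_product sV sW scale V W Z t"
  shows "lin_ext scale (\<lambda>(v, w). t v w) ` {p. Poly_Mapping.keys p \<subseteq> V \<times> W} = Z"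
    and "{p. Poly_Mapping.keys p \<subseteq> V \<times> W \<and> lin_ext scale (\<lambda>(v, w). t v w) p = 0}
      = module.span fscl (bilinearity_relations sV sW V W)"
proof -
  have *: "lin_ext scale (\<lambda>(v, w). t v w) = (\<lambda>p. \<Sum>(v, w) \<in> Poly_Mapping.keys p. scale (Poly_Mapping.lookup p (v, w)) (t v w))"
    unfolding lin_ext_def by (auto simp: case_prod_beta)
  show "lin_ext scale (\<lambda>(v, w). t v w) ` {p. Poly_Mapping.keys p \<subseteq> V \<times> W} = Z"
    "{p. Poly_Mapping.keys p \<subseteq> V \<times> W \<and> lin_ext scale (\<lambda>(v, w). t v w) p = 0}
      = module.span fscl (bilinearity_relations sV sW V W)"
    using assms unfolding is_tensor_product_def Let_def * by auto
qed

lemma tensor_product_mem: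
  assumes "is_tensor_product sV sW scale V W Z t" "v \<in> V" "w \<in> W"
  shows "t v w \<in> Z"
proof -
  have "lin_ext scale (\<lambda>(v, w). t v w) (Poly_Mapping.single (v, w) 1) = t v w"
    by (simp add: lin_ext_single)
  moreover have "Poly_Mapping.single (v, w) 1 \<in> {p. Poly_Mapping.keys p \<subseteq> V \<times> W}"
    using assms by auto
  ultimately show ?thesis
    using tensor_product_lin_ext(1)[OF assms(1)] by (metis image_eqI)
qed

lemma tensor_product_bilinear:
  assumes T: "is_tensor_product sV sW scale V W Z t"
  shows "\<lbrakk>v \<in> V; v' \<in> V; w \<in> W\<rbrakk> \<Longrightarrow> t (v + v') w = t v w + t v' w"
    and "\<lbrakk>v \<in> V; w \<in> W\<rbrakk> \<Longrightarrow> t (sV c v) w = scale c (t v w)"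
proof -
  interpret F: vector_space "fscl :: 'a \<Rightarrow> ('c \<times> 'd \<Rightarrow>\<^sub>0 'a) \<Rightarrow> _" by (rule vector_space_fscl)
  let ?l = "lin_ext scale (\<lambda>(v, w). t v w)"
  have z: "?l r = 0" if "r \<in> bilinearity_relations sV sW V W" for r
    using F.span_base[OF that] tensor_product_lin_ext(2)[OF T] by auto
  show "t (v + v') w = t v w + t v' w" if "v \<in> V" "v' \<in> V" "w \<in> W"
  proof -
    have "?l (Poly_Mapping.single (v + v', w) 1 - Poly_Mapping.single (v, w) 1 - Poly_Mapping.single (v', w) 1) = 0"
      by (rule z) (use that in \<open>auto simp: bilinearity_relations_def Let_def\<close>)
    then show ?thesis
      by (simp add: lin_ext_minus lin_ext_add lin_ext_single algebra_simps)
  qed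
  show "t (sV c v) w = scale c (t v w)" if "v \<in> V" "w \<in> W"
  proof -
    have "?l (Poly_Mapping.single (sV c v, w) 1 - fscl c (Poly_Mapping.single (v, w) 1)) = 0"
      by (rule z) (use that in \<open>auto simp: bilinearity_relations_def Let_def\<close>)
    then show ?thesis
      by (simp add: lin_ext_minus lin_ext_single lin_ext_fscl)
  qed
qed

lemma tensor_product_span:
  assumes "is_tensor_product sV sW scale V W Z t" "z \<in> Z"
  obtains K c where "finite K" "K \<subseteq> V \<times> W" "z = (\<Sum>k \<in> K. scale (c k) (t (fst k) (snd k)))"
proof -
  obtain p where "Poly_Mapping.keys p \<subseteq> V \<times> W" "z = lin_ext scale (\<lambda>(v, w). t v w) p"
    using assms tensor_product_lin_ext(1)[OF assms(1)] by blast
  then show thesis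
    using that[of "Poly_Mapping.keys p" "Poly_Mapping.lookup p"] by (simp add: lin_ext_def case_prod_beta)
qed

text \<open>The universal property in terms of relations: a formal combination that vanishes in the
  tensor product lies in the span of the bilinearity relations, and every bilinear \<beta>
  annihilates these. This spares the construction of an induced linear map.\<close>

lemma tensor_product_relation:
  assumes T: "is_tensor_product sV sW scale V W Z t"
    and K: "finite K" "\<And>k. k \<in> K \<Longrightarrow> v k \<in> V \<and> w k \<in> W" and "v0 \<in> V" "w0 \<in> W"
    and eq: "(\<Sum>k \<in> K. scale (c k) (t (v k) (w k))) = t v0 w0"
    and b: "\<And>v v' w. \<lbrakk>v \<in> V; v' \<in> V; w \<in> W\<rbrakk> \<Longrightarrow> \<beta> (v + v') w = \<beta> v w + \<beta> v' w"
      "\<And>v w w'. \<lbrakk>v \<in> V; w \<in> W; w' \<in> W\<rbrakk> \<Longrightarrow> \<beta> v (w + w') = \<beta> v w + \<beta> v w'"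
      "\<And>c v w. \<lbrakk>v \<in> V; w \<in> W\<rbrakk> \<Longrightarrow> \<beta> (sV c v) w = scale c (\<beta> v w)"
      "\<And>c v w. \<lbrakk>v \<in> V; w \<in> W\<rbrakk> \<Longrightarrow> \<beta> v (sW c w) = scale c (\<beta> v w)"
  shows "(\<Sum>k \<in> K. scale (c k) (\<beta> (v k) (w k))) = \<beta> v0 w0"
proof -
  define p where "p = (\<Sum>k \<in> K. Poly_Mapping.single (v k, w k) (c k)) - Poly_Mapping.single (v0, w0) 1"
  have l: "lin_ext scale (\<lambda>(v, w). g v w) p = (\<Sum>k \<in> K. scale (c k) (g (v k) (w k))) - g v0 w0" for g
    by (simp add: p_def lin_ext_minus lin_ext_sum lin_ext_single)
  have "Poly_Mapping.keys (\<Sum>k \<in> K. Poly_Mapping.single (v k, w k) (c k)) \<subseteq> V \<times> W"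
    using K
  proof (induction K rule: finite_induct)
    case (insert k K)
    then show ?case
      using Poly_Mapping.keys_add[of "Poly_Mapping.single (v k, w k) (c k)" "\<Sum>k \<in> K. Poly_Mapping.single (v k, w k) (c k)"]
      by (fastforce split: if_splits)
  qed simp
  then have "Poly_Mapping.keys p \<subseteq> V \<times> W"
    unfolding p_def
    using keys_diff[of "\<Sum>k \<in> K. Poly_Mapping.single (v k, w k) (c k)" "Poly_Mapping.single (v0, w0) (1::'a)"] assms(4,5)
    by auto
  moreover have "lin_ext scale (\<lambda>(v, w). t v w) p = 0"
    by (simp add: l eq)
  ultimately have "p \<in> module.span fscl (bilinearity_relations sV sW V W)"
    using tensor_product_lin_ext(2)[OF T] by blast
  then have "lin_ext scale (\<lambda>(v, w). \<beta> v w) p = 0"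
    by (rule lin_ext_span) (auto simp: bilinearity_relations_def Let_def lin_ext_minus lin_ext_single lin_ext_fscl b)
  then show ?thesis
    by (simp add: l)
qed

end

section \<open>Copowers and their universal property\<close>

context linear_category
begin

lemma Comp_in: "\<lbrakk>f \<in> Hom C x y; g \<in> Hom C y z; x \<in> Obj C; y \<in> Obj C; z \<in> Obj C\<rbrakk> \<Longrightarrow> g \<cdot> f \<in> Hom C x z"
  by (rule Comp_Hom)

lemma Hom_sum: "\<lbrakk>x \<in> Obj C; y \<in> Obj C; \<And>k. k \<in> K \<Longrightarrow> f k \<in> Hom C x y\<rbrakk> \<Longrightarrow> (\<Sum>k \<in> K. scl C (c k) (f k)) \<in> Hom C x y"
  by (intro subspace_sum Hom_subspace subspace_scale) auto

lemma Comp_sum_left: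
  assumes "x \<in> Obj C" "y \<in> Obj C" "z \<in> Obj C" "h \<in> Hom C x y" "finite K" "\<And>k. k \<in> K \<Longrightarrow> f k \<in> Hom C y z"
  shows "(\<Sum>k \<in> K. scl C (c k) (f k)) \<cdot> h = (\<Sum>k \<in> K. scl C (c k) (f k \<cdot> h))"
  using assms(5,6)
proof (induction K rule: finite_induct)
  case empty
  have "0 \<in> Hom C y z" using Hom_subspace assms subspace_0 by blast
  from Comp_scl_left[OF assms(1-4) this, of 0] show ?case by simp
next
  case (insert k K)
  then show ?case
    using Comp_add_left[OF assms(1-4), of "scl C (c k) (f k)" "\<Sum>k \<in> K. scl C (c k) (f k)"]
      Hom_sum[OF assms(2,3), of K f c] Comp_scl_left[OF assms(1-4)] subspace_scale[OF Hom_subspace[OF assms(2,3)]]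
    by simp
qed

lemma Comp_sum_right:
  assumes "x \<in> Obj C" "y \<in> Obj C" "z \<in> Obj C" "h \<in> Hom C y z" "finite K" "\<And>k. k \<in> K \<Longrightarrow> f k \<in> Hom C x y"
  shows "h \<cdot> (\<Sum>k \<in> K. scl C (c k) (f k)) = (\<Sum>k \<in> K. scl C (c k) (h \<cdot> f k))"
  using assms(5,6)
proof (induction K rule: finite_induct)
  case empty
  have "0 \<in> Hom C x y" using Hom_subspace assms subspace_0 by blast
  from Comp_scl_right[OF assms(1-3) this assms(4), of 0] show ?case by simp
next
  case (insert k K)
  then show ?case
    using Comp_add_right[OF assms(1-3) _ _ assms(4), of "scl C (c k) (f k)" "\<Sum>k \<in> K. scl C (c k) (f k)"]
      Hom_sum[OF assms(1,2), of K f c] Comp_scl_right[OF assms(1-3) _ assms(4)] subspace_scale[OF Hom_subspace[OF assms(1,2)]]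
    by simp
qed

lemma copower_typ:
  assumes "is_copower C sV V m p t" "y \<in> Obj C" "u \<in> V" "g \<in> Hom C y m"
  shows "t u g \<in> Hom C y p"
  using assms tensor_product_mem unfolding is_copower_def by blast

lemma copower_Obj: "is_copower C sV V m p t \<Longrightarrow> p \<in> Obj C"
  by (simp add: is_copower_def)

lemma copower_Comp:
  assumes "is_copower C sV V m p t" "y \<in> Obj C" "z \<in> Obj C" "u \<in> V" "g \<in> Hom C y m" "h \<in> Hom C z y"
  shows "t u (g \<cdot> h) = t u g \<cdot> h"
  using assms unfolding is_copower_def by blast

text \<open>The Yoneda element: \<open>Hom(p, p)\<close> is itself one of the tensor products, so
  the identity of \<open>p\<close> is a finite combination of values of \<open>t\<close>. Arrows out
  of \<open>p\<close> are analysed by expanding along it.\<close>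

lemma copower_Id_sum:
  assumes c: "is_copower C sV V m p t"
  obtains K c where "finite K" "K \<subseteq> V \<times> Hom C p m" "Id C p = (\<Sum>k \<in> K. scl C (c k) (t (fst k) (snd k)))"
proof -
  have "is_tensor_product sV (scl C) (scl C) V (Hom C p m) (Hom C p p) t"
    using c copower_Obj[OF c] unfolding is_copower_def by blast
  from tensor_product_span[OF this Id_Hom[OF copower_Obj[OF c]]] show thesis
    using that by blast
qed

lemma copower_unique:
  assumes c: "is_copower C sV V m p t" and "m \<in> Obj C" "d \<in> Obj C" "q \<in> Hom C p d" "q' \<in> Hom C p d"
    and eq: "\<And>y u g. \<lbrakk>y \<in> Obj C; u \<in> V; g \<in> Hom C y m\<rbrakk> \<Longrightarrow> q \<cdot> t u g = q' \<cdot> t u g"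
  shows "q = q'"
proof -
  note p = copower_Obj[OF c]
  obtain K c' where K: "finite K" "K \<subseteq> V \<times> Hom C p m" "Id C p = (\<Sum>k \<in> K. scl C (c' k) (t (fst k) (snd k)))"
    using copower_Id_sum[OF c] .
  have t: "\<And>k. k \<in> K \<Longrightarrow> t (fst k) (snd k) \<in> Hom C p p"
    using K(2) copower_typ[OF c p] by force
  have "q = q \<cdot> Id C p" using assms p Comp_Id by simp
  also have "\<dots> = (\<Sum>k \<in> K. scl C (c' k) (q \<cdot> t (fst k) (snd k)))"
    unfolding K(3) using K(1) t p assms by (intro Comp_sum_right) auto
  also have "\<dots> = (\<Sum>k \<in> K. scl C (c' k) (q' \<cdot> t (fst k) (snd k)))"
    using K(2) p by (intro sum.cong refl arg_cong[where f="scl C _"] eq) auto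
  also have "\<dots> = q' \<cdot> Id C p"
    unfolding K(3) using K(1) t p assms by (intro Comp_sum_right[symmetric]) auto
  also have "\<dots> = q'" using assms p Comp_Id by simp
  finally show ?thesis .
qed

lemma copower_universal:
  assumes c: "is_copower C sV V m p t" and m: "m \<in> Obj C" and d: "d \<in> Obj C"
    and \<omega>: "\<And>u. u \<in> V \<Longrightarrow> \<omega> u \<in> Hom C m d" "\<And>u v. \<lbrakk>u \<in> V; v \<in> V\<rbrakk> \<Longrightarrow> \<omega> (u + v) = \<omega> u + \<omega> v"
      "\<And>c u. u \<in> V \<Longrightarrow> \<omega> (sV c u) = scl C c (\<omega> u)"
  shows "\<exists>q \<in> Hom C p d. \<forall>y \<in> Obj C. \<forall>u \<in> V. \<forall>g \<in> Hom C y m. q \<cdot> t u g = \<omega> u \<cdot> g"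
proof -
  note p = copower_Obj[OF c]
  obtain K c' where K: "finite K" "K \<subseteq> V \<times> Hom C p m" "Id C p = (\<Sum>k \<in> K. scl C (c' k) (t (fst k) (snd k)))"
    using copower_Id_sum[OF c] .
  have k: "fst k \<in> V" "snd k \<in> Hom C p m" if "k \<in> K" for k
    using K(2) that by auto
  have t: "\<And>k. k \<in> K \<Longrightarrow> t (fst k) (snd k) \<in> Hom C p p"
    using copower_typ[OF c p] k by blast
  \<comment> \<open>The expansion of the identity of \<open>p\<close> with
    \<open>\<omega> v \<cdot> g\<close> in place of \<open>t v g\<close>, as linearity
    forces.\<close>
  let ?q = "\<Sum>k \<in> K. scl C (c' k) (\<omega> (fst k) \<cdot> snd k)"
  have q1: "\<And>k. k \<in> K \<Longrightarrow> \<omega> (fst k) \<cdot> snd k \<in> Hom C p d"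
    using k \<omega>(1) p m d by (blast intro: Comp_in)
  have q: "?q \<in> Hom C p d"
    using q1 by (intro Hom_sum p d)
  moreover have "?q \<cdot> t u g = \<omega> u \<cdot> g" if y: "y \<in> Obj C" and u: "u \<in> V" and g: "g \<in> Hom C y m" for y u g
  proof -
    have h: "t u g \<in> Hom C y p"
      using copower_typ[OF c y u g] .
    have T: "is_tensor_product sV (scl C) (scl C) V (Hom C y m) (Hom C y p) t"
      using c y unfolding is_copower_def by blast
    have "t u g = Id C p \<cdot> t u g"
      using h y p Id_Comp by simp
    also have "\<dots> = (\<Sum>k \<in> K. scl C (c' k) (t (fst k) (snd k) \<cdot> t u g))"
      unfolding K(3) using K(1) t p y h by (intro Comp_sum_left) auto
    also have "\<dots> = (\<Sum>k \<in> K. scl C (c' k) (t (fst k) (snd k \<cdot> t u g)))"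
      using k h y p by (intro sum.cong refl arg_cong[where f="scl C _"] copower_Comp[OF c, symmetric]) auto
    finally have eq: "(\<Sum>k \<in> K. scl C (c' k) (t (fst k) (snd k \<cdot> t u g))) = t u g" by simp
    have "?q \<cdot> t u g = (\<Sum>k \<in> K. scl C (c' k) ((\<omega> (fst k) \<cdot> snd k) \<cdot> t u g))"
      using K(1) q1 p y d h by (intro Comp_sum_left[where x=y and y=p and z=d]) auto
    also have "\<dots> = (\<Sum>k \<in> K. scl C (c' k) (\<omega> (fst k) \<cdot> (snd k \<cdot> t u g)))"
      using k h y p m d \<omega>(1) by (intro sum.cong refl arg_cong[where f="scl C _"] Comp_assoc[where w=y and x=p and y=m and z=d]) auto
    also have "\<dots> = \<omega> u \<cdot> g"
    \<comment> \<open>The expansion of \<open>t u g\<close> is a linear relation between pure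
      tensors; it is transported along the bilinear map sending \<open>v\<close> and
      \<open>g\<close> to \<open>\<omega> v \<cdot> g\<close>.\<close>
    proof (rule tensor_product_relation[OF T K(1) _ u g eq])
      show "fst k \<in> V \<and> snd k \<cdot> t u g \<in> Hom C y m" if "k \<in> K" for k
        using k[OF that] h y p m by (blast intro: Comp_in)
    qed (use y m d \<omega> in \<open>auto intro: Comp_add_left Comp_add_right Comp_scl_left Comp_scl_right\<close>)
    finally show ?thesis .
  qed
  ultimately show ?thesis
    by blast
qed

lemma copower_map:
  assumes c: "is_copower C sV V m p t" and c': "is_copower C sV' V' m' p' t'" and m: "m \<in> Obj C" "m' \<in> Obj C"
    and \<alpha>: "\<And>u. u \<in> V \<Longrightarrow> \<alpha> u \<in> V'" "\<And>u v. \<lbrakk>u \<in> V; v \<in> V\<rbrakk> \<Longrightarrow> \<alpha> (u + v) = \<alpha> u + \<alpha> v"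
      "\<And>c u. u \<in> V \<Longrightarrow> \<alpha> (sV c u) = sV' c (\<alpha> u)"
    and f: "f \<in> Hom C m m'"
  shows "copower_map C V m p t p' t' \<alpha> f \<in> Hom C p p'"
    and "\<lbrakk>y \<in> Obj C; u \<in> V; g \<in> Hom C y m\<rbrakk> \<Longrightarrow> copower_map C V m p t p' t' \<alpha> f \<cdot> t u g = t' (\<alpha> u) (f \<cdot> g)"
proof -
  have T: "is_tensor_product sV' (scl C) (scl C) V' (Hom C m m') (Hom C m p') t'"
    using c' m unfolding is_copower_def by blast
  have "\<exists>q \<in> Hom C p p'. \<forall>y \<in> Obj C. \<forall>u \<in> V. \<forall>g \<in> Hom C y m. q \<cdot> t u g = t' (\<alpha> u) f \<cdot> g"
    by (rule copower_universal[OF c m(1) copower_Obj[OF c']])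
      (use \<alpha> f m in \<open>auto simp: tensor_product_bilinear[OF T] intro: copower_typ[OF c']\<close>)
  then obtain q where q: "q \<in> Hom C p p'" "\<And>y u g. \<lbrakk>y \<in> Obj C; u \<in> V; g \<in> Hom C y m\<rbrakk> \<Longrightarrow> q \<cdot> t u g = t' (\<alpha> u) f \<cdot> g"
    by blast
  have q': "q \<cdot> t u g = t' (\<alpha> u) (f \<cdot> g)" if "y \<in> Obj C" "u \<in> V" "g \<in> Hom C y m" for y u g
    using q(2)[OF that] copower_Comp[OF c' m(1) that(1) \<alpha>(1)[OF that(2)] f that(3)] by simp
  have "copower_map C V m p t p' t' \<alpha> f = q"
    unfolding copower_map_def
  proof (rule the_equality)
    show "q' = q" if "q' \<in> Hom C p p' \<and> (\<forall>y\<in>Obj C. \<forall>u\<in>V. \<forall>g\<in>Hom C y m. q' \<cdot> t u g = t' (\<alpha> u) (f \<cdot> g))" for q'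
      by (rule copower_unique[OF c m(1) copower_Obj[OF c']]) (use that q(1) q' in auto)
  qed (use q(1) q' in blast)
  then show "copower_map C V m p t p' t' \<alpha> f \<in> Hom C p p'"
    "\<lbrakk>y \<in> Obj C; u \<in> V; g \<in> Hom C y m\<rbrakk> \<Longrightarrow> copower_map C V m p t p' t' \<alpha> f \<cdot> t u g = t' (\<alpha> u) (f \<cdot> g)"
    using q(1) q' by auto
qed

lemma Hom_dual_right_in:
  assumes "h \<in> Hom C n m" "x \<in> Obj C" "m \<in> Obj C" "n \<in> Obj C" "\<xi> \<in> Hom_dual C x m"
  shows "Hom_dual_right C x n h \<xi> \<in> Hom_dual C x n"
  using pull_post_dual[of \<xi> x m "Arrow n h m" n] assms by (simp add: pull_post tarr_def del: T.src_Ob T.tgt_Ob)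

lemma Hom_dual_left_in:
  assumes "f \<in> Hom C x x'" "x \<in> Obj C" "x' \<in> Obj C" "m \<in> Obj C" "\<xi> \<in> Hom_dual C x m"
  shows "Hom_dual_left C x' m f \<xi> \<in> Hom_dual C x' m"
  using pull_pre_dual[of \<xi> x m "Arrow x f x'" x'] assms by (simp add: pull_pre tarr_def del: T.src_Ob T.tgt_Ob)

lemma Hom_dual_right_linear:
  "Hom_dual_right C x n h (\<xi> + \<xi>') = Hom_dual_right C x n h \<xi> + Hom_dual_right C x n h \<xi>'"
  "Hom_dual_right C x n h (dual_scl c \<xi>) = dual_scl c (Hom_dual_right C x n h \<xi>)"
  by (auto simp: Hom_dual_right_def dual_scl_def)

lemma Hom_dual_left_linear:
  "Hom_dual_left C x n h (\<xi> + \<xi>') = Hom_dual_left C x n h \<xi> + Hom_dual_left C x n h \<xi>'"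
  "Hom_dual_left C x n h (dual_scl c \<xi>) = dual_scl c (Hom_dual_left C x n h \<xi>)"
  by (auto simp: Hom_dual_left_def dual_scl_def)

lemma Hom_dual_right_Id:
  assumes "\<xi> \<in> Hom_dual C x m" "x \<in> Obj C" "m \<in> Obj C"
  shows "Hom_dual_right C x m (Id C m) \<xi> = \<xi>"
  using assms Id_Comp by (auto simp: Hom_dual_right_def Hom_dual_def)

lemma endo_tF: "linear_functor C C F \<Longrightarrow> T.endo (tF F)"
  by (rule T.endoI)
    (auto simp: tarr_def tcmp_def tone_def linear_functor.FO_Obj linear_functor.FA_Hom linear_functor.FA_Id linear_functor.FA_Comp
      simp del: T.src_Ob T.tgt_Ob)

theorem nakayama_functor_universal:
  assumes "nakayama_functor C N"
  shows "\<exists>\<iota>. nakayama_universal C (tF N) \<iota>"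
proof -
  have F: "linear_functor C C N"
    using assms by (simp add: nakayama_functor_def)
  interpret F: linear_functor C C N by (rule F)
  from assms obtain P t i where
    c: "\<And>x m y. \<lbrakk>x \<in> Obj C; m \<in> Obj C; y \<in> Obj C\<rbrakk> \<Longrightarrow> is_copower C dual_scl (Hom_dual C x m) y (P x m y) (t x m y)"
    and coend: "\<And>x. x \<in> Obj C \<Longrightarrow> is_coend C C (P x)
             (\<lambda>m n y z h f. copower_map C (Hom_dual C x m) y (P x m y) (t x m y)
                (P x n z) (t x n z) (Hom_dual_right C x n h) f) (FO N x) (i x)"
    and NA: "\<And>x x' f m. \<lbrakk>x \<in> Obj C; x' \<in> Obj C; f \<in> Hom C x x'; m \<in> Obj C\<rbrakk> \<Longrightarrow>
           FA N f \<cdot> i x m =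
             i x' m \<cdot> copower_map C (Hom_dual C x m) m (P x m m) (t x m m)
                (P x' m m) (t x' m m) (Hom_dual_left C x' m f) (Id C m)"
    unfolding nakayama_functor_def by blast
  note cO = copower_Obj[OF c]
  define G where "G x = (\<lambda>m n y z h f. copower_map C (Hom_dual C x m) y (P x m y) (t x m y)
                (P x n z) (t x n z) (Hom_dual_right C x n h) f)" for x
  have coend': "is_coend C C (P x) (G x) (FO N x) (i x)" if "x \<in> Obj C" for x
    using coend[OF that] by (simp add: G_def)
  have i: "i x m \<in> Hom C (P x m m) (FO N x)" if "x \<in> Obj C" "m \<in> Obj C" for x m
    using coend'[OF that(1)] that(2) by (simp add: is_coend_def is_wedge_def)
  have G: "G x m n y z h f \<in> Hom C (P x m y) (P x n z)"
    "\<lbrakk>w \<in> Obj C; u \<in> Hom_dual C x m; g \<in> Hom C w y\<rbrakk> \<Longrightarrow>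
       G x m n y z h f \<cdot> t x m y u g = t x n z (Hom_dual_right C x n h u) (f \<cdot> g)"
    if "x \<in> Obj C" "m \<in> Obj C" "n \<in> Obj C" "y \<in> Obj C" "z \<in> Obj C" "h \<in> Hom C n m" "f \<in> Hom C y z" for x m n y z h f w u g
    unfolding G_def using that
    by (auto intro!: copower_map[OF c c] Hom_dual_right_in simp: Hom_dual_right_linear)
  have tT: "t x m y u g \<in> Hom C w (P x m y)"
    if "x \<in> Obj C" "m \<in> Obj C" "y \<in> Obj C" "w \<in> Obj C" "u \<in> Hom_dual C x m" "g \<in> Hom C w y" for x m y w u g
    using copower_typ[OF c] that by blast
  have tp: "is_tensor_product dual_scl (scl C) (scl C) (Hom_dual C x m) (Hom C m m) (Hom C m (P x m m)) (t x m m)"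
    if "x \<in> Obj C" "m \<in> Obj C" for x m
    using c[OF that(1,2,2)] that unfolding is_copower_def by blast
  \<comment> \<open>By Yoneda, an arrow out of the copower is encoded by its values on the identity
    of \<open>m\<close>, a linear map from functionals to arrows from \<open>m\<close> to
    \<open>N x\<close>; \<open>r_Comp\<close> recovers the arrow.\<close>
  define r where "r x m \<xi> = i x m \<cdot> t x m m \<xi> (Id C m)" for x m \<xi>
  have r: "r x m \<xi> \<in> Hom C m (FO N x)" if "x \<in> Obj C" "m \<in> Obj C" "\<xi> \<in> Hom_dual C x m" for x m \<xi>
    unfolding r_def using that i tT Id_Hom cO F.FO_Obj by (intro Comp_in[where x=m and y="P x m m" and z="FO N x"]) auto
  have r_Comp: "r x m \<xi> \<cdot> g = i x m \<cdot> t x m m \<xi> g" if "x \<in> Obj C" "m \<in> Obj C" "y \<in> Obj C" "\<xi> \<in> Hom_dual C x m" "g \<in> Hom C y m" for x m y \<xi> g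
  proof -
    have "r x m \<xi> \<cdot> g = i x m \<cdot> (t x m m \<xi> (Id C m) \<cdot> g)"
      unfolding r_def using that i tT Id_Hom cO F.FO_Obj by (intro Comp_assoc[where w=y and x=m and y="P x m m" and z="FO N x"]) auto
    also have "t x m m \<xi> (Id C m) \<cdot> g = t x m m \<xi> g"
      using copower_Comp[OF c[OF that(1,2,2)] that(2,3,4) Id_Hom[OF that(2)] that(5)] Id_Comp that by simp
    finally show ?thesis .
  qed
  show ?thesis
  proof (intro exI[of _ "\<lambda>x m \<xi>. Arrow m (r x m \<xi>) (FO N x)"], unfold_locales)
    show "T.endo (tF N)" using endo_tF[OF F] .
  next
    fix x m \<xi> assume "x \<in> Obj C" "m \<in> Obj C" "\<xi> \<in> Hom_dual C x m"
    then show "tarr C (Arrow m (r x m \<xi>) (FO N x))"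
      using r F.FO_Obj by (simp add: tarr_def del: T.src_Ob T.tgt_Ob)
  next
    fix x m \<xi> \<xi>' assume a: "x \<in> Obj C" "m \<in> Obj C" "\<xi> \<in> Hom_dual C x m" "\<xi>' \<in> Hom_dual C x m"
    then have "r x m (\<xi> + \<xi>') = r x m \<xi> + r x m \<xi>'"
      unfolding r_def using tensor_product_bilinear(1)[OF tp[OF a(1,2)] a(3,4) Id_Hom[OF a(2)]] i tT Id_Hom cO F.FO_Obj
      by (simp add: Comp_add_right[of m "P x m m" "FO N x"])
    then show "Arrow m (r x m (\<xi> + \<xi>')) (FO N x) = tadd (Arrow m (r x m \<xi>) (FO N x)) (Arrow m (r x m \<xi>') (FO N x))"
      by (simp add: tadd_def)
  next
    fix x m \<xi> k assume a: "x \<in> Obj C" "m \<in> Obj C" "\<xi> \<in> Hom_dual C x m"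
    then have "r x m (dual_scl k \<xi>) = scl C k (r x m \<xi>)"
      unfolding r_def using tensor_product_bilinear(2)[OF tp[OF a(1,2)] a(3) Id_Hom[OF a(2)]] i tT Id_Hom cO F.FO_Obj
      by (simp add: Comp_scl_right[of m "P x m m" "FO N x"])
    then show "Arrow m (r x m (dual_scl k \<xi>)) (FO N x) = tscl C k (Arrow m (r x m \<xi>) (FO N x))"
      by (simp add: tscl_def)
  next
    fix x h n m \<xi> assume a: "x \<in> Obj C" "tarr C h" "asrc h = n" "atgt h = m" "\<xi> \<in> Hom_dual C x m"
    let ?h = "raw h"
    have h: "n \<in> Obj C" "m \<in> Obj C" "?h \<in> Hom C n m"
      using a unfolding tarr_def by auto
    have "r x m \<xi> \<cdot> ?h = i x m \<cdot> t x m m \<xi> ?h"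
      using r_Comp[OF a(1) h(2,1) a(5) h(3)] .
    \<comment> \<open>Postcomposition with \<open>?h\<close> is the covariant action of
      \<open>G\<close>. The wedge condition exchanges it for the contravariant action, which is
      precomposition of the functional with \<open>?h\<close>.\<close>
    also have "t x m m \<xi> ?h = G x m m n m (Id C m) ?h \<cdot> t x m n \<xi> (Id C n)"
      using G(2)[of x m m n m "Id C m" ?h n \<xi> "Id C n"] a h Id_Hom Comp_Id by (simp add: Hom_dual_right_Id)
    also have "i x m \<cdot> \<dots> = (i x m \<cdot> G x m m n m (Id C m) ?h) \<cdot> t x m n \<xi> (Id C n)"
      using a h Id_Hom i G(1) tT cO F.FO_Obj
      by (intro Comp_assoc[where w=n and x="P x m n" and y="P x m m" and z="FO N x", symmetric]) auto
    also have "i x m \<cdot> G x m m n m (Id C m) ?h = i x n \<cdot> G x m n n n ?h (Id C n)"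
      using coend'[OF a(1)] h by (simp add: is_coend_def is_wedge_def)
    also have "\<dots> \<cdot> t x m n \<xi> (Id C n) = i x n \<cdot> (G x m n n n ?h (Id C n) \<cdot> t x m n \<xi> (Id C n))"
      using a h Id_Hom i G(1) tT cO F.FO_Obj
      by (intro Comp_assoc[where w=n and x="P x m n" and y="P x n n" and z="FO N x"]) auto
    also have "\<dots> = r x n (Hom_dual_right C x n ?h \<xi>)"
      unfolding r_def using G(2)[of x m n n n ?h "Id C n" n \<xi> "Id C n"] a h Id_Hom Comp_Id by simp
    finally show "tcmp C (Arrow m (r x m \<xi>) (FO N x)) h = Arrow n (r x n (pull x n (\<lambda>g. tcmp C h g) \<xi>)) (FO N x)"
      using a by (simp add: tcmp_def[of C _ h] pull_post)
  next
    fix f x x' m \<xi> assume a: "tarr C f" "asrc f = x" "atgt f = x'" "m \<in> Obj C" "\<xi> \<in> Hom_dual C x m"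
    let ?f = "raw f"
    have f: "x \<in> Obj C" "x' \<in> Obj C" "?f \<in> Hom C x x'"
      using a unfolding tarr_def by auto
    let ?c = "copower_map C (Hom_dual C x m) m (P x m m) (t x m m) (P x' m m) (t x' m m) (Hom_dual_left C x' m ?f) (Id C m)"
    have c1: "?c \<in> Hom C (P x m m) (P x' m m)"
      by (rule copower_map[OF c c]) (use a f Id_Hom in \<open>auto intro: Hom_dual_left_in simp: Hom_dual_left_linear\<close>)
    have c2: "?c \<cdot> t x m m \<xi> (Id C m) = t x' m m (Hom_dual_left C x' m ?f \<xi>) (Id C m \<cdot> Id C m)"
      by (rule copower_map[OF c c]) (use a f Id_Hom in \<open>auto intro: Hom_dual_left_in simp: Hom_dual_left_linear\<close>)
    have "FA N ?f \<cdot> r x m \<xi> = (FA N ?f \<cdot> i x m) \<cdot> t x m m \<xi> (Id C m)"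
      unfolding r_def using a f Id_Hom i tT cO F.FO_Obj F.FA_Hom
      by (intro Comp_assoc[where w=m and x="P x m m" and y="FO N x" and z="FO N x'", symmetric]) auto
    also have "\<dots> = i x' m \<cdot> (?c \<cdot> t x m m \<xi> (Id C m))"
      unfolding NA[OF f a(4)] using a f Id_Hom i tT cO F.FO_Obj c1
      by (intro Comp_assoc[where w=m and x="P x m m" and y="P x' m m" and z="FO N x'"]) auto
    also have "\<dots> = r x' m (Hom_dual_left C x' m ?f \<xi>)"
      unfolding c2 r_def using a f Id_Hom Comp_Id by simp
    finally show "tcmp C (FA (tF N) f) (Arrow m (r x m \<xi>) (FO N x)) = Arrow m (r x' m (pull x' m (\<lambda>g. tcmp C g f) \<xi>)) (FO N x')"
      using a by (simp add: tcmp_def[of C "Arrow (FO N x) (FA N (raw f)) (FO N x')"] pull_pre)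
  next
    fix x u v assume a: "x \<in> Obj C" "tarr C u" "tarr C v" "asrc u = FO (tF N) x" "asrc v = FO (tF N) x" "atgt u = atgt v"
      and eq: "\<And>m \<xi>. \<lbrakk>m \<in> Obj C; \<xi> \<in> Hom_dual C x m\<rbrakk> \<Longrightarrow>
        tcmp C u (Arrow m (r x m \<xi>) (FO N x)) = tcmp C v (Arrow m (r x m \<xi>) (FO N x))"
    let ?d = "atgt u"
    have u: "?d \<in> Obj C" "raw u \<in> Hom C (FO N x) ?d" "raw v \<in> Hom C (FO N x) ?d"
      using a unfolding tarr_def by auto
    have w: "raw w \<cdot> i x m \<cdot> t x m m \<xi> g = (raw w \<cdot> r x m \<xi>) \<cdot> g"
      if "raw w \<in> Hom C (FO N x) ?d" "m \<in> Obj C" "y \<in> Obj C" "\<xi> \<in> Hom_dual C x m" "g \<in> Hom C y m" for w m y \<xi> g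
    proof -
      have "raw w \<cdot> i x m \<cdot> t x m m \<xi> g = raw w \<cdot> (r x m \<xi> \<cdot> g)"
        unfolding r_Comp[OF a(1) that(2-5)] using that a(1) u i tT cO F.FO_Obj
        by (intro Comp_assoc[where w=y and x="P x m m" and y="FO N x" and z="?d"]) auto
      also have "\<dots> = (raw w \<cdot> r x m \<xi>) \<cdot> g"
        using that a(1) u r F.FO_Obj by (intro Comp_assoc[where w=y and x=m and y="FO N x" and z="?d", symmetric]) auto
      finally show ?thesis .
    qed
    have ui: "raw u \<cdot> i x m \<in> Hom C (P x m m) ?d" "raw v \<cdot> i x m \<in> Hom C (P x m m) ?d" if "m \<in> Obj C" for m
      using that a(1) u i cO F.FO_Obj by (auto intro!: Comp_in[where x="P x m m" and y="FO N x" and z="?d"])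
    \<comment> \<open>Agreement on the encoded arrows \<open>r\<close> gives agreement on all values
      of \<open>t\<close>, and these generate the copower.\<close>
    have uv: "raw u \<cdot> i x m = raw v \<cdot> i x m" if m: "m \<in> Obj C" for m
    proof (rule copower_unique[OF c[OF a(1) m m] m u(1) ui[OF m]])
      fix y \<xi> g assume g: "y \<in> Obj C" "\<xi> \<in> Hom_dual C x m" "g \<in> Hom C y m"
      have "raw u \<cdot> r x m \<xi> = raw v \<cdot> r x m \<xi>"
        using eq[OF m g(2)] by (simp add: tcmp_def)
      then show "raw u \<cdot> i x m \<cdot> t x m m \<xi> g = raw v \<cdot> i x m \<cdot> t x m m \<xi> g"
        using w[OF u(2) m g] w[OF u(3) m g] by simp
    qed
    \<comment> \<open>Uniqueness in the coend refers to a wedge; \<open>u\<close> and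
      \<open>v\<close> induce the same one, by \<open>uv\<close>.\<close>
    have "is_wedge C C (P x) (G x) ?d (\<lambda>m. raw u \<cdot> i x m)"
      unfolding is_wedge_def
    proof (intro conjI ballI)
      fix m n h assume h: "m \<in> Obj C" "n \<in> Obj C" "h \<in> Hom C n m"
      have "raw u \<cdot> i x m \<cdot> G x m m n m (Id C m) h = raw u \<cdot> (i x m \<cdot> G x m m n m (Id C m) h)"
        using a(1) h u i G(1) Id_Hom cO F.FO_Obj by (intro Comp_assoc[where w="P x m n" and x="P x m m" and y="FO N x" and z="?d"]) auto
      also have "i x m \<cdot> G x m m n m (Id C m) h = i x n \<cdot> G x m n n n h (Id C n)"
        using coend'[OF a(1)] h by (simp add: is_coend_def is_wedge_def)
      also have "raw u \<cdot> \<dots> = raw u \<cdot> i x n \<cdot> G x m n n n h (Id C n)"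
        using a(1) h u i G(1) Id_Hom cO F.FO_Obj
        by (intro Comp_assoc[where w="P x m n" and x="P x n n" and y="FO N x" and z="?d", symmetric]) auto
      finally show "raw u \<cdot> i x m \<cdot> G x m m n m (Id C m) h = raw u \<cdot> i x n \<cdot> G x m n n n h (Id C n)" .
    qed (use u ui in auto)
    then have "\<exists>!w. w \<in> Hom C (FO N x) ?d \<and> (\<forall>m \<in> Obj C. w \<cdot> i x m = raw u \<cdot> i x m)"
      using coend'[OF a(1)] unfolding is_coend_def by blast
    then have "raw u = raw v"
      using u uv by (metis (no_types, lifting))
    then show "u = v"
      using a by (intro arrow_eqI) simp
  next
    fix x d and \<tau> :: "'o \<Rightarrow> ('m \<Rightarrow> 'k) \<Rightarrow> ('o, 'm) arrow"
    assume a: "x \<in> Obj C" "d \<in> Obj C"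
      and \<tau>: "\<And>m \<xi>. \<lbrakk>m \<in> Obj C; \<xi> \<in> Hom_dual C x m\<rbrakk> \<Longrightarrow> tarr C (\<tau> m \<xi>) \<and> asrc (\<tau> m \<xi>) = m \<and> atgt (\<tau> m \<xi>) = d"
      and \<tau>_add: "\<And>m \<xi> \<xi>'. \<lbrakk>m \<in> Obj C; \<xi> \<in> Hom_dual C x m; \<xi>' \<in> Hom_dual C x m\<rbrakk> \<Longrightarrow> \<tau> m (\<xi> + \<xi>') = tadd (\<tau> m \<xi>) (\<tau> m \<xi>')"
      and \<tau>_scl: "\<And>m \<xi> c. \<lbrakk>m \<in> Obj C; \<xi> \<in> Hom_dual C x m\<rbrakk> \<Longrightarrow> \<tau> m (dual_scl c \<xi>) = tscl C c (\<tau> m \<xi>)"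
      and \<tau>_nat: "\<And>h \<xi>. \<lbrakk>tarr C h; \<xi> \<in> Hom_dual C x (atgt h)\<rbrakk> \<Longrightarrow>
           tcmp C (\<tau> (atgt h) \<xi>) h = \<tau> (asrc h) (pull x (asrc h) (\<lambda>g. tcmp C h g) \<xi>)"
    have \<tau>': "raw (\<tau> m \<xi>) \<in> Hom C m d" if "m \<in> Obj C" "\<xi> \<in> Hom_dual C x m" for m \<xi>
      using \<tau>[OF that] by (auto simp: tarr_def simp del: T.src_Ob T.tgt_Ob)
    \<comment> \<open>Linearity of \<tau> yields arrows out of the copowers; its naturality will
      give the wedge condition, tested on the values of \<open>t\<close>.\<close>
    have "\<exists>q \<in> Hom C (P x m m) d. \<forall>y \<in> Obj C. \<forall>u \<in> Hom_dual C x m. \<forall>g \<in> Hom C y m. q \<cdot> t x m m u g = raw (\<tau> m u) \<cdot> g"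
      if m: "m \<in> Obj C" for m
      by (rule copower_universal[OF c[OF a(1) m m] m a(2)]) (use m \<tau>' \<tau>_add \<tau>_scl in auto)
    then obtain j where j: "\<And>m. m \<in> Obj C \<Longrightarrow> j m \<in> Hom C (P x m m) d"
      "\<And>m y u g. \<lbrakk>m \<in> Obj C; y \<in> Obj C; u \<in> Hom_dual C x m; g \<in> Hom C y m\<rbrakk> \<Longrightarrow> j m \<cdot> t x m m u g = raw (\<tau> m u) \<cdot> g"
      by metis
    have "is_wedge C C (P x) (G x) d j"
      unfolding is_wedge_def
    proof (intro conjI ballI)
      fix m n h assume h: "m \<in> Obj C" "n \<in> Obj C" "h \<in> Hom C n m"
      show "j m \<cdot> G x m m n m (Id C m) h = j n \<cdot> G x m n n n h (Id C n)"
      proof (rule copower_unique[OF c[OF a(1) h(1,2)] h(2) a(2)])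
        show "j m \<cdot> G x m m n m (Id C m) h \<in> Hom C (P x m n) d"
          using a h j(1) G(1) Id_Hom cO by (intro Comp_in[where x="P x m n" and y="P x m m" and z=d]) auto
        show "j n \<cdot> G x m n n n h (Id C n) \<in> Hom C (P x m n) d"
          using a h j(1) G(1) Id_Hom cO by (intro Comp_in[where x="P x m n" and y="P x n n" and z=d]) auto
        fix y u g assume g: "y \<in> Obj C" "u \<in> Hom_dual C x m" "g \<in> Hom C y n"
        have hr: "Hom_dual_right C x n h u \<in> Hom_dual C x n"
          using Hom_dual_right_in a h g by blast
        have "j m \<cdot> G x m m n m (Id C m) h \<cdot> t x m n u g = j m \<cdot> (G x m m n m (Id C m) h \<cdot> t x m n u g)"
          using a h g j(1) G(1) tT Id_Hom cO by (intro Comp_assoc[where w=y and x="P x m n" and y="P x m m" and z=d]) auto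
        also have "\<dots> = j m \<cdot> t x m m u (h \<cdot> g)"
          using a h g Id_Hom by (subst G(2)) (auto simp: Hom_dual_right_Id)
        also have "\<dots> = raw (\<tau> m u) \<cdot> (h \<cdot> g)"
          using a h g by (intro j(2)[of m y]) (auto intro: Comp_in)
        also have "\<dots> = (raw (\<tau> m u) \<cdot> h) \<cdot> g"
          using a h g \<tau>' by (intro Comp_assoc[where w=y and x=n and y=m and z=d, symmetric]) auto
        also have "raw (\<tau> m u) \<cdot> h = raw (\<tau> n (Hom_dual_right C x n h u))"
        proof -
          have "tarr C (Arrow n h m)"
            using h by (simp add: tarr_def del: T.src_Ob T.tgt_Ob)
          from \<tau>_nat[OF this, of u] g have "tcmp C (\<tau> m u) (Arrow n h m) = \<tau> n (Hom_dual_right C x n h u)"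
            by (simp add: pull_post)
          then show ?thesis
            by (metis arrow.sel(2) raw_tcmp)
        qed
        also have "\<dots> \<cdot> g = j n \<cdot> t x n n (Hom_dual_right C x n h u) (Id C n \<cdot> g)"
          using a h g hr Id_Comp by (subst j(2)[of n y]) auto
        also have "\<dots> = j n \<cdot> (G x m n n n h (Id C n) \<cdot> t x m n u g)"
          using a h g Id_Hom by (subst G(2)) auto
        also have "\<dots> = j n \<cdot> G x m n n n h (Id C n) \<cdot> t x m n u g"
          using a h g j(1) G(1) tT Id_Hom cO by (intro Comp_assoc[where w=y and x="P x m n" and y="P x n n" and z=d, symmetric]) auto
        finally show "j m \<cdot> G x m m n m (Id C m) h \<cdot> t x m n u g = j n \<cdot> G x m n n n h (Id C n) \<cdot> t x m n u g" .
      qed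
    qed (use a j in auto)
    then obtain u where u: "u \<in> Hom C (FO N x) d" "\<And>m. m \<in> Obj C \<Longrightarrow> u \<cdot> i x m = j m"
      using coend'[OF a(1)] unfolding is_coend_def by blast
    have ur: "u \<cdot> r x m \<xi> = raw (\<tau> m \<xi>)" if m: "m \<in> Obj C" "\<xi> \<in> Hom_dual C x m" for m \<xi>
    proof -
      have "u \<cdot> r x m \<xi> = (u \<cdot> i x m) \<cdot> t x m m \<xi> (Id C m)"
        unfolding r_def using a m u i tT Id_Hom cO F.FO_Obj by (intro Comp_assoc[where w=m and x="P x m m" and y="FO N x" and z=d, symmetric]) auto
      also have "\<dots> = raw (\<tau> m \<xi>) \<cdot> Id C m"
        unfolding u(2)[OF m(1)] using m Id_Hom by (intro j(2)[of m m]) auto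
      also have "\<dots> = raw (\<tau> m \<xi>)"
        using m a \<tau>' Comp_Id by blast
      finally show ?thesis .
    qed
    have "tcmp C (Arrow (FO N x) u d) (Arrow m (r x m \<xi>) (FO N x)) = \<tau> m \<xi>" if "m \<in> Obj C" "\<xi> \<in> Hom_dual C x m" for m \<xi>
      using ur[OF that] \<tau>[OF that] by (intro arrow_eqI) (simp_all add: tcmp_def)
    moreover have "tarr C (Arrow (FO N x) u d)"
      using a u F.FO_Obj by (simp add: tarr_def del: T.src_Ob T.tgt_Ob)
    ultimately show "\<exists>u. tarr C u \<and> asrc u = FO (tF N) x \<and> atgt u = d \<and>
        (\<forall>m \<in> Obj C. \<forall>\<xi> \<in> Hom_dual C x m. tcmp C u (Arrow m (r x m \<xi>) (FO N x)) = \<tau> m \<xi>)"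
      by (intro exI[of _ "Arrow (FO N x) u d"]) auto
  qed auto
qed

end

section \<open>Tensor categories and bimodule categories with typed arrows\<close>

text \<open>After the inner evaluation a unit stands between two factors. The reversed tensor
  product merges it with the left factor by \<open>ru\<close>, the formula of
  \<open>rdual_tens\<close> with the right factor by \<open>lun\<close>; the triangle shows that
  both give the same arrow.\<close>

lemma (in monoidal) nested_reversed:
  assumes [simp]: "k \<in> Ob" "l \<in> Ob" "x \<in> Ob" "y \<in> Ob" "arr e" "src e = l \<odot> x" "tgt e = I"
  shows "((ru k \<bullet>\<^sub>A (one k \<odot>\<^sub>f e) \<bullet>\<^sub>A as k l x) \<odot>\<^sub>f one y) \<bullet>\<^sub>A A.iv (as (k \<odot> l) x y)
    = (one k \<odot>\<^sub>f (lu y \<bullet>\<^sub>A (e \<odot>\<^sub>f one y) \<bullet>\<^sub>A A.iv (as l x y))) \<bullet>\<^sub>A as k l (x \<odot> y)"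
proof (rule A.cancel_right)
  interpret R: module_cat Ob arr src tgt cmp one tns tna I as lu ru Ob arr src tgt cmp one tns tna as lu
    by (rule regular)
  have "(one k \<odot>\<^sub>f (lu y \<bullet>\<^sub>A (e \<odot>\<^sub>f one y) \<bullet>\<^sub>A A.iv (as l x y))) \<bullet>\<^sub>A as k l (x \<odot> y) \<bullet>\<^sub>A as (k \<odot> l) x y
     = (one k \<odot>\<^sub>f lu y) \<bullet>\<^sub>A (one k \<odot>\<^sub>f e \<odot>\<^sub>f one y) \<bullet>\<^sub>A as k (l \<odot> x) y \<bullet>\<^sub>A (as k l x \<odot>\<^sub>f one y)"
    by (simp add: pentagon interchange' A.assoc)
  also have "\<dots> = (one k \<odot>\<^sub>f lu y) \<bullet>\<^sub>A as k I y \<bullet>\<^sub>A ((one k \<odot>\<^sub>f e) \<odot>\<^sub>f one y) \<bullet>\<^sub>A (as k l x \<odot>\<^sub>f one y)"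
    by (simp add: A.cmp_cong2[OF R.as'_nat[symmetric]] A.assoc)
  also have "\<dots> = (ru k \<odot>\<^sub>f one y) \<bullet>\<^sub>A ((one k \<odot>\<^sub>f e) \<odot>\<^sub>f one y) \<bullet>\<^sub>A (as k l x \<odot>\<^sub>f one y)"
    by (simp add: A.cmp_cong2[OF triangle])
  finally show "(((ru k \<bullet>\<^sub>A (one k \<odot>\<^sub>f e) \<bullet>\<^sub>A as k l x) \<odot>\<^sub>f one y) \<bullet>\<^sub>A A.iv (as (k \<odot> l) x y)) \<bullet>\<^sub>A as (k \<odot> l) x y
    = ((one k \<odot>\<^sub>f (lu y \<bullet>\<^sub>A (e \<odot>\<^sub>f one y) \<bullet>\<^sub>A A.iv (as l x y))) \<bullet>\<^sub>A as k l (x \<odot> y)) \<bullet>\<^sub>A as (k \<odot> l) x y"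
    by (simp add: interchange A.assoc)
qed auto

definition tbif :: "('oa \<Rightarrow> 'om \<Rightarrow> 'op) \<Rightarrow> ('ma \<Rightarrow> 'mm \<Rightarrow> 'mp) \<Rightarrow> ('oa, 'ma) arrow \<Rightarrow> ('om, 'mm) arrow \<Rightarrow> ('op, 'mp) arrow" where
  "tbif T Ta f g = Arrow (T (asrc f) (asrc g)) (Ta (raw f) (raw g)) (T (atgt f) (atgt g))"

lemma raw_tbif [simp]: "raw (tbif T Ta f g) = Ta (raw f) (raw g)"
  by (simp add: tbif_def)

lemma tarr_D:
  "tarr C f \<Longrightarrow> asrc f \<in> Obj C" "tarr C f \<Longrightarrow> atgt f \<in> Obj C" "tarr C f \<Longrightarrow> raw f \<in> Hom C (asrc f) (atgt f)"
  by (auto simp: tarr_def)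

lemma tarr_Arrow: "\<lbrakk>x \<in> Obj C; y \<in> Obj C; f \<in> Hom C x y\<rbrakk> \<Longrightarrow> tarr C (Arrow x f y)"
  by (simp add: tarr_def)

lemma bilinear_bifunctor:
  assumes "linear_category A" "linear_category M" "bilinear_functor A M M T Ta"
  shows "bifunctor (Obj A) (tarr A) asrc atgt (tcmp A) (tone A) (Obj M) (tarr M) asrc atgt (tcmp M) (tone M) T (tbif T Ta)"
proof -
  interpret A: linear_category A by fact
  interpret M: linear_category M by fact
  interpret bilinear_functor A M M T Ta by fact
  show ?thesis
  proof unfold_locales
    fix f h assume "tarr A f" "tarr M h"
    then show "tarr M (tbif T Ta f h)"
      unfolding tbif_def by (intro tarr_Arrow bi_Obj bi_Hom) (auto dest: tarr_D)
  next
    fix f g h k assume "tarr A f" "tarr A g" "tarr M h" "tarr M k" "asrc g = atgt f" "asrc k = atgt h"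
    then show "tcmp M (tbif T Ta g k) (tbif T Ta f h) = tbif T Ta (tcmp A g f) (tcmp M k h)"
      using tarr_D[of A f] tarr_D[of A g] tarr_D[of M h] tarr_D[of M k]
        bi_Comp[of "asrc f" "atgt f" "atgt g" "asrc h" "atgt h" "atgt k" "raw f" "raw g" "raw h" "raw k"]
      by (simp add: tbif_def tcmp_def)
  qed (auto simp: tbif_def tone_def bi_Obj bi_Id)
qed

lemma bilinear_functor_flip:
  assumes "bilinear_functor M B P T Ta"
  shows "bilinear_functor B M P (\<lambda>b m. T m b) (\<lambda>g h. Ta h g)"
proof -
  interpret bilinear_functor M B P T Ta by fact
  show ?thesis
    by unfold_locales (auto intro: bi_Obj bi_Hom bi_Id bi_Comp bi_add_left bi_add_right bi_scl_left bi_scl_right)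
qed

section \<open>Inverses and zero arrows: typed against raw\<close>

context linear_category
begin

text \<open>The definite description does not fix the endpoints. Endpoints other than
  \<open>x\<close> and \<open>y\<close> are possible only for \<open>f = 0\<close>, and then the
  identities at the endpoints vanish, so that every inverse is \<open>0\<close> as well.\<close>

lemma inv_arrow_eq:
  assumes i: "inverse_arrows C x y f g" and x: "x \<in> Obj C" "y \<in> Obj C"
  shows "inv f = g"
  unfolding inv_arrow_def
proof (rule the_equality)
  show "\<exists>x\<in>Obj C. \<exists>y\<in>Obj C. inverse_arrows C x y f g"
    using assms by blast
  fix g' assume "\<exists>x\<in>Obj C. \<exists>y\<in>Obj C. inverse_arrows C x y f g'"
  then obtain x' y' where i': "inverse_arrows C x' y' f g'" and x': "x' \<in> Obj C" "y' \<in> Obj C" by blast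
  note d = i[unfolded inverse_arrows_def] i'[unfolded inverse_arrows_def]
  show "g' = g"
  proof (cases "(x, y) = (x', y')")
    case True
    then have d': "g' \<in> Hom C y x" "f \<cdot> g' = Id C y" using d by auto
    have "g' = (g \<cdot> f) \<cdot> g'" using d d' x Id_Comp by simp
    also have "\<dots> = g \<cdot> (f \<cdot> g')" using d d' x by (intro Comp_assoc[where w=y and x=x and y=y and z=x]) auto
    also have "\<dots> = g" unfolding d'(2) using d x by (blast intro: Comp_Id)
    finally show ?thesis .
  next
    case False
    then have "f = 0" using Hom_disjoint[OF x x'] d by blast
    have z: "h = 0" if h: "h \<in> Hom C b a" "f \<in> Hom C a b" "h \<cdot> f = Id C a" "a \<in> Obj C" "b \<in> Obj C" for h a b
    proof -
      have "h \<cdot> f = h \<cdot> scl C 0 f" using \<open>f = 0\<close> by simp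
      also have "\<dots> = 0" using Comp_scl_right[OF h(4,5,4,2,1), of 0] by simp
      finally have "Id C a = 0" using h by simp
      then have "h = scl C 0 (Id C a) \<cdot> h" using Id_Comp[OF h(5,4,1)] by simp
      also have "\<dots> = 0" using Comp_scl_left[OF h(5,4,4,1) Id_Hom[OF h(4)], of 0] by simp
      finally show ?thesis .
    qed
    show ?thesis using z[of g y x] z[of g' y' x'] d x x' by simp
  qed
qed

lemma iso_typed:
  assumes "iso_arrow C x y f" "x \<in> Obj C" "y \<in> Obj C"
  shows "T.iso (Arrow x f y)" "T.iv (Arrow x f y) = Arrow y (inv f) x"
proof -
  obtain g where g: "inverse_arrows C x y f g" using assms by (auto simp: iso_arrow_def)
  have *: "T.invs (Arrow x f y) (Arrow y g x)"
    using g assms unfolding T.invs_def inverse_arrows_def by (simp add: tarr_def tcmp_def tone_def del: T.src_Ob T.tgt_Ob)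
  then show "T.iso (Arrow x f y)" by (auto simp: T.iso_def)
  show "T.iv (Arrow x f y) = Arrow y (inv f) x"
    using T.iv_eq[OF *] inv_arrow_eq[OF g] assms by simp
qed

lemma raw_iv:
  assumes "T.iso f"
  shows "raw (T.iv f) = inv (raw f)"
proof -
  have "T.invs f (T.iv f)" by (rule T.invs_iv[OF assms])
  then have "inverse_arrows C (asrc f) (atgt f) (raw f) (raw (T.iv f))"
    unfolding T.invs_def inverse_arrows_def by (metis raw_tcmp raw_tone tarr_D(3))
  then show ?thesis
    using inv_arrow_eq assms tarr_D T.iso_arr by metis
qed

lemma iso_arrow_raw:
  assumes "T.iso f" "asrc f = x" "atgt f = y"
  shows "iso_arrow C x y (raw f)"
proof -
  have "T.invs f (T.iv f)" by (rule T.invs_iv[OF assms(1)])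
  then show ?thesis
    unfolding T.invs_def iso_arrow_def inverse_arrows_def using assms(2,3) by (metis raw_tcmp raw_tone tarr_D(3))
qed

lemma raw_tcmp_zero:
  assumes "tarr C f" "tarr C g" "asrc g = atgt f" "raw f = 0 \<or> raw g = 0"
  shows "raw (tcmp C g f) = 0"
  using assms(4)
proof
  note d = tarr_D[OF assms(1)] tarr_D[OF assms(2)]
  assume "raw f = 0"
  then show ?thesis
    using Comp_scl_right[of "asrc f" "atgt f" "atgt g" "raw f" "raw g" 0] d assms(3) by simp
next
  note d = tarr_D[OF assms(1)] tarr_D[OF assms(2)]
  assume "raw g = 0"
  then show ?thesis
    using Comp_scl_left[of "asrc f" "atgt f" "atgt g" "raw f" "raw g" 0] d assms(3) by simp
qed

end

lemma (in bilinear_functor) bi_zero: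
  assumes "linear_category A" "linear_category M" "linear_category P" "tarr A f" "tarr M g"
  shows "raw f = 0 \<Longrightarrow> Ta (raw f) (raw g) = 0" "raw g = 0 \<Longrightarrow> Ta (raw f) (raw g) = 0"
proof -
  interpret A: linear_category A by fact
  interpret M: linear_category M by fact
  interpret P: linear_category P by fact
  note d = tarr_D[OF assms(4)] tarr_D[OF assms(5)]
  show "raw f = 0 \<Longrightarrow> Ta (raw f) (raw g) = 0"
    using bi_scl_left[of "asrc f" "atgt f" "asrc g" "atgt g" "raw f" "raw g" 0] d by simp
  show "raw g = 0 \<Longrightarrow> Ta (raw f) (raw g) = 0"
    using bi_scl_right[of "asrc f" "atgt f" "asrc g" "atgt g" "raw f" "raw g" 0] d by simp
qed

section \<open>Tensor categories with typed structure arrows\<close>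

definition t_asc where "t_asc C x y z = Arrow ((x \<otimes>\<^bsub>C\<^esub> y) \<otimes>\<^bsub>C\<^esub> z) (asc C x y z) (x \<otimes>\<^bsub>C\<^esub> (y \<otimes>\<^bsub>C\<^esub> z))"
definition t_lun where "t_lun C x = Arrow (unit C \<otimes>\<^bsub>C\<^esub> x) (lun C x) x"
definition t_run where "t_run C x = Arrow (x \<otimes>\<^bsub>C\<^esub> unit C) (run C x) x"
definition t_lev where "t_lev C x = Arrow (x \<otimes>\<^bsub>C\<^esub> ldual C x) (lev C x) (unit C)"
definition t_lcoev where "t_lcoev C x = Arrow (unit C) (lcoev C x) (ldual C x \<otimes>\<^bsub>C\<^esub> x)"
definition t_rev where "t_rev C x = Arrow (rdual C x \<otimes>\<^bsub>C\<^esub> x) (rev C x) (unit C)"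
definition t_rcoev where "t_rcoev C x = Arrow (unit C) (rcoev C x) (x \<otimes>\<^bsub>C\<^esub> rdual C x)"

lemmas t_defs = t_asc_def t_lun_def t_run_def t_lev_def t_lcoev_def t_rev_def t_rcoev_def

lemma t_sel [simp]:
  "raw (t_asc C x y z) = asc C x y z" "asrc (t_asc C x y z) = (x \<otimes>\<^bsub>C\<^esub> y) \<otimes>\<^bsub>C\<^esub> z" "atgt (t_asc C x y z) = x \<otimes>\<^bsub>C\<^esub> (y \<otimes>\<^bsub>C\<^esub> z)"
  "raw (t_lun C x) = lun C x" "asrc (t_lun C x) = unit C \<otimes>\<^bsub>C\<^esub> x" "atgt (t_lun C x) = x"
  "raw (t_run C x) = run C x" "asrc (t_run C x) = x \<otimes>\<^bsub>C\<^esub> unit C" "atgt (t_run C x) = x"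
  "raw (t_lev C x) = lev C x" "asrc (t_lev C x) = x \<otimes>\<^bsub>C\<^esub> ldual C x" "atgt (t_lev C x) = unit C"
  "raw (t_lcoev C x) = lcoev C x" "asrc (t_lcoev C x) = unit C" "atgt (t_lcoev C x) = ldual C x \<otimes>\<^bsub>C\<^esub> x"
  "raw (t_rev C x) = rev C x" "asrc (t_rev C x) = rdual C x \<otimes>\<^bsub>C\<^esub> x" "atgt (t_rev C x) = unit C"
  "raw (t_rcoev C x) = rcoev C x" "asrc (t_rcoev C x) = unit C" "atgt (t_rcoev C x) = x \<otimes>\<^bsub>C\<^esub> rdual C x"
  by (simp_all add: t_defs)

context finite_tensor_category
begin

sublocale lc: linear_category C
  using finite_linear by (simp add: finite_linear_category_def)

lemma bifun: "bifunctor (Obj C) (tarr C) asrc atgt (tcmp C) (tone C) (Obj C) (tarr C) asrc atgt (tcmp C) (tone C)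
   (tens C) (tbif (tens C) (tensa C))"
  by (rule bilinear_bifunctor[OF lc.linear_category_axioms lc.linear_category_axioms tens_bilinear])

interpretation b: bifunctor "Obj C" "tarr C" asrc atgt "tcmp C" "tone C" "Obj C" "tarr C" asrc atgt "tcmp C" "tone C"
   "tens C" "tbif (tens C) (tensa C)"
  by (rule bifun)

lemma t_iso:
  "\<lbrakk>x \<in> Obj C; y \<in> Obj C; z \<in> Obj C\<rbrakk> \<Longrightarrow> lc.T.iso (t_asc C x y z)"
  "x \<in> Obj C \<Longrightarrow> lc.T.iso (t_lun C x)"
  "x \<in> Obj C \<Longrightarrow> lc.T.iso (t_run C x)"
  unfolding t_defs using unit_Obj by (auto intro!: lc.iso_typed asc_iso lun_iso run_iso)

lemma typed_monoidal: "monoidal (Obj C) (tarr C) asrc atgt (tcmp C) (tone C) (tens C) (tbif (tens C) (tensa C))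
    (unit C) (t_asc C) (t_lun C) (t_run C)"
proof unfold_locales
  fix f g h assume "tarr C f" "tarr C g" "tarr C h"
  then show "tcmp C (t_asc C (atgt f) (atgt g) (atgt h)) (tbif (tens C) (tensa C) (tbif (tens C) (tensa C) f g) h)
    = tcmp C (tbif (tens C) (tensa C) f (tbif (tens C) (tensa C) g h)) (t_asc C (asrc f) (asrc g) (asrc h))"
    using asc_natural[of "asrc f" "atgt f" "asrc g" "atgt g" "asrc h" "atgt h"] tarr_D[of C f] tarr_D[of C g] tarr_D[of C h]
    by (simp add: tcmp_def tbif_def)
next
  fix f assume "tarr C f"
  then show "tcmp C (t_lun C (atgt f)) (tbif (tens C) (tensa C) (tone C (unit C)) f) = tcmp C f (t_lun C (asrc f))"
    using lun_natural[of "asrc f" "atgt f"] tarr_D[of C f] by (simp add: tcmp_def tbif_def)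
next
  fix f assume "tarr C f"
  then show "tcmp C (t_run C (atgt f)) (tbif (tens C) (tensa C) f (tone C (unit C))) = tcmp C f (t_run C (asrc f))"
    using run_natural[of "asrc f" "atgt f"] tarr_D[of C f] by (simp add: tcmp_def tbif_def)
next
  fix w x y z assume a: "w \<in> Obj C" "x \<in> Obj C" "y \<in> Obj C" "z \<in> Obj C"
  \<comment> \<open>Raw composition associates to the left, typed composition is nested to the
    right. The axiom is read in the raw bracketing, then reassociated, which needs matching
    endpoints.\<close>
  have "tcmp C (t_asc C w x (y \<otimes> z)) (t_asc C (w \<otimes> x) y z)
     = tcmp C (tcmp C (tbif (tens C) (tensa C) (tone C w) (t_asc C x y z)) (t_asc C w (x \<otimes> y) z)) (tbif (tens C) (tensa C) (t_asc C w x y) (tone C z))"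
    using pentagon[OF a] by (simp add: tcmp_def tbif_def)
  then show "tcmp C (t_asc C w x (y \<otimes> z)) (t_asc C (w \<otimes> x) y z) =
       tcmp C (tbif (tens C) (tensa C) (tone C w) (t_asc C x y z))
        (tcmp C (t_asc C w (x \<otimes> y) z) (tbif (tens C) (tensa C) (t_asc C w x y) (tone C z)))"
    using a t_iso by (simp add: lc.T.assoc)
next
  fix x y assume a: "x \<in> Obj C" "y \<in> Obj C"
  show "tcmp C (tbif (tens C) (tensa C) (tone C x) (t_lun C y)) (t_asc C x (unit C) y) = tbif (tens C) (tensa C) (t_run C x) (tone C y)"
    using triangle[OF a] by (simp add: tcmp_def tbif_def)
qed (use unit_Obj t_iso in auto)

interpretation m: monoidal "Obj C" "tarr C" asrc atgt "tcmp C" "tone C" "tens C" "tbif (tens C) (tensa C)"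
    "unit C" "t_asc C" "t_lun C" "t_run C"
  by (rule typed_monoidal)

lemma t_ev_typ:
  assumes "x \<in> Obj C"
  shows "tarr C (t_lev C x)" "tarr C (t_lcoev C x)" "tarr C (t_rev C x)" "tarr C (t_rcoev C x)"
  using assms lev_Hom lcoev_Hom rev_Hom rcoev_Hom ldual_Obj rdual_Obj unit_Obj
  unfolding t_defs by (auto intro!: tarr_Arrow)

lemma typed_left_rigid: "left_rigid (Obj C) (tarr C) asrc atgt (tcmp C) (tone C) (tens C) (tbif (tens C) (tensa C))
    (unit C) (t_asc C) (t_lun C) (t_run C) (ldual C) (t_lev C) (t_lcoev C)"
proof unfold_locales
  fix x assume x: "x \<in> Obj C"
  note [simp] = x ldual_Obj[OF x] t_ev_typ[OF x]
  let ?k = "ldual C x" and ?e = "t_lev C x" and ?c = "t_lcoev C x"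
  let ?t = "tbif (tens C) (tensa C)"
  have "tcmp C (tcmp C (tcmp C (tcmp C (t_lun C x) (?t ?e (tone C x))) (lc.T.iv (t_asc C x ?k x))) (?t (tone C x) ?c)) (lc.T.iv (t_run C x))
     = tone C x"
    by (rule arrow_eqI) (simp_all add: lc.raw_iv ldual_zigzag1[OF x])
  then have 1: "tcmp C (tcmp C (t_lun C x) (tcmp C (?t ?e (tone C x)) (tcmp C (lc.T.iv (t_asc C x ?k x)) (?t (tone C x) ?c)))) (lc.T.iv (t_run C x))
     = tcmp C (t_run C x) (lc.T.iv (t_run C x))"
    by (simp add: lc.T.assoc)
  have "tcmp C (t_lun C x) (tcmp C (?t ?e (tone C x)) (tcmp C (lc.T.iv (t_asc C x ?k x)) (?t (tone C x) ?c))) = t_run C x"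
    by (rule lc.T.cancel_right[OF 1]) auto
  moreover
  have "tcmp C (tcmp C (tcmp C (tcmp C (t_run C ?k) (?t (tone C ?k) ?e)) (t_asc C ?k x ?k)) (?t ?c (tone C ?k))) (lc.T.iv (t_lun C ?k))
     = tone C ?k"
    by (rule arrow_eqI) (simp_all add: lc.raw_iv ldual_zigzag2[OF x])
  then have 2: "tcmp C (tcmp C (t_run C ?k) (tcmp C (?t (tone C ?k) ?e) (tcmp C (t_asc C ?k x ?k) (?t ?c (tone C ?k))))) (lc.T.iv (t_lun C ?k))
     = tcmp C (t_lun C ?k) (lc.T.iv (t_lun C ?k))"
    by (simp add: lc.T.assoc)
  have "tcmp C (t_run C ?k) (tcmp C (?t (tone C ?k) ?e) (tcmp C (t_asc C ?k x ?k) (?t ?c (tone C ?k)))) = t_lun C ?k"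
    by (rule lc.T.cancel_right[OF 2]) auto
  ultimately show "m.dual_pair x ?k ?e ?c"
    unfolding m.dual_pair_def by simp
qed

text \<open>Right duals are left duals for the reversed tensor product.\<close>

lemma typed_right_rigid: "left_rigid (Obj C) (tarr C) asrc atgt (tcmp C) (tone C) (\<lambda>x y. y \<otimes> x) (\<lambda>f g. tbif (tens C) (tensa C) g f)
    (unit C) (\<lambda>x y z. lc.T.iv (t_asc C z y x)) (t_run C) (t_lun C) (rdual C) (t_rev C) (t_rcoev C)"
proof -
  interpret r: monoidal "Obj C" "tarr C" asrc atgt "tcmp C" "tone C" "\<lambda>x y. y \<otimes> x" "\<lambda>f g. tbif (tens C) (tensa C) g f"
    "unit C" "\<lambda>x y z. lc.T.iv (t_asc C z y x)" "t_run C" "t_lun C"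
    by (rule m.reversed)
  show ?thesis
  proof unfold_locales
    fix x assume x: "x \<in> Obj C"
    note [simp] = x rdual_Obj[OF x] t_ev_typ[OF x]
    let ?k = "rdual C x" and ?e = "t_rev C x" and ?c = "t_rcoev C x"
    let ?t = "tbif (tens C) (tensa C)"
    have "tcmp C (tcmp C (tcmp C (tcmp C (t_run C x) (?t (tone C x) ?e)) (t_asc C x ?k x)) (?t ?c (tone C x))) (lc.T.iv (t_lun C x))
       = tone C x"
      by (rule arrow_eqI) (simp_all add: lc.raw_iv rdual_zigzag1[OF x])
    then have 1: "tcmp C (tcmp C (t_run C x) (tcmp C (?t (tone C x) ?e) (tcmp C (t_asc C x ?k x) (?t ?c (tone C x))))) (lc.T.iv (t_lun C x))
       = tcmp C (t_lun C x) (lc.T.iv (t_lun C x))"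
      by (simp add: lc.T.assoc)
    have "tcmp C (t_run C x) (tcmp C (?t (tone C x) ?e) (tcmp C (t_asc C x ?k x) (?t ?c (tone C x)))) = t_lun C x"
      by (rule lc.T.cancel_right[OF 1]) auto
    moreover
    have "tcmp C (tcmp C (tcmp C (tcmp C (t_lun C ?k) (?t ?e (tone C ?k))) (lc.T.iv (t_asc C ?k x ?k))) (?t (tone C ?k) ?c)) (lc.T.iv (t_run C ?k))
       = tone C ?k"
      by (rule arrow_eqI) (simp_all add: lc.raw_iv rdual_zigzag2[OF x])
    then have 2: "tcmp C (tcmp C (t_lun C ?k) (tcmp C (?t ?e (tone C ?k)) (tcmp C (lc.T.iv (t_asc C ?k x ?k)) (?t (tone C ?k) ?c)))) (lc.T.iv (t_run C ?k))
       = tcmp C (t_run C ?k) (lc.T.iv (t_run C ?k))"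
      by (simp add: lc.T.assoc)
    have "tcmp C (t_lun C ?k) (tcmp C (?t ?e (tone C ?k)) (tcmp C (lc.T.iv (t_asc C ?k x ?k)) (?t (tone C ?k) ?c))) = t_run C ?k"
      by (rule lc.T.cancel_right[OF 2]) auto
    ultimately show "r.dual_pair x ?k ?e ?c"
      unfolding r.dual_pair_def by simp
  qed
qed

sublocale l: left_rigid "Obj C" "tarr C" asrc atgt "tcmp C" "tone C" "tens C" "tbif (tens C) (tensa C)"
    "unit C" "t_asc C" "t_lun C" "t_run C" "ldual C" "t_lev C" "t_lcoev C"
  by (rule typed_left_rigid)

sublocale r: left_rigid "Obj C" "tarr C" asrc atgt "tcmp C" "tone C" "\<lambda>x y. y \<otimes> x" "\<lambda>f g. tbif (tens C) (tensa C) g f"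
    "unit C" "\<lambda>x y z. lc.T.iv (t_asc C z y x)" "t_run C" "t_lun C" "rdual C" "t_rev C" "t_rcoev C"
  by (rule typed_right_rigid)

end

section \<open>Typed duals and double dual constraints against their raw definitions\<close>

context finite_tensor_category
begin

lemma raw_l_ltr:
  assumes "x \<in> Obj C" "d \<in> Obj C" "tarr C g" "asrc g = x \<otimes> d" "atgt g = unit C"
  shows "raw (l.ltr x d g) = ltranspose C x d (raw g)"
proof -
  let ?t = "tbif (tens C) (tensa C)" and ?k = "ldual C x"
  have "l.ltr x d g = tcmp C (tcmp C (tcmp C (tcmp C (t_run C ?k) (?t (tone C ?k) g)) (t_asc C ?k x d)) (?t (t_lcoev C x) (tone C d)))
     (lc.T.iv (t_lun C d))"
    using assms by (simp add: l.ltr_def lc.T.assoc)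
  then show ?thesis
    using assms by (simp add: ltranspose_def lc.raw_iv)
qed

lemma raw_r_ltr:
  assumes "x \<in> Obj C" "d \<in> Obj C" "tarr C g" "asrc g = d \<otimes> x" "atgt g = unit C"
  shows "raw (r.ltr x d g) = rtranspose C x d (raw g)"
proof -
  let ?t = "tbif (tens C) (tensa C)" and ?k = "rdual C x"
  have "r.ltr x d g = tcmp C (tcmp C (tcmp C (tcmp C (t_lun C ?k) (?t g (tone C ?k))) (lc.T.iv (t_asc C d x ?k))) (?t (tone C d) (t_rcoev C x)))
     (lc.T.iv (t_run C d))"
    using assms by (simp add: r.ltr_def lc.T.assoc)
  then show ?thesis
    using assms by (simp add: rtranspose_def lc.raw_iv)
qed

lemma raw_tens_zero:
  assumes "tarr C f" "tarr C g" "raw f = 0 \<or> raw g = 0"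
  shows "raw (tbif (tens C) (tensa C) f g) = 0"
  using assms bilinear_functor.bi_zero[OF tens_bilinear lc.linear_category_axioms lc.linear_category_axioms lc.linear_category_axioms, of f g]
  by auto

text \<open>The typed dual of an arrow agrees with \<^const>\<open>ldual_arr\<close> also on zero arrows, whose endpoints
  \<^const>\<open>ldual_arr\<close> cannot recover, because both are then \<open>0\<close>.\<close>

lemma raw_l_da_zero:
  assumes "tarr C f" "raw f = 0"
  shows "raw (l.da f) = 0"
  unfolding l.da_def l.ltr_def
  using assms by (simp add: lc.raw_tcmp_zero raw_tens_zero del: raw_tcmp raw_tbif)

lemma raw_r_da_zero:
  assumes "tarr C f" "raw f = 0"
  shows "raw (r.da f) = 0"
  unfolding r.da_def r.ltr_def
  using assms by (simp add: lc.raw_tcmp_zero raw_tens_zero del: raw_tcmp raw_tbif)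

lemma raw_l_da':
  assumes "tarr C f"
  shows "raw (l.da f) = ltranspose C (asrc f) (ldual C (atgt f)) (lev C (atgt f) \<cdot> (raw f \<star> Id C (ldual C (atgt f))))"
  unfolding l.da_def using assms by (subst raw_l_ltr) auto

lemma raw_r_da':
  assumes "tarr C f"
  shows "raw (r.da f) = rtranspose C (asrc f) (rdual C (atgt f)) (rev C (atgt f) \<cdot> (Id C (rdual C (atgt f)) \<star> raw f))"
  unfolding r.da_def using assms by (subst raw_r_ltr) auto

text \<open>Different hom-spaces meet only in \<open>0\<close>, so wrong endpoints can be ascribed
  to a zero arrow only.\<close>

lemma same_raw:
  assumes "tarr C f" "x \<in> Obj C" "y \<in> Obj C" "raw f \<in> Hom C x y"
  shows "Arrow x (raw f) y = f \<or> raw f = 0"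
proof (cases "(x, y) = (asrc f, atgt f)")
  case False
  then have "Hom C x y \<inter> Hom C (asrc f) (atgt f) = {0}"
    using assms tarr_D[OF assms(1)] by (intro lc.Hom_disjoint) auto
  then show ?thesis
    using assms tarr_D[OF assms(1)] by auto
qed (cases f, simp)

text \<open>The definite description ranges over all admissible endpoints. By
  \<open>same_raw\<close> they are those of \<open>f\<close>, or \<open>f\<close> is zero and every
  choice yields \<open>0\<close> by \<open>raw_l_da_zero\<close>.\<close>

lemma raw_l_da:
  assumes f: "tarr C f"
  shows "raw (l.da f) = ldual_arr C (raw f)"
  unfolding ldual_arr_def
proof (rule the_equality[symmetric])
  show "\<exists>x\<in>Obj C. \<exists>y\<in>Obj C. raw f \<in> Hom C x y \<and>
      raw (l.da f) = ltranspose C x (ldual C y) (lev C y \<cdot> (raw f \<star> Id C (ldual C y)))"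
    using tarr_D[OF f] raw_l_da'[OF f] by blast
  fix g assume "\<exists>x\<in>Obj C. \<exists>y\<in>Obj C. raw f \<in> Hom C x y \<and> g = ltranspose C x (ldual C y) (lev C y \<cdot> (raw f \<star> Id C (ldual C y)))"
  then obtain x y where g: "x \<in> Obj C" "y \<in> Obj C" "raw f \<in> Hom C x y"
    "g = ltranspose C x (ldual C y) (lev C y \<cdot> (raw f \<star> Id C (ldual C y)))" by blast
  let ?f = "Arrow x (raw f) y"
  have f': "tarr C ?f" using g by (intro tarr_Arrow)
  have "g = raw (l.da ?f)" using raw_l_da'[OF f'] g(4) by simp
  then show "g = raw (l.da f)"
    using same_raw[OF f g(1-3)] raw_l_da_zero[OF f'] raw_l_da_zero[OF f] by auto
qed

lemma raw_r_da:
  assumes f: "tarr C f"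
  shows "raw (r.da f) = rdual_arr C (raw f)"
  unfolding rdual_arr_def
proof (rule the_equality[symmetric])
  show "\<exists>x\<in>Obj C. \<exists>y\<in>Obj C. raw f \<in> Hom C x y \<and>
      raw (r.da f) = rtranspose C x (rdual C y) (rev C y \<cdot> (Id C (rdual C y) \<star> raw f))"
    using tarr_D[OF f] raw_r_da'[OF f] by blast
  fix g assume "\<exists>x\<in>Obj C. \<exists>y\<in>Obj C. raw f \<in> Hom C x y \<and> g = rtranspose C x (rdual C y) (rev C y \<cdot> (Id C (rdual C y) \<star> raw f))"
  then obtain x y where g: "x \<in> Obj C" "y \<in> Obj C" "raw f \<in> Hom C x y"
    "g = rtranspose C x (rdual C y) (rev C y \<cdot> (Id C (rdual C y) \<star> raw f))" by blast
  let ?f = "Arrow x (raw f) y"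
  have f': "tarr C ?f" using g by (intro tarr_Arrow)
  have "g = raw (r.da ?f)" using raw_r_da'[OF f'] g(4) by simp
  then show "g = raw (r.da f)"
    using same_raw[OF f g(1-3)] raw_r_da_zero[OF f'] raw_r_da_zero[OF f] by auto
qed

lemma raw_l_dtens:
  assumes [simp]: "x \<in> Obj C" "y \<in> Obj C"
  shows "raw (l.dtens x y) = ldual_tens C x y"
proof -
  let ?t = "tbif (tens C) (tensa C)" and ?x = "ldual C x" and ?y = "ldual C y"
  let ?n = "tcmp C (tcmp C (tcmp C (tcmp C (t_lev C x) (?t (tone C x) (t_lun C ?x))) (?t (tone C x) (?t (t_lev C y) (tone C ?x))))
     (?t (tone C x) (lc.T.iv (t_asc C y ?y ?x)))) (t_asc C x y (?y \<otimes> ?x))"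
  have "l.nested x y ?x ?y (t_lev C x) (t_lev C y) = ?n"
    by (simp add: l.nested_def l.tev_def lc.T.assoc l.interchange')
  then show ?thesis
    unfolding l.dtens_def by (subst raw_l_ltr) (auto simp: ldual_tens_def lc.raw_iv)
qed

text \<open>The arguments are exchanged because the reversed product of \<open>y\<close> and
  \<open>x\<close> is \<open>x \<otimes> y\<close>; \<open>nested_reversed\<close> reconciles the
  two forms of the nested evaluation.\<close>

lemma raw_r_dtens:
  assumes [simp]: "x \<in> Obj C" "y \<in> Obj C"
  shows "raw (r.dtens y x) = rdual_tens C x y"
proof -
  let ?t = "tbif (tens C) (tensa C)" and ?x = "rdual C x" and ?y = "rdual C y"
  let ?n = "tcmp C (tcmp C (tcmp C (tcmp C (t_rev C y) (?t (tone C ?y) (t_lun C y))) (?t (tone C ?y) (?t (t_rev C x) (tone C y))))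
     (?t (tone C ?y) (lc.T.iv (t_asc C ?x x y)))) (t_asc C ?y ?x (x \<otimes> y))"
  have "r.nested y x ?y ?x (t_rev C y) (t_rev C x) = ?n"
    using l.nested_reversed[of ?y ?x x y "t_rev C x"]
    by (simp add: r.nested_def r.tev_def lc.T.assoc l.interchange')
  then show ?thesis
    unfolding r.dtens_def by (subst raw_r_ltr) (auto simp: rdual_tens_def lc.raw_iv)
qed

lemma raw_l_dunit: "raw l.dunit = ldual_unit C"
  unfolding l.dunit_def by (subst raw_l_ltr) (auto simp: ldual_unit_def)

text \<open>Reversal puts \<open>run\<close> where \<open>rdual_unit\<close> has \<open>lun\<close>;
  at the unit object they agree by \<open>lu_I\<close>.\<close>

lemma raw_r_dunit: "raw r.dunit = rdual_unit C"
  unfolding r.dunit_def l.lu_I[symmetric] by (subst raw_r_ltr) (auto simp: rdual_unit_def)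

lemma raw_l_ddtens: "\<lbrakk>x \<in> Obj C; y \<in> Obj C\<rbrakk> \<Longrightarrow> raw (l.ddtens x y) = lldual_tens C x y"
  by (simp add: l.ddtens_def lldual_tens_def raw_l_da raw_l_dtens lc.raw_iv)

lemma raw_r_ddtens: "\<lbrakk>x \<in> Obj C; y \<in> Obj C\<rbrakk> \<Longrightarrow> raw (r.ddtens y x) = rrdual_tens C x y"
  by (simp add: r.ddtens_def rrdual_tens_def raw_r_da raw_r_dtens lc.raw_iv)

lemma raw_l_ddunit: "raw l.ddunit = lldual_unit C"
  by (simp add: l.ddunit_def lldual_unit_def raw_l_da raw_l_dunit lc.raw_iv)

lemma raw_r_ddunit: "raw r.ddunit = rrdual_unit C"
  by (simp add: r.ddunit_def rrdual_unit_def raw_r_da raw_r_dunit lc.raw_iv)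

end

section \<open>Bimodule categories with typed structure arrows\<close>

definition t_lasc where "t_lasc A M a b m = Arrow ((a \<otimes>\<^bsub>A\<^esub> b) \<rhd>\<^bsub>M\<^esub> m) (lasc M a b m) (a \<rhd>\<^bsub>M\<^esub> (b \<rhd>\<^bsub>M\<^esub> m))"
definition t_lunit where "t_lunit A M m = Arrow (unit A \<rhd>\<^bsub>M\<^esub> m) (lunit M m) m"
definition t_rasc where "t_rasc B M m b c = Arrow ((m \<lhd>\<^bsub>M\<^esub> b) \<lhd>\<^bsub>M\<^esub> c) (rasc M m b c) (m \<lhd>\<^bsub>M\<^esub> (b \<otimes>\<^bsub>B\<^esub> c))"
definition t_runit where "t_runit B M m = Arrow (m \<lhd>\<^bsub>M\<^esub> unit B) (runit M m) m"
definition t_masc where "t_masc M a m b = Arrow ((a \<rhd>\<^bsub>M\<^esub> m) \<lhd>\<^bsub>M\<^esub> b) (masc M a m b) (a \<rhd>\<^bsub>M\<^esub> (m \<lhd>\<^bsub>M\<^esub> b))"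

lemmas tm_defs = t_lasc_def t_lunit_def t_rasc_def t_runit_def t_masc_def

lemma tm_sel [simp]:
  "raw (t_lasc A M a b m) = lasc M a b m" "asrc (t_lasc A M a b m) = (a \<otimes>\<^bsub>A\<^esub> b) \<rhd>\<^bsub>M\<^esub> m" "atgt (t_lasc A M a b m) = a \<rhd>\<^bsub>M\<^esub> (b \<rhd>\<^bsub>M\<^esub> m)"
  "raw (t_lunit A M m) = lunit M m" "asrc (t_lunit A M m) = unit A \<rhd>\<^bsub>M\<^esub> m" "atgt (t_lunit A M m) = m"
  "raw (t_rasc B M m p q) = rasc M m p q" "asrc (t_rasc B M m p q) = (m \<lhd>\<^bsub>M\<^esub> p) \<lhd>\<^bsub>M\<^esub> q" "atgt (t_rasc B M m p q) = m \<lhd>\<^bsub>M\<^esub> (p \<otimes>\<^bsub>B\<^esub> q)"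
  "raw (t_runit B M m) = runit M m" "asrc (t_runit B M m) = m \<lhd>\<^bsub>M\<^esub> unit B" "atgt (t_runit B M m) = m"
  "raw (t_masc M a m p) = masc M a m p" "asrc (t_masc M a m p) = (a \<rhd>\<^bsub>M\<^esub> m) \<lhd>\<^bsub>M\<^esub> p" "atgt (t_masc M a m p) = a \<rhd>\<^bsub>M\<^esub> (m \<lhd>\<^bsub>M\<^esub> p)"
  by (simp_all add: tm_defs)

locale rigid_bimodule_category =
  bimodule_category A B M + A: finite_tensor_category A + B: finite_tensor_category B
  for A :: "('k::field, 'oa, 'ma::ab_group_add, 'za) tcat_scheme"
    and B :: "('k, 'ob, 'mb::ab_group_add, 'zb) tcat_scheme"
    and M :: "('k, 'o, 'm::ab_group_add, 'oa, 'ma, 'ob, 'mb, 'z) bimod_scheme" (structure)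
begin

sublocale lm: linear_category M
  using finite_linear by (simp add: finite_linear_category_def)

lemma tm_iso:
  "\<lbrakk>a \<in> Obj A; b \<in> Obj A; m \<in> Obj M\<rbrakk> \<Longrightarrow> lm.T.iso (t_lasc A M a b m)"
  "m \<in> Obj M \<Longrightarrow> lm.T.iso (t_lunit A M m)"
  "\<lbrakk>m \<in> Obj M; c \<in> Obj B; d \<in> Obj B\<rbrakk> \<Longrightarrow> lm.T.iso (t_rasc B M m c d)"
  "m \<in> Obj M \<Longrightarrow> lm.T.iso (t_runit B M m)"
  "\<lbrakk>a \<in> Obj A; m \<in> Obj M; c \<in> Obj B\<rbrakk> \<Longrightarrow> lm.T.iso (t_masc M a m c)"
proof -
  interpret l: bilinear_functor A M M "lact M" "lacta M" by (rule lact_bilinear)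
  interpret r: bilinear_functor M B M "ract M" "racta M" by (rule ract_bilinear)
  show "\<lbrakk>a \<in> Obj A; b \<in> Obj A; m \<in> Obj M\<rbrakk> \<Longrightarrow> lm.T.iso (t_lasc A M a b m)"
    "m \<in> Obj M \<Longrightarrow> lm.T.iso (t_lunit A M m)"
    "\<lbrakk>m \<in> Obj M; c \<in> Obj B; d \<in> Obj B\<rbrakk> \<Longrightarrow> lm.T.iso (t_rasc B M m c d)"
    "m \<in> Obj M \<Longrightarrow> lm.T.iso (t_runit B M m)"
    "\<lbrakk>a \<in> Obj A; m \<in> Obj M; c \<in> Obj B\<rbrakk> \<Longrightarrow> lm.T.iso (t_masc M a m c)"
    unfolding tm_defs
    by (auto intro!: lm.iso_typed lasc_iso lunit_iso rasc_iso runit_iso masc_iso l.bi_Obj r.bi_Obj A.unit_Obj B.unit_Obj A.l.act_Ob B.l.act_Ob)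
qed

lemma typed_left_module: "rigid_module (Obj A) (tarr A) asrc atgt (tcmp A) (tone A) (tens A) (tbif (tens A) (tensa A))
    (unit A) (t_asc A) (t_lun A) (t_run A) (ldual A) (t_lev A) (t_lcoev A)
    (Obj M) (tarr M) asrc atgt (tcmp M) (tone M) (lact M) (tbif (lact M) (lacta M)) (t_lasc A M) (t_lunit A M)"
proof -
  interpret bifunctor "Obj A" "tarr A" asrc atgt "tcmp A" "tone A" "Obj M" "tarr M" asrc atgt "tcmp M" "tone M" "lact M" "tbif (lact M) (lacta M)"
    by (rule bilinear_bifunctor[OF A.lc.linear_category_axioms lm.linear_category_axioms lact_bilinear])
  show ?thesis
  proof unfold_locales
    fix f g h assume a: "tarr A f" "tarr A g" "tarr M h"
    note d = tarr_D[OF a(1)] tarr_D[OF a(2)] tarr_D[OF a(3)]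
    show "tcmp M (t_lasc A M (atgt f) (atgt g) (atgt h)) (tbif (lact M) (lacta M) (tbif (tens A) (tensa A) f g) h)
      = tcmp M (tbif (lact M) (lacta M) f (tbif (lact M) (lacta M) g h)) (t_lasc A M (asrc f) (asrc g) (asrc h))"
      by (simp only: tcmp_def tbif_def arrow.sel tm_sel lasc_natural[OF d(1,2,4,5,7,8,3,6,9)])
  next
    fix h assume "tarr M h"
    then show "tcmp M (t_lunit A M (atgt h)) (tbif (lact M) (lacta M) (tone A (unit A)) h) = tcmp M h (t_lunit A M (asrc h))"
      using lunit_natural[of "asrc h" "atgt h"] tarr_D[of M h] by (simp add: tcmp_def tbif_def)
  next
    fix a b c m assume a: "a \<in> Obj A" "b \<in> Obj A" "c \<in> Obj A" "m \<in> Obj M"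
    have "tcmp M (t_lasc A M a b (c \<rhd> m)) (t_lasc A M (a \<otimes>\<^bsub>A\<^esub> b) c m)
      = tcmp M (tcmp M (tbif (lact M) (lacta M) (tone A a) (t_lasc A M b c m)) (t_lasc A M a (b \<otimes>\<^bsub>A\<^esub> c) m))
         (tbif (lact M) (lacta M) (t_asc A a b c) (tone M m))"
      using left_pentagon[OF a] by (simp add: tcmp_def tbif_def)
    then show "tcmp M (t_lasc A M a b (c \<rhd> m)) (t_lasc A M (a \<otimes>\<^bsub>A\<^esub> b) c m)
      = tcmp M (tbif (lact M) (lacta M) (tone A a) (t_lasc A M b c m)) (tcmp M (t_lasc A M a (b \<otimes>\<^bsub>A\<^esub> c) m)
         (tbif (lact M) (lacta M) (t_asc A a b c) (tone M m)))"
      using a tm_iso by (simp add: lm.T.assoc)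
  next
    fix a m assume a: "a \<in> Obj A" "m \<in> Obj M"
    show "tcmp M (tbif (lact M) (lacta M) (tone A a) (t_lunit A M m)) (t_lasc A M a (unit A) m)
       = tbif (lact M) (lacta M) (t_run A a) (tone M m)"
      using left_triangle[OF a] by (simp add: tcmp_def tbif_def)
  qed (use tm_iso in auto)
qed

lemma typed_right_module: "rigid_module (Obj B) (tarr B) asrc atgt (tcmp B) (tone B) (\<lambda>x y. y \<otimes>\<^bsub>B\<^esub> x) (\<lambda>f g. tbif (tens B) (tensa B) g f)
    (unit B) (\<lambda>x y z. B.lc.T.iv (t_asc B z y x)) (t_run B) (t_lun B) (rdual B) (t_rev B) (t_rcoev B)
    (Obj M) (tarr M) asrc atgt (tcmp M) (tone M) (\<lambda>b m. m \<lhd> b) (tbif (\<lambda>b m. m \<lhd> b) (\<lambda>g h. h \<unlhd> g))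
    (\<lambda>b c m. lm.T.iv (t_rasc B M m c b)) (t_runit B M)"
proof -
  let ?t = "tbif (\<lambda>b m. m \<lhd> b) (\<lambda>g h. h \<unlhd> g)"
  interpret bifunctor "Obj B" "tarr B" asrc atgt "tcmp B" "tone B" "Obj M" "tarr M" asrc atgt "tcmp M" "tone M" "\<lambda>b m. m \<lhd> b" ?t
    by (rule bilinear_bifunctor[OF B.lc.linear_category_axioms lm.linear_category_axioms bilinear_functor_flip[OF ract_bilinear]])
  show ?thesis
  proof unfold_locales
    fix f g h assume a: "tarr B f" "tarr B g" "tarr M h"
    note d = tarr_D[OF a(1)] tarr_D[OF a(2)] tarr_D[OF a(3)]
    have "tcmp M (t_rasc B M (atgt h) (atgt g) (atgt f)) (?t f (?t g h)) = tcmp M (?t (tbif (tens B) (tensa B) g f) h) (t_rasc B M (asrc h) (asrc g) (asrc f))"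
      by (simp only: tcmp_def tbif_def arrow.sel tm_sel rasc_natural[OF d(7,8,4,5,1,2,9,6,3)])
    then show "tcmp M (lm.T.iv (t_rasc B M (atgt h) (atgt g) (atgt f))) (?t (tbif (tens B) (tensa B) g f) h)
      = tcmp M (?t f (?t g h)) (lm.T.iv (t_rasc B M (asrc h) (asrc g) (asrc f)))"
      by (intro lm.T.cmp_iv_swap[symmetric]) (use a tm_iso in auto)
  next
    fix h assume "tarr M h"
    then show "tcmp M (t_runit B M (atgt h)) (?t (tone B (unit B)) h) = tcmp M h (t_runit B M (asrc h))"
      using runit_natural[of "asrc h" "atgt h"] tarr_D[of M h] by (simp add: tcmp_def tbif_def)
  next
    fix a b c m assume a: "a \<in> Obj B" "b \<in> Obj B" "c \<in> Obj B" "m \<in> Obj M"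
    note [simp] = a tm_iso
    have "tcmp M (t_rasc B M m c (b \<otimes>\<^bsub>B\<^esub> a)) (t_rasc B M (m \<lhd> c) b a)
      = tcmp M (tcmp M (?t (t_asc B c b a) (tone M m)) (t_rasc B M m (c \<otimes>\<^bsub>B\<^esub> b) a)) (?t (tone B a) (t_rasc B M m c b))"
      using right_pentagon[OF a(4,3,2,1)] by (simp add: tcmp_def tbif_def)
    \<comment> \<open>The associator of the reversed action is the inverse of \<open>rasc\<close>,
      so its pentagon is the inverse of \<open>right_pentagon\<close>.\<close>
    then have "lm.T.iv (tcmp M (t_rasc B M m c (b \<otimes>\<^bsub>B\<^esub> a)) (t_rasc B M (m \<lhd> c) b a))
      = lm.T.iv (tcmp M (tcmp M (?t (t_asc B c b a) (tone M m)) (t_rasc B M m (c \<otimes>\<^bsub>B\<^esub> b) a)) (?t (tone B a) (t_rasc B M m c b)))"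
      by simp
    then show "tcmp M (lm.T.iv (t_rasc B M (m \<lhd> c) b a)) (lm.T.iv (t_rasc B M m c (b \<otimes>\<^bsub>B\<^esub> a)))
      = tcmp M (?t (tone B a) (lm.T.iv (t_rasc B M m c b))) (tcmp M (lm.T.iv (t_rasc B M m (c \<otimes>\<^bsub>B\<^esub> b) a))
         (?t (B.lc.T.iv (t_asc B c b a)) (tone M m)))"
      by (simp add: lm.T.iv_of_cmp iv_act)
  next
    fix a m assume a: "a \<in> Obj B" "m \<in> Obj M"
    note [simp] = a tm_iso
    have "tcmp M (?t (t_lun B a) (tone M m)) (t_rasc B M m (unit B) a) = ?t (tone B a) (t_runit B M m)"
      using right_triangle[OF a(2,1)] by (simp add: tcmp_def tbif_def)
    then have "tcmp M (?t (tone B a) (t_runit B M m)) (lm.T.iv (t_rasc B M m (unit B) a))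
      = tcmp M (tcmp M (?t (t_lun B a) (tone M m)) (t_rasc B M m (unit B) a)) (lm.T.iv (t_rasc B M m (unit B) a))"
      by simp
    then show "tcmp M (?t (tone B a) (t_runit B M m)) (lm.T.iv (t_rasc B M m (unit B) a)) = ?t (t_lun B a) (tone M m)"
      by (simp add: lm.T.assoc)
  qed (use tm_iso in auto)
qed

sublocale L: rigid_module "Obj A" "tarr A" asrc atgt "tcmp A" "tone A" "tens A" "tbif (tens A) (tensa A)"
    "unit A" "t_asc A" "t_lun A" "t_run A" "ldual A" "t_lev A" "t_lcoev A"
    "Obj M" "tarr M" asrc atgt "tcmp M" "tone M" "lact M" "tbif (lact M) (lacta M)" "t_lasc A M" "t_lunit A M"
  by (rule typed_left_module)

sublocale R: rigid_module "Obj B" "tarr B" asrc atgt "tcmp B" "tone B" "\<lambda>x y. y \<otimes>\<^bsub>B\<^esub> x" "\<lambda>f g. tbif (tens B) (tensa B) g f"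
    "unit B" "\<lambda>x y z. B.lc.T.iv (t_asc B z y x)" "t_run B" "t_lun B" "rdual B" "t_rev B" "t_rcoev B"
    "Obj M" "tarr M" asrc atgt "tcmp M" "tone M" "\<lambda>b m. m \<lhd> b" "tbif (\<lambda>b m. m \<lhd> b) (\<lambda>g h. h \<unlhd> g)"
    "\<lambda>b c m. lm.T.iv (t_rasc B M m c b)" "t_runit B M"
  by (rule typed_right_module)

sublocale LR: commuting_modules "Obj A" "tarr A" asrc atgt "tcmp A" "tone A" "tens A" "tbif (tens A) (tensa A)"
    "unit A" "t_asc A" "t_lun A" "t_run A"
    "Obj B" "tarr B" asrc atgt "tcmp B" "tone B" "\<lambda>x y. y \<otimes>\<^bsub>B\<^esub> x" "\<lambda>f g. tbif (tens B) (tensa B) g f"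
    "unit B" "\<lambda>x y z. B.lc.T.iv (t_asc B z y x)" "t_run B" "t_lun B"
    "Obj M" "tarr M" asrc atgt "tcmp M" "tone M" "lact M" "tbif (lact M) (lacta M)" "t_lasc A M" "t_lunit A M"
    "\<lambda>b m. m \<lhd> b" "tbif (\<lambda>b m. m \<lhd> b) (\<lambda>g h. h \<unlhd> g)" "\<lambda>b c m. lm.T.iv (t_rasc B M m c b)" "t_runit B M"
    "t_masc M"
proof
  let ?t = "tbif (\<lambda>b m. m \<lhd> b) (\<lambda>g h. h \<unlhd> g)" and ?s = "tbif (lact M) (lacta M)"
  fix f h g a a1 m m1 b b1
  assume a: "tarr A f" "tarr M h" "tarr B g" and e: "asrc f = a" "atgt f = a1" "asrc h = m" "atgt h = m1" "asrc g = b" "atgt g = b1"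
  note d = tarr_D[OF a(1)] tarr_D[OF a(2)] tarr_D[OF a(3)]
  show "tcmp M (t_masc M a1 m1 b1) (?t g (?s f h)) = tcmp M (?s f (?t g h)) (t_masc M a m b)"
    unfolding e[symmetric] by (simp only: tcmp_def tbif_def arrow.sel tm_sel masc_natural[OF d(1,2,4,5,7,8,3,6,9)])
next
  let ?t = "tbif (\<lambda>b m. m \<lhd> b) (\<lambda>g h. h \<unlhd> g)" and ?s = "tbif (lact M) (lacta M)"
  fix a a' m b assume a: "a \<in> Obj A" "a' \<in> Obj A" "m \<in> Obj M" "b \<in> Obj B"
  note [simp] = a tm_iso
  have "tcmp M (t_lasc A M a a' (m \<lhd> b)) (t_masc M (a \<otimes>\<^bsub>A\<^esub> a') m b)
    = tcmp M (tcmp M (?s (tone A a) (t_masc M a' m b)) (t_masc M a (a' \<rhd> m) b)) (?t (tone B b) (t_lasc A M a a' m))"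
    using middle_pentagon_left[OF a] by (simp add: tcmp_def tbif_def)
  then show "tcmp M (t_lasc A M a a' (m \<lhd> b)) (t_masc M (a \<otimes>\<^bsub>A\<^esub> a') m b)
    = tcmp M (?s (tone A a) (t_masc M a' m b)) (tcmp M (t_masc M a (a' \<rhd> m) b) (?t (tone B b) (t_lasc A M a a' m)))"
    by (simp add: lm.T.assoc)
next
  let ?t = "tbif (\<lambda>b m. m \<lhd> b) (\<lambda>g h. h \<unlhd> g)" and ?s = "tbif (lact M) (lacta M)"
  fix a m b b' assume a: "a \<in> Obj A" "m \<in> Obj M" "b \<in> Obj B" "b' \<in> Obj B"
  note [simp] = a tm_iso
  have "tcmp M (t_masc M a m (b \<otimes>\<^bsub>B\<^esub> b')) (t_rasc B M (a \<rhd> m) b b')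
    = tcmp M (tcmp M (?s (tone A a) (t_rasc B M m b b')) (t_masc M a (m \<lhd> b) b')) (?t (tone B b') (t_masc M a m b))"
    using middle_pentagon_right[OF a] by (simp add: tcmp_def tbif_def)
  then have "lm.T.iv (tcmp M (t_masc M a m (b \<otimes>\<^bsub>B\<^esub> b')) (t_rasc B M (a \<rhd> m) b b'))
    = lm.T.iv (tcmp M (tcmp M (?s (tone A a) (t_rasc B M m b b')) (t_masc M a (m \<lhd> b) b')) (?t (tone B b') (t_masc M a m b)))"
    by simp
  then show "tcmp M (lm.T.iv (t_rasc B M (a \<rhd> m) b b')) (lm.T.iv (t_masc M a m (b \<otimes>\<^bsub>B\<^esub> b')))
    = tcmp M (?t (tone B b') (lm.T.iv (t_masc M a m b))) (tcmp M (lm.T.iv (t_masc M a (m \<lhd> b) b')) (?s (tone A a) (lm.T.iv (t_rasc B M m b b'))))"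
    by (simp add: lm.T.iv_of_cmp L.iv_act R.iv_act)
qed (use tm_iso in auto)

end

section \<open>The bimodule structure of the Nakayama functor\<close>

locale nakayama_rigid_module =
  rigid_module ObA arrA srcA tgtA cmpA oneA tns tna I as lu ru dl le lc
    "Obj C" "tarr C" asrc atgt "tcmp C" "tone C" act acta as' lu' +
  n: nakayama_universal C N \<iota>
  for ObA :: "'oa set" and arrA :: "'fa \<Rightarrow> bool" and srcA tgtA
    and cmpA (infixr "\<bullet>\<^sub>A" 70) and oneA
    and tns (infixr "\<odot>" 75) and tna (infixr "\<odot>\<^sub>f" 75) and I as lu ru dl le lc
    and C :: "('k::field, 'o, 'm::ab_group_add, 'z) lcat_scheme"
    and act (infixr "\<triangleright>" 75) and acta (infixr "\<triangleright>\<^sub>f" 75) and as' lu'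
    and N \<iota> +
  assumes lin_actF [simp]: "a \<in> ObA \<Longrightarrow> n.lin (actF a)"
begin

text \<open>At objects the characterising equations determine the arrow, by \<open>mate_epi\<close>,
  so nothing depends on the choice.\<close>

definition \<phi> where
  "\<phi> a m = (SOME p. n.mate (actF a) (actF (dl a)) (actF (dl (dl a))) (E a) (E (dl a)) m p)"

lemma mate_\<phi>:
  assumes "a \<in> ObA" "m \<in> Obj C"
  shows "n.mate (actF a) (actF (dl a)) (actF (dl (dl a))) (E a) (E (dl a)) m (\<phi> a m)"
  unfolding \<phi>_def by (rule someI_ex, rule n.mate_exists[OF adj_E adj_E adj_E]) (use assms in auto)

lemma \<phi>_typ [simp]:
  assumes "a \<in> ObA" "m \<in> Obj C"
  shows "M.iso (\<phi> a m)" "asrc (\<phi> a m) = FO N (a \<triangleright> m)" "atgt (\<phi> a m) = dl (dl a) \<triangleright> FO N m"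
  using n.mate_simps(1-3)[OF mate_\<phi>[OF assms]] by simp_all

text \<open>The two variables are separated by interchange: in \<open>f\<close> the chains of two
  objects are compared along the mates \<open>f\<close>, \<open>da f\<close>,
  \<open>da (da f)\<close>; in \<open>h\<close> the chain is fixed and \<open>mate_natural\<close>
  applies.\<close>

lemma \<phi>_natural:
  assumes f: "arrA f" and h: "tarr C h"
  shows "n.tcmp' (\<phi> (tgtA f) (atgt h)) (FA N (f \<triangleright>\<^sub>f h)) = n.tcmp' (A.da (A.da f) \<triangleright>\<^sub>f FA N h) (\<phi> (srcA f) (asrc h))"
proof -
  let ?a = "srcA f" and ?b = "tgtA f" and ?m = "asrc h" and ?n = "atgt h"
  have 1: "n.tcmp' (A.da (A.da f) \<triangleright>\<^sub>f tone C (FO N ?m)) (\<phi> ?a ?m) = n.tcmp' (\<phi> ?b ?m) (FA N (f \<triangleright>\<^sub>f tone C ?m))"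
    by (rule n.mate_compare[OF mate_\<phi> mate_\<phi> adj_E adj_E adj_E adj_E adj_E _ _ mates_arr mates_arr]) (use f h in auto)
  have 2: "n.tcmp' (\<phi> ?b ?n) (FA N (FA (actF ?b) h)) = n.tcmp' (FA (actF (dl (dl ?b))) (FA N h)) (\<phi> ?b ?m)"
    by (rule n.mate_natural[OF mate_\<phi> mate_\<phi> adj_E adj_E adj_E]) (use f h in auto)
  have "FA N (f \<triangleright>\<^sub>f h) = n.tcmp' (FA N (FA (actF ?b) h)) (FA N (f \<triangleright>\<^sub>f tone C ?m))"
    using f h M.endo_cmp[OF n.endo_N, of "f \<triangleright>\<^sub>f tone C ?m" "oneA ?b \<triangleright>\<^sub>f h"]
    by (simp add: interchange)
  then have "n.tcmp' (\<phi> ?b ?n) (FA N (f \<triangleright>\<^sub>f h)) = n.tcmp' (n.tcmp' (\<phi> ?b ?n) (FA N (FA (actF ?b) h))) (FA N (f \<triangleright>\<^sub>f tone C ?m))"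
    using f h by (simp add: M.assoc)
  also have "\<dots> = n.tcmp' (FA (actF (dl (dl ?b))) (FA N h)) (n.tcmp' (A.da (A.da f) \<triangleright>\<^sub>f tone C (FO N ?m)) (\<phi> ?a ?m))"
    unfolding 1 2 using f h by (simp add: M.assoc)
  also have "\<dots> = n.tcmp' (A.da (A.da f) \<triangleright>\<^sub>f FA N h) (\<phi> ?a ?m)"
    using f h by (simp add: interchange')
  finally show ?thesis .
qed

text \<open>By \<open>mate_compF\<close> the composite of the two isomorphisms is a mate for the
  composed chain; it is compared with the mate for \<open>a \<odot> b\<close> along the associator
  and its successive mates.\<close>

lemma \<phi>_assoc:
  assumes a: "a \<in> ObA" "b \<in> ObA" "m \<in> Obj C"
  shows "n.tcmp' (n.tcmp' (as' (dl (dl a)) (dl (dl b)) (FO N m)) (A.A.iv (A.ddtens a b) \<triangleright>\<^sub>f tone C (FO N m))) (\<phi> (a \<odot> b) m)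
    = n.tcmp' (n.tcmp' (oneA (dl (dl a)) \<triangleright>\<^sub>f \<phi> b m) (\<phi> a (b \<triangleright> m))) (FA N (as' a b m))"
proof -
  have c: "n.mate (compF (actF a) (actF b)) (compF (actF (dl b)) (actF (dl a))) (compF (actF (dl (dl a))) (actF (dl (dl b))))
     (M.comp_counit (actF a) (actF (dl a)) (E a) (E b))
     (M.comp_counit (actF (dl b)) (actF (dl (dl b))) (E (dl b)) (E (dl a))) m
     (n.tcmp' (FA (actF (dl (dl a))) (\<phi> b m)) (\<phi> a (FO (actF b) m)))"
    by (rule n.mate_compF[OF mate_\<phi> mate_\<phi> adj_E adj_E adj_E adj_E]) (use a in auto)
  have "n.tcmp' (n.tcmp' (as' (dl (dl a)) (dl (dl b)) (FO N m)) (A.A.iv (A.ddtens a b) \<triangleright>\<^sub>f tone C (FO N m))) (\<phi> (a \<odot> b) m)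
    = n.tcmp' (n.tcmp' (FA (actF (dl (dl a))) (\<phi> b m)) (\<phi> a (FO (actF b) m))) (FA N (as' a b m))"
    by (rule n.mate_compare[OF mate_\<phi> c adj_E adj_E adj_E adj_EE adj_EE _ _ mates_tens mates_tens_dual]) (use a in auto)
  then show ?thesis by simp
qed

text \<open>The chain of \<open>I\<close> is compared with the chain of identity functors along the
  unitor and its successive mates.\<close>

lemma \<phi>_unit:
  assumes m: "m \<in> Obj C"
  shows "n.tcmp' (n.tcmp' (lu' (FO N m)) (A.A.iv A.ddunit \<triangleright>\<^sub>f tone C (FO N m))) (\<phi> I m) = FA N (lu' m)"
proof -
  have "n.tcmp' (n.tcmp' (lu' (FO N m)) (A.A.iv A.ddunit \<triangleright>\<^sub>f tone C (FO N m))) (\<phi> I m)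
    = n.tcmp' (tone C (FO N m)) (FA N (lu' m))"
    by (rule n.mate_compare[OF mate_\<phi> n.mate_idF adj_E adj_E adj_E M.adj_idF M.adj_idF _ _ mates_unit mates_unit_dual])
      (use m in auto)
  then show ?thesis using m by simp
qed

end

section \<open>Assembly of the bimodule functor\<close>

context rigid_bimodule_category
begin

lemma lin_act:
  "a \<in> Obj A \<Longrightarrow> lm.lin (L.actF a)"
  "b \<in> Obj B \<Longrightarrow> lm.lin (R.actF b)"
proof -
  interpret l: bilinear_functor A M M "lact M" "lacta M" by (rule lact_bilinear)
  interpret r: bilinear_functor M B M "ract M" "racta M" by (rule ract_bilinear)
  show "lm.lin (L.actF a)" if "a \<in> Obj A" for a
    unfolding lm.lin_def
  proof (intro conjI allI impI)
    fix f g assume f: "tarr M f" "tarr M g" "asrc g = asrc f" "atgt g = atgt f"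
    show "FA (L.actF a) (tadd f g) = tadd (FA (L.actF a) f) (FA (L.actF a) g)"
      using l.bi_add_right[OF that that tarr_D(1,2)[OF f(1)] A.lc.Id_Hom[OF that] tarr_D(3)[OF f(1)], of "raw g"]
        tarr_D(3)[OF f(2)] f(3,4) by (simp add: tbif_def tadd_def)
  next
    fix c f assume f: "tarr M f"
    show "FA (L.actF a) (tscl M c f) = tscl M c (FA (L.actF a) f)"
      using l.bi_scl_right[OF that that tarr_D(1,2)[OF f] A.lc.Id_Hom[OF that] tarr_D(3)[OF f]]
      by (simp add: tbif_def tscl_def)
  qed
  show "lm.lin (R.actF b)" if "b \<in> Obj B" for b
    unfolding lm.lin_def
  proof (intro conjI allI impI)
    fix f g assume f: "tarr M f" "tarr M g" "asrc g = asrc f" "atgt g = atgt f"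
    show "FA (R.actF b) (tadd f g) = tadd (FA (R.actF b) f) (FA (R.actF b) g)"
      using r.bi_add_left[OF tarr_D(1,2)[OF f(1)] that that tarr_D(3)[OF f(1)] _ B.lc.Id_Hom[OF that], of "raw g"]
        tarr_D(3)[OF f(2)] f(3,4) by (simp add: tbif_def tadd_def)
  next
    fix c f assume f: "tarr M f"
    show "FA (R.actF b) (tscl M c f) = tscl M c (FA (R.actF b) f)"
      using r.bi_scl_left[OF tarr_D(1,2)[OF f] that that tarr_D(3)[OF f] B.lc.Id_Hom[OF that]]
      by (simp add: tbif_def tscl_def)
  qed
qed

theorem nakayama_bimodule_functor:
  assumes N: "nakayama_functor M N"
  shows "\<exists>\<phi> \<psi>. bimodule_functor A B M (ll_rr A B M) N \<phi> \<psi>"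
proof -
  obtain \<iota> where "nakayama_universal M (tF N) \<iota>"
    using lm.nakayama_functor_universal[OF N] by blast
  then interpret n: nakayama_universal M "tF N" \<iota> .
  have lf: "linear_functor M M N"
    using N by (simp add: nakayama_functor_def)
  interpret F: linear_functor M M N by (rule lf)
  note [simp] = F.FO_Obj
  let ?d = "ldual A" and ?e = "rdual B" and ?N = "tF N"
  let ?s = "tbif (lact M) (lacta M)" and ?t = "tbif (\<lambda>b m. m \<lhd> b) (\<lambda>g h. h \<unlhd> g)"
  interpret l: nakayama_rigid_module "Obj A" "tarr A" asrc atgt "tcmp A" "tone A" "tens A" "tbif (tens A) (tensa A)"
    "unit A" "t_asc A" "t_lun A" "t_run A" "ldual A" "t_lev A" "t_lcoev A"
    M "lact M" ?s "t_lasc A M" "t_lunit A M" ?N \<iota>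
    by unfold_locales (rule lin_act)
  interpret r: nakayama_rigid_module "Obj B" "tarr B" asrc atgt "tcmp B" "tone B" "\<lambda>x y. y \<otimes>\<^bsub>B\<^esub> x" "\<lambda>f g. tbif (tens B) (tensa B) g f"
    "unit B" "\<lambda>x y z. B.lc.T.iv (t_asc B z y x)" "t_run B" "t_lun B" "rdual B" "t_rev B" "t_rcoev B"
    M "\<lambda>b m. m \<lhd> b" ?t "\<lambda>b c m. lm.T.iv (t_rasc B M m c b)" "t_runit B M" ?N \<iota>
    by unfold_locales (rule lin_act)
  define \<phi> where "\<phi> = l.\<phi>"
  define \<psi> where "\<psi> m b = r.\<phi> b m" for m b
  note \<phi> = l.mate_\<phi>[folded \<phi>_def] and \<psi> = r.mate_\<phi>[folded \<psi>_def]
  note [simp] = l.\<phi>_typ[folded \<phi>_def] r.\<phi>_typ[folded \<psi>_def]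
  note \<phi>_nat = l.\<phi>_natural[folded \<phi>_def] and \<psi>_nat = r.\<phi>_natural[folded \<psi>_def]
    and \<phi>_assoc = l.\<phi>_assoc[folded \<phi>_def] and \<psi>_assoc = r.\<phi>_assoc[folded \<psi>_def, simplified tF_simps(1)]
    and \<phi>_unit = l.\<phi>_unit[folded \<phi>_def] and \<psi>_unit = r.\<phi>_unit[folded \<psi>_def]
  \<comment> \<open>The reversed tensor category yields this axiom with inverse associators and an
    inverse double dual constraint; moving these across gives the form required of a right module
    functor.\<close>
  have \<psi>_assoc': "tcmp M (tcmp M (?t (B.r.ddtens b c) (tone M (FO N m))) (t_rasc B M (FO N m) (?e (?e c)) (?e (?e b))))
      (tcmp M (?t (tone B (?e (?e b))) (\<psi> m c)) (\<psi> (m \<lhd> c) b))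
    = tcmp M (\<psi> m (c \<otimes>\<^bsub>B\<^esub> b)) (FA ?N (t_rasc B M m c b))"
    if a: "b \<in> Obj B" "c \<in> Obj B" "m \<in> Obj M" for b c m
  proof (rule lm.T.cancel_right)
    note [simp] = a tm_iso
    let ?u = "tcmp M (lm.T.iv (t_rasc B M (FO N m) (?e (?e c)) (?e (?e b)))) (?t (B.lc.T.iv (B.r.ddtens b c)) (tone M (FO N m)))"
    have 1: "lm.T.iv ?u = tcmp M (?t (B.r.ddtens b c) (tone M (FO N m))) (t_rasc B M (FO N m) (?e (?e c)) (?e (?e b)))"
      by (simp add: lm.T.iv_of_cmp R.iv_act)
    have 2: "tcmp M (FA ?N (t_rasc B M m c b)) (FA ?N (lm.T.iv (t_rasc B M m c b))) = tone M (FO N (m \<lhd> (c \<otimes>\<^bsub>B\<^esub> b)))"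
      by (simp add: lm.T.endo_cmp[OF n.endo_N, symmetric] del: tF_simps(2))
    have "tcmp M (lm.T.iv ?u) (tcmp M (tcmp M (?t (tone B (?e (?e b))) (\<psi> m c)) (\<psi> (m \<lhd> c) b)) (FA ?N (lm.T.iv (t_rasc B M m c b))))
       = tcmp M (lm.T.iv ?u) (tcmp M ?u (\<psi> m (c \<otimes>\<^bsub>B\<^esub> b)))"
      by (subst \<psi>_assoc[OF a]) (rule refl)
    also have "\<dots> = \<psi> m (c \<otimes>\<^bsub>B\<^esub> b)"
      by (intro lm.T.iv_cmp_cmp) auto
    also have "\<dots> = tcmp M (\<psi> m (c \<otimes>\<^bsub>B\<^esub> b)) (tcmp M (FA ?N (t_rasc B M m c b)) (FA ?N (lm.T.iv (t_rasc B M m c b))))"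
      unfolding 2 by simp
    finally show "tcmp M (tcmp M (tcmp M (?t (B.r.ddtens b c) (tone M (FO N m))) (t_rasc B M (FO N m) (?e (?e c)) (?e (?e b))))
        (tcmp M (?t (tone B (?e (?e b))) (\<psi> m c)) (\<psi> (m \<lhd> c) b))) (FA ?N (lm.T.iv (t_rasc B M m c b)))
      = tcmp M (tcmp M (\<psi> m (c \<otimes>\<^bsub>B\<^esub> b)) (FA ?N (t_rasc B M m c b))) (FA ?N (lm.T.iv (t_rasc B M m c b)))"
      unfolding 1 by (simp add: lm.T.assoc del: tF_simps(2))
  qed (use a tm_iso in \<open>auto simp del: tF_simps(2)\<close>)
  have \<phi>_unit: "tcmp M (tcmp M (t_lunit A M (FO N m)) (?s (A.lc.T.iv A.l.ddunit) (tone M (FO N m)))) (\<phi> (unit A) m) = FA ?N (t_lunit A M m)"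
    if m: "m \<in> Obj M" for m
  proof -
    have "tcmp M (tcmp M (t_lunit A M (FO ?N m)) (?s (A.lc.T.iv A.l.ddunit) (tone M (FO ?N m)))) (\<phi> (unit A) m)
      = tcmp M (tone M (FO ?N m)) (FA ?N (t_lunit A M m))"
      by (rule n.mate_compare[OF \<phi> n.mate_idF L.adj_E L.adj_E L.adj_E lm.T.adj_idF lm.T.adj_idF _ _ L.mates_unit L.mates_unit_dual])
        (use m in auto)
    then show ?thesis using m by (simp del: tF_simps(2))
  qed
  have \<psi>_unit: "tcmp M (tcmp M (t_runit B M (FO N m)) (?t (B.lc.T.iv B.r.ddunit) (tone M (FO N m)))) (\<psi> m (unit B)) = FA ?N (t_runit B M m)"
    if m: "m \<in> Obj M" for m
  proof -
    have "tcmp M (tcmp M (t_runit B M (FO ?N m)) (?t (B.lc.T.iv B.r.ddunit) (tone M (FO ?N m)))) (\<psi> m (unit B))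
      = tcmp M (tone M (FO ?N m)) (FA ?N (t_runit B M m))"
      by (rule n.mate_compare[OF \<psi> n.mate_idF R.adj_E R.adj_E R.adj_E lm.T.adj_idF lm.T.adj_idF _ _ R.mates_unit R.mates_unit_dual])
        (use m in auto)
    then show ?thesis using m by (simp del: tF_simps(2))
  qed
  \<comment> \<open>Both composites are mates for composed chains, one acting with \<open>a\<close>
    first and the other with \<open>b\<close> first. \<open>mates_mas\<close> at the objects and at
    their duals relates the two chains.\<close>
  have mid: "tcmp M (t_masc M (?d (?d a)) (FO N m) (?e (?e b))) (tcmp M (?t (tone B (?e (?e b))) (\<phi> a m)) (\<psi> (a \<rhd> m) b))
     = tcmp M (tcmp M (?s (tone A (?d (?d a))) (\<psi> m b)) (\<phi> a (m \<lhd> b))) (FA ?N (t_masc M a m b))"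
    if a: "a \<in> Obj A" "b \<in> Obj B" "m \<in> Obj M" for a m b
  proof -
    have c1: "n.mate (compF (R.actF b) (L.actF a)) (compF (L.actF (?d a)) (R.actF (?e b))) (compF (R.actF (?e (?e b))) (L.actF (?d (?d a))))
       (lm.T.comp_counit (R.actF b) (R.actF (?e b)) (R.E b) (L.E a))
       (lm.T.comp_counit (L.actF (?d a)) (L.actF (?d (?d a))) (L.E (?d a)) (R.E (?e b))) m
       (tcmp M (FA (R.actF (?e (?e b))) (\<phi> a m)) (\<psi> (FO (L.actF a) m) b))"
      by (rule n.mate_compF[OF \<psi> \<phi> R.adj_E R.adj_E L.adj_E L.adj_E]) (use a in auto)
    have c2: "n.mate (compF (L.actF a) (R.actF b)) (compF (R.actF (?e b)) (L.actF (?d a))) (compF (L.actF (?d (?d a))) (R.actF (?e (?e b))))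
       (lm.T.comp_counit (L.actF a) (L.actF (?d a)) (L.E a) (R.E b))
       (lm.T.comp_counit (R.actF (?e b)) (R.actF (?e (?e b))) (R.E (?e b)) (L.E (?d a))) m
       (tcmp M (FA (L.actF (?d (?d a))) (\<psi> m b)) (\<phi> a (FO (R.actF b) m)))"
      by (rule n.mate_compF[OF \<phi> \<psi> L.adj_E L.adj_E R.adj_E R.adj_E]) (use a in auto)
    have "tcmp M (t_masc M (?d (?d a)) (FO ?N m) (?e (?e b))) (tcmp M (FA (R.actF (?e (?e b))) (\<phi> a m)) (\<psi> (FO (L.actF a) m) b))
       = tcmp M (tcmp M (FA (L.actF (?d (?d a))) (\<psi> m b)) (\<phi> a (FO (R.actF b) m))) (FA ?N (t_masc M a m b))"
      by (rule n.mate_compare[OF c1 c2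
            lm.T.adj_compF[OF R.adj_E L.adj_E] lm.T.adj_compF[OF L.adj_E R.adj_E] lm.T.adj_compF[OF R.adj_E L.adj_E]
            lm.T.adj_compF[OF L.adj_E R.adj_E] lm.T.adj_compF[OF R.adj_E L.adj_E] _ _
            LR.mates_mas[OF A.l.dual B.r.dual] LR.mates_mas[OF A.l.dual B.r.dual]]) (use a in auto)
    then show ?thesis by simp
  qed
  have l': "linear_functor M (ll_rr A B M) N"
    using lf unfolding linear_functor_def by (simp add: ll_rr_def)
  \<comment> \<open>The underlying category of \<open>ll_rr A B M\<close> is that of
    \<open>M\<close>; only actions and their constraints differ.\<close>
  have iso': "iso_arrow (ll_rr A B M) x y f = iso_arrow M x y f" for x y f
    by (simp add: iso_arrow_def inverse_arrows_def ll_rr_def)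
  show ?thesis
  proof (intro exI[of _ "\<lambda>a m. raw (\<phi> a m)"] exI[of _ "\<lambda>m b. raw (\<psi> m b)"], rule bimodule_functor.intro)
    show "linear_functor M (ll_rr A B M) N" by (rule l')
  next
    fix a m assume "a \<in> Obj A" "m \<in> Obj M"
    then show "iso_arrow (ll_rr A B M) (FO N (a \<rhd> m)) (a \<rhd>\<^bsub>ll_rr A B M\<^esub> FO N m) (raw (\<phi> a m))"
      unfolding iso' by (intro lm.iso_arrow_raw) (simp_all add: ll_rr_def lldual_def)
  next
    fix m b assume "m \<in> Obj M" "b \<in> Obj B"
    then show "iso_arrow (ll_rr A B M) (FO N (m \<lhd> b)) (FO N m \<lhd>\<^bsub>ll_rr A B M\<^esub> b) (raw (\<psi> m b))"
      unfolding iso' by (intro lm.iso_arrow_raw) (simp_all add: ll_rr_def rrdual_def)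
  next
    fix a a1 m m1 f h
    assume a: "a \<in> Obj A" "a1 \<in> Obj A" "m \<in> Obj M" "m1 \<in> Obj M" "f \<in> Hom A a a1" "h \<in> Hom M m m1"
    have f: "tarr A (Arrow a f a1)" and h: "tarr M (Arrow m h m1)"
      using a by (auto intro: tarr_Arrow)
    have "raw (A.l.da (A.l.da (Arrow a f a1))) = lldual_arr A f"
      using f by (simp add: A.raw_l_da lldual_arr_def)
    then show "raw (\<phi> a1 m1) \<cdot>\<^bsub>ll_rr A B M\<^esub> FA N (f \<unrhd> h) = (f \<unrhd>\<^bsub>ll_rr A B M\<^esub> FA N h) \<cdot>\<^bsub>ll_rr A B M\<^esub> raw (\<phi> a m)"
      using arg_cong[OF \<phi>_nat[OF f h], of raw] by (simp add: ll_rr_def)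
  next
    fix m m1 b b1 h g
    assume a: "m \<in> Obj M" "m1 \<in> Obj M" "b \<in> Obj B" "b1 \<in> Obj B" "h \<in> Hom M m m1" "g \<in> Hom B b b1"
    have g: "tarr B (Arrow b g b1)" and h: "tarr M (Arrow m h m1)"
      using a by (auto intro: tarr_Arrow)
    have "raw (B.r.da (B.r.da (Arrow b g b1))) = rrdual_arr B g"
      using g by (simp add: B.raw_r_da rrdual_arr_def)
    then show "raw (\<psi> m1 b1) \<cdot>\<^bsub>ll_rr A B M\<^esub> FA N (h \<unlhd> g) = (FA N h \<unlhd>\<^bsub>ll_rr A B M\<^esub> g) \<cdot>\<^bsub>ll_rr A B M\<^esub> raw (\<psi> m b)"
      using arg_cong[OF \<psi>_nat[OF g h], of raw] by (simp add: ll_rr_def)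
  next
    fix a b m assume a: "a \<in> Obj A" "b \<in> Obj A" "m \<in> Obj M"
    then show "lasc (ll_rr A B M) a b (FO N m) \<cdot>\<^bsub>ll_rr A B M\<^esub> raw (\<phi> (a \<otimes>\<^bsub>A\<^esub> b) m) =
       (Id A a \<unrhd>\<^bsub>ll_rr A B M\<^esub> raw (\<phi> b m)) \<cdot>\<^bsub>ll_rr A B M\<^esub> raw (\<phi> a (b \<rhd> m)) \<cdot>\<^bsub>ll_rr A B M\<^esub> FA N (lasc M a b m)"
      \<comment> \<open>In \<open>ll_rr A B M\<close> the arrow \<open>Id A a\<close> acts through
        \<open>lldual_arr\<close>, and \<open>da_one\<close> shows that its double dual is again an
        identity.\<close>
      using arg_cong[OF \<phi>_assoc[OF a], of raw] A.raw_l_da[of "A.l.da (tone A a)"] A.raw_l_da[of "tone A a"]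
      by (simp add: ll_rr_def lldual_def lldual_arr_def A.lc.raw_iv A.raw_l_ddtens A.l.da_one)
  next
    fix m b c assume a: "m \<in> Obj M" "b \<in> Obj B" "c \<in> Obj B"
    have e: "tcmp M (tcmp M (tcmp M (?t (B.r.ddtens c b) (tone M (FO N m))) (t_rasc B M (FO N m) (?e (?e b)) (?e (?e c))))
      (?t (tone B (?e (?e c))) (\<psi> m b))) (\<psi> (m \<lhd> b) c) = tcmp M (\<psi> m (b \<otimes>\<^bsub>B\<^esub> c)) (FA ?N (t_rasc B M m b c))"
      using \<psi>_assoc'[OF a(3,2,1)] a tm_iso by (simp add: lm.T.assoc del: tF_simps(2))
    show "rasc (ll_rr A B M) (FO N m) b c \<cdot>\<^bsub>ll_rr A B M\<^esub> (raw (\<psi> m b) \<unlhd>\<^bsub>ll_rr A B M\<^esub> Id B c) \<cdot>\<^bsub>ll_rr A B M\<^esub> raw (\<psi> (m \<lhd> b) c) =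
       raw (\<psi> m (b \<otimes>\<^bsub>B\<^esub> c)) \<cdot>\<^bsub>ll_rr A B M\<^esub> FA N (rasc M m b c)"
      using arg_cong[OF e, of raw] a B.raw_r_da[of "B.r.da (tone B c)"] B.raw_r_da[of "tone B c"]
      by (simp add: ll_rr_def rrdual_def rrdual_arr_def B.lc.raw_iv B.raw_r_ddtens B.r.da_one)
  next
    fix m assume m: "m \<in> Obj M"
    show "lunit (ll_rr A B M) (FO N m) \<cdot>\<^bsub>ll_rr A B M\<^esub> raw (\<phi> (unit A) m) = FA N (lunit M m)"
      using arg_cong[OF \<phi>_unit[OF m], of raw] by (simp add: ll_rr_def A.lc.raw_iv A.raw_l_ddunit)
    show "runit (ll_rr A B M) (FO N m) \<cdot>\<^bsub>ll_rr A B M\<^esub> raw (\<psi> m (unit B)) = FA N (runit M m)"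
      using arg_cong[OF \<psi>_unit[OF m], of raw] by (simp add: ll_rr_def B.lc.raw_iv B.raw_r_ddunit)
  next
    fix a m b assume a: "a \<in> Obj A" "m \<in> Obj M" "b \<in> Obj B"
    have e: "tcmp M (tcmp M (t_masc M (?d (?d a)) (FO N m) (?e (?e b))) (?t (tone B (?e (?e b))) (\<phi> a m))) (\<psi> (a \<rhd> m) b)
     = tcmp M (tcmp M (?s (tone A (?d (?d a))) (\<psi> m b)) (\<phi> a (m \<lhd> b))) (FA ?N (t_masc M a m b))"
      using mid[OF a(1,3,2)] a tm_iso by (simp add: lm.T.assoc del: tF_simps(2))
    show "masc (ll_rr A B M) a (FO N m) b \<cdot>\<^bsub>ll_rr A B M\<^esub> (raw (\<phi> a m) \<unlhd>\<^bsub>ll_rr A B M\<^esub> Id B b) \<cdot>\<^bsub>ll_rr A B M\<^esub> raw (\<psi> (a \<rhd> m) b) =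
       (Id A a \<unrhd>\<^bsub>ll_rr A B M\<^esub> raw (\<psi> m b)) \<cdot>\<^bsub>ll_rr A B M\<^esub> raw (\<phi> a (m \<lhd> b)) \<cdot>\<^bsub>ll_rr A B M\<^esub> FA N (masc M a m b)"
      using arg_cong[OF e, of raw] a A.raw_l_da[of "A.l.da (tone A a)"] A.raw_l_da[of "tone A a"]
        B.raw_r_da[of "B.r.da (tone B b)"] B.raw_r_da[of "tone B b"]
      by (simp add: ll_rr_def lldual_def lldual_arr_def rrdual_def rrdual_arr_def A.l.da_one B.r.da_one)
  qed
qed

end

theorem theorem4p5:
  fixes A :: "('k::alg_closed_field, 'oa, 'ma::ab_group_add) tcat"
    and B :: "('k, 'ob, 'mb::ab_group_add) tcat"
    and M :: "('k, 'o, 'm::ab_group_add, 'oa, 'ma, 'ob, 'mb) bimod"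
    and N :: "('o, 'm, 'o, 'm) functor_data"
  assumes "finite_tensor_category A"
    and "finite_tensor_category B"
    and "bimodule_category A B M"
    and "nakayama_functor M N"
  shows "\<exists>\<phi> \<psi>. bimodule_functor A B M (ll_rr A B M) N \<phi> \<psi>"
proof -
  interpret rigid_bimodule_category A B M
    using assms(1-3) by (simp add: rigid_bimodule_category_def)
  show ?thesis
    by (rule nakayama_bimodule_functor[OF assms(4)])
qed

end
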